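(* Let $w>-\tilde H$. The value function $$G(w)=\sup_{(\tilde a,\tilde x,\tilde s)\in\tilde{\mathcal A}(w)}\mathbb{E}\Big[\int_0^\infty e^{-\hat\delta t}U(\tilde x_t,\tilde s_t)\,\mathrm{d}t\ \Big|\ \tilde W_0=w\Big]$$ is given by $$G(w)=\Gamma^{-\gamma}\,\frac{\tilde z(w)^{1-\gamma}}{1-\gamma},$$ where $\Gamma>0$ is the constant $$\Gamma=\left(\frac{(P/\tilde\eta)^\beta}{(1-\beta)^{1-\beta}\beta^\beta}\right)^{(1-\gamma)/\gamma}\varphi,\qquad \varphi=\frac{\gamma\left(\kappa^2+2\hat\delta+2(\gamma-1)\mu_R\right)-\kappa^2}{2\gamma^2}>0 .$$ The optimal strategies are $$\tilde a^*_t=\frac{\kappa}{\gamma\sigma_S}\,\frac{\tilde Z_t}{\tilde W_t},\qquad \tilde x^*_t=\underline{x}+(1-\beta)\varphi\,\tilde Z_t,\qquad \tilde s^*_t=\underline{s}+\beta\varphi\,\frac{\tilde Z_t}{P/\tilde\eta},$$ where $\tilde W$ is the wealth process controlled by these strategies with $\tilde W_0=w$, and $\tilde Z_t=\tilde z(\tilde W_t)$, so that $\tilde Z_0=\tilde z(w)$.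
   Context: Let $B$ be a standard Brownian motion. Parameters: $\mu_S>\mu_R>0$, $\sigma_S>0$, $\kappa=(\mu_S-\mu_R)/\sigma_S$; energy price $P>0$, labour income $Y>0$, retrofit cost $K>0$, borrowing rate $\rho\ge\mu_R$, efficiencies $\tilde\eta>\eta>0$; subsistence levels $\underline{x}>0$, $\underline{s}>0$; $\beta\in(0,1)$, $\gamma>1$; $\delta,\lambda>0$ and $\hat\delta=\delta+\lambda$. The utility function is $$U(x,s)=\frac{\big((x-\underline{x})^{1-\beta}(s-\underline{s})^{\beta}\big)^{1-\gamma}}{1-\gamma}.$$ Put $\tilde Y=Y-\rho K$. For adapted controls: share of wealth in the risky asset $\tilde a_t$, and consumption rates $\tilde x_t>\underline{x}$, $\tilde s_t>\underline{s}$ (so that $U$ is well defined), wealth after immediate investment follows $$\mathrm{d}\tilde W_t=\big(\tilde a_t\mu_S\tilde W_t+(1-\tilde a_t)\mu_R\tilde W_t+\tilde Y-\tilde x_t-(\tilde s_t/\tilde\eta)P\big)\mathrm{d}t+\tilde a_t\sigma_S\tilde W_t\,\mathrm{d}B_t,\qquad \tilde W_0=w.$$ (The amount invested in the risky asset is $\tilde a_t\tilde W_t$.) Human capital is $$\tilde H=\frac1{\mu_R}\big(\tilde Y-\underline{x}-(\underline{s}/\tilde\eta)P\big),$$ and $\tilde z(w)=w+\tilde H$. For $w>-\tilde H$ the admissible set $\tilde{\mathcal A}(w)$ consists of the controls $(\tilde a,\tilde x,\tilde s)$ for which $\tilde z(\tilde W_t)>0$ for all $t\ge0$. *)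

theory Defs
  imports "HOL-Probability.Probability"
begin

section \<open>Stochastic calculus\<close>

text \<open>
  A process is indexed by all reals, but only its values at times \<open>t \<ge> 0\<close> are ever used.  In the same
  way a filtration over \<open>t \<ge> 0\<close> is given here as a \<^locale>\<open>filtration\<close> over all reals; nothing is lost,
  since one may put \<open>F t = F 0\<close> for \<open>t < 0\<close>.  No completeness or right-continuity is required.
\<close>

type_synonym 'a process = "real \<Rightarrow> 'a \<Rightarrow> real"

definition filtered_prob_space :: "'a measure \<Rightarrow> (real \<Rightarrow> 'a measure) \<Rightarrow> bool" where
  "filtered_prob_space M F \<longleftrightarrow>
     prob_space M \<and> filtration (space M) F \<and> (\<forall>t. subalgebra M (F t))"

definition adapted :: "(real \<Rightarrow> 'a measure) \<Rightarrow> 'a process \<Rightarrow> bool" where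
  "adapted F X \<longleftrightarrow> (\<forall>t\<ge>0. X t \<in> borel_measurable (F t))"

text \<open>Joint measurability is needed for time integrals along paths to be random variables.\<close>

definition measurable_adapted :: "'a measure \<Rightarrow> (real \<Rightarrow> 'a measure) \<Rightarrow> 'a process \<Rightarrow> bool" where
  "measurable_adapted M F X \<longleftrightarrow> adapted F X \<and>
     (\<lambda>(t, \<omega>). X t \<omega>) \<in> borel_measurable (restrict_space borel {0..} \<Otimes>\<^sub>M M)"

definition continuous_paths :: "'a measure \<Rightarrow> 'a process \<Rightarrow> bool" where
  "continuous_paths M X \<longleftrightarrow> (\<forall>\<omega>\<in>space M. continuous_on {0..} (\<lambda>t. X t \<omega>))"

text \<open>Standard Brownian motion relative to \<open>F\<close>: a continuous adapted process whose increments
  after time \<open>s\<close> are independent of \<open>F s\<close>.\<close>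

definition brownian_motion :: "'a measure \<Rightarrow> (real \<Rightarrow> 'a measure) \<Rightarrow> 'a process \<Rightarrow> bool" where
  "brownian_motion M F B \<longleftrightarrow>
     adapted F B \<and> continuous_paths M B \<and> (AE \<omega> in M. B 0 \<omega> = 0) \<and>
     (\<forall>s t. 0 \<le> s \<and> s < t \<longrightarrow>
        distributed M lborel (\<lambda>\<omega>. B t \<omega> - B s \<omega>) (\<lambda>x. ennreal (normal_density 0 (sqrt (t - s)) x)) \<and>
        prob_space.indep_set M (sets (F s))
          (sets (vimage_algebra (space M) (\<lambda>\<omega>. B t \<omega> - B s \<omega>) borel)))"

definition tendsto_0_in_prob :: "'a measure \<Rightarrow> (nat \<Rightarrow> 'a \<Rightarrow> ennreal) \<Rightarrow> bool" where
  "tendsto_0_in_prob M X \<longleftrightarrow>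
     (\<forall>k. X k \<in> borel_measurable M) \<and>
     (\<forall>\<epsilon>>0. (\<lambda>k. measure M {\<omega>\<in>space M. ennreal \<epsilon> < X k \<omega>}) \<longlonglongrightarrow> 0)"

text \<open>
  The simple integrand \<open>\<Sum>i<n. \<xi> i * indicator {\<tau> i<..\<tau> (i + 1)}\<close>, with bounded
  \<open>F (\<tau> i)\<close>-measurable coefficients \<open>\<xi> i\<close>, is represented by \<open>(n, \<tau>, \<xi>)\<close>.
\<close>

type_synonym 'a simple_integrand = "nat \<times> (nat \<Rightarrow> real) \<times> (nat \<Rightarrow> 'a \<Rightarrow> real)"

fun is_simple_integrand ::
    "'a measure \<Rightarrow> (real \<Rightarrow> 'a measure) \<Rightarrow> 'a simple_integrand \<Rightarrow> bool" where
  "is_simple_integrand M F (n, \<tau>, \<xi>) \<longleftrightarrow>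
     0 \<le> \<tau> 0 \<and>
     (\<forall>i<n. \<tau> i \<le> \<tau> (Suc i) \<and> \<xi> i \<in> borel_measurable (F (\<tau> i)) \<and>
            (\<exists>C. \<forall>\<omega>\<in>space M. \<bar>\<xi> i \<omega>\<bar> \<le> C))"

fun simple_process :: "'a simple_integrand \<Rightarrow> 'a process" where
  "simple_process (n, \<tau>, \<xi>) t \<omega> = (\<Sum>i<n. \<xi> i \<omega> * indicator {\<tau> i<..\<tau> (Suc i)} t)"

fun simple_integral :: "'a process \<Rightarrow> 'a simple_integrand \<Rightarrow> 'a process" where
  "simple_integral B (n, \<tau>, \<xi>) t \<omega> =
     (\<Sum>i<n. \<xi> i \<omega> * (B (min t (\<tau> (Suc i))) \<omega> - B (min t (\<tau> i)) \<omega>))"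

text \<open>
  \<open>has_ito_integral M F B H I\<close>: the continuous process \<open>I\<close> is (a version of) \<open>\<integral> H dB\<close>, for a measurable
  adapted \<open>H\<close> with almost surely locally square integrable paths.  As usual, \<open>I\<close> is the limit of
  integrals of simple integrands, uniformly on compact time intervals in probability, where the
  simple integrands converge to \<open>H\<close> in \<open>L\<^sup>2([0,T])\<close> in probability for every \<open>T\<close>.  This determines
  \<open>I\<close> up to indistinguishability.
\<close>

definition has_ito_integral ::
    "'a measure \<Rightarrow> (real \<Rightarrow> 'a measure) \<Rightarrow> 'a process \<Rightarrow> 'a process \<Rightarrow> 'a process \<Rightarrow> bool" where
  "has_ito_integral M F B H I \<longleftrightarrow>
     measurable_adapted M F H \<and>
     (AE \<omega> in M. \<forall>T\<ge>0. (\<integral>\<^sup>+t\<in>{0..T}. ennreal ((H t \<omega>)\<^sup>2) \<partial>lborel) < \<infinity>) \<and>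
     (\<forall>t\<ge>0. I t \<in> borel_measurable M) \<and> continuous_paths M I \<and>
     (\<exists>h. (\<forall>k. is_simple_integrand M F (h k)) \<and>
        (\<forall>T\<ge>0.
           tendsto_0_in_prob M
             (\<lambda>k \<omega>. \<integral>\<^sup>+t\<in>{0..T}. ennreal ((simple_process (h k) t \<omega> - H t \<omega>)\<^sup>2) \<partial>lborel) \<and>
           tendsto_0_in_prob M
             (\<lambda>k \<omega>. SUP t\<in>{0..T}. ennreal \<bar>simple_integral B (h k) t \<omega> - I t \<omega>\<bar>)))"

text \<open>Integral with values in the extended reals, so that a function of constant sign that is not
  integrable has an infinite integral (and not the default value 0).\<close>

definition ext_integral :: "'b measure \<Rightarrow> ('b \<Rightarrow> ereal) \<Rightarrow> ereal" where
  "ext_integral N f =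
     enn2ereal (\<integral>\<^sup>+x. e2ennreal (f x) \<partial>N) - enn2ereal (\<integral>\<^sup>+x. e2ennreal (- f x) \<partial>N)"


section \<open>The household's problem after investment\<close>

record household =
  mu_S :: real
  mu_R :: real
  sigma_S :: real
  energy_price :: real
  income :: real
  retrofit_cost :: real
  borrow_rate :: real
  eta :: real
  eta_new :: real
  x_min :: real
  s_min :: real
  beta :: real
  gamma :: real
  delta :: real
  lam :: real

definition valid_household :: "household \<Rightarrow> bool" where
  "valid_household p \<longleftrightarrow>
     0 < mu_R p \<and> mu_R p < mu_S p \<and> 0 < sigma_S p \<and>
     0 < energy_price p \<and> 0 < income p \<and> 0 < retrofit_cost p \<and> mu_R p \<le> borrow_rate p \<and>
     0 < eta p \<and> eta p < eta_new p \<and> 0 < x_min p \<and> 0 < s_min p \<and>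
     0 < beta p \<and> beta p < 1 \<and> 1 < gamma p \<and> 0 < delta p \<and> 0 < lam p"

definition kappa :: "household \<Rightarrow> real" where
  "kappa p = (mu_S p - mu_R p) / sigma_S p"

definition delta_hat :: "household \<Rightarrow> real" where
  "delta_hat p = delta p + lam p"

definition net_income :: "household \<Rightarrow> real" where
  "net_income p = income p - borrow_rate p * retrofit_cost p"

definition utility :: "household \<Rightarrow> real \<Rightarrow> real \<Rightarrow> real" where
  "utility p x s =
     ((x - x_min p) powr (1 - beta p) * (s - s_min p) powr beta p) powr (1 - gamma p)
       / (1 - gamma p)"

definition human_capital :: "household \<Rightarrow> real" where
  "human_capital p =
     1 / mu_R p * (net_income p - x_min p - s_min p / eta_new p * energy_price p)"

definition total_wealth :: "household \<Rightarrow> real \<Rightarrow> real" where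
  "total_wealth p w = w + human_capital p"

text \<open>A control consists of the share of wealth in the risky asset and the two consumption rates.\<close>

type_synonym 'a control = "'a process \<times> 'a process \<times> 'a process"

fun wealth_drift :: "household \<Rightarrow> 'a control \<Rightarrow> 'a process \<Rightarrow> 'a process" where
  "wealth_drift p (a, x, s) W t \<omega> =
     a t \<omega> * mu_S p * W t \<omega> + (1 - a t \<omega>) * mu_R p * W t \<omega>
       + net_income p - x t \<omega> - s t \<omega> / eta_new p * energy_price p"

text \<open>
  \<open>W\<close> solves the wealth equation for the given control, with initial value \<open>w\<close>.  Integrability is
  required of the drift and of the amount \<open>a * W\<close> in the risky asset, not of the share \<open>a\<close>, which
  may be unbounded where \<open>W\<close> is close to 0.
\<close>

fun wealth_process ::
    "'a measure \<Rightarrow> (real \<Rightarrow> 'a measure) \<Rightarrow> 'a process \<Rightarrow> household \<Rightarrow> real \<Rightarrow>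
     'a control \<Rightarrow> 'a process \<Rightarrow> bool" where
  "wealth_process M F B p w (a, x, s) W \<longleftrightarrow>
     adapted F W \<and> continuous_paths M W \<and>
     (AE \<omega> in M. \<forall>T\<ge>0. set_integrable lborel {0..T} (\<lambda>t. wealth_drift p (a, x, s) W t \<omega>)) \<and>
     (\<exists>I. has_ito_integral M F B (\<lambda>t \<omega>. a t \<omega> * sigma_S p * W t \<omega>) I \<and>
        (AE \<omega> in M. \<forall>T\<ge>0.
           W T \<omega> = w + (LBINT t:{0..T}. wealth_drift p (a, x, s) W t \<omega>) + I T \<omega>))"

fun is_control :: "'a measure \<Rightarrow> (real \<Rightarrow> 'a measure) \<Rightarrow> household \<Rightarrow> 'a control \<Rightarrow> bool" where
  "is_control M F p (a, x, s) \<longleftrightarrow>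
     measurable_adapted M F a \<and> measurable_adapted M F x \<and> measurable_adapted M F s \<and>
     (AE \<omega> in M. \<forall>t\<ge>0. x_min p < x t \<omega> \<and> s_min p < s t \<omega>)"

definition admissible_with ::
    "'a measure \<Rightarrow> (real \<Rightarrow> 'a measure) \<Rightarrow> 'a process \<Rightarrow> household \<Rightarrow> real \<Rightarrow>
     'a control \<Rightarrow> 'a process \<Rightarrow> bool" where
  "admissible_with M F B p w c W \<longleftrightarrow>
     is_control M F p c \<and> wealth_process M F B p w c W \<and>
     (AE \<omega> in M. \<forall>t\<ge>0. 0 < total_wealth p (W t \<omega>))"

definition admissible ::
    "'a measure \<Rightarrow> (real \<Rightarrow> 'a measure) \<Rightarrow> 'a process \<Rightarrow> household \<Rightarrow> real \<Rightarrow> 'a control set" where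
  "admissible M F B p w = {c. \<exists>W. admissible_with M F B p w c W}"

text \<open>The initial wealth is the constant \<open>w\<close>, so conditioning on its value is vacuous.\<close>

fun expected_utility :: "'a measure \<Rightarrow> household \<Rightarrow> 'a control \<Rightarrow> ereal" where
  "expected_utility M p (a, x, s) =
     ext_integral M (\<lambda>\<omega>. ext_integral (restrict_space lborel {0..})
       (\<lambda>t. ereal (exp (- delta_hat p * t) * utility p (x t \<omega>) (s t \<omega>))))"

definition value_function ::
    "'a measure \<Rightarrow> (real \<Rightarrow> 'a measure) \<Rightarrow> 'a process \<Rightarrow> household \<Rightarrow> real \<Rightarrow> ereal" where
  "value_function M F B p w = (SUP c\<in>admissible M F B p w. expected_utility M p c)"

definition phi :: "household \<Rightarrow> real" where
  "phi p =
     (gamma p * ((kappa p)\<^sup>2 + 2 * delta_hat p + 2 * (gamma p - 1) * mu_R p) - (kappa p)\<^sup>2)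
       / (2 * (gamma p)\<^sup>2)"

definition Gamma_const :: "household \<Rightarrow> real" where
  "Gamma_const p =
     ((energy_price p / eta_new p) powr beta p
        / ((1 - beta p) powr (1 - beta p) * beta p powr beta p))
       powr ((1 - gamma p) / gamma p) * phi p"

definition feedback_control :: "household \<Rightarrow> 'a process \<Rightarrow> 'a control" where
  "feedback_control p W =
     (\<lambda>t \<omega>. kappa p / (gamma p * sigma_S p) * (total_wealth p (W t \<omega>) / W t \<omega>),
      \<lambda>t \<omega>. x_min p + (1 - beta p) * phi p * total_wealth p (W t \<omega>),
      \<lambda>t \<omega>. s_min p + beta p * phi p * (total_wealth p (W t \<omega>) / (energy_price p / eta_new p)))"

text \<open>
  \<open>W\<close> is controlled by its own feedback strategies.  The share is a quotient by \<open>W\<close>, hence undefined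
  (0, by the convention on division) at the times where \<open>W\<close> vanishes.  The second condition says
  that these times form a null set, so that the formula determines the share for almost all
  \<open>(t, \<omega>)\<close>; it excludes spurious solutions of the wealth equation that stay at 0 because of the
  convention.
\<close>

definition feedback_wealth ::
    "'a measure \<Rightarrow> (real \<Rightarrow> 'a measure) \<Rightarrow> 'a process \<Rightarrow> household \<Rightarrow> real \<Rightarrow> 'a process \<Rightarrow> bool" where
  "feedback_wealth M F B p w W \<longleftrightarrow>
     wealth_process M F B p w (feedback_control p W) W \<and>
     (AE \<omega> in M. AE t in lborel. 0 \<le> t \<longrightarrow> W t \<omega> \<noteq> 0)"

end

theory Submission
  imports Defs
begin

text \<open>
  The upper bound is a duality argument.  Under the measure with density \<open>exp (- \<kappa> B\<^sub>T - \<kappa>\<^sup>2 T / 2)\<close> the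
  discounted total wealth plus discounted surplus consumption (expenditure above subsistence) is a
  stochastic integral bounded below, so the state price \<open>\<xi>\<close> satisfies \<open>E (\<integral> \<xi> C dt) \<le> z(w)\<close> for
  the surplus consumption \<open>C\<close> of every admissible control.  The integral enters only through simple
  integrands on a grid, which are switched off when their gains become too negative; thus discrete
  martingale transforms suffice.  Fenchel's inequality for the utility, with the multiplier for which
  equality holds at consumption \<open>\<phi> Z\<close>, turns the budget inequality into the bound for the value.

  With the feedback strategies the total wealth \<open>Z\<close> solves a linear equation, whose solution is a
  geometric Brownian motion; its Ito integral is computed from Euler sums.  Any other solution agrees
  with it, because Riemann sums approximate the Ito integrals and Gronwall's inequality applies to the
  stopped second moment of the difference.  Along this solution all inequalities are equalities.
\<close>

section \<open>Transforms of independent increments\<close>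

text \<open>The obstacle is that \<open>has_ito_integral\<close> offers only simple integrands
  converging in probability; neither a moment bound nor a martingale property comes with it. Moments
  are therefore taken on finite grids, after truncation, and the exceptional sets are accounted for
  by their probability. As the filtration is not assumed complete or right-continuous, random
  stopping is done at grid points or by an event such as \<open>small_event\<close>, which is
  decided at a fixed time. The constants are dictated by the first-order condition that the
  discounted marginal utility of the optimal wealth Z be proportional to the state price \<xi>, path
  by path. It forces the volatility \<kappa> / \<gamma> and the formula for \<open>phi\<close>. Then
  \<xi> Z is z exp (- \<phi> t) times an exponential martingale of mean 1, so the plan of consuming
  \<phi> Z costs exactly z: the budget is exhausted and the bound attained. Since \<gamma> > 1,
  utility is at most 0. Values are thus handled as integrals of nonnegative losses, and an infinite
  loss causes no difficulty.\<close>

lemma (in prob_space) indep_var_indep_set: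
  assumes sub: "subalgebra M G"
    and ind: "indep_set (sets G) (sets (vimage_algebra (space M) X borel))"
    and X: "X \<in> borel_measurable M" and z: "\<zeta> \<in> measurable G N"
  shows "indep_var N \<zeta> borel X"
proof -
  have spG: "space G = space M" and setsG: "sets G \<subseteq> sets M"
    using sub by (auto simp: subalgebra_def)
  have zM: "\<zeta> \<in> measurable M N"
    using measurable_from_subalg[OF sub z] .
  have a: "sigma_sets (space M) {\<zeta> -` A \<inter> space M |A. A \<in> sets N} \<subseteq> sets G"
    using measurable_sets[OF z] sets.sigma_sets_subset[of "{\<zeta> -` A \<inter> space M |A. A \<in> sets N}" G]
    unfolding spG by blast
  have b: "sigma_sets (space M) {X -` A \<inter> space M |A. A \<in> sets borel} =
    sets (vimage_algebra (space M) X borel)"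
    by (simp add: sets_vimage_algebra)
  have "indep_set (sigma_sets (space M) {\<zeta> -` A \<inter> space M |A. A \<in> sets N})
     (sigma_sets (space M) {X -` A \<inter> space M |A. A \<in> sets borel})"
    unfolding b using ind unfolding indep_set_def
    by (rule indep_sets_mono_sets) (use a in \<open>auto split: bool.split\<close>)
  then show ?thesis
    unfolding indep_var_eq using zM X by auto
qed

lemma abs_mult_le_squares: "\<bar>a * b\<bar> \<le> a\<^sup>2 + (b::real)\<^sup>2"
proof -
  have "2 * \<bar>a * b\<bar> \<le> a\<^sup>2 + b\<^sup>2"
    using sum_squares_bound[of "\<bar>a\<bar>" "\<bar>b\<bar>"] by (simp add: abs_mult)
  moreover have "0 \<le> \<bar>a * b\<bar>" by simp
  ultimately show ?thesis by linarith
qed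

definition transform :: "(nat \<Rightarrow> 'a \<Rightarrow> real) \<Rightarrow> (nat \<Rightarrow> 'a \<Rightarrow> real) \<Rightarrow> nat \<Rightarrow> 'a \<Rightarrow> real" where
  "transform c d j \<omega> = (\<Sum>i<j. c i \<omega> * d i \<omega>)"

lemma transform_0 [simp]: "transform c d 0 \<omega> = 0"
  by (simp add: transform_def)

lemma transform_Suc: "transform c d (Suc j) \<omega> = transform c d j \<omega> + c j \<omega> * d j \<omega>"
  by (simp add: transform_def)

text \<open>The law of the increments is left open: \<open>G i\<close> is what is known before
  \<open>d i\<close>, and only independence and two moments are prescribed. The locale is used for
  Brownian increments, under either measure, and for the relative errors \<open>gbm_error\<close> of
  geometric Brownian motion.\<close>

locale indep_increments = prob_space M for M :: "'a measure" +
  fixes n :: nat and G :: "nat \<Rightarrow> 'a measure" and d :: "nat \<Rightarrow> 'a \<Rightarrow> real" and v :: "nat \<Rightarrow> real"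
  assumes sub: "\<And>i. i \<le> n \<Longrightarrow> subalgebra M (G i)"
    and mono: "\<And>i j. i \<le> j \<Longrightarrow> j \<le> n \<Longrightarrow> sets (G i) \<subseteq> sets (G j)"
    and meas: "\<And>i. i < n \<Longrightarrow> d i \<in> borel_measurable (G (Suc i))"
    and indep: "\<And>i. i < n \<Longrightarrow>
      indep_set (sets (G i)) (sets (vimage_algebra (space M) (d i) borel))"
    and square_int: "\<And>i. i < n \<Longrightarrow> integrable M (\<lambda>\<omega>. (d i \<omega>)\<^sup>2)"
    and mean_0: "\<And>i. i < n \<Longrightarrow> expectation (d i) = 0"
    and second_moment: "\<And>i. i < n \<Longrightarrow> expectation (\<lambda>\<omega>. (d i \<omega>)\<^sup>2) = v i"
begin

lemma space_G: "i \<le> n \<Longrightarrow> space (G i) = space M"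
  using sub by (auto simp: subalgebra_def)

lemma measurable_G_mono:
  "f \<in> borel_measurable (G i) \<Longrightarrow> i \<le> j \<Longrightarrow> j \<le> n \<Longrightarrow> f \<in> borel_measurable (G j)"
  using mono[of i j] space_G[of i] space_G[of j] by (intro measurable_from_subalg[of "G j" "G i"])
    (auto simp: subalgebra_def)

lemma measurable_G: "f \<in> borel_measurable (G i) \<Longrightarrow> i \<le> n \<Longrightarrow> f \<in> borel_measurable M"
  using sub measurable_from_subalg by blast

lemma square_integrable_1:
  assumes "f \<in> borel_measurable M" "integrable M (\<lambda>\<omega>. (f \<omega> :: real)\<^sup>2)"
  shows "integrable M f"
proof (rule Bochner_Integration.integrable_bound)
  show "integrable M (\<lambda>\<omega>. 1 + (f \<omega>)\<^sup>2)" using assms by auto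
  show "AE x in M. norm (f x) \<le> norm (1 + (f x)\<^sup>2)"
    using abs_mult_le_squares[of 1]
      by (auto simp: abs_of_pos[OF add_pos_nonneg[OF zero_less_one zero_le_power2]])
qed (use assms in auto)

lemma increment:
  assumes i: "i < n" and z: "\<zeta> \<in> borel_measurable (G i)" "integrable M (\<lambda>\<omega>. (\<zeta> \<omega>)\<^sup>2)"
  shows "integrable M (\<lambda>\<omega>. \<zeta> \<omega> * d i \<omega>)" "expectation (\<lambda>\<omega>. \<zeta> \<omega> * d i \<omega>) = 0"
    "integrable M (\<lambda>\<omega>. (\<zeta> \<omega> * d i \<omega>)\<^sup>2)"
    "expectation (\<lambda>\<omega>. (\<zeta> \<omega> * d i \<omega>)\<^sup>2) = v i * expectation (\<lambda>\<omega>. (\<zeta> \<omega>)\<^sup>2)"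
proof -
  have dM: "d i \<in> borel_measurable M" using measurable_G[OF meas[OF i]] i by auto
  have zM: "\<zeta> \<in> borel_measurable M" using measurable_G[OF z(1)] i by auto
  have iv: "indep_var borel \<zeta> borel (d i)"
    by (rule indep_var_indep_set[OF sub indep dM]) (use i z in auto)
  have iv2: "indep_var borel (\<lambda>\<omega>. (\<zeta> \<omega>)\<^sup>2) borel (\<lambda>\<omega>. (d i \<omega>)\<^sup>2)"
    using indep_var_compose[OF iv, of "\<lambda>x. x\<^sup>2" borel "\<lambda>x. x\<^sup>2" borel] by (simp add: comp_def)
  have di: "integrable M (d i)" "integrable M \<zeta>"
    using square_integrable_1[OF dM square_int[OF i]] square_integrable_1[OF zM z(2)] .
  show "integrable M (\<lambda>\<omega>. \<zeta> \<omega> * d i \<omega>)"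
    using indep_var_integrable[OF iv di(2,1)] .
  show "expectation (\<lambda>\<omega>. \<zeta> \<omega> * d i \<omega>) = 0"
    using indep_var_lebesgue_integral[OF iv di(2,1)] mean_0[OF i] by simp
  show "integrable M (\<lambda>\<omega>. (\<zeta> \<omega> * d i \<omega>)\<^sup>2)"
    using indep_var_integrable[OF iv2 z(2) square_int[OF i]] by (simp add: power_mult_distrib)
  show "expectation (\<lambda>\<omega>. (\<zeta> \<omega> * d i \<omega>)\<^sup>2) = v i * expectation (\<lambda>\<omega>. (\<zeta> \<omega>)\<^sup>2)"
    using indep_var_lebesgue_integral[OF iv2 z(2) square_int[OF i]] second_moment[OF i]
    by (simp add: power_mult_distrib)
qed

lemma measurable_transform:
  assumes "\<And>i. i < j \<Longrightarrow> c i \<in> borel_measurable (G i)" "j \<le> n"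
  shows "transform c d j \<in> borel_measurable (G j)"
proof -
  have "(\<lambda>\<omega>. c i \<omega> * d i \<omega>) \<in> borel_measurable (G j)" if "i < j" for i
    using that assms meas[of i]
      by (intro borel_measurable_times measurable_G_mono[of _ i j] measurable_G_mono[of _ "Suc i" j]) auto
  then have "(\<lambda>\<omega>. \<Sum>i<j. c i \<omega> * d i \<omega>) \<in> borel_measurable (G j)"
    by (intro borel_measurable_sum) auto
  then show ?thesis by (simp add: transform_def[abs_def])
qed

text \<open>When the square is expanded, the cross term has mean 0 because the transform so far
  times \<open>c j\<close> is known before \<open>d j\<close>, hence independent of it. What remains
  is the discrete form of Ito's isometry.\<close>

lemma transform_moments:
  assumes c: "\<And>i. i < n \<Longrightarrow> c i \<in> borel_measurable (G i)"
    and ci: "\<And>i. i < n \<Longrightarrow> integrable M (\<lambda>\<omega>. (c i \<omega>)\<^sup>2)"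
  shows "j \<le> n \<Longrightarrow> integrable M (transform c d j) \<and> expectation (transform c d j) = 0 \<and>
    integrable M (\<lambda>\<omega>. (transform c d j \<omega>)\<^sup>2) \<and>
    expectation (\<lambda>\<omega>. (transform c d j \<omega>)\<^sup>2) = (\<Sum>i<j. v i * expectation (\<lambda>\<omega>. (c i \<omega>)\<^sup>2))"
proof (induction j)
  case 0
  then show ?case by (simp add: transform_def[abs_def])
next
  case (Suc j)
  let ?J = "transform c d j"
  have j: "j < n" and IH: "integrable M ?J" "expectation ?J = 0" "integrable M (\<lambda>\<omega>. (?J \<omega>)\<^sup>2)"
    "expectation (\<lambda>\<omega>. (?J \<omega>)\<^sup>2) = (\<Sum>i<j. v i * expectation (\<lambda>\<omega>. (c i \<omega>)\<^sup>2))"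
    using Suc by auto
  have Jm: "?J \<in> borel_measurable (G j)" using measurable_transform[of j c] c j by auto
  have JM: "?J \<in> borel_measurable M" using measurable_G[OF Jm] j by auto
  have cM: "c j \<in> borel_measurable M" using measurable_G[OF c[OF j]] j by auto
  have dM: "d j \<in> borel_measurable M" using measurable_G[OF meas[OF j]] j by auto
  note inc = increment[OF j c[OF j] ci[OF j]]
  have Jc: "integrable M (\<lambda>\<omega>. ?J \<omega> * c j \<omega>)"
  proof (rule Bochner_Integration.integrable_bound)
    show "integrable M (\<lambda>\<omega>. (?J \<omega>)\<^sup>2 + (c j \<omega>)\<^sup>2)" using IH ci j by auto
    show "AE x in M. norm (?J x * c j x) \<le> norm ((?J x)\<^sup>2 + (c j x)\<^sup>2)"
      using abs_mult_le_squares by auto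
  qed (use JM cM in measurable)
  have iv: "indep_var borel (\<lambda>\<omega>. ?J \<omega> * c j \<omega>) borel (d j)"
    by (rule indep_var_indep_set[OF sub indep dM]) (use j Jm c[OF j] in auto)
  have di: "integrable M (d j)" using square_integrable_1[OF dM square_int[OF j]] .
  have X: "integrable M (\<lambda>\<omega>. ?J \<omega> * c j \<omega> * d j \<omega>)" "expectation (\<lambda>\<omega>. ?J \<omega> * c j \<omega> * d j \<omega>) = 0"
    using indep_var_integrable[OF iv Jc di] indep_var_lebesgue_integral[OF iv Jc di] mean_0[OF j] by auto
  have sq: "(transform c d (Suc j) \<omega>)\<^sup>2 = (?J \<omega>)\<^sup>2 + 2 * (?J \<omega> * c j \<omega> * d j \<omega>) + (c j \<omega> * d j \<omega>)\<^sup>2" for \<omega>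
    unfolding transform_Suc by (simp only: power2_sum mult.assoc)
  have "integrable M (transform c d (Suc j))" "expectation (transform c d (Suc j)) = 0"
    unfolding transform_Suc[abs_def] using IH(1,2) inc(1,2) by simp_all
  moreover have "integrable M (\<lambda>\<omega>. (transform c d (Suc j) \<omega>)\<^sup>2)"
    unfolding sq using IH(3) X(1) inc(3) by (intro Bochner_Integration.integrable_add) simp_all
  moreover have "expectation (\<lambda>\<omega>. (transform c d (Suc j) \<omega>)\<^sup>2) =
      expectation (\<lambda>\<omega>. (?J \<omega>)\<^sup>2) + 2 * expectation (\<lambda>\<omega>. ?J \<omega> * c j \<omega> * d j \<omega>)
      + expectation (\<lambda>\<omega>. (c j \<omega> * d j \<omega>)\<^sup>2)"
    unfolding sq using IH(3) X(1) inc(3)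
    by (simp only: Bochner_Integration.integral_add Bochner_Integration.integrable_add
      integrable_mult_right integral_mult_right_zero)
  ultimately show ?case using IH(4) X(2) inc(4) by simp
qed

text \<open>The coefficients are switched off as soon as the bracket would exceed \<open>\<delta>\<close> (which is
  known one step ahead) or the transform itself exceeds \<open>\<epsilon>\<close>, and Chebyshev's inequality is applied
  to what remains.\<close>

lemma transform_maximal:
  assumes c: "\<And>i. i < n \<Longrightarrow> c i \<in> borel_measurable (G i)"
    and v: "\<And>i. i < n \<Longrightarrow> 0 < v i" and e: "0 < \<epsilon>" and dl: "0 \<le> \<delta>" and A: "A \<in> events"
  shows "prob {\<omega>\<in>A. \<exists>j\<le>n. \<epsilon> < \<bar>transform c d j \<omega>\<bar>} \<le>
    prob {\<omega>\<in>A. \<delta> < (\<Sum>i<n. (c i \<omega>)\<^sup>2 * v i)} + \<delta> / \<epsilon>\<^sup>2"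
proof -
  define ok where "ok i \<omega> \<longleftrightarrow> (\<Sum>l\<le>i. (c l \<omega>)\<^sup>2 * v l) \<le> \<delta> \<and> (\<forall>l\<le>i. \<bar>transform c d l \<omega>\<bar> \<le> \<epsilon>)" for i \<omega>
  define b where "b i \<omega> = (if ok i \<omega> then c i \<omega> else 0)" for i \<omega>
  have okm: "Measurable.pred (G i) (ok i)" if "i < n" for i
  proof -
    have c': "c l \<in> borel_measurable (G i)" if "l \<le> i" for l
      using measurable_G_mono[OF c[of l]] that \<open>i < n\<close> by auto
    have t': "transform c d l \<in> borel_measurable (G i)" if "l \<le> i" for l
      using measurable_G_mono[OF measurable_transform[of l c]] c that \<open>i < n\<close> by auto
    have "Measurable.pred (G i) (\<lambda>\<omega>. (\<Sum>l\<le>i. (c l \<omega>)\<^sup>2 * v l) \<le> \<delta>)"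
      unfolding pred_def using c'
        by (intro borel_measurable_le borel_measurable_sum borel_measurable_times
        borel_measurable_power) auto
    moreover have "Measurable.pred (G i) (\<lambda>\<omega>. \<forall>l\<in>{..i}. \<bar>transform c d l \<omega>\<bar> \<le> \<epsilon>)"
      using t' by (intro pred_intros_finite) (auto simp: pred_def intro!: borel_measurable_le
        borel_measurable_abs)
    ultimately have "Measurable.pred (G i) (\<lambda>\<omega>. (\<Sum>l\<le>i. (c l \<omega>)\<^sup>2 * v l) \<le> \<delta> \<and>
      (\<forall>l\<in>{..i}. \<bar>transform c d l \<omega>\<bar> \<le> \<epsilon>))"
      by (rule pred_intros_logic)
    then show ?thesis by (simp add: ok_def[abs_def] Ball_def)
  qed
  have bm: "b i \<in> borel_measurable (G i)" if "i < n" for i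
    unfolding b_def[abs_def] using okm[OF that] c[OF that] by measurable
  have bv: "(\<Sum>i<j. (b i \<omega>)\<^sup>2 * v i) \<le> \<delta>" if "j \<le> n" for j \<omega>
    using that
  proof (induction j)
    case (Suc j)
    show ?case
    proof (cases "ok j \<omega>")
      case True
      have "(\<Sum>i<Suc j. (b i \<omega>)\<^sup>2 * v i) \<le> (\<Sum>i<Suc j. (c i \<omega>)\<^sup>2 * v i)"
        using Suc.prems v by (intro sum_mono) (auto simp: b_def less_imp_le)
      also have "\<dots> \<le> \<delta>" using True by (simp add: ok_def lessThan_Suc_atMost)
      finally show ?thesis .
    next
      case False
      then show ?thesis using Suc by (simp add: b_def)
    qed
  qed (use dl in simp)
  have b2: "(b i \<omega>)\<^sup>2 \<le> \<delta> / v i" if i: "i < n" for i \<omega>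
  proof -
    have "(b i \<omega>)\<^sup>2 * v i \<le> (\<Sum>l<Suc i. (b l \<omega>)\<^sup>2 * v l)"
      using i v by (intro member_le_sum) (auto simp: less_imp_le)
    also have "\<dots> \<le> \<delta>" using bv[of "Suc i"] i by auto
    finally show ?thesis using v[OF i] by (simp add: field_simps)
  qed
  have bi: "integrable M (\<lambda>\<omega>. (b i \<omega>)\<^sup>2)" if i: "i < n" for i
    by (rule integrable_const_bound[of _ "\<delta> / v i"])
      (use b2[OF i] measurable_G[OF bm[OF i] less_imp_le[OF i]] in auto)
  note mom = transform_moments[of b n, OF bm bi, simplified]
  have Jbm: "transform b d n \<in> borel_measurable M"
    by (rule measurable_G[OF measurable_transform[of n b]]) (use bm in auto)
  have E: "expectation (\<lambda>\<omega>. (transform b d n \<omega>)\<^sup>2) \<le> \<delta>"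
  proof -
    have "expectation (\<lambda>\<omega>. (transform b d n \<omega>)\<^sup>2) = expectation (\<lambda>\<omega>. \<Sum>i<n. (b i \<omega>)\<^sup>2 * v i)"
      using mom bi by (subst Bochner_Integration.integral_sum) (auto simp: mult.commute)
    also have "\<dots> \<le> expectation (\<lambda>\<omega>. \<delta>)"
      using bi bv[of n] by (intro integral_mono Bochner_Integration.integrable_sum) auto
    finally show ?thesis by (simp add: prob_space)
  qed
  have cM: "c i \<in> borel_measurable M" if "i < n" for i using measurable_G[OF c[OF that]] that by auto
  have JM: "transform c d j \<in> borel_measurable M" if "j \<le> n" for j
    by (rule measurable_G[OF measurable_transform[of j c]]) (use c that in auto)
  let ?S1 = "{\<omega>\<in>A. \<delta> < (\<Sum>i<n. (c i \<omega>)\<^sup>2 * v i)}"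
  let ?S2 = "{\<omega>\<in>space M. \<epsilon>\<^sup>2 \<le> (transform b d n \<omega>)\<^sup>2}"
  have S1: "?S1 \<in> events"
  proof -
    have "{\<omega>\<in>space M. \<delta> < (\<Sum>i<n. (c i \<omega>)\<^sup>2 * v i)} \<in> events" using cM by measurable
    moreover have "?S1 = A \<inter> {\<omega>\<in>space M. \<delta> < (\<Sum>i<n. (c i \<omega>)\<^sup>2 * v i)}"
      using sets.sets_into_space[OF A] by auto
    ultimately show ?thesis using A by auto
  qed
  have S2: "?S2 \<in> events" using Jbm by measurable
  have incl: "{\<omega>\<in>A. \<exists>j\<le>n. \<epsilon> < \<bar>transform c d j \<omega>\<bar>} \<subseteq> ?S1 \<union> ?S2"
  proof (rule subsetI, rule ccontr)
    fix \<omega> assume w0: "\<omega> \<in> {\<omega>\<in>A. \<exists>j\<le>n. \<epsilon> < \<bar>transform c d j \<omega>\<bar>}" and notin: "\<omega> \<notin> ?S1 \<union> ?S2"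
    then obtain j where w: "\<omega> \<in> A" "j \<le> n" "\<epsilon> < \<bar>transform c d j \<omega>\<bar>" by auto
    have wM: "\<omega> \<in> space M" using w sets.sets_into_space[OF A] by auto
    have no: "\<not> \<epsilon>\<^sup>2 \<le> (transform b d n \<omega>)\<^sup>2" and le: "\<not> \<delta> < (\<Sum>i<n. (c i \<omega>)\<^sup>2 * v i)"
      using notin w wM by auto
    show False
    proof -
      define k where "k = (LEAST j. \<epsilon> < \<bar>transform c d j \<omega>\<bar>)"
      have k: "\<epsilon> < \<bar>transform c d k \<omega>\<bar>" "k \<le> j"
        unfolding k_def using w(3) by (auto intro: LeastI Least_le)
      have small: "\<bar>transform c d l \<omega>\<bar> \<le> \<epsilon>" if "l < k" for l
        using not_less_Least[of l "\<lambda>j. \<epsilon> < \<bar>transform c d j \<omega>\<bar>"] that unfolding k_def by auto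
      have ok: "ok i \<omega>" if "i < k" for i
      proof -
        have "(\<Sum>l\<le>i. (c l \<omega>)\<^sup>2 * v l) \<le> (\<Sum>i<n. (c i \<omega>)\<^sup>2 * v i)"
          using that k w v by (intro sum_mono2) (auto simp: less_imp_le)
        then show ?thesis using le small that by (auto simp: ok_def)
      qed
      have nok: "\<not> ok i \<omega>" if "i \<ge> k" for i using that k by (auto simp: ok_def not_le intro!: exI[of _ k])
      \<comment> \<open>\<open>k\<close> is the first exceedance. From there on every
        \<open>b i\<close> is 0, so the final value of the switched-off transform is the value of
        the original one at \<open>k\<close>, and it is enough to apply Chebyshev's inequality at
        the end.\<close>
      have "transform b d n \<omega> = (\<Sum>i<k. b i \<omega> * d i \<omega>)"
        unfolding transform_def using k w nok by (intro sum.mono_neutral_right) (auto simp: b_def not_less)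
      also have "\<dots> = transform c d k \<omega>"
        unfolding transform_def using ok by (intro sum.cong) (auto simp: b_def)
      finally have "\<epsilon> < \<bar>transform b d n \<omega>\<bar>" using k by simp
      then have "\<epsilon>\<^sup>2 \<le> (transform b d n \<omega>)\<^sup>2"
        using e by (simp add: abs_le_square_iff[symmetric])
      with no show False by simp
    qed
  qed
  have "prob {\<omega>\<in>A. \<exists>j\<le>n. \<epsilon> < \<bar>transform c d j \<omega>\<bar>} \<le> prob (?S1 \<union> ?S2)"
    using incl S1 S2 by (intro finite_measure_mono) auto
  also have "\<dots> \<le> prob ?S1 + prob ?S2" using S1 S2 by (intro measure_Un_le) auto
  also have "prob ?S2 \<le> \<delta> / \<epsilon>\<^sup>2"
  proof -
    have "prob ?S2 \<le> expectation (\<lambda>\<omega>. (transform b d n \<omega>)\<^sup>2) / \<epsilon>\<^sup>2"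
      using mom e by (intro integral_Markov_inequality_measure[where A="{}"]) auto
    also have "\<dots> \<le> \<delta> / \<epsilon>\<^sup>2" using E e by (intro divide_right_mono) auto
    finally show ?thesis .
  qed
  finally show ?thesis by simp
qed

end

section \<open>Simple integrals on grids\<close>

text \<open>Strictly increasing, because the law of an increment is only available over intervals of
  positive length and \<open>transform_maximal\<close> asks for positive variances.\<close>

definition grid :: "real \<Rightarrow> nat \<Rightarrow> (nat \<Rightarrow> real) \<Rightarrow> bool" where
  "grid T n g \<longleftrightarrow> g 0 = 0 \<and> g n = T \<and> (\<forall>i<n. g i < g (Suc i))"

lemma grid_mono: "grid T n g \<Longrightarrow> i \<le> j \<Longrightarrow> j \<le> n \<Longrightarrow> g i \<le> g j"
proof (induction j)
  case (Suc j)
  show ?case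
  proof (cases "i = Suc j")
    case False
    then have "g i \<le> g j" "g j < g (Suc j)" using Suc by (auto simp: grid_def)
    then show ?thesis by simp
  qed simp
qed simp

lemma grid_bounds: "grid T n g \<Longrightarrow> i \<le> n \<Longrightarrow> 0 \<le> g i" "grid T n g \<Longrightarrow> i \<le> n \<Longrightarrow> g i \<le> T"
  using grid_mono[of T n g 0 i] grid_mono[of T n g i n] by (auto simp: grid_def)

text \<open>The points are 0, T, and the elements of \<open>S\<close> and the multiples of
  \<open>e\<close> in [0, T], in increasing order. A cell longer than \<open>e\<close> would have a
  multiple of \<open>e\<close> in its interior. The points of \<open>S\<close> will be jump times of
  simple integrands, which must not fall inside a cell.\<close>

lemma grid_exists:
  assumes S: "finite (S::real set)" and T: "0 < T" and e: "0 < e"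
  shows "\<exists>n g. grid T n g \<and> (\<forall>i<n. g (Suc i) - g i \<le> e) \<and>
    (\<forall>x\<in>S. \<forall>i<n. x \<le> g i \<or> g (Suc i) \<le> x)"
proof -
  define K where "K = nat \<lceil>T / e\<rceil>"
  define A where "A = (S \<inter> {0..T}) \<union> {0, T} \<union> ((\<lambda>k. real k * e) ` {..K} \<inter> {0..T})"
  define xs where "xs = sorted_list_of_set A"
  define n where "n = length xs - 1"
  define g where "g i = xs ! i" for i
  have fA: "finite A" unfolding A_def using S by auto
  have sxs: "set xs = A" "sorted_wrt (<) xs" unfolding xs_def using fA by auto
  have len: "length xs = Suc n" using sxs(1) unfolding n_def A_def by (cases xs) auto
  have inc: "g i < g j" if "i < j" "j \<le> n" for i j
    using sorted_wrt_nth_less[OF sxs(2), of i j] that len unfolding g_def by auto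
  have mono: "g i \<le> g j" if "i \<le> j" "j \<le> n" for i j
    using inc[of i j] that by (cases "i = j") auto
  have inA: "g i \<in> A" if "i \<le> n" for i using that len sxs(1) nth_mem[of i xs] unfolding g_def by auto
  have surj: "\<exists>i\<le>n. g i = x" if "x \<in> A" for x
    using that len sxs(1) unfolding g_def by (metis in_set_conv_nth less_Suc_eq_le)
  have A0T: "A \<subseteq> {0..T}" unfolding A_def using T by auto
  have "g 0 = 0"
  proof -
    obtain i where "i \<le> n" "g i = 0" using surj[of 0] by (auto simp: A_def)
    then show ?thesis using mono[of 0 i] inA[of 0] A0T by force
  qed
  moreover have "g n = T"
  proof -
    obtain i where "i \<le> n" "g i = T" using surj[of T] by (auto simp: A_def)
    then show ?thesis using mono[of i n] inA[of n] A0T by force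
  qed
  ultimately have gr: "grid T n g" unfolding grid_def using inc by auto
  have avoid: "x \<le> g i \<or> g (Suc i) \<le> x" if xA: "x \<in> A" "i < n" for x i
  proof -
    obtain j where "j \<le> n" "g j = x" using surj[OF xA(1)] by auto
    then show ?thesis using mono[of j i] mono[of "Suc i" j] that by (cases "j \<le> i") auto
  qed
  have S_avoid: "x \<le> g i \<or> g (Suc i) \<le> x" if "x \<in> S" "i < n" for x i
    using avoid[of x i] that grid_bounds(1)[OF gr, of i] grid_bounds(2)[OF gr, of "Suc i"]
    by (cases "x \<in> {0..T}") (auto simp: A_def)
  have mesh: "g (Suc i) - g i \<le> e" if i: "i < n" for i
  proof (rule ccontr)
    assume "\<not> ?thesis"
    then have big: "g (Suc i) > g i + e" by simp
    define k where "k = nat \<lfloor>g i / e\<rfloor> + 1"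
    have gi: "0 \<le> g i" using grid_bounds(1)[OF gr, of i] i by auto
    have k: "real k = real_of_int \<lfloor>g i / e\<rfloor> + 1" using gi e by (simp add: k_def)
    have k1: "g i < real k * e" unfolding k using e by (simp add: pos_divide_less_eq[symmetric])
    have "real_of_int \<lfloor>g i / e\<rfloor> * e \<le> g i" using e by (simp add: pos_le_divide_eq[symmetric])
    then have k2: "real k * e \<le> g i + e" unfolding k by (simp add: algebra_simps)
    have ke: "real k * e \<le> T" using k2 big grid_bounds(2)[OF gr, of "Suc i"] i by auto
    have "real k \<le> T / e" using ke e by (simp add: field_simps)
    then have "k \<le> K" unfolding K_def by linarith
    then have "real k * e \<in> A" unfolding A_def using ke e by auto
    from avoid[OF this i] show False using k1 k2 big by auto
  qed
  show ?thesis using gr mesh S_avoid by blast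
qed

text \<open>Over one cell the left side changes by the increment of \<open>X\<close> if the cell
  lies in (a, b] and by 0 otherwise, since neither a nor b is interior to a cell. Which case holds
  can be read off the right end point.\<close>

lemma simple_integral_grid_aux:
  assumes gr: "grid T n g" and t: "0 \<le> a" "a \<le> b"
    and av: "\<And>i. i < n \<Longrightarrow> a \<le> g i \<or> g (Suc i) \<le> a" "\<And>i. i < n \<Longrightarrow> b \<le> g i \<or> g (Suc i) \<le> b"
  shows "j \<le> n \<Longrightarrow> X (min (g j) b) - X (min (g j) a) =
    (\<Sum>i<j. indicator {a<..b} (g (Suc i)) * (X (g (Suc i)) - X (g i) :: real))"
proof (induction j)
  case 0
  then show ?case using gr t by (auto simp: grid_def min_def)
next
  case (Suc j)
  then have j: "j < n" and gj: "g j < g (Suc j)" using gr by (auto simp: grid_def)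
  have IH: "X (min (g j) b) - X (min (g j) a) =
    (\<Sum>i<j. indicator {a<..b} (g (Suc i)) * (X (g (Suc i)) - X (g i)))" using Suc by simp
  consider "g (Suc j) \<le> a" | "a \<le> g j" "g (Suc j) \<le> b" | "b \<le> g j"
    using av(1)[OF j] av(2)[OF j] by fastforce
  then have "X (min (g (Suc j)) b) - X (min (g (Suc j)) a) =
    X (min (g j) b) - X (min (g j) a) + indicator {a<..b} (g (Suc j)) * (X (g (Suc j)) - X (g j))"
  proof cases
    case 1
    then have "min (g (Suc j)) b = g (Suc j)" "min (g (Suc j)) a = g (Suc j)" "min (g j) b = g j"
      "min (g j) a = g j"
      "indicator {a<..b} (g (Suc j)) = (0::real)"
      using t gj by auto
    then show ?thesis by simp
  next
    case 2
    then have "min (g (Suc j)) b = g (Suc j)" "min (g (Suc j)) a = a" "min (g j) b = g j" "min (g j) a = a"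
      "indicator {a<..b} (g (Suc j)) = (1::real)"
      using t gj by auto
    then show ?thesis by simp
  next
    case 3
    then have "min (g (Suc j)) b = b" "min (g (Suc j)) a = a" "min (g j) b = b" "min (g j) a = a"
      "indicator {a<..b} (g (Suc j)) = (0::real)"
      using t gj by auto
    then show ?thesis by simp
  qed
  then show ?case using IH by simp
qed

text \<open>The integrand enters by its value at the right end of each cell, because simple
  processes are constant on left-open intervals; by \<open>simple_process_measurable\<close> this
  value is nevertheless known at the left end.\<close>

lemma simple_integral_grid:
  assumes gr: "grid T n g" and h: "is_simple_integrand M F (k, \<tau>, \<xi>)"
    and av: "\<And>l i. l \<le> k \<Longrightarrow> i < n \<Longrightarrow> \<tau> l \<le> g i \<or> g (Suc i) \<le> \<tau> l" and j: "j \<le> n"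
  shows "simple_integral X (k, \<tau>, \<xi>) (g j) \<omega> =
    transform (\<lambda>i. simple_process (k, \<tau>, \<xi>) (g (Suc i))) (\<lambda>i \<omega>. X (g (Suc i)) \<omega> - X (g i) \<omega>) j \<omega>"
proof -
  have tau: "0 \<le> \<tau> l" if "l \<le> k" for l
    using that
  proof (induction l)
    case (Suc l)
    then show ?case using h by (auto dest!: spec[of _ l])
  qed (use h in auto)
  have "simple_integral X (k, \<tau>, \<xi>) (g j) \<omega> =
     (\<Sum>l<k. \<xi> l \<omega> * (\<Sum>i<j. indicator {\<tau> l<..\<tau> (Suc l)} (g (Suc i)) * (X (g (Suc i)) \<omega> - X (g i) \<omega>)))"
    unfolding simple_integral.simps
  proof (rule sum.cong[OF refl])
    fix l assume l: "l \<in> {..<k}"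
    have "X (min (g j) (\<tau> (Suc l))) \<omega> - X (min (g j) (\<tau> l)) \<omega> =
      (\<Sum>i<j. indicator {\<tau> l<..\<tau> (Suc l)} (g (Suc i)) * (X (g (Suc i)) \<omega> - X (g i) \<omega>))"
      by (rule simple_integral_grid_aux[OF gr, where X="\<lambda>t. X t \<omega>"]) (use l tau av h j in auto)
    then show "\<xi> l \<omega> * (X (min (g j) (\<tau> (Suc l))) \<omega> - X (min (g j) (\<tau> l)) \<omega>) =
      \<xi> l \<omega> * (\<Sum>i<j. indicator {\<tau> l<..\<tau> (Suc l)} (g (Suc i)) * (X (g (Suc i)) \<omega> - X (g i) \<omega>))"
      by simp
  qed
  also have "\<dots> = (\<Sum>l<k. \<Sum>i<j. \<xi> l \<omega> * indicator {\<tau> l<..\<tau> (Suc l)} (g (Suc i)) * (X (g (Suc i)) \<omega>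
    - X (g i) \<omega>))"
    by (simp only: sum_distrib_left mult.assoc)
  also have "\<dots> = (\<Sum>i<j. \<Sum>l<k. \<xi> l \<omega> * indicator {\<tau> l<..\<tau> (Suc l)} (g (Suc i)) * (X (g (Suc i)) \<omega>
    - X (g i) \<omega>))"
    by (rule sum.swap)
  also have "\<dots> = transform (\<lambda>i. simple_process (k, \<tau>, \<xi>) (g (Suc i))) (\<lambda>i \<omega>. X (g (Suc i)) \<omega>
    - X (g i) \<omega>) j \<omega>"
    by (simp only: transform_def sum_distrib_right simple_process.simps)
  finally show ?thesis .
qed

lemma simple_process_grid:
  assumes av: "\<And>l. l \<le> k \<Longrightarrow> \<tau> l \<le> a \<or> b \<le> \<tau> l" and t: "a < t" "t \<le> b"
  shows "simple_process (k, \<tau>, \<xi>) t \<omega> = simple_process (k, \<tau>, \<xi>) b \<omega>"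
  unfolding simple_process.simps
proof (rule sum.cong[OF refl])
  fix l assume "l \<in> {..<k}"
  then have "\<tau> l \<le> a \<or> b \<le> \<tau> l" "\<tau> (Suc l) \<le> a \<or> b \<le> \<tau> (Suc l)" using av by auto
  then have "indicator {\<tau> l<..\<tau> (Suc l)} t = (indicator {\<tau> l<..\<tau> (Suc l)} b :: real)"
    using t by (auto simp: indicator_def)
  then show "\<xi> l \<omega> * indicator {\<tau> l<..\<tau> (Suc l)} t = \<xi> l \<omega> * indicator {\<tau> l<..\<tau> (Suc l)} b"
    by simp
qed

text \<open>Predictability: an interval starting at \<open>\<tau> l\<close> contributes at time b
  only if \<open>\<tau> l < b\<close>, and then \<open>\<tau> l \<le> a\<close> by the hypothesis,
  so its coefficient is already known at a.\<close>

lemma simple_process_measurable: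
  assumes filt: "filtration \<Omega> F" and h: "is_simple_integrand M F (k, \<tau>, \<xi>)"
    and av: "\<And>l. l \<le> k \<Longrightarrow> \<tau> l \<le> a \<or> b \<le> \<tau> l"
  shows "simple_process (k, \<tau>, \<xi>) b \<in> borel_measurable (F a)"
proof -
  have "(\<lambda>\<omega>. \<xi> l \<omega> * indicator {\<tau> l<..\<tau> (Suc l)} b) \<in> borel_measurable (F a)" if l: "l < k" for l
  proof (cases "\<tau> l \<le> a")
    case True
    have "subalgebra (F a) (F (\<tau> l))"
      using filtration.sets_F_mono[OF filt True] filtration.space_F[OF filt] by (auto simp: subalgebra_def)
    then have "\<xi> l \<in> borel_measurable (F a)" by (rule measurable_from_subalg) (use h l in simp)
    then show ?thesis by auto
  next
    case False
    then have "b \<le> \<tau> l" using av[of l] l by auto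
    then show ?thesis by (simp add: indicator_def)
  qed
  then have "(\<lambda>\<omega>. \<Sum>l<k. \<xi> l \<omega> * indicator {\<tau> l<..\<tau> (Suc l)} b) \<in> borel_measurable (F a)"
    by (intro borel_measurable_sum) auto
  moreover have "simple_process (k, \<tau>, \<xi>) b = (\<lambda>\<omega>. \<Sum>l<k. \<xi> l \<omega> * indicator {\<tau> l<..\<tau> (Suc l)} b)"
    by (rule ext) (simp only: simple_process.simps)
  ultimately show ?thesis by (simp only:)
qed

lemma simple_process_bounded:
  assumes h: "is_simple_integrand M F (k, \<tau>, \<xi>)"
  shows "\<exists>C\<ge>0. \<forall>t. \<forall>\<omega>\<in>space M. \<bar>simple_process (k, \<tau>, \<xi>) t \<omega>\<bar> \<le> C"
proof -
  have "\<forall>l\<in>{..<k}. \<exists>C. \<forall>\<omega>\<in>space M. \<bar>\<xi> l \<omega>\<bar> \<le> C" using h by auto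
  then obtain C where C: "\<And>l \<omega>. l < k \<Longrightarrow> \<omega> \<in> space M \<Longrightarrow> \<bar>\<xi> l \<omega>\<bar> \<le> C l"
    by (metis lessThan_iff)
  have "\<bar>simple_process (k, \<tau>, \<xi>) t \<omega>\<bar> \<le> (\<Sum>l<k. \<bar>C l\<bar>)" if "\<omega> \<in> space M" for t \<omega>
  proof -
    have "\<bar>simple_process (k, \<tau>, \<xi>) t \<omega>\<bar> \<le> (\<Sum>l<k. \<bar>\<xi> l \<omega> * indicator {\<tau> l<..\<tau> (Suc l)} t\<bar>)"
      unfolding simple_process.simps by (rule sum_abs)
    also have "\<dots> \<le> (\<Sum>l<k. \<bar>C l\<bar>)"
      using C[OF _ that] by (intro sum_mono) (fastforce simp: indicator_def)
    finally show ?thesis .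
  qed
  then show ?thesis by (intro exI[of _ "\<Sum>l<k. \<bar>C l\<bar>"]) (auto intro: sum_nonneg)
qed

lemma nn_integral_grid:
  assumes gr: "grid T n g" and f: "f \<in> borel_measurable borel"
  shows "j \<le> n \<Longrightarrow> (\<integral>\<^sup>+t\<in>{0..g j}. f t \<partial>lborel) = (\<Sum>i<j. \<integral>\<^sup>+t\<in>{g i<..g (Suc i)}. f t \<partial>lborel)"
proof (induction j)
  case 0
  have "AE t in lborel. f t * indicator {0..0::real} t = 0"
    using AE_lborel_singleton[of "0::real"] by eventually_elim (auto simp: indicator_def)
  then have "(\<integral>\<^sup>+t\<in>{0..0::real}. f t \<partial>lborel) = (\<integral>\<^sup>+(t::real). 0 \<partial>lborel)" by (rule nn_integral_cong_AE)
  then show ?case using gr by (simp add: grid_def)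
next
  case (Suc j)
  have "0 \<le> g j" "g j < g (Suc j)" using grid_bounds[OF gr, of j] Suc gr by (auto simp: grid_def)
  then have *: "f t * indicator {0..g (Suc j)} t =
     f t * indicator {0..g j} t + f t * indicator {g j<..g (Suc j)} t" for t
    by (auto simp: indicator_def)
  have "(\<integral>\<^sup>+t\<in>{0..g (Suc j)}. f t \<partial>lborel) =
     (\<integral>\<^sup>+t\<in>{0..g j}. f t \<partial>lborel) + (\<integral>\<^sup>+t\<in>{g j<..g (Suc j)}. f t \<partial>lborel)"
    unfolding * using f by (intro nn_integral_add) auto
  then show ?case using Suc by simp
qed

lemma (in prob_space) indep_set_compose:
  assumes ind: "indep_set A (sets (vimage_algebra (space M) D borel))"
    and g: "g \<in> measurable borel N"
  shows "indep_set A (sets (vimage_algebra (space M) (\<lambda>\<omega>. g (D \<omega>)) N))"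
proof -
  have "sets (vimage_algebra (space M) (\<lambda>\<omega>. g (D \<omega>)) N) \<subseteq> sets (vimage_algebra (space M) D borel)"
  proof (rule sets_image_in_sets)
    show "space (vimage_algebra (space M) D borel) = space M" by simp
    show "(\<lambda>\<omega>. g (D \<omega>)) \<in> measurable (vimage_algebra (space M) D borel) N"
      by (rule measurable_compose[OF measurable_vimage_algebra1 g]) auto
  qed
  with ind show ?thesis
    unfolding indep_set_def by (elim indep_sets_mono_sets) (auto split: bool.split)
qed

text \<open>The horizon is part of the locale because the measure of Girsanov's theorem changes with
  \<open>T\<close> and is used for the shifted process up to \<open>T\<close> only. The value at
  time 0 is left free, since everything is expressed by increments.\<close>

locale brownian_upto = prob_space M for M :: "'a measure" +
  fixes F :: "real \<Rightarrow> 'a measure" and X :: "'a process" and T :: real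
  assumes filt: "filtration (space M) F" and sub: "\<And>t. subalgebra M (F t)"
    and adap: "\<And>t. 0 \<le> t \<Longrightarrow> t \<le> T \<Longrightarrow> X t \<in> borel_measurable (F t)"
    and distr: "\<And>s t. 0 \<le> s \<Longrightarrow> s < t \<Longrightarrow> t \<le> T \<Longrightarrow>
      distributed M lborel (\<lambda>\<omega>. X t \<omega> - X s \<omega>) (\<lambda>x. ennreal (normal_density 0 (sqrt (t - s)) x))"
    and ind: "\<And>s t. 0 \<le> s \<Longrightarrow> s < t \<Longrightarrow> t \<le> T \<Longrightarrow>
      indep_set (sets (F s)) (sets (vimage_algebra (space M) (\<lambda>\<omega>. X t \<omega> - X s \<omega>) borel))"
begin

lemma measurable_F_mono: "f \<in> borel_measurable (F s) \<Longrightarrow> s \<le> t \<Longrightarrow> f \<in> borel_measurable (F t)"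
  by (rule measurable_from_subalg[of "F t" "F s"])
    (use filtration.sets_F_mono[OF filt] filtration.space_F[OF filt] in \<open>auto simp: subalgebra_def\<close>)

lemma measurable_F: "f \<in> borel_measurable (F s) \<Longrightarrow> f \<in> borel_measurable M"
  using sub measurable_from_subalg by blast

text \<open>The increments pass through functions \<open>\<psi> i\<close>, with all moments reduced
  to Gaussian integrals, so that one statement covers the plain increments and the errors of the
  Euler scheme for geometric Brownian motion.\<close>

lemma indep_increments_grid:
  assumes gr: "grid T n g" and psi: "\<And>i. i < n \<Longrightarrow> \<psi> i \<in> borel_measurable borel"
    and i1: "\<And>i. i < n \<Longrightarrow> integrable lborel (\<lambda>x. normal_density 0 (sqrt (g (Suc i) - g i)) x * (\<psi> i x)\<^sup>2)"
    and i2: "\<And>i. i < n \<Longrightarrow> (\<integral>x. normal_density 0 (sqrt (g (Suc i) - g i)) x * \<psi> i x \<partial>lborel) = 0"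
    and i3: "\<And>i. i < n \<Longrightarrow> (\<integral>x. normal_density 0 (sqrt (g (Suc i) - g i)) x * (\<psi> i x)\<^sup>2 \<partial>lborel) = v i"
  shows "indep_increments M n (\<lambda>i. F (g i)) (\<lambda>i \<omega>. \<psi> i (X (g (Suc i)) \<omega> - X (g i) \<omega>)) v"
proof
  show "subalgebra M (F (g i))" for i by (rule sub)
  show "sets (F (g i)) \<subseteq> sets (F (g j))" if "i \<le> j" "j \<le> n" for i j
    using filtration.sets_F_mono[OF filt grid_mono[OF gr that]] .
  fix i assume i: "i < n"
  let ?D = "\<lambda>\<omega>. X (g (Suc i)) \<omega> - X (g i) \<omega>"
  have b: "0 \<le> g i" "g i < g (Suc i)" "g (Suc i) \<le> T"
    using grid_bounds(1)[OF gr, of i] grid_bounds(2)[OF gr, of "Suc i"] gr i by (auto simp: grid_def)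
  have D: "?D \<in> borel_measurable (F (g (Suc i)))"
    using adap[of "g (Suc i)"] measurable_F_mono[OF adap[of "g i"], of "g (Suc i)"] b by auto
  then show m: "(\<lambda>\<omega>. \<psi> i (?D \<omega>)) \<in> borel_measurable (F (g (Suc i)))"
    using measurable_compose[OF D psi[OF i]] by simp
  have DM: "?D \<in> borel_measurable M" using measurable_F[OF D] .
  note dst = distr[OF b]
  show "indep_set (sets (F (g i))) (sets (vimage_algebra (space M) (\<lambda>\<omega>. \<psi> i (?D \<omega>)) borel))"
    by (rule indep_set_compose[OF ind[OF b] psi[OF i]])
  have p2: "(\<lambda>x. (\<psi> i x)\<^sup>2) \<in> borel_measurable lborel" "\<psi> i \<in> borel_measurable lborel"
    using psi[OF i] by auto
  show "integrable M (\<lambda>\<omega>. (\<psi> i (?D \<omega>))\<^sup>2)"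
    using i1[OF i] distributed_integrable[OF dst p2(1)] by auto
  show "expectation (\<lambda>\<omega>. \<psi> i (?D \<omega>)) = 0"
    using i2[OF i] distributed_integral[OF dst p2(2)] by auto
  show "expectation (\<lambda>\<omega>. (\<psi> i (?D \<omega>))\<^sup>2) = v i"
    using i3[OF i] distributed_integral[OF dst p2(1)] by auto
qed

lemma indep_increments_id:
  assumes gr: "grid T n g"
  shows "indep_increments M n (\<lambda>i. F (g i)) (\<lambda>i \<omega>. X (g (Suc i)) \<omega> - X (g i) \<omega>) (\<lambda>i. g (Suc i) - g i)"
proof (rule indep_increments_grid[OF gr, where \<psi>="\<lambda>i x. x"])
  fix i assume "i < n"
  then have p: "0 < sqrt (g (Suc i) - g i)" using gr by (auto simp: grid_def)
  show "integrable lborel (\<lambda>x. normal_density 0 (sqrt (g (Suc i) - g i)) x * x\<^sup>2)"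
    using integrable_normal_moment[OF p, of 0 2] by (simp only: diff_zero)
  show "(\<integral>x. normal_density 0 (sqrt (g (Suc i) - g i)) x * x \<partial>lborel) = 0"
    by (rule integral_normal_moment_nz_1[OF p, of 0])
  show "(\<integral>x. normal_density 0 (sqrt (g (Suc i) - g i)) x * x\<^sup>2 \<partial>lborel) = g (Suc i) - g i"
    using integral_normal_moment_even[OF p, of 0 1] p by (simp add: fact_2 real_sqrt_gt_0_iff)
qed simp

end

section \<open>Change of measure\<close>

lemma nn_integral_lborel_shift:
  fixes c :: real
  assumes [measurable]: "f \<in> borel_measurable borel"
  shows "(\<integral>\<^sup>+x. f (x + c) \<partial>lborel) = (\<integral>\<^sup>+x. f x \<partial>lborel)"
  using nn_integral_real_affine[of f 1 c] by (simp add: add.commute)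

text \<open>Completing the square: tilting a centred Gaussian by an exponential only moves its
  centre. Girsanov's theorem and the lognormal moments both rest on this identity.\<close>

lemma normal_density_exp_shift:
  fixes k :: real
  assumes "0 < u"
  shows "normal_density 0 (sqrt u) x * exp (- k * x - k\<^sup>2 * u / 2) = normal_density 0 (sqrt u) (x + k * u)"
proof -
  have "- x\<^sup>2 / (2 * u) + (- k * x - k\<^sup>2 * u / 2) = - (x + k * u)\<^sup>2 / (2 * u)"
    using assms by (simp add: field_simps power2_eq_square)
  then show ?thesis
    using assms unfolding normal_density_def by (simp add: exp_add[symmetric])
qed

text \<open>Girsanov's density. The initial value is subtracted since a Brownian motion starts at 0
  only almost surely, whereas this process is 1 at time 0 for every \<omega>.\<close>

definition exp_density :: "'a process \<Rightarrow> real \<Rightarrow> real \<Rightarrow> 'a \<Rightarrow> real" where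
  "exp_density X k t \<omega> = exp (- k * (X t \<omega> - X 0 \<omega>) - k\<^sup>2 * t / 2)"

lemma exp_density_pos: "0 < exp_density X k t \<omega>"
  by (simp add: exp_density_def)

context brownian_upto
begin

lemma nn_integral_increment:
  fixes \<zeta> :: "'a \<Rightarrow> ennreal" and g :: "real \<Rightarrow> ennreal"
  assumes st: "0 \<le> s" "s < t" "t \<le> T"
    and z: "\<zeta> \<in> borel_measurable (F s)" and g: "g \<in> borel_measurable borel"
  shows "(\<integral>\<^sup>+\<omega>. \<zeta> \<omega> * g (X t \<omega> - X s \<omega>) \<partial>M) =
    (\<integral>\<^sup>+\<omega>. \<zeta> \<omega> \<partial>M) * (\<integral>\<^sup>+x. ennreal (normal_density 0 (sqrt (t - s)) x) * g x \<partial>lborel)"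
proof -
  let ?D = "\<lambda>\<omega>. X t \<omega> - X s \<omega>"
  have D: "?D \<in> borel_measurable M"
    using distr[OF st] by (simp add: distributed_def)
  have gD: "(\<lambda>\<omega>. g (?D \<omega>)) \<in> borel_measurable M" using D g by measurable
  have iv: "indep_var borel \<zeta> borel (\<lambda>\<omega>. g (?D \<omega>))"
    by (rule indep_var_indep_set[OF sub indep_set_compose[OF ind[OF st] g] gD z])
  have "(\<integral>\<^sup>+\<omega>. (\<Prod>i\<in>UNIV. case_bool \<zeta> (\<lambda>\<omega>. g (?D \<omega>)) i \<omega>) \<partial>M) =
      (\<Prod>i\<in>UNIV. \<integral>\<^sup>+\<omega>. case_bool \<zeta> (\<lambda>\<omega>. g (?D \<omega>)) i \<omega> \<partial>M)"
  proof (rule indep_vars_nn_integral)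
    have "case_bool (borel :: ennreal measure) borel = (\<lambda>_. borel)" by (auto split: bool.split)
    then show "indep_vars (\<lambda>_. borel) (case_bool \<zeta> (\<lambda>\<omega>. g (?D \<omega>))) UNIV"
      using iv unfolding indep_var_def by simp
  qed auto
  then have "(\<integral>\<^sup>+\<omega>. \<zeta> \<omega> * g (?D \<omega>) \<partial>M) = (\<integral>\<^sup>+\<omega>. \<zeta> \<omega> \<partial>M) * (\<integral>\<^sup>+\<omega>. g (?D \<omega>) \<partial>M)"
    by (simp add: UNIV_bool mult.commute)
  also have "(\<integral>\<^sup>+\<omega>. g (?D \<omega>) \<partial>M) = (\<integral>\<^sup>+x. ennreal (normal_density 0 (sqrt (t - s)) x) * g x \<partial>lborel)"
    using distributed_nn_integral[OF distr[OF st], of g] g by simp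
  finally show ?thesis .
qed

lemma exp_density_measurable:
  assumes "0 \<le> t" "t \<le> T"
  shows "exp_density X k t \<in> borel_measurable (F t)"
proof -
  have [measurable]: "X t \<in> borel_measurable (F t)" "X 0 \<in> borel_measurable (F t)"
    using adap[of t] measurable_F_mono[OF adap[of 0]] assms by auto
  show ?thesis unfolding exp_density_def[abs_def] by measurable
qed

text \<open>The density at \<open>t\<close> is the density at \<open>s\<close> times an exponential
  in the increment, and this factor moves the centre of the Gaussian increment to - k (t - s), which
  cancels the added drift.\<close>

lemma exp_density_increment:
  fixes \<zeta> :: "'a \<Rightarrow> ennreal" and g :: "real \<Rightarrow> ennreal"
  assumes st: "0 \<le> s" "s < t" "t \<le> T"
    and z: "\<zeta> \<in> borel_measurable (F s)" and g: "g \<in> borel_measurable borel"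
  shows "(\<integral>\<^sup>+\<omega>. \<zeta> \<omega> * g (X t \<omega> - X s \<omega> + k * (t - s)) * exp_density X k t \<omega> \<partial>M) =
    (\<integral>\<^sup>+\<omega>. \<zeta> \<omega> * exp_density X k s \<omega> \<partial>M) * (\<integral>\<^sup>+x. ennreal (normal_density 0 (sqrt (t - s)) x) * g x
      \<partial>lborel)"
proof -
  note [measurable] = g
  let ?e = "\<lambda>x. exp (- k * x - k\<^sup>2 * (t - s) / 2)"
  have e: "exp_density X k t \<omega> = exp_density X k s \<omega> * ?e (X t \<omega> - X s \<omega>)" for \<omega>
    unfolding exp_density_def by (simp add: exp_add[symmetric] field_simps)
  have "(\<integral>\<^sup>+\<omega>. \<zeta> \<omega> * g (X t \<omega> - X s \<omega> + k * (t - s)) * exp_density X k t \<omega> \<partial>M) =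
    (\<integral>\<^sup>+\<omega>. (\<zeta> \<omega> * exp_density X k s \<omega>) * (g (X t \<omega> - X s \<omega> + k * (t - s)) * ?e (X t \<omega> - X s \<omega>)) \<partial>M)"
    by (intro nn_integral_cong) (simp add: e ennreal_mult exp_density_pos less_imp_le ac_simps)
  also have "\<dots> = (\<integral>\<^sup>+\<omega>. \<zeta> \<omega> * exp_density X k s \<omega> \<partial>M) *
     (\<integral>\<^sup>+x. ennreal (normal_density 0 (sqrt (t - s)) x) * (g (x + k * (t - s)) * ?e x) \<partial>lborel)"
    using z exp_density_measurable[of s k] st
    by (intro nn_integral_increment[OF st]) auto
  also have "(\<integral>\<^sup>+x. ennreal (normal_density 0 (sqrt (t - s)) x) * (g (x + k * (t - s)) * ?e x) \<partial>lborel) =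
    (\<integral>\<^sup>+x. ennreal (normal_density 0 (sqrt (t - s)) (x + k * (t - s))) * g (x + k * (t - s)) \<partial>lborel)"
  proof (intro nn_integral_cong)
    fix x
    have "ennreal (normal_density 0 (sqrt (t - s)) x) * ennreal (?e x) =
      ennreal (normal_density 0 (sqrt (t - s)) (x + k * (t - s)))"
      using normal_density_exp_shift[of "t - s" x k] st by (simp add: ennreal_mult[symmetric])
    then show "ennreal (normal_density 0 (sqrt (t - s)) x) * (g (x + k * (t - s)) * ennreal (?e x)) =
      ennreal (normal_density 0 (sqrt (t - s)) (x + k * (t - s))) * g (x + k * (t - s))"
      by (simp add: ac_simps) (metis mult.assoc mult.commute)
  qed
  also have "\<dots> = (\<integral>\<^sup>+x. ennreal (normal_density 0 (sqrt (t - s)) x) * g x \<partial>lborel)"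
    by (rule nn_integral_lborel_shift[where f="\<lambda>x. ennreal (normal_density 0 (sqrt (t - s)) x) * g x"]) simp
  finally show ?thesis .
qed

lemma nn_integral_normal_density:
  assumes "0 < u"
  shows "(\<integral>\<^sup>+x. ennreal (normal_density 0 (sqrt u) x) \<partial>lborel) = 1"
  using assms by (subst nn_integral_eq_integral) auto

lemma exp_density_martingale:
  fixes \<zeta> :: "'a \<Rightarrow> ennreal"
  assumes st: "0 \<le> s" "s \<le> t" "t \<le> T" and z: "\<zeta> \<in> borel_measurable (F s)"
  shows "(\<integral>\<^sup>+\<omega>. \<zeta> \<omega> * exp_density X k t \<omega> \<partial>M) = (\<integral>\<^sup>+\<omega>. \<zeta> \<omega> * exp_density X k s \<omega> \<partial>M)"
proof (cases "s = t")
  case False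
  then have "s < t" using st by auto
  from exp_density_increment[OF st(1) this st(3) z, of "\<lambda>_. 1" k] show ?thesis
    using nn_integral_normal_density[of "t - s"] \<open>s < t\<close> by simp
qed simp

text \<open>Everything follows from one factorization, \<open>key\<close>: for \<zeta> known at s,
  the increment of the shifted process integrates under the new measure as an independent centred
  Gaussian would. With \<zeta> = 1 it gives the law, with indicators the independence. In its proof
  the density at T is exchanged for that at t by the martingale property.\<close>

theorem girsanov:
  assumes T: "0 \<le> T"
  shows "brownian_upto (density M (\<lambda>\<omega>. ennreal (exp_density X k T \<omega>))) F (\<lambda>t \<omega>. X t \<omega> + k * t) T"
proof -
  let ?Q = "density M (\<lambda>\<omega>. ennreal (exp_density X k T \<omega>))"
  have LT [measurable]: "exp_density X k T \<in> borel_measurable M"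
    using measurable_F[OF exp_density_measurable[of T k]] T by auto
  have "emeasure ?Q (space M) = (\<integral>\<^sup>+\<omega>. 1 * ennreal (exp_density X k T \<omega>) \<partial>M)"
    by (subst emeasure_density) (auto intro!: nn_integral_cong)
  also have "\<dots> = (\<integral>\<^sup>+\<omega>. 1 * ennreal (exp_density X k 0 \<omega>) \<partial>M)"
    using T by (intro exp_density_martingale) auto
  also have "\<dots> = 1" by (simp add: exp_density_def emeasure_space_1)
  finally have pQ: "prob_space ?Q" by (intro prob_spaceI) simp
  interpret Q: prob_space ?Q by (rule pQ)
  have nnQ: "(\<integral>\<^sup>+\<omega>. \<zeta> \<omega> \<partial>?Q) = (\<integral>\<^sup>+\<omega>. \<zeta> \<omega> * exp_density X k T \<omega> \<partial>M)" if "\<zeta> \<in> borel_measurable M"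
    for \<zeta> :: "'a \<Rightarrow> ennreal"
    using that by (subst nn_integral_density) (auto simp: mult.commute)
  have key: "(\<integral>\<^sup>+\<omega>. \<zeta> \<omega> * g (X t \<omega> + k * t - (X s \<omega> + k * s)) \<partial>?Q) =
      (\<integral>\<^sup>+\<omega>. \<zeta> \<omega> \<partial>?Q) * (\<integral>\<^sup>+x. ennreal (normal_density 0 (sqrt (t - s)) x) * g x \<partial>lborel)"
    if st: "0 \<le> s" "s < t" "t \<le> T"
      and z: "\<zeta> \<in> borel_measurable (F s)" and g: "g \<in> borel_measurable borel" for s t
        and \<zeta> :: "'a \<Rightarrow> ennreal" and g :: "real \<Rightarrow> ennreal"
  proof -
    note [measurable] = g
    have m: "\<zeta> \<in> borel_measurable (F t)" "X s \<in> borel_measurable (F t)" "X t \<in> borel_measurable (F t)"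
      using measurable_F_mono[OF adap[of s]] st adap[of t]
        measurable_from_subalg[OF _ z, of "F t"] filtration.sets_F_mono[OF filt, of s t]
          filtration.space_F[OF filt]
      by (auto simp: subalgebra_def)
    have m2: "(\<lambda>\<omega>. \<zeta> \<omega> * g (X t \<omega> + k * t - (X s \<omega> + k * s))) \<in> borel_measurable (F t)"
      using m by measurable
    have "(\<integral>\<^sup>+\<omega>. \<zeta> \<omega> * g (X t \<omega> + k * t - (X s \<omega> + k * s)) \<partial>?Q) =
       (\<integral>\<^sup>+\<omega>. \<zeta> \<omega> * g (X t \<omega> + k * t - (X s \<omega> + k * s)) * exp_density X k T \<omega> \<partial>M)"
      by (rule nnQ) (rule measurable_from_subalg[OF sub m2])
    also have "\<dots> = (\<integral>\<^sup>+\<omega>. \<zeta> \<omega> * g (X t \<omega> + k * t - (X s \<omega> + k * s)) * exp_density X k t \<omega> \<partial>M)"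
      by (rule exp_density_martingale[OF _ st(3) _ m2]) (use st in auto)
    also have "\<dots> = (\<integral>\<^sup>+\<omega>. \<zeta> \<omega> * g (X t \<omega> - X s \<omega> + k * (t - s)) * exp_density X k t \<omega> \<partial>M)"
      by (simp add: algebra_simps)
    also have "\<dots> = (\<integral>\<^sup>+\<omega>. \<zeta> \<omega> * exp_density X k s \<omega> \<partial>M) *
      (\<integral>\<^sup>+x. ennreal (normal_density 0 (sqrt (t - s)) x) * g x \<partial>lborel)"
      by (rule exp_density_increment[OF st z g])
    also have "(\<integral>\<^sup>+\<omega>. \<zeta> \<omega> * exp_density X k s \<omega> \<partial>M) = (\<integral>\<^sup>+\<omega>. \<zeta> \<omega> * exp_density X k T \<omega> \<partial>M)"
      by (rule exp_density_martingale[symmetric, OF st(1) _ _ z]) (use st in auto)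
    also have "\<dots> = (\<integral>\<^sup>+\<omega>. \<zeta> \<omega> \<partial>?Q)"
      by (rule nnQ[symmetric]) (rule measurable_from_subalg[OF sub z])
    finally show ?thesis .
  qed
  show ?thesis
  proof (intro brownian_upto.intro brownian_upto_axioms.intro)
    show "prob_space ?Q" by (rule pQ)
    show "filtration (space ?Q) F" using filt by simp
    show "subalgebra ?Q (F t)" for t using sub[of t] by (simp add: subalgebra_def)
    show "(\<lambda>\<omega>. X t \<omega> + k * t) \<in> borel_measurable (F t)" if "0 \<le> t" "t \<le> T" for t
      using adap[OF that] by measurable
  next
    fix s t assume st: "0 \<le> s" "s < t" "t \<le> T"
    let ?D = "\<lambda>\<omega>. X t \<omega> + k * t - (X s \<omega> + k * s)"
    let ?N = "\<lambda>x. ennreal (normal_density 0 (sqrt (t - s)) x)"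
    have [measurable]: "X t \<in> borel_measurable M" "X s \<in> borel_measurable M"
      using measurable_F[OF adap[of t]] measurable_F[OF adap[of s]] st by auto
    have D [measurable]: "?D \<in> borel_measurable M" by measurable
    have one: "(\<integral>\<^sup>+\<omega>. 1 \<partial>?Q) = 1" by (simp only: nn_integral_const Q.emeasure_space_1 mult_1)
    have dD: "emeasure ?Q (?D -` E \<inter> space M) = emeasure (density lborel ?N) E" if E: "E \<in> sets borel" for E
    proof -
      have "emeasure ?Q (?D -` E \<inter> space M) = (\<integral>\<^sup>+\<omega>. 1 * indicator E (?D \<omega>) \<partial>?Q)"
      proof -
        have S: "?D -` E \<inter> space M \<in> sets ?Q" using measurable_sets[OF D E] by simp
        show ?thesis unfolding nn_integral_indicator[OF S, symmetric]
          by (rule nn_integral_cong) (simp add: indicator_def)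
      qed
      also have "\<dots> = (\<integral>\<^sup>+x. ?N x * indicator E x \<partial>lborel)"
        using key[OF st, of "\<lambda>_. 1" "indicator E"] E one by simp
      also have "\<dots> = emeasure (density lborel ?N) E"
        using E by (simp add: emeasure_density)
      finally show ?thesis .
    qed
    show "distributed ?Q lborel ?D ?N"
      unfolding distributed_def
    proof (intro conjI)
      show "distr ?Q lborel ?D = density lborel ?N"
      proof (rule measure_eqI)
        fix E assume "E \<in> sets (distr ?Q lborel ?D)"
        then have E: "E \<in> sets borel" by simp
        then have "emeasure (distr ?Q lborel ?D) E = emeasure ?Q (?D -` E \<inter> space M)"
          using D by (subst emeasure_distr) auto
        then show "emeasure (distr ?Q lborel ?D) E = emeasure (density lborel ?N) E" using dD[OF E] by simp
      qed simp
    qed auto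
    show "Q.indep_set (sets (F s)) (sets (vimage_algebra (space ?Q) ?D borel))"
    proof (rule Q.indep_setI)
      show "sets (F s) \<subseteq> sets ?Q" using sub[of s] by (simp add: subalgebra_def)
      have V: "sets (vimage_algebra (space ?Q) ?D borel) = {?D -` A \<inter> space M | A. A \<in> sets borel}"
        by (subst sets_vimage_algebra2) auto
      show "sets (vimage_algebra (space ?Q) ?D borel) \<subseteq> sets ?Q" unfolding V
        using measurable_sets[OF D] by auto
      fix a b assume a: "a \<in> sets (F s)" and "b \<in> sets (vimage_algebra (space ?Q) ?D borel)"
      then obtain E where E: "E \<in> sets borel" and b: "b = ?D -` E \<inter> space M" unfolding V by auto
      have aM: "a \<in> sets M" using a sub[of s] by (auto simp: subalgebra_def)
      have bM: "b \<in> sets M" unfolding b using measurable_sets[OF D E] .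
      have "emeasure ?Q (a \<inter> b) = (\<integral>\<^sup>+\<omega>. indicator a \<omega> * indicator E (?D \<omega>) \<partial>?Q)"
      proof -
        have S: "a \<inter> b \<in> sets ?Q" using aM bM by simp
        show ?thesis unfolding nn_integral_indicator[OF S, symmetric]
          by (rule nn_integral_cong) (simp add: indicator_def b)
      qed
      also have "\<dots> = (\<integral>\<^sup>+\<omega>. indicator a \<omega> \<partial>?Q) * (\<integral>\<^sup>+x. ?N x * indicator E x \<partial>lborel)"
        using a E by (intro key[OF st]) auto
      also have "\<dots> = emeasure ?Q a * emeasure ?Q b"
        using aM E dD[OF E] by (simp add: b emeasure_density)
      finally show "Q.prob (a \<inter> b) = Q.prob a * Q.prob b"
        by (simp add: Q.emeasure_eq_measure ennreal_mult[symmetric])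
    qed
  qed
qed

end

section \<open>The budget inequality\<close>

lemma (in prob_space) prob_incseq_full:
  assumes G: "\<And>n. G n \<in> events" "incseq G" "(\<Union>n. G n) = space M" and e: "0 < (e::real)"
  shows "\<exists>n. prob (space M - G n) < e"
proof -
  have "(\<lambda>n. prob (G n)) \<longlonglongrightarrow> prob (\<Union>n. G n)"
    using G by (intro finite_Lim_measure_incseq) auto
  then have "(\<lambda>n. prob (G n)) \<longlonglongrightarrow> 1" using G prob_space by simp
  then have "eventually (\<lambda>n. 1 - e < prob (G n)) sequentially"
    by (rule order_tendstoD) (use e in simp)
  then obtain n where "1 - e < prob (G n)" by (auto simp: eventually_sequentially)
  then have "prob (space M - G n) < e" using prob_compl[OF G(1)[of n]] by simp
  then show ?thesis ..
qed

text \<open>The multiples q T with rational q in [0, 1] form a countable dense subset of [0, T] that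
  contains both end points even if T is irrational. Measurability of events and suprema over an
  interval of times is checked on it.\<close>

lemma rational_dense:
  fixes s T d :: real
  assumes "s \<in> {0..T}" "0 < d"
  shows "\<exists>q\<in>\<rat>. q \<in> {0..1} \<and> \<bar>q * T - s\<bar> < d"
proof (cases "T = 0")
  case True
  then show ?thesis using assms by (intro bexI[of _ 0]) auto
next
  case False
  then have T: "0 < T" using assms by auto
  show ?thesis
  proof (cases "s = T")
    case True
    then show ?thesis using assms T by (intro bexI[of _ 1]) auto
  next
    case ne: False
    have "s / T < min 1 (s / T + d / T)" using ne assms T by (auto simp: field_simps)
    then obtain q where q: "q \<in> \<rat>" "s / T < q" "q < min 1 (s / T + d / T)"
      using Rats_dense_in_real by blast
    have "0 \<le> s / T" using assms T by simp
    then have "q \<in> {0..1}" using q by auto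
    moreover have "s < q * T" "q * T < s + d" using q T by (auto simp: field_simps)
    ultimately show ?thesis using q by (intro bexI[of _ q]) auto
  qed
qed

text \<open>Each path is uniformly continuous on the compact interval, but with a modulus of its
  own. The events on which distance 1 / (n + 1) suffices at rational points increase to the whole
  space, so one n does outside a set of small probability; continuity extends the estimate to all
  points.\<close>

lemma (in prob_space) continuity_modulus:
  fixes Z :: "real \<Rightarrow> 'a \<Rightarrow> real"
  assumes m: "\<And>t. t \<in> {0..T} \<Longrightarrow> Z t \<in> borel_measurable M"
    and c: "\<And>\<omega>. \<omega> \<in> space M \<Longrightarrow> continuous_on {0..T} (\<lambda>t. Z t \<omega> :: real)"
    and T: "0 \<le> T" and w: "0 < w" and e: "0 < (e::real)"
  obtains \<eta> G where "0 < \<eta>" "G \<in> events" "prob (space M - G) < e"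
    "\<And>\<omega> s t. \<omega> \<in> G \<Longrightarrow> s \<in> {0..T} \<Longrightarrow> t \<in> {0..T} \<Longrightarrow> \<bar>s - t\<bar> < \<eta> \<Longrightarrow> \<bar>Z s \<omega> - Z t \<omega>\<bar> \<le> w"
proof -
  let ?R = "\<rat> \<inter> {0..1::real}"
  define P where "P n q r \<omega> \<longleftrightarrow> \<bar>q * T - r * T\<bar> < 1 / real (Suc n) \<longrightarrow> \<bar>Z (q * T) \<omega> - Z (r * T) \<omega>\<bar> \<le> w"
    for n q r \<omega>
  define G where "G n = {\<omega>\<in>space M. \<forall>q\<in>?R. \<forall>r\<in>?R. P n q r \<omega>}" for n
  have RT: "q * T \<in> {0..T}" if "q \<in> ?R" for q using that T by (auto intro: mult_left_le_one_le)
  have cR: "countable ?R" using countable_rat by (rule countable_subset[rotated]) auto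
  have Gm: "G n \<in> events" for n
  proof -
    have "{\<omega>\<in>space M. P n q r \<omega>} \<in> events" if "q \<in> ?R" "r \<in> ?R" for q r
    proof -
      have [measurable]: "Z (q * T) \<in> borel_measurable M" "Z (r * T) \<in> borel_measurable M"
        using m RT that by auto
      show ?thesis unfolding P_def by measurable
    qed
    then have "{\<omega>\<in>space M. \<forall>r\<in>?R. P n q r \<omega>} \<in> events" if "q \<in> ?R" for q
      using that by (intro sets.sets_Collect_countable_All'[OF _ cR]) auto
    then show ?thesis unfolding G_def
      by (rule sets.sets_Collect_countable_All'[OF _ cR])
  qed
  have Ginc: "incseq G"
  proof (rule incseq_SucI, rule subsetI)
    fix n \<omega> assume w: "\<omega> \<in> G n"
    have le: "1 / real (Suc (Suc n)) \<le> 1 / real (Suc n)" by (simp add: field_simps)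
    have "P (Suc n) q r \<omega>" if "q \<in> ?R" "r \<in> ?R" for q r
      using w that le unfolding G_def P_def by (auto simp del: of_nat_Suc)
    then show "\<omega> \<in> G (Suc n)" using w unfolding G_def by auto
  qed
  have GU: "(\<Union>n. G n) = space M"
  proof (intro equalityI subsetI)
    fix \<omega> assume om: "\<omega> \<in> space M"
    have "uniformly_continuous_on {0..T} (\<lambda>t. Z t \<omega>)"
      using c[OF om] by (intro compact_uniformly_continuous) auto
    then obtain d where d: "0 < d" "\<And>s t. s \<in> {0..T} \<Longrightarrow> t \<in> {0..T} \<Longrightarrow> \<bar>t - s\<bar> < d \<Longrightarrow> \<bar>Z t \<omega> - Z s \<omega>\<bar> < w"
      using w unfolding uniformly_continuous_on_def dist_real_def by blast
    obtain n where n: "1 / real (Suc n) < d" using d(1) nat_approx_posE by metis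
    have "P n q r \<omega>" if "q \<in> ?R" "r \<in> ?R" for q r
      using d(2)[OF RT[OF that(2)] RT[OF that(1)]] n unfolding P_def by (auto simp del: of_nat_Suc)
    then have "\<omega> \<in> G n" unfolding G_def using om by auto
    then show "\<omega> \<in> (\<Union>n. G n)" by auto
  qed (auto simp: G_def)
  obtain n where n: "prob (space M - G n) < e"
    using prob_incseq_full[OF Gm Ginc GU e] by auto
  have "\<bar>Z s \<omega> - Z t \<omega>\<bar> \<le> w" if om: "\<omega> \<in> G n" and s: "s \<in> {0..T}" and t: "t \<in> {0..T}"
    and st: "\<bar>s - t\<bar> < 1 / real (Suc n)" for \<omega> s t
  proof (rule field_le_epsilon)
    fix u :: real assume u: "0 < u"
    have oM: "\<omega> \<in> space M" using om unfolding G_def by auto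
    \<comment> \<open>The slack lets \<open>s\<close> and \<open>t\<close> be replaced by nearby
      rational points, \<open>v / 2\<close> for each, within the range of the modulus.\<close>
    define v where "v = 1 / real (Suc n) - \<bar>s - t\<bar>"
    have v: "0 < v" using st unfolding v_def by auto
    have cont: "\<exists>d>0. \<forall>r\<in>{0..T}. \<bar>r - x\<bar> < d \<longrightarrow> \<bar>Z r \<omega> - Z x \<omega>\<bar> < u / 2" if "x \<in> {0..T}" for x
      using c[OF oM] that u half_gt_zero[OF u] unfolding continuous_on_iff dist_real_def by blast
    obtain d1 where d1: "0 < d1" "\<And>r. r \<in> {0..T} \<Longrightarrow> \<bar>r - s\<bar> < d1 \<Longrightarrow> \<bar>Z r \<omega> - Z s \<omega>\<bar> < u / 2"
      using cont[OF s] by blast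
    obtain d2 where d2: "0 < d2" "\<And>r. r \<in> {0..T} \<Longrightarrow> \<bar>r - t\<bar> < d2 \<Longrightarrow> \<bar>Z r \<omega> - Z t \<omega>\<bar> < u / 2"
      using cont[OF t] by blast
    note d = d1(1) d2(1) d1(2) d2(2)
    obtain q where q: "q \<in> ?R" "\<bar>q * T - s\<bar> < min d1 (v / 2)"
      using rational_dense[OF s, of "min d1 (v/2)"] d v by auto
    obtain r where r: "r \<in> ?R" "\<bar>r * T - t\<bar> < min d2 (v / 2)"
      using rational_dense[OF t, of "min d2 (v/2)"] d v by auto
    have "\<bar>q * T - r * T\<bar> < 1 / real (Suc n)"
    proof -
      have "\<bar>q * T - s\<bar> < v / 2" "\<bar>r * T - t\<bar> < v / 2" "1 / real (Suc n) = v + \<bar>s - t\<bar>"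
        using q(2) r(2) by (auto simp: v_def)
      then show ?thesis by arith
    qed
    then have "\<bar>Z (q * T) \<omega> - Z (r * T) \<omega>\<bar> \<le> w"
      using om q r unfolding G_def P_def by auto
    then show "\<bar>Z s \<omega> - Z t \<omega>\<bar> \<le> w + u"
      using d(3)[OF RT[OF q(1)]] d(4)[OF RT[OF r(1)]] q(2) r(2) by linarith
  qed
  then show thesis using that[of "1 / real (Suc n)" "G n"] Gm[of n] n by simp
qed

lemma set_integral_split:
  fixes f :: "real \<Rightarrow> real"
  assumes "set_integrable lborel {0..T} f" "0 \<le> s" "s \<le> t" "t \<le> T"
  shows "(LBINT u:{0..t}. f u) = (LBINT u:{0..s}. f u) + (LBINT u:{s<..t}. f u)"
proof -
  have "{0..t} = {0..s} \<union> {s<..t}" using assms by auto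
  moreover have "(LBINT u:{0..s} \<union> {s<..t}. f u) = (LBINT u:{0..s}. f u) + (LBINT u:{s<..t}. f u)"
    using assms by (intro set_integral_Un set_integrable_subset[OF assms(1)]) auto
  ultimately show ?thesis by simp
qed

text \<open>Summation by parts with decreasing weights: the error does not grow with the number of
  summands, although every increment of \<open>E\<close> may be as large as 2 e. This allows the
  approximation error of an Ito integral to be discounted along a fine grid.\<close>

lemma abel_bound:
  fixes E D :: "nat \<Rightarrow> real"
  assumes E: "\<And>i. i \<le> n \<Longrightarrow> \<bar>E i\<bar> \<le> e" and D: "\<And>i. i < n \<Longrightarrow> D (Suc i) \<le> D i" "D 0 = 1" "\<And>i. i \<le> n \<Longrightarrow> 0 \<le> D i"
  shows "j \<le> n \<Longrightarrow> - 3 * e \<le> (\<Sum>i<j. D (Suc i) * (E (Suc i) - E i))"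
proof -
  assume j: "j \<le> n"
  \<comment> \<open>The term - e (1 - D j) is the part of the allowance spent so far; it carries the
    induction and never exceeds \<open>e\<close> in size.\<close>
  have "D j * E j - E 0 - e * (1 - D j) \<le> (\<Sum>i<j. D (Suc i) * (E (Suc i) - E i))" using j
  proof (induction j)
    case (Suc j)
    have "- (E j) \<le> e" using E[of j] Suc by auto
    then have "(D j - D (Suc j)) * (- E j) \<le> (D j - D (Suc j)) * e"
      using D(1)[of j] Suc by (intro mult_left_mono) auto
    then show ?case using Suc by (simp add: algebra_simps)
  qed (use D in simp)
  moreover have D1: "D j \<le> 1" using j
  proof (induction j)
    case (Suc j)
    then show ?case using D(1)[of j] by auto
  qed (use D in simp)
  moreover have "- e \<le> D j * E j"
  proof -
    have "\<bar>D j * E j\<bar> \<le> 1 * e" unfolding abs_mult using E[OF j] D1 D(3)[OF j] by (intro mult_mono) auto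
    then show ?thesis by simp
  qed
  moreover have "e * (1 - D j) \<le> e" using E[of 0] D(3)[OF j] by (simp add: algebra_simps)
  moreover have "E 0 \<le> e" using E[of 0] by auto
  ultimately show ?thesis by linarith
qed

text \<open>The weights \<open>exp (- r * g (Suc i))\<close> are such that \<open>exp (- r * g (Suc i)) * (1 + r * (g (Suc i) - g i))\<close>
  is at most \<open>exp (- r * g i)\<close>; as \<open>Z \<ge> 0\<close>, discounting at the right end point only loses on the safe side.\<close>

lemma discounted_increments:
  fixes Z C Y :: "real \<Rightarrow> real"
  assumes gr: "grid T n g" and mesh: "\<And>i. i < n \<Longrightarrow> g (Suc i) - g i \<le> \<eta>" and r: "0 \<le> r"
    and Z: "continuous_on {0..T} Z" "\<And>t. t \<in> {0..T} \<Longrightarrow> 0 \<le> Z t"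
    and w: "\<And>i t. i < n \<Longrightarrow> t \<in> {g i..g (Suc i)} \<Longrightarrow> \<bar>Z t - Z (g i)\<bar> \<le> w"
    and C: "set_integrable lborel {0..T} C" "\<And>t. t \<in> {0..T} \<Longrightarrow> 0 \<le> C t"
    and Y: "\<And>t. t \<in> {0..T} \<Longrightarrow> Z t = z + r * (LBINT u:{0..t}. Z u) - (LBINT u:{0..t}. C u) + Y t"
    and Y0: "Y 0 = 0"
  shows "j \<le> n \<Longrightarrow> exp (- r * g j) * Z (g j) - z + exp (- r * \<eta>) * (LBINT u:{0..g j}. exp (- r * u) *
    C u) - r * w * g j
    \<le> (\<Sum>i<j. exp (- r * g (Suc i)) * (Y (g (Suc i)) - Y (g i)))"
proof (induction j)
  case 0
  have "(LBINT u:{0..0::real}. f u) = 0" for f :: "real \<Rightarrow> real"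
    using AE_lborel_singleton[of "0::real"]
      by (auto simp: set_lebesgue_integral_def intro!: integral_eq_zero_AE elim!: eventually_mono)
  moreover have "g 0 = 0" "0 \<in> {0..T}" using gr grid_bounds(2)[OF gr, of 0] by (auto simp: grid_def)
  ultimately show ?case using Y[of 0] Y0 by simp
next
  case (Suc j)
  let ?D = "\<lambda>i. exp (- r * g i)"
  have j: "j < n" using Suc by auto
  have b: "0 \<le> g j" "g j < g (Suc j)" "g (Suc j) \<le> T"
    using grid_bounds(1)[OF gr, of j] grid_bounds(2)[OF gr, of "Suc j"] gr j by (auto simp: grid_def)
  let ?I = "{g j<..g (Suc j)}"
  let ?d = "g (Suc j) - g j"
  have Zi: "set_integrable lborel {0..T} Z"
    using Z(1) by (rule borel_integrable_atLeastAtMost')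
  have eCi: "set_integrable lborel {0..T} (\<lambda>u. exp (- r * u) * C u)"
  proof (rule set_integrable_bound[OF C(1)])
    show "set_borel_measurable lborel {0..T} (\<lambda>u. exp (- r * u) * C u)"
    proof -
      have "(\<lambda>u. exp (- r * u) * (indicator {0..T} u *\<^sub>R C u)) \<in> borel_measurable lborel"
        by (intro borel_measurable_times
          borel_measurable_integrable[OF C(1)[unfolded set_integrable_def]]) auto
      then show ?thesis unfolding set_borel_measurable_def by (simp add: mult.left_commute)
    qed
    show "AE x in lborel. x \<in> {0..T} \<longrightarrow> norm (exp (- r * x) * C x) \<le> norm (C x)"
      using r by (auto simp: abs_mult intro!: mult_left_le_one_le)
  qed
  have sub: "?I \<subseteq> {0..T}" using b by auto
  have incr: "Y (g (Suc j)) - Y (g j) = Z (g (Suc j)) - Z (g j) - r * (LBINT u:?I. Z u) + (LBINT u:?I. C u)"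
    using Y[of "g j"] Y[of "g (Suc j)"] b set_integral_split[OF Zi, of "g j" "g (Suc j)"]
      set_integral_split[OF C(1), of "g j" "g (Suc j)"] by (simp add: algebra_simps)
  \<comment> \<open>Within the cell \<open>Z\<close> exceeds its left value by at most
    \<open>w\<close>; summed over the cells this costs the term r w g j of the claim.\<close>
  have "(LBINT u:?I. Z u) \<le> (LBINT u:?I. Z (g j) + w)"
  proof (rule set_integral_mono)
    show "set_integrable lborel ?I Z" using set_integrable_subset[OF Zi _ sub] by auto
    show "set_integrable lborel ?I (\<lambda>u. Z (g j) + w)"
      by (rule set_integrable_subset[OF borel_integrable_atLeastAtMost'[of 0 T] _ sub]) auto
    fix u assume "u \<in> ?I"
    then show "Z u \<le> Z (g j) + w" using w[OF j, of u] by auto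
  qed
  also have "\<dots> = (Z (g j) + w) * ?d"
  proof -
    have "integrable lborel (indicat_real ?I)" by (rule integrable_real_indicator) (use b in auto)
    then have "(\<integral>u. indicat_real ?I u * (Z (g j) + w) \<partial>lborel) = (\<integral>u. indicat_real ?I u \<partial>lborel) *
      (Z (g j) + w)"
      by simp
    also have "(\<integral>u. indicat_real ?I u \<partial>lborel) = ?d" using b by simp
    finally show ?thesis by (simp only: set_lebesgue_integral_def real_scaleR_def mult.commute)
  qed
  finally have ZI: "r * (LBINT u:?I. Z u) \<le> r * ((Z (g j) + w) * ?d)" using r by (intro mult_left_mono)
  \<comment> \<open>Consumption at \<open>u\<close> should be discounted by exp (- r u) but receives
    the weight of the right end of the cell. As the mesh is at most \<open>\<eta>\<close>, the
    factor exp (- r \<eta>) covers the difference.\<close>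
  have "exp (- r * \<eta>) * (LBINT u:?I. exp (- r * u) * C u) =
    (LBINT u:?I. exp (- r * \<eta>) * (exp (- r * u) * C u))"
    by simp
  also have "\<dots> \<le> (LBINT u:?I. ?D (Suc j) * C u)"
  proof (rule set_integral_mono)
    show "set_integrable lborel ?I (\<lambda>u. exp (- r * \<eta>) * (exp (- r * u) * C u))"
      using set_integrable_subset[OF eCi _ sub] by auto
    show "set_integrable lborel ?I (\<lambda>u. ?D (Suc j) * C u)"
      using set_integrable_subset[OF C(1) _ sub] by auto
    fix u assume u: "u \<in> ?I"
    have "g (Suc j) \<le> \<eta> + u" using mesh[OF j] u by auto
    then have "r * g (Suc j) \<le> r * (\<eta> + u)" using r by (rule mult_left_mono)
    then have "exp (- r * \<eta>) * exp (- r * u) \<le> ?D (Suc j)"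
      by (simp add: exp_add[symmetric] algebra_simps)
    then show "exp (- r * \<eta>) * (exp (- r * u) * C u) \<le> ?D (Suc j) * C u"
      using mult_right_mono[OF _ C(2)[of u]] sub u by (auto simp: mult.assoc[symmetric])
  qed
  also have "\<dots> = ?D (Suc j) * (LBINT u:?I. C u)" by simp
  finally have CI: "exp (- r * \<eta>) * (LBINT u:?I. exp (- r * u) * C u) \<le> ?D (Suc j) * (LBINT u:?I. C u)" .
  have "?D (Suc j) * (1 + r * ?d) \<le> ?D (Suc j) * exp (r * ?d)"
    by (intro mult_left_mono exp_ge_add_one_self) auto
  also have "\<dots> = ?D j" by (simp add: exp_add[symmetric] algebra_simps)
  finally have D1: "?D (Suc j) * (1 + r * ?d) * Z (g j) \<le> ?D j * Z (g j)"
    using Z(2)[of "g j"] b by (intro mult_right_mono) auto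
  have w0: "0 \<le> w" using w[OF j, of "g j"] b by auto
  have "?D (Suc j) * (r * w * ?d) \<le> 1 * (r * w * ?d)"
    using b r w0 by (intro mult_right_mono) auto
  then have D2: "?D (Suc j) * (r * w * ?d) \<le> r * w * ?d" by simp
  have "?D (Suc j) * (Z (g (Suc j)) - Z (g j) - r * ((Z (g j) + w) * ?d)) \<le>
    ?D (Suc j) * (Z (g (Suc j)) - Z (g j) - r * (LBINT u:?I. Z u))"
    using ZI by (intro mult_left_mono) auto
  then have e1: "?D (Suc j) * Z (g (Suc j)) - ?D (Suc j) * (1 + r * ?d) * Z (g j)
    - ?D (Suc j) * (r * w * ?d)
      \<le> ?D (Suc j) * (Z (g (Suc j)) - Z (g j) - r * (LBINT u:?I. Z u))"
    by (simp add: algebra_simps)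
  have e2: "?D (Suc j) * (Y (g (Suc j)) - Y (g j)) =
    ?D (Suc j) * (Z (g (Suc j)) - Z (g j) - r * (LBINT u:?I. Z u)) + ?D (Suc j) * (LBINT u:?I. C u)"
    unfolding incr by (simp only: distrib_left)
  have e3: "exp (- r * \<eta>) * (LBINT u:{0..g (Suc j)}. exp (- r * u) * C u) =
     exp (- r * \<eta>) * (LBINT u:{0..g j}. exp (- r * u) * C u) + exp (- r * \<eta>) *
       (LBINT u:?I. exp (- r * u) * C u)"
    using set_integral_split[OF eCi, of "g j" "g (Suc j)"] b by (simp only: distrib_left less_imp_le)
  have e4: "r * w * g (Suc j) = r * w * g j + r * w * ?d" by (simp add: algebra_simps)
  have "?D (Suc j) * Z (g (Suc j)) - z + exp (- r * \<eta>) * (LBINT u:{0..g (Suc j)}. exp (- r * u) * C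
    u) - r * w * g (Suc j)
    \<le> ?D j * Z (g j) - z + exp (- r * \<eta>) * (LBINT u:{0..g j}. exp (- r * u) * C u) - r * w * g j
      + ?D (Suc j) * (Y (g (Suc j)) - Y (g j))"
    unfolding e2 e3 e4 using e1 CI D1 D2 by linarith
  also have "\<dots> \<le> (\<Sum>i<Suc j. ?D (Suc i) * (Y (g (Suc i)) - Y (g i)))"
    using Suc by simp
  finally show ?case .
qed

lemma simple_integral_at_0: "is_simple_integrand M F h \<Longrightarrow> simple_integral X h 0 \<omega> = 0"
proof (cases h)
  case (fields k \<tau> \<xi>)
  assume h: "is_simple_integrand M F h"
  have tau: "0 \<le> \<tau> l" if "l \<le> k" for l
    using that
  proof (induction l)
    case (Suc l)
    then show ?case using h unfolding fields by (auto dest!: spec[of _ l])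
  qed (use h fields in auto)
  show ?thesis unfolding fields simple_integral.simps using tau by (intro sum.neutral) (auto simp: min_def)
qed

text \<open>Tolerances are chosen below as e / (q + 1) for a factor q that multiplies them later;
  adding 1 admits q = 0.\<close>

lemma divide_add_one_bounds:
  fixes q e :: real
  assumes "0 \<le> q" "0 < e"
  shows "0 < e / (q + 1)" "q * (e / (q + 1)) \<le> e" "e / (q + 1) \<le> e"
  using assms by (auto simp: field_simps)

context brownian_upto
begin

text \<open>Switching off the integrand once its gains fall below \<open>- z - 1\<close> changes nothing where all
  approximations are good, because the gains are at least \<open>- z - 5 * e\<close> there, and the gains then have mean 0
  and are bounded below except for an overshoot, which is controlled by the second moment.\<close>

lemma discounted_consumption_truncated:
  fixes Z C Y :: "'a process"
  assumes T: "0 < T" and r: "0 \<le> r" and z: "0 < z" and R: "0 \<le> R" and e: "0 < e" "e < 1 / 8"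
    and Xc: "\<And>\<omega>. \<omega> \<in> space M \<Longrightarrow> continuous_on {0..T} (\<lambda>t. X t \<omega>)"
    and Zm: "\<And>t. t \<in> {0..T} \<Longrightarrow> Z t \<in> borel_measurable M"
    and Zc: "\<And>\<omega>. \<omega> \<in> space M \<Longrightarrow> continuous_on {0..T} (\<lambda>t. Z t \<omega>)"
    and approx: "\<And>e. 0 < e \<Longrightarrow> \<exists>h A. is_simple_integrand M F h \<and> A \<in> events \<and> prob (space M - A) < e \<and>
      (\<forall>\<omega>\<in>A. \<forall>t\<in>{0..T}. \<bar>simple_integral X h t \<omega> - Y t \<omega>\<bar> \<le> e)"
    and ae: "AE \<omega> in M. (\<forall>t\<in>{0..T}. 0 \<le> Z t \<omega> \<and> 0 \<le> C t \<omega>) \<and> set_integrable lborel {0..T} (\<lambda>t. C t \<omega>) \<and>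
      (\<forall>t\<in>{0..T}. Z t \<omega> = z + r * (LBINT u:{0..t}. Z u \<omega>) - (LBINT u:{0..t}. C u \<omega>) + Y t \<omega>)"
    and Qm: "(\<lambda>\<omega>. LBINT u:{0..T}. exp (- r * u) * C u \<omega>) \<in> borel_measurable M"
  shows "expectation (\<lambda>\<omega>. min (LBINT u:{0..T}. exp (- r * u) * C u \<omega>) R) \<le> z + e * (13 + 2 * z + 4 * R)"
proof -
  let ?Q = "\<lambda>\<omega>. LBINT u:{0..T}. exp (- r * u) * C u \<omega>"
  from approx[OF e(1)] obtain h A where hA: "is_simple_integrand M F h \<and> A \<in> events \<and>
    prob (space M - A) < e \<and>
      (\<forall>\<omega>\<in>A. \<forall>t\<in>{0..T}. \<bar>simple_integral X h t \<omega> - Y t \<omega>\<bar> \<le> e)" by (elim exE)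
  then have h0: "is_simple_integrand M F h" and A: "A \<in> events" "prob (space M - A) < e" by simp_all
  have YA: "\<bar>simple_integral X h t \<omega> - Y t \<omega>\<bar> \<le> e" if "\<omega> \<in> A" "t \<in> {0..T}" for \<omega> t
    using hA that by blast
  obtain k \<tau> \<xi> where hk: "h = (k, \<tau>, \<xi>)" by (cases h)
  note h = h0[unfolded hk]
  obtain C0 where C0: "0 \<le> C0" "\<And>t \<omega>. \<omega> \<in> space M \<Longrightarrow> \<bar>simple_process h t \<omega>\<bar> \<le> C0"
    using simple_process_bounded[OF h] unfolding hk by blast
  \<comment> \<open>\<open>C0\<close> bounds the integrand, so C0^2 T bounds the second moment of
    the gains; \<open>\<theta>\<close> is the weight at which this second moment costs at most
    \<open>e\<close>.\<close>
  define \<theta> where "\<theta> = e / (C0\<^sup>2 * T + 1)"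
  have th: "0 < \<theta>" "\<theta> * (C0\<^sup>2 * T) \<le> e"
    unfolding \<theta>_def using divide_add_one_bounds[of "C0\<^sup>2 * T" e] e T by (auto simp: mult.commute)
  define w where "w = e / (r * T + 1)"
  have w: "0 < w" "r * w * T \<le> e"
    unfolding w_def using divide_add_one_bounds[of "r * T" e] e r T
      by (auto simp: mult.commute mult.left_commute)
  \<comment> \<open>If increments of \<open>X\<close> are at most \<open>w1\<close>, no single step
    changes the gains by more than 1. This bounds the overshoot when they are switched off.\<close>
  define w1 where "w1 = 1 / (C0 + 1)"
  have w1: "0 < w1" "C0 * w1 \<le> 1" unfolding w1_def using divide_add_one_bounds[of C0 1] C0(1) by auto
  obtain \<eta>1 GZ where GZ: "0 < \<eta>1" "GZ \<in> events" "prob (space M - GZ) < e"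
    "\<And>\<omega> s t. \<omega> \<in> GZ \<Longrightarrow> s \<in> {0..T} \<Longrightarrow> t \<in> {0..T} \<Longrightarrow> \<bar>s - t\<bar> < \<eta>1 \<Longrightarrow> \<bar>Z s \<omega> - Z t \<omega>\<bar> \<le> w"
    by (rule continuity_modulus[OF Zm Zc less_imp_le[OF T] w(1) e(1)]) (assumption | rule that)+
  have Xm: "X t \<in> borel_measurable M" if "t \<in> {0..T}" for t using measurable_F[OF adap] that by auto
  \<comment> \<open>\<open>GX\<close> may fail with probability \<open>e * \<theta>\<close> only,
    because on its complement the price 1 / \<theta> is paid in \<open>low\<close>.\<close>
  have eth: "0 < e * \<theta>" using e th by simp
  obtain \<eta>2 GX where GX: "0 < \<eta>2" "GX \<in> events" "prob (space M - GX) < e * \<theta>"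
    "\<And>\<omega> s t. \<omega> \<in> GX \<Longrightarrow> s \<in> {0..T} \<Longrightarrow> t \<in> {0..T} \<Longrightarrow> \<bar>s - t\<bar> < \<eta>2 \<Longrightarrow> \<bar>X s \<omega> - X t \<omega>\<bar> \<le> w1"
    by (rule continuity_modulus[OF Xm Xc less_imp_le[OF T] w1(1) eth]) (assumption | rule that)+
  define \<eta> where "\<eta> = min (min (\<eta>1 / 2) (\<eta>2 / 2)) (e / (r + 1))"
  have eta: "0 < \<eta>" "\<eta> < \<eta>1" "\<eta> < \<eta>2" "r * \<eta> \<le> e"
  proof -
    show "0 < \<eta>" "\<eta> < \<eta>1" "\<eta> < \<eta>2" unfolding \<eta>_def using GZ(1) GX(1) e r by auto
    have "r * \<eta> \<le> r * (e / (r + 1))" unfolding \<eta>_def using r by (intro mult_left_mono) auto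
    also have "\<dots> \<le> e" using divide_add_one_bounds[of r e] r e by auto
    finally show "r * \<eta> \<le> e" .
  qed
  have "finite (\<tau> ` {..k})" by simp
  from grid_exists[OF this T eta(1)] obtain n g where gr: "grid T n g"
    and mesh: "\<And>i. i < n \<Longrightarrow> g (Suc i) - g i \<le> \<eta>"
    and av: "\<And>l i. l \<le> k \<Longrightarrow> i < n \<Longrightarrow> \<tau> l \<le> g i \<or> g (Suc i) \<le> \<tau> l"
    by fastforce
  have gT: "g i \<in> {0..T}" if "i \<le> n" for i using grid_bounds[OF gr that] by auto
  define d where "d i \<omega> = X (g (Suc i)) \<omega> - X (g i) \<omega>" for i \<omega>
  define c where "c i \<omega> = exp (- r * g (Suc i)) * simple_process h (g (Suc i)) \<omega>" for i \<omega>
  interpret I: indep_increments M n "\<lambda>i. F (g i)" d "\<lambda>i. g (Suc i) - g i"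
    unfolding d_def[abs_def] by (rule indep_increments_id[OF gr])
  have cm: "c i \<in> borel_measurable (F (g i))" if "i < n" for i
  proof -
    have "simple_process (k, \<tau>, \<xi>) (g (Suc i)) \<in> borel_measurable (F (g i))"
      by (rule simple_process_measurable[OF filt h]) (use av that in auto)
    then show ?thesis unfolding c_def[abs_def] hk by measurable
  qed
  have cb: "\<bar>c i \<omega>\<bar> \<le> C0" if "i < n" "\<omega> \<in> space M" for i \<omega>
  proof -
    have "exp (- r * g (Suc i)) * \<bar>simple_process h (g (Suc i)) \<omega>\<bar> \<le> 1 * C0"
      using C0 that gT[of "Suc i"] r by (intro mult_mono) auto
    then show ?thesis unfolding c_def abs_mult by simp
  qed
  define V where "V = transform c d"
  define b where "b i \<omega> = (if \<forall>l\<in>{..i}. - z - 1 \<le> V l \<omega> then c i \<omega> else 0)" for i \<omega>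
  have bm: "b i \<in> borel_measurable (F (g i))" if "i < n" for i
  proof -
    have "V l \<in> borel_measurable (F (g i))" if "l \<le> i" for l
      unfolding V_def using I.measurable_G_mono[OF I.measurable_transform[of l c]] cm that \<open>i < n\<close> by auto
    then have "Measurable.pred (F (g i)) (\<lambda>\<omega>. \<forall>l\<in>{..i}. - z - 1 \<le> V l \<omega>)"
      by (intro pred_intros_finite) (auto simp: pred_def intro!: borel_measurable_le)
    then show ?thesis unfolding b_def[abs_def] using cm[OF that] by measurable
  qed
  have bb: "\<bar>b i \<omega>\<bar> \<le> C0" if "i < n" "\<omega> \<in> space M" for i \<omega>
    using cb[OF that] C0 unfolding b_def by auto
  have b2: "(b i \<omega>)\<^sup>2 \<le> C0\<^sup>2" if "i < n" "\<omega> \<in> space M" for i \<omega>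
    using bb[OF that] C0 by (simp add: abs_le_square_iff[symmetric])
  have bi: "integrable M (\<lambda>\<omega>. (b i \<omega>)\<^sup>2)" if i: "i < n" for i
  proof (rule integrable_const_bound[of _ "C0\<^sup>2"])
    show "AE x in M. norm ((b i x)\<^sup>2) \<le> C0\<^sup>2" using b2[OF i] by auto
    show "(\<lambda>\<omega>. (b i \<omega>)\<^sup>2) \<in> borel_measurable M"
      using measurable_F[OF bm[OF i]] by measurable
  qed
  define V' where "V' = transform b d"
  have mom: "integrable M (V' n)" "expectation (V' n) = 0" "integrable M (\<lambda>\<omega>. (V' n \<omega>)\<^sup>2)"
    "expectation (\<lambda>\<omega>. (V' n \<omega>)\<^sup>2) = (\<Sum>i<n. (g (Suc i) - g i) * expectation (\<lambda>\<omega>. (b i \<omega>)\<^sup>2))"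
    using I.transform_moments[of b n, OF bm bi] unfolding V'_def by auto
  have V'2: "expectation (\<lambda>\<omega>. (V' n \<omega>)\<^sup>2) \<le> C0\<^sup>2 * T"
  proof -
    have "(\<Sum>i<n. (g (Suc i) - g i) * expectation (\<lambda>\<omega>. (b i \<omega>)\<^sup>2)) \<le> (\<Sum>i<n. (g (Suc i) - g i) * C0\<^sup>2)"
    proof (intro sum_mono mult_left_mono)
      fix i assume i: "i \<in> {..<n}"
      show "0 \<le> g (Suc i) - g i" using gr i by (auto simp: grid_def less_imp_le)
      have "expectation (\<lambda>\<omega>. (b i \<omega>)\<^sup>2) \<le> expectation (\<lambda>\<omega>. C0\<^sup>2)"
        using bi i b2 by (intro integral_mono) auto
      then show "expectation (\<lambda>\<omega>. (b i \<omega>)\<^sup>2) \<le> C0\<^sup>2" by (simp add: prob_space)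
    qed
    also have "\<dots> = (\<Sum>i<n. g (Suc i) - g i) * C0\<^sup>2" by (simp add: sum_distrib_right)
    also have "(\<Sum>i<n. g (Suc i) - g i) = T" using gr by (simp add: sum_lessThan_telescope grid_def)
    finally show ?thesis using mom(4) by (simp add: mult.commute)
  qed
  have dX: "\<bar>d i \<omega>\<bar> \<le> w1" if "i < n" "\<omega> \<in> GX" for i \<omega>
  proof -
    have "\<bar>g (Suc i) - g i\<bar> < \<eta>2" using mesh[OF that(1)] eta gr that by (auto simp: grid_def)
    then show ?thesis unfolding d_def using GX(4)[OF that(2) gT[of "Suc i"] gT[of i]] that by auto
  qed
  \<comment> \<open>The overshoot: the gains are at least - z - 1 before the last active step, and
    on \<open>GX\<close> that step loses at most 1.\<close>
  have stop: "- z - 2 \<le> V' j \<omega> \<and> ((\<forall>l\<le>j. - z - 1 \<le> V l \<omega>) \<longrightarrow> V' j \<omega> = V j \<omega>)"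
    if "j \<le> n" "\<omega> \<in> GX" for j \<omega>
    using that(1)
  proof (induction j)
    case 0
    then show ?case unfolding V_def V'_def using z by simp
  next
    case (Suc j)
    have oM: "\<omega> \<in> space M" using that(2) GX(2) sets.sets_into_space by auto
    show ?case
    proof (cases "\<forall>l\<le>j. - z - 1 \<le> V l \<omega>")
      case True
      have "\<bar>c j \<omega> * d j \<omega>\<bar> \<le> C0 * w1" unfolding abs_mult
        using cb[OF _ oM, of j] dX[OF _ that(2), of j] Suc C0 by (intro mult_mono) auto
      then have small: "\<bar>c j \<omega> * d j \<omega>\<bar> \<le> 1" using w1 by simp
      have "V' (Suc j) \<omega> = V j \<omega> + c j \<omega> * d j \<omega>"
        using True Suc unfolding V'_def transform_Suc b_def by auto
      moreover have "V (Suc j) \<omega> = V j \<omega> + c j \<omega> * d j \<omega>" unfolding V_def transform_Suc ..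
      moreover have "- z - 1 \<le> V j \<omega>" using True by auto
      ultimately show ?thesis using small by auto
    next
      case False
      then have "V' (Suc j) \<omega> = V' j \<omega>" unfolding V'_def transform_Suc b_def by auto
      then show ?thesis using Suc False by (auto intro: le_SucI)
    qed
  qed
  have "AE \<omega> in M. \<omega> \<in> A \<inter> GZ \<longrightarrow> - z - 5 * e + (1 - e) * min (?Q \<omega>) R \<le> V' n \<omega> \<or> \<omega> \<notin> GX"
    using ae
  proof eventually_elim
    case (elim \<omega>)
    show ?case
    proof (intro impI disjCI)
      assume om: "\<omega> \<in> A \<inter> GZ" and "\<not> \<omega> \<notin> GX"
      then have oX: "\<omega> \<in> GX" by simp
      have oM: "\<omega> \<in> space M" using oX GX(2) sets.sets_into_space by auto
      let ?Y = "\<lambda>t. Y t \<omega>"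
      \<comment> \<open>Simple integrals vanish at time 0, so \<open>Y\<close> is within
        \<open>e\<close> of 0 there. Of the five \<open>e\<close> in \<open>lower\<close>, this
        accounts for one, the discretization of \<open>Z\<close> for another, and Abel's bound for
        three.\<close>
      have Y0: "\<bar>?Y 0\<bar> \<le> e"
        using YA[of \<omega> 0] om T simple_integral_at_0[OF h0, of X \<omega>] by auto
      define E where "E i = simple_integral X h (g i) \<omega> - ?Y (g i)" for i
      have E: "\<bar>E i\<bar> \<le> e" if "i \<le> n" for i unfolding E_def using YA[of \<omega> "g i"] om gT[OF that] by auto
      have VE: "V j \<omega> = (\<Sum>i<j. exp (- r * g (Suc i)) * ((?Y (g (Suc i)) - ?Y 0) - (?Y (g i) - ?Y 0)))
          + (\<Sum>i<j. exp (- r * g (Suc i)) * (E (Suc i) - E i))" if "j \<le> n" for j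
      proof -
        have "c i \<omega> * d i \<omega> = exp (- r * g (Suc i)) * ((?Y (g (Suc i)) - ?Y 0) - (?Y (g i) - ?Y 0))
          + exp (- r * g (Suc i)) * (E (Suc i) - E i)"
          if "i < j" for i
        proof -
          have "simple_integral X h (g (Suc i)) \<omega> - simple_integral X h (g i) \<omega> =
            simple_process h (g (Suc i)) \<omega> * d i \<omega>"
            using simple_integral_grid[OF gr h av, of "Suc i" X \<omega>]
              simple_integral_grid[OF gr h av, of i X \<omega>] that \<open>j \<le> n\<close>
            unfolding hk d_def by (simp add: transform_Suc del: simple_process.simps simple_integral.simps)
          then have eq: "simple_process h (g (Suc i)) \<omega> * d i \<omega> = (?Y (g (Suc i)) - ?Y (g i))
            + (E (Suc i) - E i)"
            unfolding E_def by simp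
          show ?thesis unfolding c_def mult.assoc eq by (simp add: algebra_simps)
        qed
        then show ?thesis unfolding V_def transform_def by (simp add: sum.distrib)
      qed
      have ab: "- 3 * e \<le> (\<Sum>i<j. exp (- r * g (Suc i)) * (E (Suc i) - E i))" if "j \<le> n" for j
      proof (rule abel_bound[where n=n and D="\<lambda>i. exp (- r * g i)", OF E _ _ _ that])
        show "exp (- r * g (Suc i)) \<le> exp (- r * g i)" if "i < n" for i
          using gr that r by (auto simp: grid_def intro!: mult_left_mono)
        show "exp (- r * g 0) = 1" using gr by (simp add: grid_def)
      qed auto
      have di: "exp (- r * g j) * Z (g j) \<omega> - (z + ?Y 0) + exp (- r * \<eta>) *
        (LBINT u:{0..g j}. exp (- r * u) * C u \<omega>) - r * w * g j
         \<le> (\<Sum>i<j. exp (- r * g (Suc i)) * ((?Y (g (Suc i)) - ?Y 0) - (?Y (g i) - ?Y 0)))" if "j \<le> n" for j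
      proof (rule discounted_increments[OF gr mesh r Zc[OF oM], where Y="\<lambda>t. ?Y t - ?Y 0", OF _ _ _
        _ _ _ _ that])
        fix i t assume i: "i < n" and t: "t \<in> {g i..g (Suc i)}"
        have "t \<in> {0..T}" using t gT[of i] gT[of "Suc i"] i by auto
        moreover have "\<bar>t - g i\<bar> < \<eta>1" using t mesh[OF i] eta by auto
        ultimately show "\<bar>Z t \<omega> - Z (g i) \<omega>\<bar> \<le> w" using GZ(4)[of \<omega> t "g i"] om gT[of i] i by auto
      qed (use elim in auto)
      have lower: "- z - 5 * e + exp (- r * \<eta>) * (LBINT u:{0..g j}. exp (- r * u) * C u \<omega>) \<le> V j \<omega>"
        if j: "j \<le> n" for j
      proof -
        have "0 \<le> exp (- r * g j) * Z (g j) \<omega>" using elim gT[OF j] by auto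
        moreover have "r * w * g j \<le> r * w * T" using r w gT[OF j] by (intro mult_left_mono) auto
        ultimately show ?thesis using di[OF j] ab[OF j] VE[OF j] w(2) Y0 by linarith
      qed
      have Cpos: "0 \<le> (LBINT u:{0..g j}. exp (- r * u) * C u \<omega>)" if "j \<le> n" for j
        unfolding set_lebesgue_integral_def using elim gT[OF that]
        by (intro integral_nonneg_AE) (auto simp: indicator_def)
      have "V' n \<omega> = V n \<omega>"
      proof -
        \<comment> \<open>As e < 1/8, 5 e is less than 1. So on the good events the gains never
          reach the level at which they would be switched off.\<close>
        have "- z - 1 \<le> V l \<omega>" if "l \<le> n" for l
        proof -
          have "0 \<le> exp (- r * \<eta>) * (LBINT u:{0..g l}. exp (- r * u) * C u \<omega>)" using Cpos[OF that] by simp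
          then show ?thesis using lower[OF that] e by linarith
        qed
        then show ?thesis using stop[of n \<omega>] oX by auto
      qed
      moreover have "(1 - e) * min (?Q \<omega>) R \<le> exp (- r * \<eta>) * ?Q \<omega>"
      proof -
        have gn: "g n = T" using gr by (simp add: grid_def)
        have "1 - e \<le> 1 + (- r * \<eta>)" using eta by simp
        also have "\<dots> \<le> exp (- r * \<eta>)" by (rule exp_ge_add_one_self)
        finally show ?thesis using Cpos[of n] e R unfolding gn by (intro mult_mono) auto
      qed
      moreover have "- z - 5 * e + exp (- r * \<eta>) * ?Q \<omega> \<le> V n \<omega>" using lower[of n] gr
        by (simp add: grid_def)
      ultimately show "- z - 5 * e + (1 - e) * min (?Q \<omega>) R \<le> V' n \<omega>" by linarith
    qed
  qed
  moreover have Qpos: "AE \<omega> in M. 0 \<le> ?Q \<omega>"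
    using ae by eventually_elim (auto simp: set_lebesgue_integral_def indicator_def intro!:
      integral_nonneg_AE)
  moreover have "AE \<omega> in M. \<omega> \<in> space M" by simp
  \<comment> \<open>A lower bound for the final gains on almost the whole space. Where
    \<open>A\<close> or \<open>GZ\<close> fails, the general bound - z - 2 is used, at a cost of at
    most 2 + R. Where \<open>GX\<close> fails there is no pathwise bound, and the gains are
    controlled by - V \<le> \<theta> V^2 + 1 / \<theta>, whose quadratic term has a small
    mean.\<close>
  ultimately have low: "AE \<omega> in M. - z - 5 * e + (1 - e) * min (?Q \<omega>) R
      - (2 + R) * indicator (space M - A) \<omega> - (2 + R) * indicator (space M - GZ) \<omega>
      - (\<theta> * (V' n \<omega>)\<^sup>2 + (1 / \<theta> + z + 2 + R) * indicator (space M - GX) \<omega>) \<le> V' n \<omega>"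
  proof eventually_elim
    case (elim \<omega>)
    let ?m = "min (?Q \<omega>) R"
    have m: "0 \<le> ?m" "?m \<le> R" using elim R by auto
    have m2: "(1 - e) * ?m \<le> R" using m e mult_mono[of "1 - e" 1 ?m R] by auto
    show ?case
    proof (cases "\<omega> \<in> GX")
      case True
      have "0 \<le> \<theta> * (V' n \<omega>)\<^sup>2" using th by simp
      then show ?thesis using elim True m2 stop[OF _ True, of n] e R
        by (cases "\<omega> \<in> A"; cases "\<omega> \<in> GZ") (auto simp: indicator_def)
    next
      case False
      have "- V' n \<omega> \<le> \<theta> * (V' n \<omega>)\<^sup>2 + 1 / \<theta>"
      proof -
        have "0 \<le> \<theta> * (V' n \<omega> + 1 / \<theta>)\<^sup>2" using th by simp
        also have "\<dots> = \<theta> * (V' n \<omega>)\<^sup>2 + 2 * V' n \<omega> + 1 / \<theta>"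
          using th by (simp add: power2_eq_square field_simps)
        finally have "- 2 * V' n \<omega> \<le> \<theta> * (V' n \<omega>)\<^sup>2 + 1 / \<theta>" by simp
        moreover have "0 \<le> \<theta> * (V' n \<omega>)\<^sup>2 + 1 / \<theta>" using th by simp
        ultimately show ?thesis by linarith
      qed
      moreover have "0 \<le> (2 + R) * indicator (space M - A) \<omega>" "0 \<le> (2 + R) * indicator (space M - GZ) \<omega>"
        using R by (auto simp: indicator_def)
      moreover have "indicator (space M - GX) \<omega> = (1::real)" using False elim by auto
      ultimately show ?thesis using m2 e z by simp
    qed
  qed
  have im: "integrable M (\<lambda>\<omega>. min (?Q \<omega>) R)"
  proof (rule integrable_const_bound[of _ R])
    show "AE x in M. norm (min (?Q x) R) \<le> R" using Qpos by eventually_elim (use R in auto)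
  qed (use Qm in measurable)
  have ind: "integrable M (indicator B :: 'a \<Rightarrow> real)" if "B \<in> events" for B
    using that by (intro integrable_real_indicator) (auto simp: emeasure_eq_measure)
  have ev: "space M - A \<in> events" "space M - GZ \<in> events" "space M - GX \<in> events" using A GZ GX by auto
  \<comment> \<open>The gains have mean 0, so expectations leave a bound for consumption alone. The
    final coefficient 13 collects 5 from \<open>lower\<close>, 2 each from \<open>A\<close> and
    \<open>GZ\<close>, 1 from the second moment and 3 from \<open>GX\<close>.\<close>
  have "expectation (\<lambda>\<omega>. - z - 5 * e + (1 - e) * min (?Q \<omega>) R
      - (2 + R) * indicator (space M - A) \<omega> - (2 + R) * indicator (space M - GZ) \<omega>
      - (\<theta> * (V' n \<omega>)\<^sup>2 + (1 / \<theta> + z + 2 + R) * indicator (space M - GX) \<omega>)) \<le> expectation (V' n)"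
    using low im ind ev mom by (intro integral_mono_AE) auto
  then have "- z - 5 * e + (1 - e) * expectation (\<lambda>\<omega>. min (?Q \<omega>) R)
      - (2 + R) * prob (space M - A) - (2 + R) * prob (space M - GZ)
      - (\<theta> * expectation (\<lambda>\<omega>. (V' n \<omega>)\<^sup>2) + (1 / \<theta> + z + 2 + R) * prob (space M - GX)) \<le> 0"
    using im ind ev mom by (simp add: prob_space)
  moreover have "(2 + R) * prob (space M - A) \<le> (2 + R) * e" "(2 + R) * prob (space M - GZ) \<le> (2 + R) * e"
    using A GZ R by (auto intro!: mult_left_mono)
  moreover have "\<theta> * expectation (\<lambda>\<omega>. (V' n \<omega>)\<^sup>2) \<le> e"
    using th order_trans[OF mult_left_mono[OF V'2 less_imp_le[OF th(1)]]] by simp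
  moreover have "(1 / \<theta> + z + 2 + R) * prob (space M - GX) \<le> e + (z + 2 + R) * e"
  proof -
    have t1: "\<theta> \<le> 1"
      unfolding \<theta>_def using divide_add_one_bounds(3)[of "C0\<^sup>2 * T" e] e T by auto
    have "(1 / \<theta> + z + 2 + R) * prob (space M - GX) \<le> (1 / \<theta> + z + 2 + R) * (e * \<theta>)"
      using GX th z R by (intro mult_left_mono) auto
    also have "\<dots> = e + (z + 2 + R) * (e * \<theta>)" using th by (simp add: field_simps)
    also have "\<dots> \<le> e + (z + 2 + R) * (e * 1)" using t1 e z R by (intro add_left_mono mult_left_mono) auto
    finally show ?thesis by simp
  qed
  moreover have "expectation (\<lambda>\<omega>. min (?Q \<omega>) R) \<le> R"
  proof -
    have "expectation (\<lambda>\<omega>. min (?Q \<omega>) R) \<le> expectation (\<lambda>\<omega>. R)" using im by (intro integral_mono) auto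
    then show ?thesis by (simp add: prob_space)
  qed
  then have "e * expectation (\<lambda>\<omega>. min (?Q \<omega>) R) \<le> e * R" using e by (intro mult_left_mono) auto
  moreover have "(1 - e) * expectation (\<lambda>\<omega>. min (?Q \<omega>) R) =
      expectation (\<lambda>\<omega>. min (?Q \<omega>) R) - e * expectation (\<lambda>\<omega>. min (?Q \<omega>) R)" "(2 + R) * e = 2 * e + e
        * R" "(z + 2 + R) * e = z * e + 2 * e + e * R"
    "e * (13 + 2 * z + 4 * R) = 13 * e + 2 * (z * e) + 4 * (e * R)"
    by (simp_all add: algebra_simps)
  moreover have "0 \<le> z * e" using z e by simp
  ultimately show ?thesis by linarith
qed

text \<open>The mean of discounted consumption is not known to be finite beforehand. It is therefore
  truncated at \<open>n\<close>, where the error \<open>e\<close> can be sent to 0, and recovered by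
  monotone convergence.\<close>

theorem discounted_consumption_le:
  fixes Z C Y :: "'a process"
  assumes T: "0 < T" and r: "0 \<le> r" and z: "0 < z"
    and Xc: "\<And>\<omega>. \<omega> \<in> space M \<Longrightarrow> continuous_on {0..T} (\<lambda>t. X t \<omega>)"
    and Zm: "\<And>t. t \<in> {0..T} \<Longrightarrow> Z t \<in> borel_measurable M"
    and Zc: "\<And>\<omega>. \<omega> \<in> space M \<Longrightarrow> continuous_on {0..T} (\<lambda>t. Z t \<omega>)"
    and approx: "\<And>e. 0 < e \<Longrightarrow> \<exists>h A. is_simple_integrand M F h \<and> A \<in> events \<and> prob (space M - A) < e \<and>
      (\<forall>\<omega>\<in>A. \<forall>t\<in>{0..T}. \<bar>simple_integral X h t \<omega> - Y t \<omega>\<bar> \<le> e)"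
    and ae: "AE \<omega> in M. (\<forall>t\<in>{0..T}. 0 \<le> Z t \<omega> \<and> 0 \<le> C t \<omega>) \<and> set_integrable lborel {0..T} (\<lambda>t. C t \<omega>) \<and>
      (\<forall>t\<in>{0..T}. Z t \<omega> = z + r * (LBINT u:{0..t}. Z u \<omega>) - (LBINT u:{0..t}. C u \<omega>) + Y t \<omega>)"
    and Qm: "(\<lambda>\<omega>. LBINT u:{0..T}. exp (- r * u) * C u \<omega>) \<in> borel_measurable M"
  shows "(\<integral>\<^sup>+\<omega>. ennreal (LBINT u:{0..T}. exp (- r * u) * C u \<omega>) \<partial>M) \<le> ennreal z"
proof -
  let ?Q = "\<lambda>\<omega>. LBINT u:{0..T}. exp (- r * u) * C u \<omega>"
  have Qpos: "AE \<omega> in M. 0 \<le> ?Q \<omega>"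
    using ae by eventually_elim (auto simp: set_lebesgue_integral_def indicator_def intro!:
      integral_nonneg_AE)
  have trunc: "(\<integral>\<^sup>+\<omega>. ennreal (min (?Q \<omega>) (real n)) \<partial>M) \<le> ennreal z" for n :: nat
  proof -
    have nn: "AE \<omega> in M. 0 \<le> min (?Q \<omega>) (real n)" using Qpos by eventually_elim auto
    have int: "integrable M (\<lambda>\<omega>. min (?Q \<omega>) (real n))"
    proof (rule integrable_const_bound[of _ "real n"])
      show "AE x in M. norm (min (?Q x) (real n)) \<le> real n" using Qpos by eventually_elim auto
    qed (use Qm in measurable)
    have "expectation (\<lambda>\<omega>. min (?Q \<omega>) (real n)) \<le> z"
    proof (rule field_le_epsilon)
      fix u :: real assume u: "0 < u"
      let ?K = "13 + 2 * z + 4 * real n"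
      define e where "e = min (1 / 16) (u / ?K)"
      have K: "0 < ?K" using z by simp
      have e: "0 < e" "e < 1 / 8" "e * ?K \<le> u"
      proof -
        show "0 < e" "e < 1 / 8" unfolding e_def using u K by auto
        have "e * ?K \<le> u / ?K * ?K" unfolding e_def using K by (intro mult_right_mono) auto
        then show "e * ?K \<le> u" using K by simp
      qed
      have "expectation (\<lambda>\<omega>. min (?Q \<omega>) (real n)) \<le> z + e * ?K"
        by (rule discounted_consumption_truncated[OF T r z _ e(1,2) Xc Zm Zc approx ae Qm]) auto
      then show "expectation (\<lambda>\<omega>. min (?Q \<omega>) (real n)) \<le> z + u" using e(3) by simp
    qed
    then show ?thesis using nn_integral_eq_integral[OF int nn] by (simp add: ennreal_leI)
  qed
  have "(\<integral>\<^sup>+\<omega>. ennreal (?Q \<omega>) \<partial>M) = (\<integral>\<^sup>+\<omega>. (SUP n. ennreal (min (?Q \<omega>) (real n))) \<partial>M)"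
  proof (intro nn_integral_cong)
    fix \<omega>
    obtain n :: nat where n: "?Q \<omega> \<le> real n" using real_arch_simple by blast
    show "ennreal (?Q \<omega>) = (SUP n. ennreal (min (?Q \<omega>) (real n)))"
    proof (rule antisym)
      have "ennreal (?Q \<omega>) \<le> ennreal (min (?Q \<omega>) (real n))" using n by simp
      also have "\<dots> \<le> (SUP n. ennreal (min (?Q \<omega>) (real n)))" by (rule SUP_upper) simp
      finally show "ennreal (?Q \<omega>) \<le> (SUP n. ennreal (min (?Q \<omega>) (real n)))" .
    qed (auto intro!: SUP_least ennreal_leI)
  qed
  also have "\<dots> = (SUP n. \<integral>\<^sup>+\<omega>. ennreal (min (?Q \<omega>) (real n)) \<partial>M)"
    using Qm by (intro nn_integral_monotone_convergence_SUP)
      (auto simp: incseq_def le_fun_def intro!: ennreal_leI)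
  also have "\<dots> \<le> ennreal z" using trunc by (intro SUP_least) auto
  finally show ?thesis .
qed

end

section \<open>Transfer of Ito integrals to the measure of Girsanov's theorem\<close>

lemma (in prob_space) density_prob_small:
  assumes L: "L \<in> borel_measurable M" "\<And>\<omega>. 0 \<le> L \<omega>" and Q: "prob_space (density M (\<lambda>\<omega>. ennreal (L \<omega>)))"
    and e: "0 < (e::real)"
  shows "\<exists>d>0. \<forall>A\<in>events. prob A < d \<longrightarrow> measure (density M (\<lambda>\<omega>. ennreal (L \<omega>))) A < e"
proof -
  let ?Q = "density M (\<lambda>\<omega>. ennreal (L \<omega>))"
  interpret Q: prob_space ?Q by (rule Q)
  define G where "G n = {\<omega>\<in>space M. L \<omega> \<le> real n}" for n :: nat
  have Gm: "G n \<in> events" for n unfolding G_def using L(1) by measurable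
  have "\<exists>n. Q.prob (space ?Q - G n) < e / 2"
  proof (rule Q.prob_incseq_full)
    show "G n \<in> Q.events" for n using Gm by simp
    show "incseq G" unfolding incseq_def G_def by (auto intro: order_trans)
    show "(\<Union>n. G n) = space ?Q" unfolding G_def using real_arch_simple by auto
  qed (use e in simp)
  then obtain n where n: "Q.prob (space M - G n) < e / 2" by auto
  \<comment> \<open>Absolute continuity in quantitative form: where the density is at most
    \<open>n\<close>, the new measure is at most n times the old one, and the rest is small by the
    choice of \<open>n\<close>.\<close>
  have le: "Q.prob (A \<inter> G n) \<le> real n * prob A" if A: "A \<in> events" for A
  proof -
    have "emeasure ?Q (A \<inter> G n) = (\<integral>\<^sup>+\<omega>. ennreal (L \<omega>) * indicator (A \<inter> G n) \<omega> \<partial>M)"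
      using A Gm L(1) by (intro emeasure_density) auto
    also have "\<dots> \<le> (\<integral>\<^sup>+\<omega>. ennreal (real n) * indicator A \<omega> \<partial>M)"
      by (intro nn_integral_mono) (auto simp: indicator_def G_def ennreal_of_nat_eq_real_of_nat ennreal_leI)
    also have "\<dots> = ennreal (real n) * emeasure M A" using A by (simp add: nn_integral_cmult_indicator)
    finally show ?thesis
      by (simp add: Q.emeasure_eq_measure emeasure_eq_measure ennreal_mult[symmetric])
  qed
  have "Q.prob A < e" if A: "A \<in> events" and small: "prob A < e / (2 * (real n + 1))" for A
  proof -
    have "Q.prob A \<le> Q.prob ((A \<inter> G n) \<union> (space M - G n))"
      using A Gm[of n] sets.sets_into_space[OF A] by (intro Q.finite_measure_mono) auto
    also have "\<dots> \<le> Q.prob (A \<inter> G n) + Q.prob (space M - G n)"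
      using A Gm[of n] by (intro measure_Un_le) auto
    also have "\<dots> < real n * prob A + e / 2" using le[OF A] n by linarith
    also have "real n * prob A \<le> (real n + 1) * (e / (2 * (real n + 1)))"
      using small by (intro mult_mono) auto
    also have "\<dots> = e / 2" by (simp add: field_simps)
    finally show ?thesis by simp
  qed
  then show ?thesis using e by (intro exI[of _ "e / (2 * (real n + 1))"]) auto
qed

text \<open>Joint measurability is given on \<open>{0..}\<close> only. Freezing the process at its
  value at time 0 for negative times gives a function measurable on the whole product, to which
  Fubini's theorem for \<open>lborel\<close> applies.\<close>

lemma measurable_adapted_joint:
  assumes "measurable_adapted M F X"
  shows "(\<lambda>(t, \<omega>). X (max 0 t) \<omega>) \<in> borel_measurable (borel \<Otimes>\<^sub>M M)"
proof -
  have [measurable]: "(\<lambda>y. max 0 (fst y :: real)) \<in> borel_measurable (borel \<Otimes>\<^sub>M M)" by measurable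
  have "(\<lambda>y. (max 0 (fst y :: real), snd y)) \<in> measurable (borel \<Otimes>\<^sub>M M) (restrict_space borel {0..} \<Otimes>\<^sub>M M)"
    by (intro measurable_Pair measurable_restrict_space2) auto
  from measurable_compose[OF this, of "\<lambda>(t, \<omega>). X t \<omega>" borel] show ?thesis
    using assms by (simp add: measurable_adapted_def split_beta)
qed

lemma measurable_adapted_section:
  assumes "measurable_adapted M F X" "\<omega> \<in> space M"
  shows "(\<lambda>t. X (max 0 t) \<omega>) \<in> borel_measurable borel"
proof -
  have "(\<lambda>t. (t, \<omega>)) \<in> measurable borel (borel \<Otimes>\<^sub>M M)" using assms(2) by auto
  from measurable_compose[OF this measurable_adapted_joint[OF assms(1)]] show ?thesis by simp
qed

lemma measurable_adapted_section_indicator: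
  assumes "measurable_adapted M F X" "\<omega> \<in> space M"
  shows "(\<lambda>t. indicator {0..T} t *\<^sub>R X t \<omega>) \<in> borel_measurable borel"
proof -
  have "(\<lambda>t. indicator {0..T} t *\<^sub>R X (max 0 t) \<omega>) \<in> borel_measurable borel"
    using measurable_adapted_section[OF assms] by measurable
  moreover have "(\<lambda>t. indicator {0..T} t *\<^sub>R X (max 0 t) \<omega>) = (\<lambda>t. indicator {0..T} t *\<^sub>R X t \<omega>)"
    by (auto simp: indicator_def max_def)
  ultimately show ?thesis by simp
qed

lemma simple_process_borel: "(\<lambda>t. simple_process h t \<omega>) \<in> borel_measurable borel"
proof (cases h)
  case (fields n \<tau> \<xi>)
  show ?thesis unfolding fields simple_process.simps
    by (intro borel_measurable_sum borel_measurable_times) auto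
qed

text \<open>With the clock as integrator the simple integral is a Lebesgue integral. This identifies
  the drift part of a simple integral against \<open>B t + k * t\<close>.\<close>

lemma simple_integral_time:
  assumes "is_simple_integrand M F h" "0 \<le> t"
  shows "set_integrable lborel {0..t} (\<lambda>u. simple_process h u \<omega>)"
    "simple_integral (\<lambda>t \<omega>. t) h t \<omega> = (LBINT u:{0..t}. simple_process h u \<omega>)"
proof -
  obtain n \<tau> \<xi> where h: "h = (n, \<tau>, \<xi>)" by (cases h)
  have tau: "0 \<le> \<tau> l" if "l \<le> n" for l
    using that
  proof (induction l)
    case (Suc l)
    then show ?case using assms(1) unfolding h by (auto dest!: spec[of _ l])
  qed (use assms h in auto)
  have int: "set_integrable lborel {0..t} (\<lambda>u. indicat_real {a<..b} u)" for a b
    by (rule set_integrable_bound[OF borel_integrable_atLeastAtMost'[of 0 t "\<lambda>_. 1::real"]])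
      (auto simp: set_borel_measurable_def indicator_def)
  have val: "(LBINT u:{0..t}. indicat_real {a<..b} u) = min t b - min t a" if "0 \<le> a" "a \<le> b" for a b
  proof -
    have "(LBINT u:{0..t}. indicat_real {a<..b} u) = (\<integral>u. indicat_real {min t a<..min t b} u \<partial>lborel)"
      unfolding set_lebesgue_integral_def using that assms(2)
      by (intro Bochner_Integration.integral_cong) (auto simp: indicator_def)
    also have "\<dots> = min t b - min t a" using that by (auto simp: min_def)
    finally show ?thesis .
  qed
  have sp: "simple_process h u \<omega> = (\<Sum>i<n. \<xi> i \<omega> * indicat_real {\<tau> i<..\<tau> (Suc i)} u)" for u
    unfolding h by (simp only: simple_process.simps)
  have i1: "set_integrable lborel {0..t} (\<lambda>u. \<xi> i \<omega> * indicat_real {\<tau> i<..\<tau> (Suc i)} u)" for i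
    using int by (intro set_integrable_mult_right)
  have i2: "indicator {0..t} u *\<^sub>R simple_process h u \<omega> =
    (\<Sum>i<n. indicator {0..t} u *\<^sub>R (\<xi> i \<omega> * indicat_real {\<tau> i<..\<tau> (Suc i)} u))" for u
    unfolding sp by (rule scaleR_sum_right)
  show "set_integrable lborel {0..t} (\<lambda>u. simple_process h u \<omega>)"
    unfolding set_integrable_def i2 using i1 unfolding set_integrable_def
      by (intro Bochner_Integration.integrable_sum)
  have "(LBINT u:{0..t}. simple_process h u \<omega>) =
    (\<Sum>i<n. LBINT u:{0..t}. \<xi> i \<omega> * indicat_real {\<tau> i<..\<tau> (Suc i)} u)"
    unfolding set_lebesgue_integral_def i2 using i1 unfolding set_integrable_def
    by (intro Bochner_Integration.integral_sum)
  also have "\<dots> = (\<Sum>i<n. \<xi> i \<omega> * (min t (\<tau> (Suc i)) - min t (\<tau> i)))"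
    using tau assms(1) unfolding h by (intro sum.cong) (auto simp: val)
  finally show "simple_integral (\<lambda>t \<omega>. t) h t \<omega> = (LBINT u:{0..t}. simple_process h u \<omega>)"
    unfolding h by (simp only: simple_integral.simps)
qed

lemma simple_integral_add_time:
  "simple_integral (\<lambda>t \<omega>. X t \<omega> + k * t) h t \<omega> = simple_integral X h t \<omega> + k * simple_integral
    (\<lambda>t \<omega>. t) h t \<omega>"
proof (cases h)
  case (fields n \<tau> \<xi>)
  have "\<xi> i \<omega> * (X (min t (\<tau> (Suc i))) \<omega> + k * min t (\<tau> (Suc i)) - (X (min t (\<tau> i)) \<omega> + k * min t (\<tau> i))) =
     \<xi> i \<omega> * (X (min t (\<tau> (Suc i))) \<omega> - X (min t (\<tau> i)) \<omega>) + k *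
       (\<xi> i \<omega> * (min t (\<tau> (Suc i)) - min t (\<tau> i)))" for i
    by (simp add: algebra_simps)
  then show ?thesis unfolding fields simple_integral.simps by (simp only: sum.distrib sum_distrib_left)
qed

lemma abs_le_square_div: "0 < e \<Longrightarrow> \<bar>u\<bar> \<le> e + u\<^sup>2 / (e::real)"
proof -
  assume e: "0 < e"
  have "0 \<le> (\<bar>u\<bar> - e)\<^sup>2" by simp
  then have "2 * (\<bar>u\<bar> * e) \<le> e\<^sup>2 + u\<^sup>2" by (simp add: power2_diff)
  moreover have "0 \<le> \<bar>u\<bar> * e" using e by simp
  ultimately have "\<bar>u\<bar> * e \<le> e\<^sup>2 + u\<^sup>2" by linarith
  then show ?thesis using e by (simp add: field_simps power2_eq_square)
qed

text \<open>The inequality |u| \<le> e + u^2 / e, integrated over [0, T]. For c = e^2 the bound is e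
  (T + 1), so convergence in L2 gives convergence of the time integrals.\<close>

lemma integral_abs_le_square:
  fixes f :: "real \<Rightarrow> real"
  assumes f: "(\<lambda>t. indicator {0..T} t *\<^sub>R f t) \<in> borel_measurable borel" and T: "0 \<le> T" and e: "0 < e"
    and sq: "(\<integral>\<^sup>+t\<in>{0..T}. ennreal ((f t)\<^sup>2) \<partial>lborel) \<le> ennreal c" and c: "0 \<le> c"
  shows "set_integrable lborel {0..T} f" "t \<in> {0..T} \<Longrightarrow> \<bar>LBINT u:{0..t}. f u\<bar> \<le> e * T + c / e"
proof -
  let ?f = "\<lambda>t. indicator {0..T} t * f t"
  have [measurable]: "?f \<in> borel_measurable borel" using f by simp
  have sqi: "(\<integral>\<^sup>+t. ennreal ((?f t)\<^sup>2) \<partial>lborel) \<le> ennreal c"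
    using sq by (rule order_trans[rotated]) (auto intro!: nn_integral_mono simp: indicator_def)
  have "(\<integral>\<^sup>+t. ennreal \<bar>?f t\<bar> \<partial>lborel) \<le>
    (\<integral>\<^sup>+t. ennreal e * indicator {0..T} t + ennreal (1 / e) * ennreal ((?f t)\<^sup>2) \<partial>lborel)"
  proof (rule nn_integral_mono)
    fix t
    have "\<bar>?f t\<bar> \<le> e * indicator {0..T} t + 1 / e * (?f t)\<^sup>2"
      using abs_le_square_div[OF e, of "f t"] by (auto simp: indicator_def)
    then have "ennreal \<bar>?f t\<bar> \<le> ennreal (e * indicator {0..T} t + 1 / e * (?f t)\<^sup>2)" by (rule ennreal_leI)
    also have "\<dots> = ennreal e * indicator {0..T} t + ennreal (1 / e) * ennreal ((?f t)\<^sup>2)"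
      using e by (auto simp: indicator_def ennreal_plus[symmetric] ennreal_mult[symmetric] simp del:
        ennreal_plus)
    finally show "ennreal \<bar>?f t\<bar> \<le> ennreal e * indicator {0..T} t + ennreal (1 / e) * ennreal ((?f t)\<^sup>2)" .
  qed
  also have "\<dots> = ennreal e * ennreal T + ennreal (1 / e) * (\<integral>\<^sup>+t. ennreal ((?f t)\<^sup>2) \<partial>lborel)"
    using T by (subst nn_integral_add; (subst nn_integral_cmult)?) (auto simp: nn_integral_cmult_indicator)
  also have "\<dots> \<le> ennreal e * ennreal T + ennreal (1 / e) * ennreal c"
    using sqi by (intro add_left_mono mult_left_mono) auto
  also have "\<dots> = ennreal (e * T + c / e)"
    using e T c by (simp add: ennreal_mult[symmetric] ennreal_plus[symmetric] del: ennreal_plus)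
  finally have le: "(\<integral>\<^sup>+t. ennreal \<bar>?f t\<bar> \<partial>lborel) \<le> ennreal (e * T + c / e)" .
  have int: "integrable lborel ?f"
    using le f by (intro integrableI_bounded) (auto simp: le_less_trans[OF _ ennreal_less_top])
  then show fi: "set_integrable lborel {0..T} f" by (simp add: set_integrable_def)
  have nn: "(\<integral>t. \<bar>?f t\<bar> \<partial>lborel) \<le> e * T + c / e"
  proof -
    have "ennreal (\<integral>t. \<bar>?f t\<bar> \<partial>lborel) \<le> ennreal (e * T + c / e)"
      using nn_integral_eq_integral[OF integrable_abs[OF int]] le by simp
    then show ?thesis using e T c by (subst (asm) ennreal_le_iff) auto
  qed
  show "\<bar>LBINT u:{0..t}. f u\<bar> \<le> e * T + c / e" if t: "t \<in> {0..T}"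
  proof -
    have sub: "set_integrable lborel {0..t} f" using t by (intro set_integrable_subset[OF fi]) auto
    have "\<bar>LBINT u:{0..t}. f u\<bar> \<le> (\<integral>u. \<bar>indicator {0..t} u *\<^sub>R f u\<bar> \<partial>lborel)"
      unfolding set_lebesgue_integral_def by (rule integral_abs_bound)
    also have "\<dots> \<le> (\<integral>u. \<bar>?f u\<bar> \<partial>lborel)"
      using sub int t unfolding set_integrable_def by (intro integral_mono integrable_abs)
        (auto simp: indicator_def)
    finally show ?thesis using nn by simp
  qed
qed

text \<open>One member of the approximating sequence is picked so late that both of its errors are
  small outside a single event.\<close>

lemma ito_approx:
  assumes M: "prob_space M" and I: "has_ito_integral M F B H I" and T: "0 \<le> T"
    and e: "0 < e" "0 < (e'::real)"
  obtains h A where "is_simple_integrand M F h" "A \<in> sets M" "measure M (space M - A) < e'"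
    "\<And>\<omega> t. \<omega> \<in> A \<Longrightarrow> t \<in> {0..T} \<Longrightarrow> \<bar>simple_integral B h t \<omega> - I t \<omega>\<bar> \<le> e"
    "\<And>\<omega>. \<omega> \<in> A \<Longrightarrow> (\<integral>\<^sup>+t\<in>{0..T}. ennreal ((simple_process h t \<omega> - H t \<omega>)\<^sup>2) \<partial>lborel) \<le> ennreal e"
proof -
  interpret prob_space M by (rule M)
  obtain h where h: "\<And>k. is_simple_integrand M F (h k)"
    "tendsto_0_in_prob M (\<lambda>k \<omega>. \<integral>\<^sup>+t\<in>{0..T}. ennreal ((simple_process (h k) t \<omega> - H t \<omega>)\<^sup>2) \<partial>lborel)"
    "tendsto_0_in_prob M (\<lambda>k \<omega>. SUP t\<in>{0..T}. ennreal \<bar>simple_integral B (h k) t \<omega> - I t \<omega>\<bar>)"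
    using I T unfolding has_ito_integral_def by (elim conjE exE) (metis (no_types, lifting))
  let ?A = "\<lambda>k \<omega>. \<integral>\<^sup>+t\<in>{0..T}. ennreal ((simple_process (h k) t \<omega> - H t \<omega>)\<^sup>2) \<partial>lborel"
  let ?B = "\<lambda>k \<omega>. SUP t\<in>{0..T}. ennreal \<bar>simple_integral B (h k) t \<omega> - I t \<omega>\<bar>"
  have lim: "(\<lambda>k. prob {\<omega>\<in>space M. ennreal e < ?A k \<omega>}) \<longlonglongrightarrow> 0"
    "(\<lambda>k. prob {\<omega>\<in>space M. ennreal e < ?B k \<omega>}) \<longlonglongrightarrow> 0"
    using h(2,3) e unfolding tendsto_0_in_prob_def by auto
  have m: "?A k \<in> borel_measurable M" "?B k \<in> borel_measurable M" for k
    using h(2,3) unfolding tendsto_0_in_prob_def by auto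
  have "eventually (\<lambda>k. prob {\<omega>\<in>space M. ennreal e < ?A k \<omega>} < e' / 2 \<and>
    prob {\<omega>\<in>space M. ennreal e < ?B k \<omega>} < e' / 2) sequentially"
    by (intro eventually_conj order_tendstoD(2)[OF lim(1)] order_tendstoD(2)[OF lim(2)]) (use e in auto)
  then obtain k where k: "prob {\<omega>\<in>space M. ennreal e < ?A k \<omega>} < e' / 2"
    "prob {\<omega>\<in>space M. ennreal e < ?B k \<omega>} < e' / 2"
    by (auto simp: eventually_sequentially)
  define A where "A = {\<omega>\<in>space M. ?A k \<omega> \<le> ennreal e \<and> ?B k \<omega> \<le> ennreal e}"
  have Am: "A \<in> events" unfolding A_def using m[of k] by measurable
  have bm: "{\<omega>\<in>space M. ennreal e < ?A k \<omega>} \<in> events" "{\<omega>\<in>space M. ennreal e < ?B k \<omega>} \<in> events"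
    using m[of k] by measurable
  have "prob (space M - A) \<le> prob ({\<omega>\<in>space M. ennreal e < ?A k \<omega>} \<union> {\<omega>\<in>space M. ennreal e < ?B k \<omega>})"
    using bm by (intro finite_measure_mono) (auto simp: A_def)
  also have "\<dots> \<le> prob {\<omega>\<in>space M. ennreal e < ?A k \<omega>} + prob {\<omega>\<in>space M. ennreal e < ?B k \<omega>}"
    using bm by (intro measure_Un_le)
  also have "\<dots> < e'" using k by linarith
  finally have small: "prob (space M - A) < e'" .
  show thesis
  proof (rule that[OF h(1) Am small])
    fix \<omega> t assume om: "\<omega> \<in> A" and t: "t \<in> {0..T}"
    have "ennreal \<bar>simple_integral B (h k) t \<omega> - I t \<omega>\<bar> \<le> ?B k \<omega>" using t by (rule SUP_upper)
    also have "\<dots> \<le> ennreal e" using om by (simp add: A_def)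
    finally show "\<bar>simple_integral B (h k) t \<omega> - I t \<omega>\<bar> \<le> e" using e by simp
  next
    fix \<omega> assume "\<omega> \<in> A"
    then show "?A k \<omega> \<le> ennreal e" by (simp add: A_def)
  qed
qed


locale brownian =
  fixes M :: "'a measure" and F :: "real \<Rightarrow> 'a measure" and B :: "'a process"
  assumes fps: "filtered_prob_space M F" and bm: "brownian_motion M F B"
begin

sublocale prob_space M using fps by (simp add: filtered_prob_space_def)

lemma upto: "brownian_upto M F B T"
  by (intro brownian_upto.intro brownian_upto_axioms.intro prob_space_axioms)
    (use fps bm in \<open>auto simp: filtered_prob_space_def brownian_motion_def adapted_def\<close>)

sublocale brownian_upto M F B T for T by (rule upto)

lemma continuous_B: "\<omega> \<in> space M \<Longrightarrow> continuous_on {0..T} (\<lambda>t. B t \<omega>)"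
  using bm unfolding brownian_motion_def continuous_paths_def
  by (auto intro: continuous_on_subset[of "{0..}"])

lemma adapted_F: "adapted F X \<Longrightarrow> 0 \<le> t \<Longrightarrow> X t \<in> borel_measurable (F t)"
  by (simp add: adapted_def)

lemma adapted_M: "adapted F X \<Longrightarrow> 0 \<le> t \<Longrightarrow> X t \<in> borel_measurable M"
  by (rule measurable_F, rule adapted_F)

text \<open>Against \<open>B t + k * t\<close> the integral of \<open>H\<close> is \<open>I\<close>
  plus k times the time integral of \<open>H\<close>; the L2 convergence of the simple integrands
  takes care of the second part. Exceptional sets that are small under the old measure are small
  under the new one.\<close>

lemma ito_approx_drift:
  assumes I: "has_ito_integral M F B H I" and T: "0 < T" and e: "0 < e" and k: "0 \<le> k"
  shows "\<exists>h A. is_simple_integrand M F h \<and> A \<in> events \<and>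
      measure (density M (\<lambda>\<omega>. ennreal (exp_density B k T \<omega>))) (space M - A) < e \<and>
      (\<forall>\<omega>\<in>A. \<forall>t\<in>{0..T}. \<bar>simple_integral (\<lambda>t \<omega>. B t \<omega> + k * t) h t \<omega>
        - (I t \<omega> + k * (LBINT u:{0..t}. H u \<omega>))\<bar> \<le> e)"
proof -
  let ?Q = "density M (\<lambda>\<omega>. ennreal (exp_density B k T \<omega>))"
  interpret Q: brownian_upto ?Q F "\<lambda>t \<omega>. B t \<omega> + k * t" T
    by (rule girsanov) (use T in simp)
  have L: "exp_density B k T \<in> borel_measurable M"
    using measurable_F[OF exp_density_measurable[of T T k]] T by auto
  have "\<exists>d>0. \<forall>A\<in>events. prob A < d \<longrightarrow> Q.prob A < e"
    by (rule density_prob_small[OF L _ Q.prob_space_axioms e]) (simp add: exp_density_pos less_imp_le)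
  then obtain d where d: "0 < d" "\<And>A. A \<in> events \<Longrightarrow> prob A < d \<Longrightarrow> Q.prob A < e"
    by blast
  \<comment> \<open>\<open>e1\<close> is spent once on the stochastic part and k (T + 1) times on
    the drift part. Its square \<open>e2\<close> is the accuracy in L2 that
    \<open>integral_abs_le_square\<close> turns into \<open>e1\<close>.\<close>
  define e1 where "e1 = min 1 (e / (1 + k * (T + 1)))"
  define e2 where "e2 = e1 * e1"
  have den: "0 < 1 + k * (T + 1)" using k T by (intro add_pos_nonneg) auto
  have e1: "0 < e1" "e1 \<le> 1" "e1 * (1 + k * (T + 1)) \<le> e"
  proof -
    show "0 < e1" "e1 \<le> 1" unfolding e1_def using e den by auto
    have "e1 * (1 + k * (T + 1)) \<le> e / (1 + k * (T + 1)) * (1 + k * (T + 1))"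
      unfolding e1_def using den by (intro mult_right_mono) auto
    then show "e1 * (1 + k * (T + 1)) \<le> e" using den by simp
  qed
  have e2: "0 < e2" "e2 \<le> e1" "e2 / e1 = e1" unfolding e2_def using e1 mult_left_le[of e1 e1] by auto
  obtain h A where hA: "is_simple_integrand M F h" "A \<in> events" "prob (space M - A) < d"
    "\<And>\<omega> t. \<omega> \<in> A \<Longrightarrow> t \<in> {0..T} \<Longrightarrow> \<bar>simple_integral B h t \<omega> - I t \<omega>\<bar> \<le> e2"
    "\<And>\<omega>. \<omega> \<in> A \<Longrightarrow> (\<integral>\<^sup>+t\<in>{0..T}. ennreal ((simple_process h t \<omega> - H t \<omega>)\<^sup>2) \<partial>lborel) \<le> ennreal e2"
    by (rule ito_approx[OF prob_space_axioms I less_imp_le[OF T] e2(1) d(1)]) (assumption | rule that)+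
  have H: "measurable_adapted M F H" using I by (simp add: has_ito_integral_def)
  have "\<bar>simple_integral (\<lambda>t \<omega>. B t \<omega> + k * t) h t \<omega> - (I t \<omega> + k * (LBINT u:{0..t}. H u \<omega>))\<bar> \<le> e"
    if om: "\<omega> \<in> A" and t: "t \<in> {0..T}" for \<omega> t
  proof -
    have oM: "\<omega> \<in> space M" using om hA(2) sets.sets_into_space by auto
    have m: "(\<lambda>t. indicator {0..T} t *\<^sub>R (simple_process h t \<omega> - H t \<omega>)) \<in> borel_measurable borel"
      unfolding scaleR_diff_right
      by (intro borel_measurable_diff measurable_adapted_section_indicator[OF H oM]
        borel_measurable_scaleR simple_process_borel) auto
    note b = integral_abs_le_square[OF m less_imp_le[OF T] e1(1) hA(5)[OF om] less_imp_le[OF e2(1)]]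
    have t': "{0..t} \<subseteq> {0..T}" using t by auto
    have si: "set_integrable lborel {0..t} (\<lambda>u. simple_process h u \<omega>)"
      by (rule simple_integral_time[OF hA(1)]) (use t in auto)
    have di: "set_integrable lborel {0..t} (\<lambda>u. simple_process h u \<omega> - H u \<omega>)"
      by (rule set_integrable_subset[OF b(1) _ t']) auto
    have "(LBINT u:{0..t}. H u \<omega>) = (LBINT u:{0..t}. simple_process h u \<omega> - (simple_process h u \<omega> - H u \<omega>))"
      by simp
    also have "\<dots> = (LBINT u:{0..t}. simple_process h u \<omega>) - (LBINT u:{0..t}. simple_process h u \<omega> - H u \<omega>)"
      by (rule set_integral_diff(2)[OF si di])
    finally have Hd: "(LBINT u:{0..t}. H u \<omega>) = simple_integral (\<lambda>t \<omega>. t) h t \<omega>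
      - (LBINT u:{0..t}. simple_process h u \<omega> - H u \<omega>)"
      using simple_integral_time(2)[OF hA(1), of t \<omega>] t by simp
    have eq: "simple_integral (\<lambda>t \<omega>. B t \<omega> + k * t) h t \<omega> - (I t \<omega> + k * (LBINT u:{0..t}. H u \<omega>)) =
       (simple_integral B h t \<omega> - I t \<omega>) + k * (LBINT u:{0..t}. simple_process h u \<omega> - H u \<omega>)"
      unfolding simple_integral_add_time Hd by (simp add: algebra_simps)
    have "\<bar>simple_integral (\<lambda>t \<omega>. B t \<omega> + k * t) h t \<omega> - (I t \<omega> + k * (LBINT u:{0..t}. H u \<omega>))\<bar>
       \<le> \<bar>simple_integral B h t \<omega> - I t \<omega>\<bar> + k * \<bar>LBINT u:{0..t}. simple_process h u \<omega> - H u \<omega>\<bar>"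
      unfolding eq using k by (intro order_trans[OF abs_triangle_ineq]) (simp add: abs_mult)
    also have "\<dots> \<le> e1 + k * (e1 * T + e1)"
      using hA(4)[OF om t] e2 b(2)[OF t] k by (intro add_mono mult_left_mono) auto
    also have "\<dots> = e1 * (1 + k * (T + 1))" by (simp add: algebra_simps)
    finally show ?thesis using e1 by linarith
  qed
  moreover have "Q.prob (space M - A) < e" using d(2)[of "space M - A"] hA(2,3) by auto
  ultimately show ?thesis using hA(1,2) by blast
qed

end

section \<open>Total wealth and the budget constraint of admissible controls\<close>

definition surplus :: "household \<Rightarrow> 'a process \<Rightarrow> 'a process \<Rightarrow> 'a process" where
  "surplus p x s t \<omega> = (x t \<omega> - x_min p) + (s t \<omega> - s_min p) * (energy_price p / eta_new p)"

definition state_price :: "household \<Rightarrow> 'a process \<Rightarrow> 'a process" where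
  "state_price p B t \<omega> = exp (- mu_R p * t) * exp_density B (kappa p) t \<omega>"

lemma state_price_pos: "0 < state_price p B t \<omega>"
  by (simp add: state_price_def exp_density_pos)

text \<open>Human capital is a perpetuity: \<open>mu_R p * human_capital p\<close> is the income
  left after subsistence consumption. Total wealth thus earns the riskless rate, and the exposure a
  \<sigma> W earns the premium \<open>kappa p\<close> per unit.\<close>

lemma total_wealth_drift:
  assumes "valid_household p"
  shows "wealth_drift p (a, x, s) W t \<omega> =
    mu_R p * total_wealth p (W t \<omega>) + kappa p * (a t \<omega> * sigma_S p * W t \<omega>) - surplus p x s t \<omega>"
proof -
  have "sigma_S p \<noteq> 0" "mu_R p \<noteq> 0" "eta_new p \<noteq> 0" using assms by (auto simp: valid_household_def)
  then have "kappa p * sigma_S p = mu_S p - mu_R p"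
    "mu_R p * human_capital p = net_income p - x_min p - s_min p / eta_new p * energy_price p"
    by (simp_all add: kappa_def human_capital_def)
  then have tw: "mu_R p * total_wealth p (W t \<omega>) + kappa p * (a t \<omega> * sigma_S p * W t \<omega>) =
    mu_R p * W t \<omega> + (net_income p - x_min p - s_min p / eta_new p * energy_price p)
     + (mu_S p - mu_R p) * (a t \<omega> * W t \<omega>)"
    unfolding total_wealth_def distrib_left by (metis mult.assoc mult.left_commute)
  have alg: "\<alpha> * S * v + (1 - \<alpha>) * r * v + N - \<xi> - y * q =
    r * v + (N - xm - sm * q) + (S - r) * (\<alpha> * v) - ((\<xi> - xm) + (y - sm) * q)" for \<alpha> S v r N \<xi> y q
      xm sm :: real
    by (simp add: algebra_simps)
  have dv: "y / eta_new p * energy_price p = y * (energy_price p / eta_new p)" for y by simp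
  show ?thesis unfolding wealth_drift.simps surplus_def tw dv by (rule alg)
qed

context brownian
begin

text \<open>The process is the pointwise limit of processes that are constant in time on cells of
  length 1 / (n + 1), with the value at the left end. Such a process involves only countably many
  random variables and is jointly measurable.\<close>

lemma measurable_adapted_continuous:
  assumes X: "adapted F X" and c: "continuous_paths M X"
  shows "measurable_adapted M F X"
  unfolding measurable_adapted_def
proof (intro conjI X)
  let ?N = "restrict_space borel {0::real..} \<Otimes>\<^sub>M M"
  define Y where "Y n y = X (real (nat \<lfloor>fst y * real (Suc n)\<rfloor>) / real (Suc n)) (snd y)" for n :: nat
    and y :: "real \<times> 'a"
  have "fst \<in> measurable ?N borel"
    by (rule measurable_compose[OF measurable_fst]) (rule measurable_restrict_space1, simp)
  then have [measurable]: "(\<lambda>y. nat \<lfloor>fst y * real (Suc n)\<rfloor>) \<in> measurable ?N (count_space UNIV)" for n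
    by measurable
  have "(\<lambda>y. X (real i / real (Suc n)) (snd y)) \<in> borel_measurable ?N" for i n :: nat
    by (rule measurable_compose[OF measurable_snd]) (rule adapted_M[OF X], simp)
  then have Ym: "Y n \<in> borel_measurable ?N" for n
    unfolding Y_def[abs_def]
    by (rule measurable_compose_countable[where f="\<lambda>i y. X (real i / real (Suc n)) (snd y)"]) measurable
  show "(\<lambda>(t, \<omega>). X t \<omega>) \<in> borel_measurable ?N"
  proof (rule borel_measurable_LIMSEQ_real[OF _ Ym])
    fix y assume "y \<in> space ?N"
    then obtain t \<omega> where y: "y = (t, \<omega>)" "0 \<le> t" "\<omega> \<in> space M"
      by (auto simp: space_pair_measure space_restrict_space)
    have "(\<lambda>n. real (nat \<lfloor>t * real (Suc n)\<rfloor>) / real (Suc n)) \<longlonglongrightarrow> t"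
    proof (rule tendsto_sandwich[of "\<lambda>n. t - 1 / real (Suc n)" _ _ "\<lambda>n. t"])
      have lo: "t - 1 / real (Suc n) \<le> real (nat \<lfloor>t * real (Suc n)\<rfloor>) / real (Suc n)" for n
      proof -
        have "t * real (Suc n) - 1 \<le> real (nat \<lfloor>t * real (Suc n)\<rfloor>)" using y(2) by linarith
        then have "(t * real (Suc n) - 1) / real (Suc n) \<le> real (nat \<lfloor>t * real (Suc n)\<rfloor>) / real (Suc n)"
          by (rule divide_right_mono) simp
        then show ?thesis by (simp add: diff_divide_distrib del: of_nat_Suc)
      qed
      have hi: "real (nat \<lfloor>t * real (Suc n)\<rfloor>) / real (Suc n) \<le> t" for n
      proof -
        have "real (nat \<lfloor>t * real (Suc n)\<rfloor>) \<le> t * real (Suc n)" using y(2) by (simp add: of_nat_nat)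
        then show ?thesis by (simp add: pos_divide_le_eq del: of_nat_Suc)
      qed
      show "\<forall>\<^sub>F n in sequentially. t - 1 / real (Suc n) \<le> real (nat \<lfloor>t * real (Suc n)\<rfloor>) / real (Suc n)"
        using lo by simp
      show "\<forall>\<^sub>F n in sequentially. real (nat \<lfloor>t * real (Suc n)\<rfloor>) / real (Suc n) \<le> t" using hi by simp
      have "(\<lambda>n. t - 1 / real (Suc n)) \<longlonglongrightarrow> t - 0"
        by (intro tendsto_diff tendsto_const LIMSEQ_inverse_real_of_nat[unfolded inverse_eq_divide])
      then show "(\<lambda>n. t - 1 / real (Suc n)) \<longlonglongrightarrow> t" by simp
    qed simp
    moreover have "continuous_on {0..} (\<lambda>t. X t \<omega>)" using c y by (simp add: continuous_paths_def)
    ultimately have "(\<lambda>n. X (real (nat \<lfloor>t * real (Suc n)\<rfloor>) / real (Suc n)) \<omega>) \<longlonglongrightarrow> X t \<omega>"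
      using y by (intro continuous_on_tendsto_compose[where f="\<lambda>t. X t \<omega>" and s="{0..}"]) auto
    then show "(\<lambda>n. Y n y) \<longlonglongrightarrow> (case y of (t, \<omega>) \<Rightarrow> X t \<omega>)" unfolding Y_def y by simp
  qed
qed

lemma measurable_adapted_borel:
  assumes g: "g \<in> borel_measurable borel" and X: "measurable_adapted M F X"
  shows "measurable_adapted M F (\<lambda>t \<omega>. g (X t \<omega>))"
proof -
  have "adapted F X" and j: "(\<lambda>(t, \<omega>). X t \<omega>) \<in> borel_measurable (restrict_space borel {0..} \<Otimes>\<^sub>M M)"
    using X by (auto simp: measurable_adapted_def)
  then have "adapted F (\<lambda>t \<omega>. g (X t \<omega>))"
    unfolding adapted_def using measurable_compose[OF _ g] by blast
  then show ?thesis unfolding measurable_adapted_def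
    using measurable_compose[OF j g] by (simp add: split_beta)
qed

lemma integral_measurable:
  fixes f :: "real \<Rightarrow> real"
  assumes X: "measurable_adapted M F X" and f: "f \<in> borel_measurable borel"
  shows "(\<lambda>\<omega>. LBINT u:{0..T}. f u * X u \<omega>) \<in> borel_measurable M"
proof -
  have "(\<lambda>(u, \<omega>). X (max 0 u) \<omega>) \<in> borel_measurable (borel \<Otimes>\<^sub>M M)" by (rule measurable_adapted_joint[OF X])
  then have m: "(\<lambda>y. X (max 0 (snd y)) (fst y)) \<in> borel_measurable (M \<Otimes>\<^sub>M lborel)"
    using measurable_compose[OF measurable_pair_swap'[of M borel]]
    by (subst measurable_cong_sets[OF sets_pair_measure_cong[OF refl sets_lborel] refl])
      (simp add: split_beta)
  have f': "(\<lambda>y. f (snd y)) \<in> borel_measurable (M \<Otimes>\<^sub>M lborel)"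
    using f by measurable
  have "(\<lambda>(\<omega>, u). indicator {0..T} u *\<^sub>R (f u * X (max 0 u) \<omega>)) \<in> borel_measurable (M \<Otimes>\<^sub>M lborel)"
    using m f' by (simp add: split_beta)
  then have "(\<lambda>\<omega>. \<integral>u. indicator {0..T} u *\<^sub>R (f u * X (max 0 u) \<omega>) \<partial>lborel) \<in> borel_measurable M"
    by (rule lborel.borel_measurable_lebesgue_integral)
  moreover have "(\<integral>u. indicator {0..T} u *\<^sub>R (f u * X (max 0 u) \<omega>) \<partial>lborel) =
    (LBINT u:{0..T}. f u * X u \<omega>)" for \<omega>
    unfolding set_lebesgue_integral_def by (intro Bochner_Integration.integral_cong)
      (auto simp: indicator_def max_def)
  ultimately show ?thesis by simp
qed

lemma measurable_adapted_surplus: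
  assumes "measurable_adapted M F x" "measurable_adapted M F s"
  shows "measurable_adapted M F (surplus p x s)"
proof -
  have 1: "(\<lambda>y. x (fst y) (snd y)) \<in> borel_measurable (restrict_space borel {0..} \<Otimes>\<^sub>M M)"
    "(\<lambda>y. s (fst y) (snd y)) \<in> borel_measurable (restrict_space borel {0..} \<Otimes>\<^sub>M M)"
    using assms by (auto simp: measurable_adapted_def split_beta)
  have 2: "x t \<in> borel_measurable (F t)" "s t \<in> borel_measurable (F t)" if "0 \<le> t" for t
    using assms that by (auto simp: measurable_adapted_def adapted_def)
  have "surplus p x s t \<in> borel_measurable (F t)" if "0 \<le> t" for t
    unfolding surplus_def[abs_def] using 2[OF that]
      by (intro borel_measurable_add borel_measurable_diff borel_measurable_times) auto
  moreover have "(\<lambda>y. surplus p x s (fst y) (snd y)) \<in> borel_measurable (restrict_space borel {0..} \<Otimes>\<^sub>M M)"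
    unfolding surplus_def using 1
      by (intro borel_measurable_add borel_measurable_diff borel_measurable_times) auto
  ultimately show ?thesis by (simp add: measurable_adapted_def adapted_def split_beta)
qed

lemma measurable_adapted_state_price: "measurable_adapted M F (state_price p B)"
proof (rule measurable_adapted_continuous)
  show "adapted F (state_price p B)" unfolding adapted_def
  proof (intro allI impI)
    fix t :: real assume t: "0 \<le> t"
    have "exp_density B (kappa p) t \<in> borel_measurable (F t)"
      using exp_density_measurable[of t t] t by auto
    then show "state_price p B t \<in> borel_measurable (F t)" unfolding state_price_def[abs_def] by measurable
  qed
  show "continuous_paths M (state_price p B)"
    using bm unfolding brownian_motion_def continuous_paths_def state_price_def exp_density_def
    by (auto intro!: continuous_intros)
qed

text \<open>Under the new measure \<open>discounted_consumption_le\<close> applies to total wealth,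
  with \<open>I\<close> plus \<kappa> times the time integral of the exposure as gains. On the way
  back the density at T may be replaced by that at t, since consumption at t is known at t; the
  discount factor times the latter is the state price.\<close>

theorem budget_constraint:
  assumes p: "valid_household p" and adm: "admissible_with M F B p w (a, x, s) W"
    and z: "0 < total_wealth p w" and T: "0 < T"
  shows "(\<integral>\<^sup>+\<omega>. (\<integral>\<^sup>+t\<in>{0..T}. ennreal (state_price p B t \<omega> * surplus p x s t \<omega>) \<partial>lborel) \<partial>M)
    \<le> ennreal (total_wealth p w)"
proof -
  let ?k = "kappa p" and ?r = "mu_R p" and ?C = "surplus p x s"
  let ?H = "\<lambda>t \<omega>. a t \<omega> * sigma_S p * W t \<omega>" and ?Z = "\<lambda>t \<omega>. total_wealth p (W t \<omega>)"
  have ctrl: "is_control M F p (a, x, s)" and wp: "wealth_process M F B p w (a, x, s) W"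
    and pos: "AE \<omega> in M. \<forall>t\<ge>0. 0 < ?Z t \<omega>"
    using adm by (auto simp: admissible_with_def)
  have W: "adapted F W" "continuous_paths M W"
    and di: "AE \<omega> in M. \<forall>T\<ge>0. set_integrable lborel {0..T} (\<lambda>t. wealth_drift p (a, x, s) W t \<omega>)"
    using wp by (auto simp del: wealth_drift.simps)
  obtain I where I: "has_ito_integral M F B ?H I"
    and We: "AE \<omega> in M. \<forall>T\<ge>0. W T \<omega> = w + (LBINT t:{0..T}. wealth_drift p (a, x, s) W t \<omega>) + I T \<omega>"
    using wp by (auto simp del: wealth_drift.simps)
  have H: "measurable_adapted M F ?H"
    and Hsq: "AE \<omega> in M. \<forall>T\<ge>0. (\<integral>\<^sup>+t\<in>{0..T}. ennreal ((?H t \<omega>)\<^sup>2) \<partial>lborel) < \<infinity>"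
    using I by (auto simp: has_ito_integral_def)
  have k: "0 \<le> ?k" "0 \<le> ?r" using p by (auto simp: valid_household_def kappa_def)
  have q: "0 < energy_price p / eta_new p" using p by (auto simp: valid_household_def)
  have Cm: "measurable_adapted M F ?C" using ctrl by (auto intro: measurable_adapted_surplus)
  have Cpos: "AE \<omega> in M. \<forall>t\<ge>0. 0 \<le> ?C t \<omega>"
  proof -
    have "AE \<omega> in M. \<forall>t\<ge>0. x_min p < x t \<omega> \<and> s_min p < s t \<omega>" using ctrl by auto
    then show ?thesis
    proof eventually_elim
      case (elim \<omega>)
      have "0 \<le> ?C t \<omega>" if "0 \<le> t" for t
      proof -
        have "0 \<le> x t \<omega> - x_min p" "0 \<le> s t \<omega> - s_min p" using elim that by (auto simp: less_imp_le)
        then show ?thesis unfolding surplus_def using q by (intro add_nonneg_nonneg mult_nonneg_nonneg) auto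
      qed
      then show ?case by blast
    qed
  qed
  have Qm: "(\<lambda>\<omega>. LBINT u:{0..T}. exp (- ?r * u) * ?C u \<omega>) \<in> borel_measurable M"
    by (rule integral_measurable[OF Cm]) auto
  have Zc: "continuous_on {0..T} (\<lambda>t. ?Z t \<omega>)" if "\<omega> \<in> space M" for \<omega>
    using W(2) that unfolding continuous_paths_def total_wealth_def
    by (auto intro!: continuous_intros intro: continuous_on_subset[of "{0..}"])
  have main: "AE \<omega> in M. (\<forall>t\<in>{0..T}. 0 \<le> ?Z t \<omega> \<and> 0 \<le> ?C t \<omega>) \<and> set_integrable lborel {0..T} (\<lambda>t. ?C t \<omega>) \<and>
      (\<forall>t\<in>{0..T}. ?Z t \<omega> = total_wealth p w + ?r * (LBINT u:{0..t}. ?Z u \<omega>) - (LBINT u:{0..t}. ?C u \<omega>)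
        + (I t \<omega> + ?k * (LBINT u:{0..t}. ?H u \<omega>)))"
    using pos di We Hsq Cpos AE_space
  proof eventually_elim
    case (elim \<omega>)
    have Zi: "set_integrable lborel {0..t} (\<lambda>u. ?Z u \<omega>)" if "t \<in> {0..T}" for t
      by (rule borel_integrable_atLeastAtMost', rule continuous_on_subset[OF Zc]) (use elim that in auto)
    have Hfin: "(\<integral>\<^sup>+t\<in>{0..T}. ennreal ((?H t \<omega>)\<^sup>2) \<partial>lborel) < \<infinity>"
      using elim T by auto
    \<comment> \<open>Square integrability on a bounded interval makes the exposure integrable, so
      the drift can be split and the surplus consumption is integrable as a difference.\<close>
    have HiT: "set_integrable lborel {0..T} (\<lambda>u. ?H u \<omega>)"
      by (rule integral_abs_le_square(1)[OF measurable_adapted_section_indicator[OF H] _ zero_less_one,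
            of _ _ "enn2real (\<integral>\<^sup>+t\<in>{0..T}. ennreal ((?H t \<omega>)\<^sup>2) \<partial>lborel)"])
        (use elim T Hfin in \<open>auto simp: ennreal_enn2real\<close>)
    have Hi: "set_integrable lborel {0..t} (\<lambda>u. ?H u \<omega>)" if "t \<in> {0..T}" for t
      by (rule set_integrable_subset[OF HiT]) (use that in auto)
    have Ceq: "?C u \<omega> = ?r * ?Z u \<omega> + ?k * ?H u \<omega> - wealth_drift p (a, x, s) W u \<omega>" for u
      using total_wealth_drift[OF p, of a x s W u \<omega>] by simp
    have d: "set_integrable lborel {0..t} (\<lambda>u. wealth_drift p (a, x, s) W u \<omega>)" if "t \<in> {0..T}" for t
      using elim that by auto
    have Ci: "set_integrable lborel {0..t} (\<lambda>u. ?C u \<omega>)" if t: "t \<in> {0..T}" for t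
      unfolding Ceq using Zi[OF t] Hi[OF t] d[OF t]
      by (intro set_integral_diff set_integral_add set_integrable_mult_right)
    have "?Z t \<omega> = total_wealth p w + ?r * (LBINT u:{0..t}. ?Z u \<omega>) - (LBINT u:{0..t}. ?C u \<omega>)
        + (I t \<omega> + ?k * (LBINT u:{0..t}. ?H u \<omega>))" if t: "t \<in> {0..T}" for t
    proof -
      have "(LBINT u:{0..t}. ?C u \<omega>) = (LBINT u:{0..t}. ?r * ?Z u \<omega> + ?k * ?H u \<omega>)
        - (LBINT u:{0..t}. wealth_drift p (a, x, s) W u \<omega>)"
        unfolding Ceq using Zi[OF t] Hi[OF t] d[OF t]
        by (intro set_integral_diff set_integral_add set_integrable_mult_right)
      also have "(LBINT u:{0..t}. ?r * ?Z u \<omega> + ?k * ?H u \<omega>) = (LBINT u:{0..t}. ?r * ?Z u \<omega>)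
        + (LBINT u:{0..t}. ?k * ?H u \<omega>)"
        using Zi[OF t] Hi[OF t] by (intro set_integral_add set_integrable_mult_right)
      finally have "(LBINT u:{0..t}. ?C u \<omega>) = ?r * (LBINT u:{0..t}. ?Z u \<omega>) + ?k * (LBINT u:{0..t}. ?H u \<omega>)
         - (LBINT u:{0..t}. wealth_drift p (a, x, s) W u \<omega>)" by simp
      moreover have "W t \<omega> = w + (LBINT u:{0..t}. wealth_drift p (a, x, s) W u \<omega>) + I t \<omega>"
        using elim t by auto
      ultimately show ?thesis by (simp add: total_wealth_def)
    qed
    then show ?case using elim Ci[of T] T by (auto simp: less_imp_le simp del: wealth_drift.simps)
  qed
  let ?L = "\<lambda>\<omega>. exp_density B ?k T \<omega>"
  let ?Q = "density M (\<lambda>\<omega>. ennreal (?L \<omega>))"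
  interpret Q: brownian_upto ?Q F "\<lambda>t \<omega>. B t \<omega> + ?k * t" T
    by (rule girsanov) (use T in simp)
  have L [measurable]: "?L \<in> borel_measurable M"
    using measurable_F[OF exp_density_measurable[of T T ?k]] T by auto
  have "(\<integral>\<^sup>+\<omega>. ennreal (LBINT u:{0..T}. exp (- ?r * u) * ?C u \<omega>) \<partial>?Q) \<le> ennreal (total_wealth p w)"
  proof (rule Q.discounted_consumption_le[where Z="?Z" and
    Y="\<lambda>t \<omega>. I t \<omega> + ?k * (LBINT u:{0..t}. ?H u \<omega>)", OF T k(2) z])
    show "continuous_on {0..T} (\<lambda>t. B t \<omega> + ?k * t)" if "\<omega> \<in> space ?Q" for \<omega>
      using continuous_B[of \<omega> T] that by (auto intro!: continuous_intros)
    show "?Z t \<in> borel_measurable ?Q" if "t \<in> {0..T}" for t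
      using adapted_M[OF W(1), of t] that unfolding total_wealth_def by simp
    show "continuous_on {0..T} (\<lambda>t. ?Z t \<omega>)" if "\<omega> \<in> space ?Q" for \<omega> using Zc that by simp
    show "AE \<omega> in ?Q. (\<forall>t\<in>{0..T}. 0 \<le> ?Z t \<omega> \<and> 0 \<le> ?C t \<omega>) \<and> set_integrable lborel {0..T} (\<lambda>t. ?C t \<omega>) \<and>
      (\<forall>t\<in>{0..T}. ?Z t \<omega> = total_wealth p w + ?r * (LBINT u:{0..t}. ?Z u \<omega>) - (LBINT u:{0..t}. ?C u \<omega>)
        + (I t \<omega> + ?k * (LBINT u:{0..t}. ?H u \<omega>)))"
      using main L by (subst AE_density) (auto elim: eventually_mono)
    show "(\<lambda>\<omega>. LBINT u:{0..T}. exp (- ?r * u) * ?C u \<omega>) \<in> borel_measurable ?Q" using Qm by simp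
    fix e :: real assume e: "0 < e"
    have simp_eq: "is_simple_integrand ?Q F h = is_simple_integrand M F h" for h by (cases h) simp
    show "\<exists>h A. is_simple_integrand ?Q F h \<and> A \<in> Q.events \<and> Q.prob (space ?Q - A) < e \<and>
      (\<forall>\<omega>\<in>A. \<forall>t\<in>{0..T}. \<bar>simple_integral (\<lambda>t \<omega>. B t \<omega> + ?k * t) h t \<omega>
        - (I t \<omega> + ?k * (LBINT u:{0..t}. ?H u \<omega>))\<bar> \<le> e)"
      unfolding simp_eq space_density sets_density by (rule ito_approx_drift[OF I T e k(1)])
  qed
  also have "(\<integral>\<^sup>+\<omega>. ennreal (LBINT u:{0..T}. exp (- ?r * u) * ?C u \<omega>) \<partial>?Q) =
    (\<integral>\<^sup>+\<omega>. ennreal (?L \<omega>) * ennreal (LBINT u:{0..T}. exp (- ?r * u) * ?C u \<omega>) \<partial>M)"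
    using Qm by (intro nn_integral_density) auto
  finally have Qle: "(\<integral>\<^sup>+\<omega>. ennreal (?L \<omega>) * ennreal (LBINT u:{0..T}. exp (- ?r * u) * ?C u \<omega>) \<partial>M) \<le>
    ennreal (total_wealth p w)" .
  \<comment> \<open>Discounted consumption before T, frozen for negative times to be jointly
    measurable; not to be confused with the constant \<open>phi\<close>.\<close>
  define \<phi> where "\<phi> u \<omega> = indicator {0..T} u * ennreal (exp (- ?r * u) * ?C (max 0 u) \<omega>)" for u \<omega>
  have Cj: "(\<lambda>y. ?C (max 0 (fst y)) (snd y)) \<in> borel_measurable (lborel \<Otimes>\<^sub>M M)"
    using measurable_adapted_joint[OF Cm]
    by (subst measurable_cong_sets[OF sets_pair_measure_cong[OF sets_lborel refl] refl])
      (simp add: split_beta)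
  have Lj: "(\<lambda>y. state_price p B (max 0 (fst y)) (snd y)) \<in> borel_measurable (lborel \<Otimes>\<^sub>M M)"
    using measurable_adapted_joint[OF measurable_adapted_state_price[of p]]
    by (subst measurable_cong_sets[OF sets_pair_measure_cong[OF sets_lborel refl] refl])
      (simp add: split_beta)
  have pj [measurable]: "(\<lambda>y. \<phi> (fst y) (snd y)) \<in> borel_measurable (lborel \<Otimes>\<^sub>M M)"
    unfolding \<phi>_def using Cj by measurable
  interpret P: pair_sigma_finite lborel M by unfold_locales
  have "(\<integral>\<^sup>+\<omega>. (\<integral>\<^sup>+t\<in>{0..T}. ennreal (state_price p B t \<omega> * ?C t \<omega>) \<partial>lborel) \<partial>M) =
    (\<integral>\<^sup>+\<omega>. (\<integral>\<^sup>+t. ennreal (state_price p B (max 0 t) \<omega> * ?C (max 0 t) \<omega>) * indicator {0..T} t \<partial>lborel) \<partial>M)"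
    by (intro nn_integral_cong) (auto simp: indicator_def max_def)
  also have "\<dots> = (\<integral>\<^sup>+t. (\<integral>\<^sup>+\<omega>. ennreal (state_price p B (max 0 t) \<omega> * ?C (max 0 t) \<omega>) * indicator
    {0..T} t \<partial>M) \<partial>lborel)"
    using Cj Lj by (intro P.Fubini') (simp add: split_beta)
  also have "\<dots> = (\<integral>\<^sup>+t. (\<integral>\<^sup>+\<omega>. \<phi> t \<omega> * ennreal (?L \<omega>) \<partial>M) \<partial>lborel)"
  proof (rule nn_integral_cong)
    fix t :: real
    show "(\<integral>\<^sup>+\<omega>. ennreal (state_price p B (max 0 t) \<omega> * ?C (max 0 t) \<omega>) * indicator {0..T} t \<partial>M) =
      (\<integral>\<^sup>+\<omega>. \<phi> t \<omega> * ennreal (?L \<omega>) \<partial>M)"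
    proof (cases "t \<in> {0..T}")
      case True
      have "?C t \<in> borel_measurable (F t)" using Cm True by (auto simp: measurable_adapted_def adapted_def)
      then have "\<phi> t \<in> borel_measurable (F t)" unfolding \<phi>_def[abs_def] using True by (simp add: max_def)
      then have "(\<integral>\<^sup>+\<omega>. \<phi> t \<omega> * ennreal (?L \<omega>) \<partial>M) = (\<integral>\<^sup>+\<omega>. \<phi> t \<omega> * ennreal (exp_density B ?k t \<omega>) \<partial>M)"
        using True by (intro exp_density_martingale[of t T T]) auto
      also have "\<dots> = (\<integral>\<^sup>+\<omega>. ennreal (state_price p B (max 0 t) \<omega> * ?C (max 0 t) \<omega>) * indicator {0..T} t \<partial>M)"
        using True by (intro nn_integral_cong)
          (simp add: \<phi>_def state_price_def max_def ennreal_mult'[symmetric] exp_density_pos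
            less_imp_le mult.assoc mult.left_commute mult.commute)
      finally show ?thesis by simp
    qed (simp add: \<phi>_def)
  qed
  also have "\<dots> = (\<integral>\<^sup>+\<omega>. (\<integral>\<^sup>+t. \<phi> t \<omega> * ennreal (?L \<omega>) \<partial>lborel) \<partial>M)"
    by (rule P.Fubini'[symmetric]) (simp add: split_beta)
  also have "\<dots> = (\<integral>\<^sup>+\<omega>. ennreal (?L \<omega>) * ennreal (LBINT u:{0..T}. exp (- ?r * u) * ?C u \<omega>) \<partial>M)"
  proof (rule nn_integral_cong_AE)
    show "AE \<omega> in M. (\<integral>\<^sup>+t. \<phi> t \<omega> * ennreal (?L \<omega>) \<partial>lborel) =
      ennreal (?L \<omega>) * ennreal (LBINT u:{0..T}. exp (- ?r * u) * ?C u \<omega>)"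
      using main AE_space
    proof eventually_elim
      case (elim \<omega>)
      have eC: "set_integrable lborel {0..T} (\<lambda>u. exp (- ?r * u) * ?C u \<omega>)"
      proof (rule set_integrable_bound)
        show "set_integrable lborel {0..T} (\<lambda>t. ?C t \<omega>)" using elim by simp
        have "(\<lambda>u. exp (- ?r * u) * (indicator {0..T} u *\<^sub>R ?C u \<omega>)) \<in> borel_measurable lborel"
          using measurable_adapted_section_indicator[OF Cm, of \<omega> T] elim
            by (intro borel_measurable_times) auto
        then show "set_borel_measurable lborel {0..T} (\<lambda>u. exp (- ?r * u) * ?C u \<omega>)"
          unfolding set_borel_measurable_def by (simp add: mult.left_commute)
        show "AE u in lborel. u \<in> {0..T} \<longrightarrow> norm (exp (- ?r * u) * ?C u \<omega>) \<le> norm (?C u \<omega>)"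
          using k by (auto simp: abs_mult intro!: mult_left_le_one_le)
      qed
      have "(\<integral>\<^sup>+t. \<phi> t \<omega> \<partial>lborel) =
        (\<integral>\<^sup>+u. ennreal (indicator {0..T} u *\<^sub>R (exp (- ?r * u) * ?C u \<omega>)) \<partial>lborel)"
        by (intro nn_integral_cong) (auto simp: \<phi>_def indicator_def max_def)
      also have "\<dots> = ennreal (LBINT u:{0..T}. exp (- ?r * u) * ?C u \<omega>)"
        unfolding set_lebesgue_integral_def using eC elim
        by (intro nn_integral_eq_integral) (auto simp: set_integrable_def indicator_def)
      finally have eq: "(\<integral>\<^sup>+t. \<phi> t \<omega> \<partial>lborel) = ennreal (LBINT u:{0..T}. exp (- ?r * u) * ?C u \<omega>)" .
      have "(\<lambda>t. \<phi> t \<omega>) \<in> borel_measurable lborel"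
        using measurable_compose[OF _ pj, of "\<lambda>t. (t, \<omega>)" lborel] elim by simp
      then show ?case using eq by (simp add: nn_integral_multc mult.commute)
    qed
  qed
  finally show ?thesis using Qle by simp
qed

end

declare simple_process.simps [simp del] simple_integral.simps [simp del] wealth_drift.simps [simp del]

section \<open>Uniqueness for linear stochastic differential equations\<close>

lemma square_sum_le: "(a + b)\<^sup>2 \<le> 2 * a\<^sup>2 + 2 * (b::real)\<^sup>2"
proof -
  have "0 \<le> (a - b)\<^sup>2" by simp
  then show ?thesis by (simp add: power2_sum power2_diff)
qed

lemma grid_sum: "grid T n g \<Longrightarrow> (\<Sum>i<n. g (Suc i) - g i) = T"
  by (simp add: sum_lessThan_telescope grid_def)

context brownian
begin

text \<open>The value at time 0 is determined only through the approximation: simple integrals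
  vanish there and converge in probability.\<close>

lemma ito_integral_0:
  assumes I: "has_ito_integral M F B H I"
  shows "AE \<omega> in M. I 0 \<omega> = 0"
proof -
  have Im: "I 0 \<in> borel_measurable M" using I by (simp add: has_ito_integral_def)
  have small: "prob {\<omega>\<in>space M. e < \<bar>I 0 \<omega>\<bar>} \<le> e'" if e: "0 < e" "0 < e'" for e e' :: real
  proof -
    obtain h A where hA: "is_simple_integrand M F h" "A \<in> events" "prob (space M - A) < e'"
      "\<And>\<omega> t. \<omega> \<in> A \<Longrightarrow> t \<in> {0..0} \<Longrightarrow> \<bar>simple_integral B h t \<omega> - I t \<omega>\<bar> \<le> e"
      by (rule ito_approx[OF prob_space_axioms I order_refl e]) (assumption | rule that)+
    have "prob {\<omega>\<in>space M. e < \<bar>I 0 \<omega>\<bar>} \<le> prob (space M - A)"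
      using hA(2) hA(4)[of _ 0] simple_integral_at_0[OF hA(1), of B] by (intro finite_measure_mono)
        fastforce+
    then show ?thesis using hA(3) by simp
  qed
  have z: "prob {\<omega>\<in>space M. 1 / real (Suc n) < \<bar>I 0 \<omega>\<bar>} = 0" for n
    by (rule antisym[OF field_le_epsilon]) (use small[of "1 / real (Suc n)"] in auto)
  have "AE \<omega> in M. \<forall>n. \<not> 1 / real (Suc n) < \<bar>I 0 \<omega>\<bar>"
    unfolding AE_all_countable using z Im by (subst prob_Collect_eq_0[symmetric]) auto
  then show ?thesis
  proof eventually_elim
    case (elim \<omega>)
    then show ?case using nat_approx_posE[of "\<bar>I 0 \<omega>\<bar>"] by (metis zero_less_abs_iff)
  qed
qed

text \<open>Finitely many points have to be in the grid, since the simple integrands may jump there.\<close>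

lemma ito_riemann:
  assumes I: "has_ito_integral M F B H I" and K: "adapted F K" "continuous_paths M K"
    and HK: "AE \<omega> in M. AE t in lborel. 0 \<le> t \<longrightarrow> H t \<omega> = K t \<omega>" and T: "0 < T" and e: "0 < (e::real)"
  shows "\<exists>S \<eta>. finite S \<and> 0 < \<eta> \<and> (\<forall>n g. grid T n g \<longrightarrow> (\<forall>i<n. g (Suc i) - g i \<le> \<eta>) \<longrightarrow>
      (\<forall>x\<in>S. \<forall>i<n. x \<le> g i \<or> g (Suc i) \<le> x) \<longrightarrow>
      (\<exists>A\<in>events. prob (space M - A) < e \<and>
        (\<forall>\<omega>\<in>A. \<bar>transform (\<lambda>i. K (g i)) (\<lambda>i \<omega>. B (g (Suc i)) \<omega> - B (g i) \<omega>) n \<omega> - I T \<omega>\<bar> \<le> e)))"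
proof -
  define \<epsilon> where "\<epsilon> = e / 2"
  \<comment> \<open>\<delta> / \<epsilon>^2 = e / 8 is the probability in
    \<open>transform_maximal\<close>. Half of \<open>\<delta>\<close> is reserved for the L2 error
    of the simple integrand, by \<open>e1\<close>, and half for the oscillation of \<open>K\<close>,
    by \<open>w\<close>.\<close>
  define \<delta> where "\<delta> = \<epsilon>\<^sup>2 * (e / 8)"
  define e1 where "e1 = min (e / 8) (min \<epsilon> (\<delta> / 4))"
  define w where "w = sqrt (\<delta> / (4 * T))"
  have pos: "0 < \<epsilon>" "0 < \<delta>" "0 < e1" "0 < w" using e T unfolding \<epsilon>_def \<delta>_def e1_def w_def by auto
  have w2: "2 * (w\<^sup>2 * T) = \<delta> / 2" using pos T unfolding w_def by (simp add: field_simps)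
  obtain h A1 where h0: "is_simple_integrand M F h" and A1: "A1 \<in> events" "prob (space M - A1) < e / 8"
    "\<And>\<omega> t. \<omega> \<in> A1 \<Longrightarrow> t \<in> {0..T} \<Longrightarrow> \<bar>simple_integral B h t \<omega> - I t \<omega>\<bar> \<le> e1"
    "\<And>\<omega>. \<omega> \<in> A1 \<Longrightarrow> (\<integral>\<^sup>+t\<in>{0..T}. ennreal ((simple_process h t \<omega> - H t \<omega>)\<^sup>2) \<partial>lborel) \<le> ennreal e1"
    by (rule ito_approx[OF prob_space_axioms I less_imp_le[OF T] pos(3), of "e / 8"])
      (assumption | rule that | use e in simp)+
  obtain k \<tau> \<xi> where hk: "h = (k, \<tau>, \<xi>)" by (cases h)
  note h = h0[unfolded hk]
  have Kc: "continuous_on {0..T} (\<lambda>t. K t \<omega>)" if "\<omega> \<in> space M" for \<omega>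
    using K(2) that unfolding continuous_paths_def by (auto intro: continuous_on_subset[of "{0..}"])
  have Km: "K t \<in> borel_measurable M" if "t \<in> {0..T}" for t using adapted_M[OF K(1)] that by auto
  have e8: "0 < e / 8" using e by simp
  obtain \<eta> G where G: "0 < \<eta>" "G \<in> events" "prob (space M - G) < e / 8"
    "\<And>\<omega> s t. \<omega> \<in> G \<Longrightarrow> s \<in> {0..T} \<Longrightarrow> t \<in> {0..T} \<Longrightarrow> \<bar>s - t\<bar> < \<eta> \<Longrightarrow> \<bar>K s \<omega> - K t \<omega>\<bar> \<le> w"
    by (rule continuity_modulus[OF Km Kc less_imp_le[OF T] pos(4) e8]) (assumption | rule that)+
  obtain N where N: "N \<in> events" "prob N = 1" "\<And>\<omega>. \<omega> \<in> N \<Longrightarrow> AE t in lborel. 0 \<le> t \<longrightarrow> H t \<omega> = K t \<omega>"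
  proof -
    obtain N' where N': "{\<omega>\<in>space M. \<not> (AE t in lborel. 0 \<le> t \<longrightarrow> H t \<omega> = K t \<omega>)} \<subseteq> N'"
      "emeasure M N' = 0" "N' \<in> events"
      using AE_E[OF HK] by blast
    have "prob (space M - N') = 1" using N'(2,3) by (subst prob_compl) (auto simp: measure_def)
    then show ?thesis using that[of "space M - N'"] N' by auto
  qed
  have "\<exists>A\<in>events. prob (space M - A) < e \<and>
        (\<forall>\<omega>\<in>A. \<bar>transform (\<lambda>i. K (g i)) (\<lambda>i \<omega>. B (g (Suc i)) \<omega> - B (g i) \<omega>) n \<omega> - I T \<omega>\<bar> \<le> e)"
    if gr: "grid T n g" and mesh: "\<forall>i<n. g (Suc i) - g i \<le> \<eta> / 2"
      and av: "\<forall>x\<in>\<tau> ` {..k}. \<forall>i<n. x \<le> g i \<or> g (Suc i) \<le> x" for n g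
  proof -
    have gT: "g i \<in> {0..T}" if "i \<le> n" for i using grid_bounds[OF gr that] by auto
    have gS: "g i < g (Suc i)" if "i < n" for i using gr that by (auto simp: grid_def)
    define d where "d i \<omega> = B (g (Suc i)) \<omega> - B (g i) \<omega>" for i \<omega>
    interpret G: indep_increments M n "\<lambda>i. F (g i)" d "\<lambda>i. g (Suc i) - g i"
      unfolding d_def[abs_def] by (rule indep_increments_id[OF gr])
    \<comment> \<open>The simple integrand stays fixed while the grid is refined. Its integral
      differs from the Riemann sum by the transform with these coefficients, both parts of which are
      known at the left end of the cell.\<close>
    define c where "c i \<omega> = simple_process h (g (Suc i)) \<omega> - K (g i) \<omega>" for i \<omega>
    have cm: "c i \<in> borel_measurable (F (g i))" if "i < n" for i
    proof -
      have "simple_process (k, \<tau>, \<xi>) (g (Suc i)) \<in> borel_measurable (F (g i))"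
        by (rule simple_process_measurable[OF filt h]) (use av that in auto)
      then show ?thesis unfolding c_def[abs_def] hk using adapted_F[OF K(1), of "g i"] gT[of i] that
        by (intro borel_measurable_diff) auto
    qed
    define A' where "A' = A1 \<inter> G \<inter> N"
    have A': "A' \<in> events" unfolding A'_def using A1 G N by auto
    \<comment> \<open>The bracket is a squared L2 distance of two step functions. It is estimated by
      passing through \<open>H\<close>, which equals \<open>K\<close> at almost every time of the
      cell.\<close>
    have br: "(\<Sum>i<n. (c i \<omega>)\<^sup>2 * (g (Suc i) - g i)) \<le> \<delta>" if om: "\<omega> \<in> A'" for \<omega>
    proof -
      have oM: "\<omega> \<in> space M" using om A' sets.sets_into_space by auto
      have sb: "(\<lambda>t. simple_process h t \<omega>) \<in> borel_measurable borel" by (rule simple_process_borel)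
      have Hb: "(\<lambda>t. indicator {0..T} t *\<^sub>R H t \<omega>) \<in> borel_measurable borel"
        using I oM by (intro measurable_adapted_section_indicator) (auto simp: has_ito_integral_def)
      define q where "q t = ennreal ((simple_process h t \<omega> - indicator {0..T} t *\<^sub>R H t \<omega>)\<^sup>2)" for t
      have qm [measurable]: "q \<in> borel_measurable borel" unfolding q_def[abs_def] using sb Hb by measurable
      have "ennreal (\<Sum>i<n. (c i \<omega>)\<^sup>2 * (g (Suc i) - g i)) = (\<Sum>i<n. ennreal ((c i \<omega>)\<^sup>2 * (g (Suc i) - g i)))"
        by (intro sum_ennreal[symmetric] mult_nonneg_nonneg) (auto simp: gS less_imp_le)
      also have "\<dots> = (\<Sum>i<n. \<integral>\<^sup>+t\<in>{g i<..g (Suc i)}. ennreal ((c i \<omega>)\<^sup>2) \<partial>lborel)"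
        using gS by (intro sum.cong) (auto simp: nn_integral_cmult_indicator ennreal_mult less_imp_le)
      also have "\<dots> \<le> (\<Sum>i<n. \<integral>\<^sup>+t\<in>{g i<..g (Suc i)}. (2 * q t + ennreal (2 * w\<^sup>2)) \<partial>lborel)"
      proof (intro sum_mono nn_integral_mono_AE)
        fix i assume i: "i \<in> {..<n}"
        show "AE t in lborel. ennreal ((c i \<omega>)\<^sup>2) * indicator {g i<..g (Suc i)} t \<le>
          (2 * q t + ennreal (2 * w\<^sup>2)) * indicator {g i<..g (Suc i)} t"
          using N(3)[of \<omega>]
        proof (rule eventually_mono)
          show "\<omega> \<in> N" using om by (simp add: A'_def)
          fix t assume HKt: "0 \<le> t \<longrightarrow> H t \<omega> = K t \<omega>"
          show "ennreal ((c i \<omega>)\<^sup>2) * indicator {g i<..g (Suc i)} t \<le>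
            (2 * q t + ennreal (2 * w\<^sup>2)) * indicator {g i<..g (Suc i)} t"
          proof (cases "t \<in> {g i<..g (Suc i)}")
            case True
            have tT: "t \<in> {0..T}" using True gT[of i] gT[of "Suc i"] i by auto
            have "simple_process h t \<omega> = simple_process h (g (Suc i)) \<omega>"
              unfolding hk by (rule simple_process_grid[of k \<tau> "g i"]) (use av i True in auto)
            then have ci: "c i \<omega> = (simple_process h t \<omega> - H t \<omega>) + (K t \<omega> - K (g i) \<omega>)"
              using HKt tT by (simp add: c_def)
            have "\<bar>t - g i\<bar> < \<eta>" using True mesh i G(1) by auto
            then have "\<bar>K t \<omega> - K (g i) \<omega>\<bar> \<le> w" using G(4)[of \<omega> t "g i"] om tT gT[of i] i
              by (auto simp: A'_def)
            then have kw: "(K t \<omega> - K (g i) \<omega>)\<^sup>2 \<le> w\<^sup>2" using pos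
              by (simp add: abs_le_square_iff[symmetric])
            have "(c i \<omega>)\<^sup>2 \<le> 2 * (simple_process h t \<omega> - H t \<omega>)\<^sup>2 + 2 * w\<^sup>2"
              unfolding ci using square_sum_le[of "simple_process h t \<omega> - H t \<omega>"
                "K t \<omega> - K (g i) \<omega>"] kw by linarith
            then have "ennreal ((c i \<omega>)\<^sup>2) \<le>
              ennreal (2 * (simple_process h t \<omega> - H t \<omega>)\<^sup>2 + 2 * w\<^sup>2)" by (rule ennreal_leI)
            also have "\<dots> = 2 * q t + ennreal (2 * w\<^sup>2)"
              using tT by (simp add: q_def ennreal_plus ennreal_mult)
            finally show ?thesis by (rule mult_right_mono) simp
          qed simp
        qed
      qed
      also have "\<dots> = (\<integral>\<^sup>+t\<in>{0..g n}. (2 * q t + ennreal (2 * w\<^sup>2)) \<partial>lborel)"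
        by (rule nn_integral_grid[OF gr _ order_refl, symmetric]) measurable
      also have "\<dots> = (\<integral>\<^sup>+t. 2 * (q t * indicator {0..T} t) + ennreal (2 * w\<^sup>2) * indicator {0..T} t
        \<partial>lborel)"
        using gr by (intro nn_integral_cong) (auto simp: grid_def indicator_def)
      also have "\<dots> = 2 * (\<integral>\<^sup>+t\<in>{0..T}. q t \<partial>lborel) + ennreal (2 * w\<^sup>2) * ennreal T"
        using T by (subst nn_integral_add) (auto simp: nn_integral_cmult nn_integral_cmult_indicator)
      also have "(\<integral>\<^sup>+t\<in>{0..T}. q t \<partial>lborel) =
        (\<integral>\<^sup>+t\<in>{0..T}. ennreal ((simple_process h t \<omega> - H t \<omega>)\<^sup>2) \<partial>lborel)"
        by (intro nn_integral_cong) (auto simp: q_def indicator_def)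
      also have "2 * \<dots> + ennreal (2 * w\<^sup>2) * ennreal T \<le> 2 * ennreal e1 + ennreal (2 * w\<^sup>2) * ennreal T"
        using A1(4)[of \<omega>] om by (intro add_right_mono mult_left_mono) (auto simp: A'_def)
      also have "\<dots> = ennreal (2 * e1 + 2 * (w\<^sup>2 * T))"
        using pos T by (simp add: ennreal_plus ennreal_mult mult.assoc)
      also have "\<dots> \<le> ennreal \<delta>" unfolding w2 using pos by (intro ennreal_leI) (simp add: e1_def)
      finally show ?thesis using pos by simp
    qed
    define Bad where "Bad = {\<omega>\<in>A'. \<exists>j\<le>n. \<epsilon> < \<bar>transform c d j \<omega>\<bar>}"
    have Jm: "transform c d j \<in> borel_measurable M" if "j \<le> n" for j
      by (rule G.measurable_G[OF G.measurable_transform[of j c]]) (use cm that in auto)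
    have Bad: "Bad \<in> events"
    proof -
      have "Bad = A' \<inter> (\<Union>j\<in>{..n}. {\<omega>\<in>space M. \<epsilon> < \<bar>transform c d j \<omega>\<bar>})"
        using sets.sets_into_space[OF A'] by (auto simp: Bad_def)
      moreover have "{\<omega>\<in>space M. \<epsilon> < \<bar>transform c d j \<omega>\<bar>} \<in> events" if "j \<le> n" for j
        using Jm[OF that] by measurable
      ultimately show ?thesis using A' by auto
    qed
    have "prob Bad \<le> prob {\<omega>\<in>A'. \<delta> < (\<Sum>i<n. (c i \<omega>)\<^sup>2 * (g (Suc i) - g i))} + \<delta> / \<epsilon>\<^sup>2"
      unfolding Bad_def by (rule G.transform_maximal[OF cm _ pos(1) less_imp_le[OF pos(2)] A'])
        (use gS in auto)
    also have "{\<omega>\<in>A'. \<delta> < (\<Sum>i<n. (c i \<omega>)\<^sup>2 * (g (Suc i) - g i))} = {}"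
      using br by (auto simp: not_less)
    finally have pBad: "prob Bad \<le> e / 8" using pos by (simp add: \<delta>_def)
    have "prob (space M - (A' - Bad)) \<le> prob ((space M - A1) \<union> ((space M - G) \<union> ((space M - N) \<union> Bad)))"
      using A1 G N Bad by (intro finite_measure_mono) (auto simp: A'_def)
    also have "\<dots> \<le> prob (space M - A1) + prob ((space M - G) \<union> ((space M - N) \<union> Bad))"
      using A1 G N Bad by (intro measure_Un_le) auto
    also have "prob ((space M - G) \<union> ((space M - N) \<union> Bad)) \<le> prob (space M - G)
      + prob ((space M - N) \<union> Bad)"
      using A1 G N Bad by (intro measure_Un_le) auto
    also have "prob ((space M - N) \<union> Bad) \<le> prob (space M - N) + prob Bad"
      using N Bad by (intro measure_Un_le) auto
    finally have small: "prob (space M - (A' - Bad)) < e"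
      using A1(2) G(3) pBad prob_compl[OF N(1)] N(2) e by simp
    have "\<bar>transform (\<lambda>i. K (g i)) d n \<omega> - I T \<omega>\<bar> \<le> e" if om: "\<omega> \<in> A' - Bad" for \<omega>
    proof -
      have gn: "g n = T" using gr by (simp add: grid_def)
      have "simple_integral B h T \<omega> = transform (\<lambda>i. simple_process h (g (Suc i))) d n \<omega>"
        using simple_integral_grid[OF gr h _ order_refl, of B \<omega>] av unfolding hk d_def gn by auto
      then have "transform (\<lambda>i. K (g i)) d n \<omega> = simple_integral B h T \<omega> - transform c d n \<omega>"
        by (simp add: transform_def c_def left_diff_distrib sum_subtractf)
      moreover have "\<bar>transform c d n \<omega>\<bar> \<le> \<epsilon>" using om by (auto simp: Bad_def not_less)
      moreover have "\<bar>simple_integral B h T \<omega> - I T \<omega>\<bar> \<le> e1" using A1(3)[of \<omega> T] om T by (auto simp: A'_def)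
      moreover have "e1 \<le> \<epsilon>" "\<epsilon> + \<epsilon> = e" by (auto simp: e1_def \<epsilon>_def)
      ultimately show ?thesis by linarith
    qed
    then show ?thesis using small A' Bad unfolding d_def by (intro bexI[of _ "A' - Bad"]) auto
  qed
  then show ?thesis using G(1) by (intro exI[of _ "\<tau> ` {..k}"] exI[of _ "\<eta> / 2"]) simp
qed

end

lemma riemann_sum_error:
  fixes f :: "real \<Rightarrow> real"
  assumes gr: "grid T n g" and f: "continuous_on {0..T} f"
    and w: "\<And>i t. i < n \<Longrightarrow> t \<in> {g i..g (Suc i)} \<Longrightarrow> \<bar>f t - f (g i)\<bar> \<le> w"
  shows "j \<le> n \<Longrightarrow> \<bar>(\<Sum>i<j. f (g i) * (g (Suc i) - g i)) - (LBINT u:{0..g j}. f u)\<bar> \<le> w * g j"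
proof (induction j)
  case 0
  have "(LBINT u:{0..0::real}. f u) = 0"
    using AE_lborel_singleton[of "0::real"]
      by (auto simp: set_lebesgue_integral_def intro!: integral_eq_zero_AE elim!: eventually_mono)
  then show ?case using gr by (simp add: grid_def)
next
  case (Suc j)
  then have j: "j < n" by simp
  have b: "0 \<le> g j" "g j < g (Suc j)" "g (Suc j) \<le> T"
    using grid_bounds(1)[OF gr, of j] grid_bounds(2)[OF gr, of "Suc j"] gr j by (auto simp: grid_def)
  let ?I = "{g j<..g (Suc j)}" and ?d = "g (Suc j) - g j"
  have fi: "set_integrable lborel {0..T} f" using f by (rule borel_integrable_atLeastAtMost')
  have ci: "set_integrable lborel {0..T} (\<lambda>u. c)" for c :: real
    by (rule borel_integrable_atLeastAtMost') auto
  have sub: "?I \<subseteq> {0..T}" using b by auto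
  have const: "(LBINT u:?I. c) = c * ?d" for c :: real
    using set_integral_split[OF ci[of c], of "g j" "g (Suc j)"] b
      by (simp add: set_lebesgue_integral_def algebra_simps)
  have "\<bar>(LBINT u:?I. f (g j)) - (LBINT u:?I. f u)\<bar> = \<bar>LBINT u:?I. f (g j) - f u\<bar>"
    using set_integral_diff(2)[OF set_integrable_subset[OF ci _ sub]
      set_integrable_subset[OF fi _ sub]] by simp
  also have "\<dots> \<le> (LBINT u:?I. w)"
  proof -
    have i: "set_integrable lborel ?I (\<lambda>u. f (g j) - f u)" "set_integrable lborel ?I (\<lambda>u. w)"
      by (auto intro!: set_integral_diff(1) set_integrable_subset[OF ci _ sub]
        set_integrable_subset[OF fi _ sub])
    have "\<bar>LBINT u:?I. f (g j) - f u\<bar> \<le> (\<integral>u. \<bar>indicator ?I u *\<^sub>R (f (g j) - f u)\<bar> \<partial>lborel)"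
      unfolding set_lebesgue_integral_def by (rule integral_abs_bound)
    also have "\<dots> \<le> (\<integral>u. indicator ?I u *\<^sub>R w \<partial>lborel)"
      using i w[OF j] unfolding set_integrable_def
      by (intro integral_mono integrable_abs) (auto simp: indicator_def abs_minus_commute)
    finally show ?thesis by (simp add: set_lebesgue_integral_def)
  qed
  finally have "\<bar>f (g j) * ?d - (LBINT u:?I. f u)\<bar> \<le> w * ?d" unfolding const .
  moreover have "(LBINT u:{0..g (Suc j)}. f u) = (LBINT u:{0..g j}. f u) + (LBINT u:?I. f u)"
    using set_integral_split[OF fi, of "g j" "g (Suc j)"] b by auto
  moreover have "w * g (Suc j) = w * g j + w * ?d" by (simp add: algebra_simps)
  ultimately show ?case using Suc by simp
qed

context brownian
begin

text \<open>A solution nearly satisfies its own Euler scheme: \<open>ito_riemann\<close> treats the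
  noise and \<open>riemann_sum_error\<close> the drift. In this form the stochastic integral is
  eliminated, so two solutions can be subtracted on a common grid.\<close>

lemma linear_sde_riemann:
  assumes I: "has_ito_integral M F B H I" and Z: "adapted F Z" "continuous_paths M Z"
    and H: "AE \<omega> in M. AE t in lborel. 0 \<le> t \<longrightarrow> H t \<omega> = \<nu> * Z t \<omega>"
    and eq: "AE \<omega> in M. \<forall>T\<ge>0. Z T \<omega> = z + m * (LBINT t:{0..T}. Z t \<omega>) + I T \<omega>"
    and T: "0 < T" and e: "0 < (e::real)"
  shows "\<exists>S \<eta>. finite S \<and> 0 < \<eta> \<and> (\<forall>n g. grid T n g \<longrightarrow> (\<forall>i<n. g (Suc i) - g i \<le> \<eta>) \<longrightarrow>
      (\<forall>x\<in>S. \<forall>i<n. x \<le> g i \<or> g (Suc i) \<le> x) \<longrightarrow>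
      (\<exists>A\<in>events. prob (space M - A) < e \<and>
        (\<forall>\<omega>\<in>A. \<bar>transform (\<lambda>i. Z (g i)) (\<lambda>i \<omega>. m * (g (Suc i) - g i) + \<nu> *
          (B (g (Suc i)) \<omega> - B (g i) \<omega>)) n \<omega> + z - Z T \<omega>\<bar> \<le> e)))"
proof -
  have nZ: "adapted F (\<lambda>t \<omega>. \<nu> * Z t \<omega>)" "continuous_paths M (\<lambda>t \<omega>. \<nu> * Z t \<omega>)"
    using Z unfolding adapted_def continuous_paths_def by (auto intro!: continuous_intros)
  have e2: "0 < e / 2" using e by simp
  obtain S \<eta>1 where S: "finite S" "0 < \<eta>1"
    "\<And>n g. grid T n g \<Longrightarrow> (\<forall>i<n. g (Suc i) - g i \<le> \<eta>1) \<Longrightarrow> (\<forall>x\<in>S. \<forall>i<n. x \<le> g i \<or> g (Suc i) \<le> x) \<Longrightarrow>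
      \<exists>A\<in>events. prob (space M - A) < e / 2 \<and>
        (\<forall>\<omega>\<in>A. \<bar>transform (\<lambda>i \<omega>. \<nu> * Z (g i) \<omega>) (\<lambda>i \<omega>. B (g (Suc i)) \<omega> - B (g i) \<omega>) n \<omega> - I T \<omega>\<bar> \<le> e / 2)"
    using ito_riemann[OF I nZ H T e2] by (elim exE conjE) auto
  define w where "w = e / 2 / (\<bar>m\<bar> * T + 1)"
  have w: "0 < w" "\<bar>m\<bar> * (w * T) \<le> e / 2"
    unfolding w_def using divide_add_one_bounds[of "\<bar>m\<bar> * T" "e / 2"] e2 T
      by (auto simp: mult.commute mult.left_commute)
  have Zc: "continuous_on {0..T} (\<lambda>t. Z t \<omega>)" if "\<omega> \<in> space M" for \<omega>
    using Z(2) that unfolding continuous_paths_def by (auto intro: continuous_on_subset[of "{0..}"])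
  have Zm: "Z t \<in> borel_measurable M" if "t \<in> {0..T}" for t using adapted_M[OF Z(1)] that by auto
  obtain \<eta>2 G where G: "0 < \<eta>2" "G \<in> events" "prob (space M - G) < e / 2"
    "\<And>\<omega> s t. \<omega> \<in> G \<Longrightarrow> s \<in> {0..T} \<Longrightarrow> t \<in> {0..T} \<Longrightarrow> \<bar>s - t\<bar> < \<eta>2 \<Longrightarrow> \<bar>Z s \<omega> - Z t \<omega>\<bar> \<le> w"
    by (rule continuity_modulus[OF Zm Zc less_imp_le[OF T] w(1) e2]) (assumption | rule that)+
  obtain N where N: "N \<in> events" "prob N = 1" "\<And>\<omega>. \<omega> \<in> N \<Longrightarrow> Z T \<omega> = z + m * (LBINT t:{0..T}. Z t \<omega>) + I T \<omega>"
  proof -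
    obtain N' where N': "{\<omega>\<in>space M. \<not> (\<forall>T\<ge>0. Z T \<omega> = z + m * (LBINT t:{0..T}. Z t \<omega>) + I T \<omega>)} \<subseteq>
      N'" "emeasure M N' = 0" "N' \<in> events"
      using AE_E[OF eq] by blast
    have "prob (space M - N') = 1" using N'(2,3) by (subst prob_compl) (auto simp: measure_def)
    moreover have "Z T \<omega> = z + m * (LBINT t:{0..T}. Z t \<omega>) + I T \<omega>" if "\<omega> \<in> space M - N'" for \<omega>
    proof -
      have "\<forall>T\<ge>0. Z T \<omega> = z + m * (LBINT t:{0..T}. Z t \<omega>) + I T \<omega>" using N'(1) that by blast
      then show ?thesis using T by simp
    qed
    ultimately show ?thesis using that[of "space M - N'"] N'(3) by blast
  qed
  show ?thesis
  proof (intro exI[of _ S] exI[of _ "min \<eta>1 (\<eta>2 / 2)"] conjI allI impI)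
    show "finite S" "0 < min \<eta>1 (\<eta>2 / 2)" using S G by auto
    fix n g assume gr: "grid T n g" and mesh: "\<forall>i<n. g (Suc i) - g i \<le> min \<eta>1 (\<eta>2 / 2)"
      and av: "\<forall>x\<in>S. \<forall>i<n. x \<le> g i \<or> g (Suc i) \<le> x"
    obtain A where A: "A \<in> events" "prob (space M - A) < e / 2"
      "\<And>\<omega>. \<omega> \<in> A \<Longrightarrow> \<bar>transform (\<lambda>i \<omega>. \<nu> * Z (g i) \<omega>) (\<lambda>i \<omega>. B (g (Suc i)) \<omega> - B (g i) \<omega>) n \<omega>
        - I T \<omega>\<bar> \<le> e / 2"
      using S(3)[OF gr _ av] mesh by auto
    have gT: "g i \<in> {0..T}" if "i \<le> n" for i using grid_bounds[OF gr that] by auto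
    have gn: "g n = T" using gr by (simp add: grid_def)
    let ?A = "A \<inter> G \<inter> N"
    have "prob (space M - ?A) \<le> prob ((space M - A) \<union> ((space M - G) \<union> (space M - N)))"
      using A G N by (intro finite_measure_mono) auto
    also have "\<dots> \<le> prob (space M - A) + prob ((space M - G) \<union> (space M - N))"
      using A G N by (intro measure_Un_le) auto
    also have "prob ((space M - G) \<union> (space M - N)) \<le> prob (space M - G) + prob (space M - N)"
      using G N by (intro measure_Un_le) auto
    finally have small: "prob (space M - ?A) < e" using A G N prob_compl[OF N(1)] by simp
    have "\<bar>transform (\<lambda>i. Z (g i)) (\<lambda>i \<omega>. m * (g (Suc i) - g i) + \<nu> * (B (g (Suc i)) \<omega> - B (g i) \<omega>))
      n \<omega> + z - Z T \<omega>\<bar> \<le> e"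
      if om: "\<omega> \<in> ?A" for \<omega>
    proof -
      have oM: "\<omega> \<in> space M" using om A(1) sets.sets_into_space by auto
      have "\<bar>(\<Sum>i<n. Z (g i) \<omega> * (g (Suc i) - g i)) - (LBINT u:{0..g n}. Z u \<omega>)\<bar> \<le> w * g n"
      proof (rule riemann_sum_error[OF gr Zc[OF oM] _ order_refl])
        fix i t assume i: "i < n" and t: "t \<in> {g i..g (Suc i)}"
        have "t \<in> {0..T}" using t gT[of i] gT[of "Suc i"] i by auto
        moreover have "\<bar>t - g i\<bar> < \<eta>2" using t mesh i G(1) by auto
        ultimately show "\<bar>Z t \<omega> - Z (g i) \<omega>\<bar> \<le> w" using G(4)[of \<omega> t "g i"] om gT[of i] i by auto
      qed
      then have "\<bar>m\<bar> * \<bar>(\<Sum>i<n. Z (g i) \<omega> * (g (Suc i) - g i)) - (LBINT u:{0..T}. Z u \<omega>)\<bar> \<le> \<bar>m\<bar> * (w * T)"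
        unfolding gn by (intro mult_left_mono) auto
      then have "\<bar>m * (\<Sum>i<n. Z (g i) \<omega> * (g (Suc i) - g i)) - m * (LBINT u:{0..T}. Z u \<omega>)\<bar> \<le> e / 2"
        using w(2) by (simp add: abs_mult[symmetric] right_diff_distrib)
      moreover have "transform (\<lambda>i. Z (g i)) (\<lambda>i \<omega>. m * (g (Suc i) - g i)
        + \<nu> * (B (g (Suc i)) \<omega> - B (g i) \<omega>)) n \<omega> =
        m * (\<Sum>i<n. Z (g i) \<omega> * (g (Suc i) - g i)) + transform (\<lambda>i \<omega>. \<nu> * Z (g i) \<omega>)
          (\<lambda>i \<omega>. B (g (Suc i)) \<omega> - B (g i) \<omega>) n \<omega>"
        unfolding transform_def sum_distrib_left sum.distrib[symmetric] by (intro sum.cong)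
          (auto simp: algebra_simps)
      moreover have "Z T \<omega> = z + m * (LBINT t:{0..T}. Z t \<omega>) + I T \<omega>" using N(3) om by auto
      ultimately show ?thesis using A(3)[of \<omega>] om by (simp add: abs_if split: if_splits)
    qed
    then show "\<exists>A\<in>events. prob (space M - A) < e \<and>
        (\<forall>\<omega>\<in>A. \<bar>transform (\<lambda>i. Z (g i)) (\<lambda>i \<omega>. m * (g (Suc i) - g i) + \<nu> *
          (B (g (Suc i)) \<omega> - B (g i) \<omega>)) n \<omega> + z - Z T \<omega>\<bar> \<le> e)"
      using small A G N by (intro bexI[of _ ?A]) auto
  qed
qed

text \<open>By continuity the bound on [0, t] can be tested at rational multiples of t, so the event
  is known at t. Multiplication by its indicator takes the place of stopping at an exit
  time.\<close>

lemma sup_event_measurable: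
  assumes D: "adapted F D" "continuous_paths M D" and t: "0 \<le> t"
  shows "{\<omega>\<in>space M. \<forall>r\<in>{0..t}. \<bar>D r \<omega>\<bar> \<le> c} \<in> sets (F t)"
proof -
  let ?R = "\<rat> \<inter> {0..1::real}"
  have cR: "countable ?R" using countable_rat by (rule countable_subset[rotated]) auto
  have RT: "q * t \<in> {0..t}" if "q \<in> ?R" for q using that t by (auto intro: mult_left_le_one_le)
  have sp: "space (F t) = space M" using filtration.space_F[OF filt] .
  have "{\<omega>\<in>space (F t). \<bar>D (q * t) \<omega>\<bar> \<le> c} \<in> sets (F t)" if "q \<in> ?R" for q
  proof -
    have [measurable]: "D (q * t) \<in> borel_measurable (F t)"
      using measurable_F_mono[OF adapted_F[OF D(1)], of "q * t" t] RT[OF that] by auto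
    show ?thesis by measurable
  qed
  then have "{\<omega>\<in>space (F t). \<forall>q\<in>?R. \<bar>D (q * t) \<omega>\<bar> \<le> c} \<in> sets (F t)"
    by (rule sets.sets_Collect_countable_All'[OF _ cR])
  moreover have "{\<omega>\<in>space (F t). \<forall>q\<in>?R. \<bar>D (q * t) \<omega>\<bar> \<le> c} = {\<omega>\<in>space M. \<forall>r\<in>{0..t}. \<bar>D r \<omega>\<bar> \<le> c}"
  proof (intro Collect_cong conj_cong, simp add: sp, rule iffI)
    fix \<omega> assume om: "\<omega> \<in> space M" and a: "\<forall>q\<in>?R. \<bar>D (q * t) \<omega>\<bar> \<le> c"
    have c: "continuous_on {0..t} (\<lambda>t. D t \<omega>)"
      using D(2) om unfolding continuous_paths_def by (auto intro: continuous_on_subset[of "{0..}"])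
    show "\<forall>r\<in>{0..t}. \<bar>D r \<omega>\<bar> \<le> c"
    proof (rule ballI, rule field_le_epsilon)
      fix r u :: real assume r: "r \<in> {0..t}" and u: "0 < u"
      obtain d where d: "0 < d" "\<And>s. s \<in> {0..t} \<Longrightarrow> \<bar>s - r\<bar> < d \<Longrightarrow> \<bar>D s \<omega> - D r \<omega>\<bar> < u"
        using c r u unfolding continuous_on_iff dist_real_def by blast
      obtain q where q: "q \<in> ?R" "\<bar>q * t - r\<bar> < d" using rational_dense[OF r d(1)] by auto
      have "\<bar>D (q * t) \<omega> - D r \<omega>\<bar> < u" using d(2)[OF RT[OF q(1)] q(2)] .
      then show "\<bar>D r \<omega>\<bar> \<le> c + u" using a q(1)
        by (auto simp: abs_if split: if_splits dest!: bspec[of _ _ q])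
    qed
  next
    fix \<omega> assume "\<forall>r\<in>{0..t}. \<bar>D r \<omega>\<bar> \<le> c"
    then show "\<forall>q\<in>?R. \<bar>D (q * t) \<omega>\<bar> \<le> c" using RT by blast
  qed
  ultimately show ?thesis by simp
qed

end

section \<open>Gronwall estimate for the second moment of a truncated process\<close>

lemma square_le_diff: "x\<^sup>2 \<le> 2 * y\<^sup>2 + 2 * (x - y :: real)\<^sup>2"
  using square_sum_le[of y "x - y"] by simp

lemma weighted_cauchy_schwarz:
  fixes x d :: "nat \<Rightarrow> real"
  assumes "\<And>i. i < n \<Longrightarrow> 0 \<le> d i"
  shows "(\<Sum>i<n. x i * d i)\<^sup>2 \<le> (\<Sum>i<n. d i) * (\<Sum>i<n. (x i)\<^sup>2 * d i)"
proof -
  have "(\<Sum>i<n. (x i * sqrt (d i)) * sqrt (d i))\<^sup>2 \<le> (\<Sum>i<n. (x i * sqrt (d i))\<^sup>2) * (\<Sum>i<n. (sqrt (d i))\<^sup>2)"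
    by (rule Cauchy_Schwarz_ineq_sum)
  moreover have "(\<Sum>i<n. (x i * sqrt (d i)) * sqrt (d i)) = (\<Sum>i<n. x i * d i)"
    "(\<Sum>i<n. (x i * sqrt (d i))\<^sup>2) = (\<Sum>i<n. (x i)\<^sup>2 * d i)" "(\<Sum>i<n. (sqrt (d i))\<^sup>2) = (\<Sum>i<n. d i)"
    using assms by (auto intro!: sum.cong simp: power_mult_distrib mult.assoc)
  ultimately show ?thesis by (simp add: mult.commute)
qed

lemma exp_riemann_le:
  assumes gr: "grid T n g" and L: "0 < L"
  shows "(\<Sum>i<n. (g (Suc i) - g i) * exp (L * g i)) \<le> exp (L * T) / L"
proof -
  have "(\<Sum>i<n. (g (Suc i) - g i) * exp (L * g i)) \<le> (\<Sum>i<n. exp (L * g (Suc i)) / L - exp (L * g i) / L)"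
  proof (rule sum_mono)
    fix i assume "i \<in> {..<n}"
    have "exp (L * g i) * (1 + L * (g (Suc i) - g i)) \<le> exp (L * g i) * exp (L * (g (Suc i) - g i))"
      by (intro mult_left_mono exp_ge_add_one_self) auto
    also have "\<dots> = exp (L * g (Suc i))" by (simp add: exp_add[symmetric] algebra_simps)
    finally show "(g (Suc i) - g i) * exp (L * g i) \<le> exp (L * g (Suc i)) / L - exp (L * g i) / L"
      using L by (simp add: field_simps)
  qed
  also have "\<dots> = exp (L * g n) / L - exp (L * g 0) / L" by (rule sum_lessThan_telescope)
  also have "\<dots> \<le> exp (L * T) / L" using gr L by (simp add: grid_def)
  finally show ?thesis .
qed

context brownian
begin

text \<open>Of the linear equation only the Euler form is kept, which differences of solutions
  inherit. The second moment \<open>f\<close> is taken on the event that the path has stayed within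
  \<open>c\<close>; this makes it finite, and these events decrease in time.\<close>

context
  fixes \<Delta> :: "'a process" and m \<nu> c T :: real and f :: "real \<Rightarrow> real"
  assumes D: "adapted F \<Delta>" "continuous_paths M \<Delta>" and T: "0 < T" and c: "0 \<le> c"
    and approx: "\<And>t e. 0 < t \<Longrightarrow> 0 < e \<Longrightarrow> \<exists>n g. grid t n g \<and> (\<exists>A\<in>events. prob (space M - A) < e \<and>
      (\<forall>\<omega>\<in>A. \<bar>transform (\<lambda>i. \<Delta> (g i)) (\<lambda>i \<omega>. m * (g (Suc i) - g i) + \<nu> *
        (B (g (Suc i)) \<omega> - B (g i) \<omega>)) n \<omega> - \<Delta> t \<omega>\<bar> \<le> e))"
    and D0: "AE \<omega> in M. \<Delta> 0 \<omega> = 0"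
  defines "f \<equiv> \<lambda>t. expectation (\<lambda>\<omega>. indicator {\<omega>\<in>space M. \<forall>r\<in>{0..t}. \<bar>\<Delta> r \<omega>\<bar> \<le> c} \<omega> * (\<Delta> t \<omega>)\<^sup>2)"
begin

abbreviation small_event :: "real \<Rightarrow> 'a set" where
  "small_event t \<equiv> {\<omega>\<in>space M. \<forall>r\<in>{0..t}. \<bar>\<Delta> r \<omega>\<bar> \<le> c}"

lemma small_event_bound: "0 \<le> t \<Longrightarrow> indicator (small_event t) \<omega> * (\<Delta> t \<omega>)\<^sup>2 \<le> c\<^sup>2"
  using c by (auto simp: indicator_def abs_le_square_iff[symmetric])

lemma small_event_sets: "0 \<le> t \<Longrightarrow> small_event t \<in> sets (F t)" "0 \<le> t \<Longrightarrow> small_event t \<in> events"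
  using sup_event_measurable[OF D] sub unfolding subalgebra_def by blast+

lemma stopped_integrable: "0 \<le> t \<Longrightarrow> integrable M (\<lambda>\<omega>. indicator (small_event t) \<omega> * (\<Delta> t \<omega>)\<^sup>2)"
proof (rule integrable_const_bound[of _ "c\<^sup>2"])
  assume t: "0 \<le> t"
  have [measurable]: "\<Delta> t \<in> borel_measurable M" "small_event t \<in> events"
    using adapted_M[OF D(1) t] small_event_sets(2)[OF t] by auto
  show "(\<lambda>\<omega>. indicator (small_event t) \<omega> * (\<Delta> t \<omega>)\<^sup>2) \<in> borel_measurable M" by measurable
  show "AE x in M. norm (indicator (small_event t) x * (\<Delta> t x)\<^sup>2) \<le> c\<^sup>2"
    using small_event_bound[OF t] by simp
qed

lemma stopped_moment_bounds: "0 \<le> t \<Longrightarrow> 0 \<le> f t" "0 \<le> t \<Longrightarrow> f t \<le> c\<^sup>2"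
proof -
  assume t: "0 \<le> t"
  show "0 \<le> f t" unfolding f_def by (intro integral_nonneg_AE) simp
  have "f t \<le> expectation (\<lambda>\<omega>. c\<^sup>2)"
    unfolding f_def using stopped_integrable[OF t] small_event_bound[OF t] by (intro integral_mono) auto
  then show "f t \<le> c\<^sup>2" by (simp add: prob_space)
qed

text \<open>On \<open>small_event t\<close> all earlier small events hold, so the Euler sum does not
  change there when its coefficients are multiplied by their indicators. The Cauchy-Schwarz
  inequality then bounds the drift sum and the isometry the noise sum; the factor 4 comes from
  splitting a square twice.\<close>

lemma stopped_moment_euler:
  assumes t: "0 < t" and e: "0 < (e::real)"
  shows "\<exists>n g. grid t n g \<and>
    f t \<le> 4 * (m\<^sup>2 * t + \<nu>\<^sup>2) * (\<Sum>i<n. (g (Suc i) - g i) * f (g i)) + (2 * e\<^sup>2 + c\<^sup>2 * e)"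
proof -
  obtain n g A where gr: "grid t n g" and A: "A \<in> events" "prob (space M - A) < e"
    "\<And>\<omega>. \<omega> \<in> A \<Longrightarrow> \<bar>transform (\<lambda>i. \<Delta> (g i)) (\<lambda>i \<omega>. m * (g (Suc i) - g i)
      + \<nu> * (B (g (Suc i)) \<omega> - B (g i) \<omega>)) n \<omega> - \<Delta> t \<omega>\<bar> \<le> e"
    using approx[OF t e] by auto
  let ?E = "\<lambda>i. small_event (g i)" and ?d = "\<lambda>i. g (Suc i) - g i"
  have gT: "0 \<le> g i" "g i \<le> t" if "i \<le> n" for i using grid_bounds[OF gr that] by auto
  have dpos: "0 \<le> ?d i" if "i < n" for i using gr that by (auto simp: grid_def less_imp_le)
  interpret G: indep_increments M n "\<lambda>i. F (g i)" "\<lambda>i \<omega>. B (g (Suc i)) \<omega> - B (g i) \<omega>" ?d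
    by (rule indep_increments_id[OF gr])
  define b where "b i \<omega> = indicator (?E i) \<omega> * \<Delta> (g i) \<omega>" for i \<omega>
  have b2: "(b i \<omega>)\<^sup>2 = indicator (?E i) \<omega> * (\<Delta> (g i) \<omega>)\<^sup>2" for i \<omega>
    by (auto simp: b_def indicator_def)
  have bm: "b i \<in> borel_measurable (F (g i))" if "i < n" for i
    unfolding b_def[abs_def] using adapted_F[OF D(1), of "g i"] small_event_sets(1)[of "g i"]
      gT(1)[of i] that
    by (intro borel_measurable_times borel_measurable_indicator) auto
  have bi: "integrable M (\<lambda>\<omega>. (b i \<omega>)\<^sup>2)" if "i < n" for i
    unfolding b2 using stopped_integrable[of "g i"] gT(1)[of i] that by auto
  have fb: "expectation (\<lambda>\<omega>. (b i \<omega>)\<^sup>2) = f (g i)" for i unfolding b2 f_def ..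
  define J where "J \<omega> = transform b (\<lambda>i \<omega>. B (g (Suc i)) \<omega> - B (g i) \<omega>) n \<omega>" for \<omega>
  have J: "integrable M (\<lambda>\<omega>. (J \<omega>)\<^sup>2)" "expectation (\<lambda>\<omega>. (J \<omega>)\<^sup>2) = (\<Sum>i<n. ?d i * f (g i))"
    using G.transform_moments[OF bm bi order_refl] unfolding J_def fb by auto
  define V where "V \<omega> = (\<Sum>i<n. (b i \<omega>)\<^sup>2 * ?d i)" for \<omega>
  have V: "integrable M V" "expectation V = (\<Sum>i<n. ?d i * f (g i))"
  proof -
    show "integrable M V" unfolding V_def[abs_def] using bi
      by (intro Bochner_Integration.integrable_sum) auto
    have "expectation V = (\<Sum>i<n. expectation (\<lambda>\<omega>. (b i \<omega>)\<^sup>2 * ?d i))"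
      unfolding V_def[abs_def] using bi by (intro Bochner_Integration.integral_sum) auto
    also have "\<dots> = (\<Sum>i<n. ?d i * f (g i))"
      by (intro sum.cong refl) (simp add: fb mult.commute)
    finally show "expectation V = (\<Sum>i<n. ?d i * f (g i))" .
  qed
  have ptw: "indicator (small_event t) \<omega> * (\<Delta> t \<omega>)\<^sup>2 \<le> 4 * (m\<^sup>2 * t) * V \<omega> + 4 * \<nu>\<^sup>2 * (J \<omega>)\<^sup>2
    + 2 * e\<^sup>2 + c\<^sup>2 * indicator (space M - A) \<omega>"
    if om: "\<omega> \<in> space M" for \<omega>
  proof -
    have V0: "0 \<le> V \<omega>" unfolding V_def using dpos by (intro sum_nonneg) auto
    then have pos: "0 \<le> 4 * (m\<^sup>2 * t) * V \<omega> + 4 * \<nu>\<^sup>2 * (J \<omega>)\<^sup>2 + 2 * e\<^sup>2" using t by simp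
    consider "\<omega> \<notin> A" | "\<omega> \<in> A" "\<omega> \<notin> small_event t" | "\<omega> \<in> A" "\<omega> \<in> small_event t" by blast
    then show ?thesis
    proof cases
      case 1
      then have "indicator (space M - A) \<omega> = (1::real)" using om by simp
      then show ?thesis using small_event_bound[of t \<omega>] t pos by simp
    next
      case 2
      have "0 \<le> c\<^sup>2 * (indicator (space M - A) \<omega> :: real)" by simp
      then show ?thesis using pos 2 by simp
    next
      case 3
      have "b i \<omega> = \<Delta> (g i) \<omega>" if "i < n" for i
        using 3(2) gT[of i] that unfolding b_def by (auto simp: indicator_def)
      then have "transform (\<lambda>i. \<Delta> (g i)) (\<lambda>i \<omega>. m * ?d i + \<nu> * (B (g (Suc i)) \<omega> - B (g i) \<omega>)) n \<omega> =
        m * (\<Sum>i<n. b i \<omega> * ?d i) + \<nu> * J \<omega>"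
        unfolding transform_def J_def sum_distrib_left sum.distrib[symmetric]
        by (intro sum.cong) (auto simp: algebra_simps)
      then have "\<bar>m * (\<Sum>i<n. b i \<omega> * ?d i) + \<nu> * J \<omega> - \<Delta> t \<omega>\<bar> \<le> e" using A(3)[OF 3(1)] by simp
      then have "(\<Delta> t \<omega> - (m * (\<Sum>i<n. b i \<omega> * ?d i) + \<nu> * J \<omega>))\<^sup>2 \<le> e\<^sup>2"
        using e by (simp add: abs_le_square_iff[symmetric] abs_minus_commute)
      moreover have "(\<Delta> t \<omega>)\<^sup>2 \<le> 2 * (m * (\<Sum>i<n. b i \<omega> * ?d i) + \<nu> * J \<omega>)\<^sup>2
        + 2 * (\<Delta> t \<omega> - (m * (\<Sum>i<n. b i \<omega> * ?d i) + \<nu> * J \<omega>))\<^sup>2"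
        by (rule square_le_diff)
      moreover have "(m * (\<Sum>i<n. b i \<omega> * ?d i) + \<nu> * J \<omega>)\<^sup>2 \<le> 2 * (m * (\<Sum>i<n. b i \<omega> * ?d i))\<^sup>2
        + 2 * (\<nu> * J \<omega>)\<^sup>2"
        by (rule square_sum_le)
      moreover have "(m * (\<Sum>i<n. b i \<omega> * ?d i))\<^sup>2 \<le> m\<^sup>2 * (t * V \<omega>)"
        unfolding power_mult_distrib V_def
        using weighted_cauchy_schwarz[of n ?d "\<lambda>i. b i \<omega>"] dpos grid_sum[OF gr]
          by (intro mult_left_mono) auto
      ultimately have "(\<Delta> t \<omega>)\<^sup>2 \<le> 4 * (m\<^sup>2 * (t * V \<omega>)) + 4 * (\<nu> * J \<omega>)\<^sup>2 + 2 * e\<^sup>2" by linarith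
      then show ?thesis using 3 by (simp add: power_mult_distrib mult.assoc)
    qed
  qed
  have "f t \<le> expectation (\<lambda>\<omega>. 4 * (m\<^sup>2 * t) * V \<omega> + 4 * \<nu>\<^sup>2 * (J \<omega>)\<^sup>2 + 2 * e\<^sup>2 + c\<^sup>2 * indicator
    (space M - A) \<omega>)"
    unfolding f_def using stopped_integrable[of t] t V J A ptw by (intro integral_mono)
      (auto intro!: integrable_real_indicator simp: emeasure_eq_measure)
  also have "\<dots> = 4 * (m\<^sup>2 * t) * expectation V + 4 * \<nu>\<^sup>2 * expectation (\<lambda>\<omega>. (J \<omega>)\<^sup>2) + 2 * e\<^sup>2
    + c\<^sup>2 * prob (space M - A)"
  proof -
    have "integrable M (indicator (space M - A) :: 'a \<Rightarrow> real)"
      using A by (intro integrable_real_indicator) (auto simp: emeasure_eq_measure)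
    then show ?thesis using V J A by (simp add: prob_space)
  qed
  also have "\<dots> \<le> 4 * (m\<^sup>2 * t) * expectation V + 4 * \<nu>\<^sup>2 * expectation (\<lambda>\<omega>. (J \<omega>)\<^sup>2) + 2 * e\<^sup>2 + c\<^sup>2 * e"
    using A(2) by (intro add_left_mono mult_left_mono) auto
  also have "\<dots> = 4 * (m\<^sup>2 * t + \<nu>\<^sup>2) * (\<Sum>i<n. ?d i * f (g i)) + (2 * e\<^sup>2 + c\<^sup>2 * e)"
    unfolding V J by (simp add: algebra_simps)
  finally show ?thesis using gr by blast
qed

text \<open>Gronwall's argument: the weight \<open>exp (- L * t)\<close> turns the estimate above into a contraction for
  large \<open>L\<close>, as a left Riemann sum of an increasing function does not exceed its integral.\<close>

lemma stopped_moment_zero: "t \<in> {0..T} \<Longrightarrow> f t = 0"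
proof -
  define C where "C = 4 * (m\<^sup>2 * T + \<nu>\<^sup>2)"
  \<comment> \<open>This makes the contraction factor C / L at most 1/2, and keeps \<open>L\<close>
    positive if C = 0.\<close>
  define L where "L = 2 * C + 1"
  have C0: "0 \<le> C" unfolding C_def using T by simp
  then have L: "0 < L" "C / L \<le> 1 / 2" unfolding L_def by (auto simp: field_simps)
  define S where "S = (SUP t\<in>{0..T}. f t * exp (- L * t))"
  have bdd: "bdd_above ((\<lambda>t. f t * exp (- L * t)) ` {0..T})"
  proof (rule bdd_aboveI2)
    fix t assume "t \<in> {0..T}"
    then show "f t * exp (- L * t) \<le> c\<^sup>2 * 1" using stopped_moment_bounds[of t] L by (intro mult_mono) auto
  qed
  have fS: "f t \<le> S * exp (L * t)" if "t \<in> {0..T}" for t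
  proof -
    have "f t * exp (- L * t) \<le> S" unfolding S_def by (rule cSUP_upper[OF that bdd])
    then have "f t * exp (- L * t) * exp (L * t) \<le> S * exp (L * t)" by (rule mult_right_mono) simp
    then show ?thesis by (simp add: mult.assoc exp_add[symmetric])
  qed
  have S0: "0 \<le> S"
  proof -
    have "0 \<le> f 0 * exp (- L * 0)" using stopped_moment_bounds(1)[of 0] by simp
    also have "\<dots> \<le> S" unfolding S_def by (rule cSUP_upper[OF _ bdd]) (use T in simp)
    finally show ?thesis .
  qed
  have half: "f t * exp (- L * t) \<le> S / 2" if t: "t \<in> {0..T}" for t
  proof (cases "t = 0")
    case True
    \<comment> \<open>The Euler form is available for positive times; time 0 is covered by the
      initial condition.\<close>
    have "f 0 = expectation (\<lambda>\<omega>. 0)" unfolding f_def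
      using D0 adapted_M[OF D(1), of 0] small_event_sets(2)[of 0] by (intro integral_cong_AE)
        (auto elim: eventually_mono)
    then show ?thesis using True S0 by simp
  next
    case False
    then have t0: "0 < t" using t by auto
    have "f t \<le> S / 2 * exp (L * t)"
    proof (rule field_le_epsilon)
      fix u :: real assume u: "0 < u"
      define e where "e = min 1 (u / (2 + c\<^sup>2))"
      have e: "0 < e" "2 * e\<^sup>2 + c\<^sup>2 * e \<le> u"
      proof -
        have k: "0 < 2 + c\<^sup>2" by (simp add: add_pos_nonneg)
        show e0: "0 < e" unfolding e_def using u k by simp
        have "e\<^sup>2 \<le> e" unfolding power2_eq_square using e0 by (intro mult_left_le) (auto simp: e_def)
        then have "2 * e\<^sup>2 + c\<^sup>2 * e \<le> e * (2 + c\<^sup>2)" by (simp add: algebra_simps)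
        also have "\<dots> \<le> u / (2 + c\<^sup>2) * (2 + c\<^sup>2)" using k by (intro mult_right_mono) (auto simp: e_def)
        finally show "2 * e\<^sup>2 + c\<^sup>2 * e \<le> u" using k by simp
      qed
      obtain n g where gr: "grid t n g" and
        le: "f t \<le> 4 * (m\<^sup>2 * t + \<nu>\<^sup>2) * (\<Sum>i<n. (g (Suc i) - g i) * f (g i)) + (2 * e\<^sup>2 + c\<^sup>2 * e)"
        using stopped_moment_euler[OF t0 e(1)] by blast
      have gt: "0 \<le> g i" "g i \<le> t" if "i \<le> n" for i using grid_bounds[OF gr that] by auto
      have d: "0 \<le> g (Suc i) - g i" if "i < n" for i using gr that by (auto simp: grid_def less_imp_le)
      have "4 * (m\<^sup>2 * t + \<nu>\<^sup>2) * (\<Sum>i<n. (g (Suc i) - g i) * f (g i)) \<le>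
        C * (\<Sum>i<n. (g (Suc i) - g i) * (S * exp (L * g i)))"
      proof (rule mult_mono)
        show "4 * (m\<^sup>2 * t + \<nu>\<^sup>2) \<le> C" unfolding C_def using t by (auto intro!: mult_left_mono)
        show "(\<Sum>i<n. (g (Suc i) - g i) * f (g i)) \<le> (\<Sum>i<n. (g (Suc i) - g i) * (S * exp (L * g i)))"
        proof (rule sum_mono)
          fix i assume i: "i \<in> {..<n}"
          have "g i \<in> {0..T}" using gt[of i] t i by auto
          then show "(g (Suc i) - g i) * f (g i) \<le> (g (Suc i) - g i) * (S * exp (L * g i))"
            using fS d i by (intro mult_left_mono) auto
        qed
        show "0 \<le> (\<Sum>i<n. (g (Suc i) - g i) * f (g i))"
          using d gt stopped_moment_bounds by (intro sum_nonneg mult_nonneg_nonneg) auto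
      qed (rule C0)
      also have "(\<Sum>i<n. (g (Suc i) - g i) * (S * exp (L * g i))) =
        S * (\<Sum>i<n. (g (Suc i) - g i) * exp (L * g i))"
        by (simp add: sum_distrib_left mult.left_commute)
      also have "C * (S * (\<Sum>i<n. (g (Suc i) - g i) * exp (L * g i))) \<le> C * (S * (exp (L * t) / L))"
        using C0 S0 exp_riemann_le[OF gr L(1)] by (intro mult_left_mono) auto
      also have "\<dots> = (C / L) * (S * exp (L * t))" by simp
      also have "\<dots> \<le> (1 / 2) * (S * exp (L * t))" using L S0 by (intro mult_right_mono) auto
      finally show "f t \<le> S / 2 * exp (L * t) + u" using le e(2) by simp
    qed
    then have "f t * exp (- L * t) \<le> S / 2 * exp (L * t) * exp (- L * t)" by (rule mult_right_mono) simp
    then show ?thesis by (simp add: mult.assoc exp_add[symmetric])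
  qed
  have "S \<le> S / 2" unfolding S_def[symmetric] by (subst S_def, rule cSUP_least) (use half T in auto)
  then have "S = 0" using S0 by simp
  then show "f t = 0" if "t \<in> {0..T}" using fS[OF that] stopped_moment_bounds(1)[of t] that by simp
qed

end

text \<open>On a grid containing the exceptional points of both solutions both Euler forms hold, and
  the difference satisfies the homogeneous one. Its stopped moments vanish for every truncation
  level. As paths are bounded on compact intervals, some level applies to each of them, and rational
  times suffice by continuity.\<close>

theorem linear_sde_unique:
  assumes 1: "has_ito_integral M F B H1 I1" "adapted F Z1" "continuous_paths M Z1"
      "AE \<omega> in M. AE t in lborel. 0 \<le> t \<longrightarrow> H1 t \<omega> = \<nu> * Z1 t \<omega>"
      "AE \<omega> in M. \<forall>T\<ge>0. Z1 T \<omega> = z + m * (LBINT t:{0..T}. Z1 t \<omega>) + I1 T \<omega>"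
    and 2: "has_ito_integral M F B H2 I2" "adapted F Z2" "continuous_paths M Z2"
      "AE \<omega> in M. AE t in lborel. 0 \<le> t \<longrightarrow> H2 t \<omega> = \<nu> * Z2 t \<omega>"
      "AE \<omega> in M. \<forall>T\<ge>0. Z2 T \<omega> = z + m * (LBINT t:{0..T}. Z2 t \<omega>) + I2 T \<omega>"
  shows "AE \<omega> in M. \<forall>t\<ge>0. Z1 t \<omega> = Z2 t \<omega>"
proof -
  define \<Delta> where "\<Delta> t \<omega> = Z1 t \<omega> - Z2 t \<omega>" for t \<omega>
  have D: "adapted F \<Delta>" "continuous_paths M \<Delta>"
    using 1(2,3) 2(2,3) unfolding adapted_def continuous_paths_def \<Delta>_def[abs_def]
    by (auto intro!: continuous_intros borel_measurable_diff)
  have D0: "AE \<omega> in M. \<Delta> 0 \<omega> = 0"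
    using ito_integral_0[OF 1(1)] ito_integral_0[OF 2(1)] 1(5) 2(5)
  proof eventually_elim
    case (elim \<omega>)
    have "(LBINT u:{0..0::real}. h u) = 0" for h :: "real \<Rightarrow> real"
      using AE_lborel_singleton[of "0::real"]
        by (auto simp: set_lebesgue_integral_def intro!: integral_eq_zero_AE elim!: eventually_mono)
    then have "Z1 0 \<omega> = z" "Z2 0 \<omega> = z" using elim by (auto dest!: spec[of _ 0])
    then show ?case by (simp add: \<Delta>_def)
  qed
  have approx: "\<exists>n g. grid t n g \<and> (\<exists>A\<in>events. prob (space M - A) < e \<and>
      (\<forall>\<omega>\<in>A. \<bar>transform (\<lambda>i. \<Delta> (g i)) (\<lambda>i \<omega>. m * (g (Suc i) - g i) + \<nu> *
        (B (g (Suc i)) \<omega> - B (g i) \<omega>)) n \<omega> - \<Delta> t \<omega>\<bar> \<le> e))"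
    if t: "0 < t" and e: "0 < e" for t e :: real
  proof -
    have e2: "0 < e / 2" using e by simp
    let ?R = "\<lambda>Z n g \<omega>. transform (\<lambda>i. Z (g i)) (\<lambda>i \<omega>. m * (g (Suc i) - g i)
      + \<nu> * (B (g (Suc i)) \<omega> - B (g i) \<omega>)) n \<omega>"
    obtain S1 \<eta>1 where S1: "finite S1" "0 < \<eta>1"
      "\<And>n g. grid t n g \<Longrightarrow> (\<forall>i<n. g (Suc i) - g i \<le> \<eta>1) \<Longrightarrow> (\<forall>x\<in>S1. \<forall>i<n. x \<le> g i \<or> g (Suc i) \<le> x) \<Longrightarrow>
      \<exists>A\<in>events. prob (space M - A) < e / 2 \<and> (\<forall>\<omega>\<in>A. \<bar>?R Z1 n g \<omega> + z - Z1 t \<omega>\<bar> \<le> e / 2)"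
      using linear_sde_riemann[OF 1 t e2] by (elim exE conjE) auto
    obtain S2 \<eta>2 where S2: "finite S2" "0 < \<eta>2"
      "\<And>n g. grid t n g \<Longrightarrow> (\<forall>i<n. g (Suc i) - g i \<le> \<eta>2) \<Longrightarrow> (\<forall>x\<in>S2. \<forall>i<n. x \<le> g i \<or> g (Suc i) \<le> x) \<Longrightarrow>
      \<exists>A\<in>events. prob (space M - A) < e / 2 \<and> (\<forall>\<omega>\<in>A. \<bar>?R Z2 n g \<omega> + z - Z2 t \<omega>\<bar> \<le> e / 2)"
      using linear_sde_riemann[OF 2 t e2] by (elim exE conjE) auto
    have "finite (S1 \<union> S2)" "0 < min \<eta>1 \<eta>2" using S1 S2 by auto
    from grid_exists[OF this(1) t this(2)] obtain n g where g: "grid t n g"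
      "\<forall>i<n. g (Suc i) - g i \<le> min \<eta>1 \<eta>2" "\<forall>x\<in>S1 \<union> S2. \<forall>i<n. x \<le> g i \<or> g (Suc i) \<le> x"
      by (elim exE conjE)
    have m1: "\<forall>i<n. g (Suc i) - g i \<le> \<eta>1" and m2: "\<forall>i<n. g (Suc i) - g i \<le> \<eta>2" using g(2) by auto
    have a1: "\<forall>x\<in>S1. \<forall>i<n. x \<le> g i \<or> g (Suc i) \<le> x" and a2: "\<forall>x\<in>S2. \<forall>i<n. x \<le> g i \<or> g (Suc i) \<le> x"
      using g(3) by auto
    obtain A1 where A1: "A1 \<in> events" "prob (space M - A1) < e / 2" "\<And>\<omega>. \<omega> \<in> A1 \<Longrightarrow> \<bar>?R Z1 n g \<omega> + z
      - Z1 t \<omega>\<bar> \<le> e / 2"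
      using S1(3)[OF g(1) m1 a1] by auto
    obtain A2 where A2: "A2 \<in> events" "prob (space M - A2) < e / 2" "\<And>\<omega>. \<omega> \<in> A2 \<Longrightarrow> \<bar>?R Z2 n g \<omega> + z
      - Z2 t \<omega>\<bar> \<le> e / 2"
      using S2(3)[OF g(1) m2 a2] by auto
    have "prob (space M - A1 \<inter> A2) \<le> prob ((space M - A1) \<union> (space M - A2))"
      using A1 A2 by (intro finite_measure_mono) auto
    also have "\<dots> \<le> prob (space M - A1) + prob (space M - A2)" using A1 A2 by (intro measure_Un_le) auto
    finally have small: "prob (space M - A1 \<inter> A2) < e" using A1 A2 by simp
    have "\<bar>?R \<Delta> n g \<omega> - \<Delta> t \<omega>\<bar> \<le> e" if om: "\<omega> \<in> A1 \<inter> A2" for \<omega>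
    proof -
      have "?R \<Delta> n g \<omega> = ?R Z1 n g \<omega> - ?R Z2 n g \<omega>"
        by (simp add: transform_def \<Delta>_def left_diff_distrib sum_subtractf)
      then have "?R \<Delta> n g \<omega> - \<Delta> t \<omega> = (?R Z1 n g \<omega> + z - Z1 t \<omega>) - (?R Z2 n g \<omega> + z - Z2 t \<omega>)"
        by (simp add: \<Delta>_def)
      moreover have "\<bar>?R Z1 n g \<omega> + z - Z1 t \<omega>\<bar> \<le> e / 2" "\<bar>?R Z2 n g \<omega> + z - Z2 t \<omega>\<bar> \<le> e / 2"
        using A1(3) A2(3) om by auto
      ultimately show ?thesis by linarith
    qed
    then show ?thesis using g(1) small A1(1) A2(1)
      by (intro exI[of _ n] exI[of _ g] conjI bexI[of _ "A1 \<inter> A2"]) auto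
  qed
  have zero: "AE \<omega> in M. \<Delta> T \<omega> = 0" if T: "0 < T" for T
  proof -
    have "AE \<omega> in M. \<forall>k::nat. \<omega> \<in> small_event \<Delta> (real k) T \<longrightarrow> \<Delta> T \<omega> = 0"
      unfolding AE_all_countable
    proof
      fix k :: nat
      have k0: "0 \<le> real k" and T0: "0 \<le> T" using T by auto
      have ae0: "AE \<omega> in M. 0 \<le> indicator (small_event \<Delta> (real k) T) \<omega> * (\<Delta> T \<omega>)\<^sup>2" by simp
      have "expectation (\<lambda>\<omega>. indicator (small_event \<Delta> (real k) T) \<omega> * (\<Delta> T \<omega>)\<^sup>2) = 0"
        by (rule stopped_moment_zero[OF D T k0 approx D0]) (use T in auto)
      then have "AE \<omega> in M. indicator (small_event \<Delta> (real k) T) \<omega> * (\<Delta> T \<omega>)\<^sup>2 = 0"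
        using integral_nonneg_eq_0_iff_AE[OF stopped_integrable[OF D T k0 approx D0 T0] ae0] by simp
      then show "AE \<omega> in M. \<omega> \<in> small_event \<Delta> (real k) T \<longrightarrow> \<Delta> T \<omega> = 0"
        by eventually_elim (auto simp: indicator_def)
    qed
    then show ?thesis using AE_space
    proof eventually_elim
      case (elim \<omega>)
      have "continuous_on {0..T} (\<lambda>t. \<Delta> t \<omega>)"
        using D(2) elim unfolding continuous_paths_def by (auto intro: continuous_on_subset[of "{0..}"])
      then have "bounded ((\<lambda>t. \<Delta> t \<omega>) ` {0..T})"
        by (intro compact_imp_bounded compact_continuous_image) auto
      then obtain a where a: "\<forall>t\<in>{0..T}. \<bar>\<Delta> t \<omega>\<bar> \<le> a" unfolding bounded_iff by auto
      obtain k :: nat where "a \<le> real k" using real_arch_simple by blast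
      then have "\<omega> \<in> small_event \<Delta> (real k) T" using a elim by (fastforce intro: order_trans)
      then show ?case using elim by blast
    qed
  qed
  have "AE \<omega> in M. \<forall>q\<in>\<rat> \<inter> {0<..}. \<Delta> q \<omega> = 0"
    by (rule AE_ball_countable'[OF zero]) (auto intro: countable_subset[OF _ countable_rat])
  then show ?thesis using D0 AE_space
  proof eventually_elim
    case (elim \<omega>)
    have c: "continuous_on {0..} (\<lambda>t. \<Delta> t \<omega>)" using D(2) elim by (simp add: continuous_paths_def)
    have "\<Delta> t \<omega> = 0" if t: "0 \<le> t" for t
    proof (rule ccontr)
      assume ne: "\<Delta> t \<omega> \<noteq> 0"
      obtain d where d: "0 < d" "\<And>s. s \<in> {0..} \<Longrightarrow> \<bar>s - t\<bar> < d \<Longrightarrow> \<bar>\<Delta> s \<omega> - \<Delta> t \<omega>\<bar> < \<bar>\<Delta> t \<omega>\<bar>"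
        using c t ne unfolding continuous_on_iff dist_real_def by (meson atLeast_iff zero_less_abs_iff)
      obtain q where q: "q \<in> \<rat>" "t < q" "q < t + d" using Rats_dense_in_real[of t "t + d"] d(1) by auto
      have "\<Delta> q \<omega> = 0" using elim q t by auto
      then show False using d(2)[of q] q t by auto
    qed
    then show ?case by (simp add: \<Delta>_def)
  qed
qed

end

section \<open>Geometric Brownian motion\<close>

text \<open>The closed solution of dZ = m Z dt + \<nu> Z dX for a Brownian motion X. Subtracting
  \<open>X 0\<close> makes the initial value z exact for every \<omega>.\<close>

definition gbm :: "real \<Rightarrow> real \<Rightarrow> real \<Rightarrow> 'a process \<Rightarrow> 'a process" where
  "gbm z m \<nu> X t \<omega> = z * exp ((m - \<nu>\<^sup>2 / 2) * t + \<nu> * (X t \<omega> - X 0 \<omega>))"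

lemma gbm_pos: "0 < z \<Longrightarrow> 0 < gbm z m \<nu> X t \<omega>"
  by (simp add: gbm_def)

lemma gbm_increment:
  "gbm z m \<nu> X t \<omega> = gbm z m \<nu> X s \<omega> * exp ((m - \<nu>\<^sup>2 / 2) * (t - s) + \<nu> * (X t \<omega> - X s \<omega>))"
  unfolding gbm_def mult.assoc exp_add[symmetric] by (simp add: field_simps)

text \<open>Completing the square again, now for real-valued integrals; it yields the lognormal
  moments in \<open>gbm_error_moments\<close>.\<close>

lemma normal_shift_integral:
  fixes \<nu> :: real and f :: "real \<Rightarrow> real"
  assumes u: "0 < u"
  shows "integrable lborel (\<lambda>x. normal_density 0 (sqrt u) x * f (x + \<nu> * u)) \<Longrightarrow>
      integrable lborel (\<lambda>x. normal_density 0 (sqrt u) x * (exp (\<nu> * x - \<nu>\<^sup>2 * u / 2) * f x))"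
    "(\<integral>x. normal_density 0 (sqrt u) x * (exp (\<nu> * x - \<nu>\<^sup>2 * u / 2) * f x) \<partial>lborel) =
      (\<integral>x. normal_density 0 (sqrt u) x * f (x + \<nu> * u) \<partial>lborel)"
proof -
  have eq: "normal_density 0 (sqrt u) x * (exp (\<nu> * x - \<nu>\<^sup>2 * u / 2) * f x) =
      normal_density 0 (sqrt u) (x - \<nu> * u) * f (x - \<nu> * u + \<nu> * u)" for x
    using normal_density_exp_shift[OF u, of x "- \<nu>"] by (simp add: mult.assoc[symmetric])
  let ?h = "\<lambda>x. normal_density 0 (sqrt u) x * f (x + \<nu> * u)"
  have sh: "(\<lambda>x. normal_density 0 (sqrt u) x * (exp (\<nu> * x - \<nu>\<^sup>2 * u / 2) * f x)) =
    (\<lambda>x. ?h (- \<nu> * u + 1 * x))"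
    using eq by (simp add: fun_eq_iff)
  show "integrable lborel ?h \<Longrightarrow>
    integrable lborel (\<lambda>x. normal_density 0 (sqrt u) x * (exp (\<nu> * x - \<nu>\<^sup>2 * u / 2) * f x))"
    unfolding sh by (rule lborel_integrable_real_affine) auto
  show "(\<integral>x. normal_density 0 (sqrt u) x * (exp (\<nu> * x - \<nu>\<^sup>2 * u / 2) * f x) \<partial>lborel) = (\<integral>x. ?h x \<partial>lborel)"
    unfolding sh using lborel_integral_real_affine[of 1 ?h "- \<nu> * u"] by simp
qed

text \<open>Over a step of length \<open>u\<close> in which the Brownian motion increases by \<open>x\<close>, the relative increment of
  \<open>gbm\<close> is \<open>(exp (m * u) - 1) + \<nu> * x\<close> plus this error of mean 0.\<close>

definition gbm_error :: "real \<Rightarrow> real \<Rightarrow> real \<Rightarrow> real \<Rightarrow> real" where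
  "gbm_error m \<nu> u x = exp ((m - \<nu>\<^sup>2 / 2) * u + \<nu> * x) - exp (m * u) - \<nu> * x"

text \<open>The second moment of the error under a Gaussian of variance u, arranged to show its
  order: the first summand is of order u^3, the second of order u^2, so the sum over the 1 / u steps
  of a unit interval vanishes with u.\<close>

definition gbm_error_var :: "real \<Rightarrow> real \<Rightarrow> real \<Rightarrow> real" where
  "gbm_error_var m \<nu> u = \<nu>\<^sup>2 * u * (exp (m * u) - 1)\<^sup>2 + (exp (m * u))\<^sup>2 * (exp (\<nu>\<^sup>2 * u) - 1 - \<nu>\<^sup>2 * u)"

text \<open>With a = exp (m u) and the normalized exponential E of mean 1, the error is a E - a -
  \<nu> x. The mixed moment of E and x is \<nu> u, by shifting the centre; the rest is expansion of
  the square.\<close>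

lemma gbm_error_moments:
  assumes u: "0 < u"
  shows "integrable lborel (\<lambda>x. normal_density 0 (sqrt u) x * (gbm_error m \<nu> u x)\<^sup>2)"
    "(\<integral>x. normal_density 0 (sqrt u) x * gbm_error m \<nu> u x \<partial>lborel) = 0"
    "(\<integral>x. normal_density 0 (sqrt u) x * (gbm_error m \<nu> u x)\<^sup>2 \<partial>lborel) = gbm_error_var m \<nu> u"
proof -
  let ?N = "normal_density 0 (sqrt u)" and ?E = "\<lambda>x. exp (\<nu> * x - \<nu>\<^sup>2 * u / 2)"
    and ?E2 = "\<lambda>x. exp (2 * \<nu> * x - (2 * \<nu>)\<^sup>2 * u / 2)"
  have s: "0 < sqrt u" using u by simp
  let ?a = "exp (m * u)"
  have N0: "integrable lborel ?N" "(\<integral>x. ?N x \<partial>lborel) = 1" using s by auto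
  have N1: "integrable lborel (\<lambda>x. ?N x * x)" "(\<integral>x. ?N x * x \<partial>lborel) = 0"
    using integrable_normal_moment_nz_1[OF s, of 0] integral_normal_moment_nz_1[OF s, of 0] by simp_all
  have N2: "integrable lborel (\<lambda>x. ?N x * x\<^sup>2)" "(\<integral>x. ?N x * x\<^sup>2 \<partial>lborel) = u"
    using integrable_normal_moment[OF s, of 0 2] integral_normal_moment_even[OF s, of 0 1] u
      by (simp_all add: fact_2)
  have E0: "integrable lborel (\<lambda>x. ?N x * ?E x)" "(\<integral>x. ?N x * ?E x \<partial>lborel) = 1"
    using normal_shift_integral[OF u, where f="\<lambda>_. 1" and \<nu>=\<nu>] N0 by simp_all
  have E1: "integrable lborel (\<lambda>x. ?N x * (?E x * x))" "(\<integral>x. ?N x * (?E x * x) \<partial>lborel) = \<nu> * u"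
  proof -
    have i: "integrable lborel (\<lambda>x. ?N x * (x + \<nu> * u))" "(\<integral>x. ?N x * (x + \<nu> * u) \<partial>lborel) = \<nu> * u"
      unfolding distrib_left using N0 N1 by simp_all
    show "integrable lborel (\<lambda>x. ?N x * (?E x * x))" "(\<integral>x. ?N x * (?E x * x) \<partial>lborel) = \<nu> * u"
      using normal_shift_integral[OF u, where f="\<lambda>x. x" and \<nu>=\<nu>] i by simp_all
  qed
  have E2: "integrable lborel (\<lambda>x. ?N x * ?E2 x)" "(\<integral>x. ?N x * ?E2 x \<partial>lborel) = 1"
    using normal_shift_integral[OF u, where f="\<lambda>_. 1" and \<nu>="2 * \<nu>"] N0 by simp_all
  have err: "gbm_error m \<nu> u x = ?a * ?E x - ?a - \<nu> * x" for x
    unfolding gbm_error_def by (simp add: exp_add[symmetric] algebra_simps)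
  have Esq: "(?E x)\<^sup>2 = exp (\<nu>\<^sup>2 * u) * ?E2 x" for x
    unfolding power2_eq_square exp_add[symmetric] by (simp add: power2_eq_square algebra_simps)
  have sq: "?N x * (gbm_error m \<nu> u x)\<^sup>2 = ?a\<^sup>2 * exp (\<nu>\<^sup>2 * u) * (?N x * ?E2 x) + ?a\<^sup>2 * ?N x
    + \<nu>\<^sup>2 * (?N x * x\<^sup>2)
     - 2 * ?a\<^sup>2 * (?N x * ?E x) - 2 * ?a * \<nu> * (?N x * (?E x * x)) + 2 * ?a * \<nu> * (?N x * x)" for x
  proof -
    have "(gbm_error m \<nu> u x)\<^sup>2 = ?a\<^sup>2 * (?E x)\<^sup>2 + ?a\<^sup>2 + \<nu>\<^sup>2 * x\<^sup>2 - 2 * ?a\<^sup>2 * ?E x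
      - 2 * ?a * \<nu> * (?E x * x) + 2 * ?a * \<nu> * x"
      unfolding err by (simp add: power2_eq_square algebra_simps)
    moreover have "n * (a2 * (c * e2) + a2 + v * x2 - 2 * a2 * e - 2 * a * \<nu> * (e * x) + 2 * a * \<nu> * x) =
      a2 * c * (n * e2) + a2 * n + v * (n * x2) - 2 * a2 * (n * e) - 2 * a * \<nu> * (n * (e * x)) + 2 *
        a * \<nu> * (n * x)"
      for n a2 c e2 v x2 e a :: real by (simp add: algebra_simps)
    ultimately show ?thesis unfolding Esq by (simp only:)
  qed
  show "integrable lborel (\<lambda>x. ?N x * (gbm_error m \<nu> u x)\<^sup>2)"
    unfolding sq using N0 N1 N2 E0 E1 E2
      by (intro Bochner_Integration.integrable_add Bochner_Integration.integrable_diff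
      integrable_mult_right) auto
  have lin: "?N x * gbm_error m \<nu> u x = ?a * (?N x * ?E x) - ?a * ?N x - \<nu> * (?N x * x)" for x
    unfolding err by (simp add: algebra_simps)
  have "(\<integral>x. ?N x * gbm_error m \<nu> u x \<partial>lborel) = ?a * 1 - ?a * 1 - \<nu> * 0"
    unfolding lin using N0 N1 E0 by simp
  then show "(\<integral>x. ?N x * gbm_error m \<nu> u x \<partial>lborel) = 0" by simp
  have "(\<integral>x. ?N x * (gbm_error m \<nu> u x)\<^sup>2 \<partial>lborel) =
     ?a\<^sup>2 * exp (\<nu>\<^sup>2 * u) * 1 + ?a\<^sup>2 * 1 + \<nu>\<^sup>2 * u - 2 * ?a\<^sup>2 * 1 - 2 * ?a * \<nu> * (\<nu> * u) + 2 * ?a * \<nu> * 0"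
    unfolding sq using N0 N1 N2 E0 E1 E2 by simp
  also have "\<dots> = gbm_error_var m \<nu> u"
    unfolding gbm_error_var_def by (simp add: power2_eq_square algebra_simps)
  finally show "(\<integral>x. ?N x * (gbm_error m \<nu> u x)\<^sup>2 \<partial>lborel) = gbm_error_var m \<nu> u" .
qed

text \<open>Strict positivity, which \<open>transform_maximal\<close> asks for, comes from the
  quadratic term of the exponential series.\<close>

lemma gbm_error_var_pos:
  assumes "0 < u" "\<nu> \<noteq> 0"
  shows "0 < gbm_error_var m \<nu> u"
proof -
  have b: "0 < \<nu>\<^sup>2 * u" using assms by simp
  have "0 < (\<nu>\<^sup>2 * u)\<^sup>2 / 2" using zero_less_power[OF b, of 2] by (rule half_gt_zero)
  then have "1 + \<nu>\<^sup>2 * u < exp (\<nu>\<^sup>2 * u)" using exp_lower_Taylor_quadratic[OF less_imp_le[OF b]] by linarith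
  then show ?thesis unfolding gbm_error_var_def using assms by (intro add_nonneg_pos mult_pos_pos) auto
qed

lemma gbm_error_var_small: "(\<lambda>k. real (Suc k) * gbm_error_var m \<nu> (1 / real (Suc k))) \<longlonglongrightarrow> 0"
proof -
  have lim: "(\<lambda>k. a * (1 / real (Suc k))) \<longlonglongrightarrow> 0" for a
    using tendsto_mult_right_zero[OF LIMSEQ_inverse_real_of_nat] by (simp add: inverse_eq_divide)
  have e1: "(\<lambda>k. exp (a * (1 / real (Suc k)))) \<longlonglongrightarrow> 1" for a using tendsto_exp[OF lim[of a]] by simp
  have A: "(\<lambda>k. \<nu>\<^sup>2 * (exp (m * (1 / real (Suc k))) - 1)\<^sup>2) \<longlonglongrightarrow> \<nu>\<^sup>2 * (1 - 1)\<^sup>2"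
    by (intro tendsto_intros e1)
  let ?r = "\<lambda>k. real (Suc k) * (exp (\<nu>\<^sup>2 * (1 / real (Suc k))) - 1 - \<nu>\<^sup>2 * (1 / real (Suc k)))"
  have B: "?r \<longlonglongrightarrow> 0"
  proof (rule tendsto_sandwich[of "\<lambda>_. 0" _ _ "\<lambda>k. \<nu>\<^sup>2 * \<nu>\<^sup>2 * (1 / real (Suc k))"])
    show "\<forall>\<^sub>F k in sequentially. 0 \<le> ?r k"
    proof (rule always_eventually, rule allI, rule mult_nonneg_nonneg)
      fix k
      show "0 \<le> exp (\<nu>\<^sup>2 * (1 / real (Suc k))) - 1 - \<nu>\<^sup>2 * (1 / real (Suc k))"
        using exp_ge_add_one_self[of "\<nu>\<^sup>2 * (1 / real (Suc k))"] by linarith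
    qed simp
    have "\<forall>\<^sub>F k in sequentially. \<nu>\<^sup>2 * (1 / real (Suc k)) < 1"
      by (rule order_tendstoD(2)[OF lim]) simp
    then show "\<forall>\<^sub>F k in sequentially. ?r k \<le> \<nu>\<^sup>2 * \<nu>\<^sup>2 * (1 / real (Suc k))"
    proof eventually_elim
      case (elim k)
      have "exp (\<nu>\<^sup>2 * (1 / real (Suc k))) \<le> 1 + \<nu>\<^sup>2 * (1 / real (Suc k)) + (\<nu>\<^sup>2 * (1 / real (Suc k)))\<^sup>2"
        using elim by (intro exp_bound) auto
      then have "?r k \<le> real (Suc k) * (\<nu>\<^sup>2 * (1 / real (Suc k)))\<^sup>2"
        by (intro mult_left_mono) auto
      also have "\<dots> = \<nu>\<^sup>2 * \<nu>\<^sup>2 * (1 / real (Suc k))" by (simp add: power2_eq_square del: of_nat_Suc)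
      finally show ?case .
    qed
    show "(\<lambda>k. \<nu>\<^sup>2 * \<nu>\<^sup>2 * (1 / real (Suc k))) \<longlonglongrightarrow> 0" by (rule lim)
  qed simp
  have "(\<lambda>k. \<nu>\<^sup>2 * (exp (m * (1 / real (Suc k))) - 1)\<^sup>2 + (exp (m * (1 / real (Suc k))))\<^sup>2 * ?r k) \<longlonglongrightarrow>
    \<nu>\<^sup>2 * (1 - 1)\<^sup>2 + 1\<^sup>2 * 0"
    by (intro tendsto_add A tendsto_mult tendsto_power e1 B)
  moreover have "real (Suc k) * gbm_error_var m \<nu> (1 / real (Suc k)) =
      \<nu>\<^sup>2 * (exp (m * (1 / real (Suc k))) - 1)\<^sup>2 + (exp (m * (1 / real (Suc k))))\<^sup>2 * ?r k" for k
    unfolding gbm_error_var_def by (simp add: distrib_left del: of_nat_Suc)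
  ultimately show ?thesis by simp
qed

text \<open>Over a step of length u the scheme compounds, exp (m u) - 1, where the equation has m u.
  By the derivative of exp at 0 the difference is o(u), hence negligible over the steps of a unit
  interval.\<close>

lemma exp_remainder_small: "(\<lambda>k. real (Suc k) * \<bar>exp (m / real (Suc k)) - 1 - m / real (Suc k)\<bar>) \<longlonglongrightarrow> 0"
proof -
  have lim: "(\<lambda>k. m / real (Suc k)) \<longlonglongrightarrow> 0"
    using tendsto_mult_right_zero[OF LIMSEQ_inverse_real_of_nat, of m] by (simp add: field_simps)
  have d: "((\<lambda>h. (exp (0 + h) - exp 0) / h) \<longlongrightarrow> 1) (at (0::real))"
    using DERIV_exp[of "0::real"] unfolding DERIV_def by simp
  show ?thesis
  proof (cases "m = 0")
    case False
    have "filterlim (\<lambda>k. m / real (Suc k)) (at 0) sequentially"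
      unfolding filterlim_at using lim False by auto
    from filterlim_compose[OF d this] have "(\<lambda>k. (exp (m / real (Suc k)) - 1) / (m / real (Suc k)))
      \<longlonglongrightarrow> 1" by simp
    then have "(\<lambda>k. \<bar>m\<bar> * \<bar>(exp (m / real (Suc k)) - 1) / (m / real (Suc k)) - 1\<bar>) \<longlonglongrightarrow> \<bar>m\<bar> * \<bar>1 - 1\<bar>"
      by (intro tendsto_intros)
    moreover have "\<bar>m\<bar> * \<bar>(exp (m / real (Suc k)) - 1) / (m / real (Suc k)) - 1\<bar> =
      real (Suc k) * \<bar>exp (m / real (Suc k)) - 1 - m / real (Suc k)\<bar>" for k
    proof -
      have "real (Suc k) * (exp (m / real (Suc k)) - 1 - m / real (Suc k)) =
        m * ((exp (m / real (Suc k)) - 1) / (m / real (Suc k)) - 1)"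
        using False by (simp add: field_simps del: of_nat_Suc)
      then have "\<bar>real (Suc k) * (exp (m / real (Suc k)) - 1 - m / real (Suc k))\<bar> =
        \<bar>m * ((exp (m / real (Suc k)) - 1) / (m / real (Suc k)) - 1)\<bar>" by simp
      then show ?thesis unfolding abs_mult by simp
    qed
    ultimately show ?thesis by simp
  qed simp
qed

section \<open>Convergence in probability, suprema over time, and uniform grids\<close>

lemma (in prob_space) tendsto_0_in_prob_AE:
  fixes X :: "nat \<Rightarrow> 'a \<Rightarrow> ennreal"
  assumes X: "\<And>k. X k \<in> borel_measurable M"
    and lim: "\<And>e. 0 < e \<Longrightarrow> AE \<omega> in M. \<forall>\<^sub>F k in sequentially. X k \<omega> \<le> ennreal e"
  shows "tendsto_0_in_prob M X"
  unfolding tendsto_0_in_prob_def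
proof (intro conjI allI impI X)
  fix e :: real assume e: "0 < e"
  have m: "{\<omega>\<in>space M. ennreal e < X k \<omega>} \<in> events" for k using X[of k] by measurable
  have "(\<lambda>k. expectation (indicator {\<omega>\<in>space M. ennreal e < X k \<omega>})) \<longlonglongrightarrow> expectation (\<lambda>\<omega>. 0::real)"
  proof (rule integral_dominated_convergence[where w="\<lambda>_. 1"])
    show "AE \<omega> in M. (\<lambda>k. indicator {\<omega>\<in>space M. ennreal e < X k \<omega>} \<omega> :: real) \<longlonglongrightarrow> 0"
      using lim[OF e]
    proof eventually_elim
      case (elim \<omega>)
      then show ?case
        by (intro tendsto_eventually) (auto elim!: eventually_mono simp: indicator_def not_less)
    qed
  qed (use m in auto)
  then show "(\<lambda>k. prob {\<omega>\<in>space M. ennreal e < X k \<omega>}) \<longlonglongrightarrow> 0" using m by simp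
qed

lemma (in prob_space) prob_tendsto_0:
  assumes m: "\<And>k. A k \<in> events" and lim: "\<And>\<omega>. \<omega> \<in> space M \<Longrightarrow> \<forall>\<^sub>F k in sequentially. \<omega> \<notin> A k"
  shows "(\<lambda>k::nat. prob (A k)) \<longlonglongrightarrow> 0"
proof -
  have "(\<lambda>k. expectation (indicator (A k))) \<longlonglongrightarrow> expectation (\<lambda>\<omega>. 0::real)"
  proof (rule integral_dominated_convergence[where w="\<lambda>_. 1"])
    show "AE \<omega> in M. (\<lambda>k. indicator (A k) \<omega> :: real) \<longlonglongrightarrow> 0"
      using lim by (intro AE_I2 tendsto_eventually) (auto elim!: eventually_mono simp: indicator_def)
  qed (use m in auto)
  then show ?thesis using m by simp
qed

lemma sup_measurable:
  fixes f :: "real \<Rightarrow> 'a \<Rightarrow> real"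
  assumes T: "0 \<le> T" and m: "\<And>t. t \<in> {0..T} \<Longrightarrow> f t \<in> borel_measurable M"
    and c: "\<And>\<omega>. \<omega> \<in> space M \<Longrightarrow> continuous_on {0..T} (\<lambda>t. f t \<omega>)"
  shows "(\<lambda>\<omega>. SUP t\<in>{0..T}. ennreal \<bar>f t \<omega>\<bar>) \<in> borel_measurable M"
proof -
  let ?R = "\<rat> \<inter> {0..1::real}"
  have cR: "countable ?R" using countable_rat by (rule countable_subset[rotated]) auto
  have RT: "q * T \<in> {0..T}" if "q \<in> ?R" for q using that T by (auto intro: mult_left_le_one_le)
  have "(\<lambda>\<omega>. SUP q\<in>?R. ennreal \<bar>f (q * T) \<omega>\<bar>) \<in> borel_measurable M"
  proof (rule borel_measurable_SUP[OF cR])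
    fix q assume "q \<in> ?R"
    then show "(\<lambda>\<omega>. ennreal \<bar>f (q * T) \<omega>\<bar>) \<in> borel_measurable M" using m[OF RT] by measurable
  qed
  moreover have "(SUP t\<in>{0..T}. ennreal \<bar>f t \<omega>\<bar>) = (SUP q\<in>?R. ennreal \<bar>f (q * T) \<omega>\<bar>)"
    if om: "\<omega> \<in> space M" for \<omega>
  proof (rule antisym)
    show "(SUP q\<in>?R. ennreal \<bar>f (q * T) \<omega>\<bar>) \<le> (SUP t\<in>{0..T}. ennreal \<bar>f t \<omega>\<bar>)"
    proof (rule SUP_least)
      fix q assume q: "q \<in> ?R"
      show "ennreal \<bar>f (q * T) \<omega>\<bar> \<le> (SUP t\<in>{0..T}. ennreal \<bar>f t \<omega>\<bar>)" by (rule SUP_upper[OF RT[OF q]])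
    qed
    show "(SUP t\<in>{0..T}. ennreal \<bar>f t \<omega>\<bar>) \<le> (SUP q\<in>?R. ennreal \<bar>f (q * T) \<omega>\<bar>)"
    proof (rule SUP_least, rule ennreal_le_epsilon)
      fix t u :: real assume t: "t \<in> {0..T}" and u: "0 < u"
      obtain d where d: "0 < d" "\<And>s. s \<in> {0..T} \<Longrightarrow> \<bar>s - t\<bar> < d \<Longrightarrow> \<bar>f s \<omega> - f t \<omega>\<bar> < u"
        using c[OF om] t u unfolding continuous_on_iff dist_real_def by blast
      obtain q where q: "q \<in> ?R" "\<bar>q * T - t\<bar> < d" using rational_dense[OF t d(1)] by auto
      have "\<bar>f t \<omega>\<bar> \<le> \<bar>f (q * T) \<omega>\<bar> + u" using d(2)[OF RT[OF q(1)] q(2)] by linarith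
      then have "ennreal \<bar>f t \<omega>\<bar> \<le> ennreal (\<bar>f (q * T) \<omega>\<bar> + u)" by (rule ennreal_leI)
      also have "\<dots> = ennreal \<bar>f (q * T) \<omega>\<bar> + ennreal u" using u by (intro ennreal_plus) auto
      also have "\<dots> \<le> (SUP q\<in>?R. ennreal \<bar>f (q * T) \<omega>\<bar>) + ennreal u" by (intro add_right_mono SUP_upper q)
      finally show "ennreal \<bar>f t \<omega>\<bar> \<le> (SUP q\<in>?R. ennreal \<bar>f (q * T) \<omega>\<bar>) + ennreal u" .
    qed
  qed
  ultimately show ?thesis by (subst measurable_cong) auto
qed

lemma continuous_indefinite_integral:
  fixes f :: "real \<Rightarrow> real"
  assumes f: "continuous_on {0..} f"
  shows "continuous_on {0..} (\<lambda>t. LBINT u:{0..t}. f u)"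
  unfolding continuous_on_eq_continuous_within
proof
  fix t :: real assume t: "t \<in> {0..}"
  have eq: "(LBINT u:{0..s}. f u) = integral {0..s} f" for s
    by (rule set_borel_integral_eq_integral(2)[OF borel_integrable_atLeastAtMost'])
      (rule continuous_on_subset[OF f], auto)
  have "continuous_on {0..t + 1} (\<lambda>s. integral {0..s} f)"
    by (rule indefinite_integral_continuous_1, rule integrable_continuous_real)
      (rule continuous_on_subset[OF f], auto)
  then have "continuous (at t within {0..t + 1}) (\<lambda>s. LBINT u:{0..s}. f u)"
    unfolding eq using t by (auto simp: continuous_on_eq_continuous_within)
  moreover have "at t within {0..t + 1} = at t within {0..}"
    by (rule at_within_nhd[of t "{..<t + 1}"]) (auto simp: t)
  ultimately show "continuous (at t within {0..}) (\<lambda>s. LBINT u:{0..s}. f u)"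
    by (simp add: continuous_within)
qed

lemma uniform_grid: "0 < K \<Longrightarrow> grid (real p) (p * K) (\<lambda>l. real l / real K)"
  by (auto simp: grid_def field_simps)

lemma simple_process_uniform:
  assumes K: "0 < K" and i: "i < n" and t: "real i / real K < t" "t \<le> real (Suc i) / real K"
  shows "simple_process (n, \<lambda>i. real i / real K, \<xi>) t \<omega> = \<xi> i \<omega>"
proof -
  have "\<xi> l \<omega> * indicator {real l / real K<..real (Suc l) / real K} t = (if l = i then \<xi> i \<omega> else 0)" for l
  proof (cases "l = i")
    case False
    have "t \<notin> {real l / real K<..real (Suc l) / real K}"
    proof (cases "l < i")
      case True
      then have "real (Suc l) / real K \<le> real i / real K" by (intro divide_right_mono) auto
      then show ?thesis using t by auto
    next
      case False2: False
      then have "real (Suc i) / real K \<le> real l / real K" using False by (intro divide_right_mono) auto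
      then show ?thesis using t by auto
    qed
    then show ?thesis using False by simp
  qed (use t in simp)
  then show ?thesis using i by (simp add: simple_process.simps del: of_nat_Suc)
qed

lemma simple_integral_uniform:
  assumes K: "0 < K" and i: "i < n" and t: "real i / real K \<le> t" "t \<le> real (Suc i) / real K"
  shows "simple_integral X (n, \<lambda>i. real i / real K, \<xi>) t \<omega> =
    (\<Sum>l<i. \<xi> l \<omega> * (X (real (Suc l) / real K) \<omega> - X (real l / real K) \<omega>)) + \<xi> i \<omega> *
      (X t \<omega> - X (real i / real K) \<omega>)"
proof -
  let ?\<phi> = "\<lambda>l. \<xi> l \<omega> * (X (min t (real (Suc l) / real K)) \<omega> - X (min t (real l / real K)) \<omega>)"
  have mono: "real a / real K \<le> real b / real K" if "a \<le> b" for a b using that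
    by (intro divide_right_mono) auto
  have "(\<Sum>l<n. ?\<phi> l) = (\<Sum>l<Suc i. ?\<phi> l)"
  proof (rule sum.mono_neutral_right)
    show "\<forall>l\<in>{..<n} - {..<Suc i}. ?\<phi> l = 0"
    proof
      fix l assume "l \<in> {..<n} - {..<Suc i}"
      then have "t \<le> real l / real K" "t \<le> real (Suc l) / real K"
        using t(2) mono[of "Suc i" l] mono[of "Suc i" "Suc l"] by auto
      then show "?\<phi> l = 0" by simp
    qed
  qed (use i in auto)
  also have "\<dots> = (\<Sum>l<i. ?\<phi> l) + ?\<phi> i" by simp
  also have "?\<phi> i = \<xi> i \<omega> * (X t \<omega> - X (real i / real K) \<omega>)" using t by (simp add: min_def)
  also have "(\<Sum>l<i. ?\<phi> l) = (\<Sum>l<i. \<xi> l \<omega> * (X (real (Suc l) / real K) \<omega> - X (real l / real K) \<omega>))"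
  proof (rule sum.cong[OF refl])
    fix l assume "l \<in> {..<i}"
    then have "real l / real K \<le> t" "real (Suc l) / real K \<le> t"
      using t(1) mono[of l i] mono[of "Suc l" i] by auto
    then show "?\<phi> l = \<xi> l \<omega> * (X (real (Suc l) / real K) \<omega> - X (real l / real K) \<omega>)" by (simp add: min_def)
  qed
  finally show ?thesis by (simp add: simple_integral.simps)
qed

lemma floor_cell:
  assumes "0 < K" "0 \<le> t"
  shows "real (nat \<lfloor>t * real K\<rfloor>) / real K \<le> t" "t < real (Suc (nat \<lfloor>t * real K\<rfloor>)) / real K"
proof -
  have "real (nat \<lfloor>t * real K\<rfloor>) \<le> t * real K" using assms by simp
  then show "real (nat \<lfloor>t * real K\<rfloor>) / real K \<le> t" using assms by (simp add: pos_divide_le_eq)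
  have "t * real K < real (Suc (nat \<lfloor>t * real K\<rfloor>))" by linarith
  then show "t < real (Suc (nat \<lfloor>t * real K\<rfloor>)) / real K" using assms by (simp add: pos_less_divide_eq)
qed

text \<open>Rounding up, unlike in \<open>floor_cell\<close>, because simple processes are constant
  on left-open cells; hence t > 0.\<close>

lemma ceiling_cell:
  assumes "0 < K" "0 < t"
  obtains i where "real i / real K < t" "t \<le> real (Suc i) / real K"
proof -
  have tK: "0 < t * real K" using assms by simp
  define i where "i = nat (\<lceil>t * real K\<rceil> - 1)"
  have "1 \<le> \<lceil>t * real K\<rceil>" using tK by linarith
  then have i: "real i = of_int \<lceil>t * real K\<rceil> - 1" unfolding i_def by simp
  have "real i < t * real K" "t * real K \<le> real (Suc i)" unfolding of_nat_Suc i by linarith+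
  then have "real i / real K < t" "t \<le> real (Suc i) / real K"
    using assms by (auto simp: pos_divide_less_eq pos_le_divide_eq)
  then show ?thesis by (rule that)
qed

lemma uniform_modulus:
  fixes f :: "real \<Rightarrow> real"
  assumes "continuous_on {0..T} f" "0 < w"
  obtains d where "0 < d" "\<And>s t. s \<in> {0..T} \<Longrightarrow> t \<in> {0..T} \<Longrightarrow> \<bar>s - t\<bar> < d \<Longrightarrow> \<bar>f s - f t\<bar> \<le> w"
proof -
  have "uniformly_continuous_on {0..T} f" using assms by (intro compact_uniformly_continuous) auto
  then obtain d where "0 < d" "\<forall>t\<in>{0..T}. \<forall>s\<in>{0..T}. \<bar>s - t\<bar> < d \<longrightarrow> \<bar>f s - f t\<bar> < w"
    using assms(2) unfolding uniformly_continuous_on_def dist_real_def by blast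
  then show ?thesis using that[of d] by (simp add: less_imp_le)
qed

lemma eventually_Suc_large:
  shows "\<forall>\<^sub>F k in sequentially. (a::real) \<le> real (Suc k)"
    "0 < d \<Longrightarrow> \<forall>\<^sub>F k in sequentially. 1 / real (Suc k) < d"
proof -
  obtain n :: nat where n: "a \<le> real n" using real_arch_simple by blast
  show "\<forall>\<^sub>F k in sequentially. a \<le> real (Suc k)"
    using eventually_ge_at_top[of n] by eventually_elim (use n in auto)
  show "0 < d \<Longrightarrow> \<forall>\<^sub>F k in sequentially. 1 / real (Suc k) < d"
    using order_tendstoD(2)[OF LIMSEQ_inverse_real_of_nat] by (simp add: inverse_eq_divide)
qed

section \<open>Euler sums of geometric Brownian motion\<close>

context brownian
begin

context
  fixes z m \<nu> :: real
  assumes z: "0 < z" and nu: "0 < \<nu>"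
begin

abbreviation Z :: "'a process" where "Z \<equiv> gbm z m \<nu> B"

text \<open>The steps of length 1 / (k + 1) reach up to time k + 1, so one sequence serves all
  horizons. The minimum keeps the coefficients bounded, as simple integrands must be; for a given
  path on a given interval it is inactive once k is large.\<close>

definition euler :: "nat \<Rightarrow> 'a simple_integrand" where
  "euler k = (Suc k * Suc k, \<lambda>i. real i / real (Suc k), \<lambda>i \<omega>. min (real (Suc k))
    (\<nu> * Z (real i / real (Suc k)) \<omega>))"

text \<open>The integral of \<nu> Z as the equation for Z dictates it. That the Euler sums converge
  to it is shown directly, in place of Ito's formula.\<close>

definition gbm_integral :: "'a process" where
  "gbm_integral t \<omega> = Z t \<omega> - z - m * (LBINT u:{0..t}. Z u \<omega>)"

text \<open>The accumulated errors of the steps, weighted by the current value of Z: the one part of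
  the discrepancy that is small for probabilistic rather than pathwise reasons.\<close>

definition euler_martingale :: "nat \<Rightarrow> nat \<Rightarrow> 'a \<Rightarrow> real" where
  "euler_martingale k = transform (\<lambda>l. Z (real l / real (Suc k)))
     (\<lambda>l \<omega>. gbm_error m \<nu> (1 / real (Suc k)) (B (real (Suc l) / real (Suc k)) \<omega> - B
       (real l / real (Suc k)) \<omega>))"

lemma gbm_adapted: "adapted F Z"
  unfolding adapted_def
proof (intro allI impI)
  fix t :: real assume t: "0 \<le> t"
  have [measurable]: "B t \<in> borel_measurable (F t)" "B 0 \<in> borel_measurable (F t)"
    using adap[of t t] measurable_F_mono[OF adap[of 0 0]] t by auto
  show "Z t \<in> borel_measurable (F t)" unfolding gbm_def[abs_def] by measurable
qed

lemma gbm_continuous: "continuous_paths M Z"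
  using bm unfolding brownian_motion_def continuous_paths_def gbm_def by (auto intro!: continuous_intros)

lemma gbm_continuous_on: "\<omega> \<in> space M \<Longrightarrow> continuous_on {0..T} (\<lambda>t. Z t \<omega>)"
  using gbm_continuous unfolding continuous_paths_def by (auto intro: continuous_on_subset[of "{0..}"])

lemma gbm_bounded:
  assumes "\<omega> \<in> space M"
  obtains R where "0 \<le> R" "\<And>t. t \<in> {0..T} \<Longrightarrow> Z t \<omega> \<le> R"
proof -
  have "bounded ((\<lambda>t. Z t \<omega>) ` {0..T})"
    using gbm_continuous_on[OF assms] by (intro compact_imp_bounded compact_continuous_image) auto
  then obtain a where a: "\<forall>t\<in>{0..T}. \<bar>Z t \<omega>\<bar> \<le> a" unfolding bounded_iff by auto
  show ?thesis by (rule that[of "\<bar>a\<bar>"]) (use a in fastforce)+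
qed

lemma gbm_integral_continuous: "continuous_paths M gbm_integral"
  unfolding continuous_paths_def gbm_integral_def
proof
  fix \<omega> assume om: "\<omega> \<in> space M"
  have c: "continuous_on {0..} (\<lambda>t. Z t \<omega>)" using gbm_continuous om by (simp add: continuous_paths_def)
  show "continuous_on {0..} (\<lambda>t. Z t \<omega> - z - m * (LBINT u:{0..t}. Z u \<omega>))"
    by (intro continuous_on_diff continuous_on_mult continuous_on_const c continuous_indefinite_integral)
qed

lemma gbm_integral_measurable: "0 \<le> t \<Longrightarrow> gbm_integral t \<in> borel_measurable M"
proof -
  assume t: "0 \<le> t"
  have [measurable]: "Z t \<in> borel_measurable M" by (rule adapted_M[OF gbm_adapted t])
  have [measurable]: "(\<lambda>\<omega>. LBINT u:{0..t}. Z u \<omega>) \<in> borel_measurable M"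
    using integral_measurable[OF measurable_adapted_continuous[OF gbm_adapted gbm_continuous], of
      "\<lambda>_. 1" t] by simp
  show ?thesis unfolding gbm_integral_def[abs_def] by measurable
qed

lemma euler_simple: "is_simple_integrand M F (euler k)"
  unfolding euler_def is_simple_integrand.simps
proof (intro conjI allI impI)
  fix i
  show "real i / real (Suc k) \<le> real (Suc i) / real (Suc k)" by (intro divide_right_mono) auto
  have [measurable]: "Z (real i / real (Suc k)) \<in> borel_measurable (F (real i / real (Suc k)))"
    by (rule adapted_F[OF gbm_adapted]) simp
  show "(\<lambda>\<omega>. min (real (Suc k)) (\<nu> * Z (real i / real (Suc k)) \<omega>)) \<in> borel_measurable
    (F (real i / real (Suc k)))"
    by measurable
  have "0 \<le> \<nu> * Z (real i / real (Suc k)) \<omega>" for \<omega> using nu gbm_pos[OF z, of m \<nu> B _ \<omega>]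
    by (simp add: less_imp_le)
  then show "\<exists>C. \<forall>\<omega>\<in>space M. \<bar>min (real (Suc k)) (\<nu> * Z (real i / real (Suc k)) \<omega>)\<bar> \<le> C"
    by (intro exI[of _ "real (Suc k)"]) (auto simp: abs_of_nonneg simp del: of_nat_Suc)
qed simp

text \<open>For a given path and large k, the truncation is inactive, the horizon is covered, and
  cells are shorter than a modulus of continuity. The Euler integrand is then \<nu> Z at the left
  end of the cell, close to \<open>H\<close> at almost every time.\<close>

lemma euler_path_L2:
  assumes om: "\<omega> \<in> space M" and HZ: "AE t in lborel. 0 \<le> t \<longrightarrow> H t \<omega> = \<nu> * Z t \<omega>" and e: "0 < (e::real)"
  shows "\<forall>\<^sub>F k in sequentially.
    (\<integral>\<^sup>+t\<in>{0..real p}. ennreal ((simple_process (euler k) t \<omega> - H t \<omega>)\<^sup>2) \<partial>lborel) \<le> ennreal e"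
proof -
  obtain R where R: "0 \<le> R" "\<And>t. t \<in> {0..real p} \<Longrightarrow> Z t \<omega> \<le> R" by (rule gbm_bounded[OF om])
    (rule that, assumption+)
  define w where "w = sqrt (e / (real p + 1)) / \<nu>"
  have w: "0 < w" "(\<nu> * w)\<^sup>2 * real p \<le> e"
    unfolding w_def using nu divide_add_one_bounds[of "real p" e] e by (auto simp: mult.commute)
  obtain d where d: "0 < d" "\<And>s t. s \<in> {0..real p} \<Longrightarrow> t \<in> {0..real p} \<Longrightarrow> \<bar>s - t\<bar> < d \<Longrightarrow> \<bar>Z s \<omega> - Z t \<omega>\<bar> \<le> w"
    by (rule uniform_modulus[OF gbm_continuous_on[OF om] w(1)]) (rule that, assumption+)
  show ?thesis
    using eventually_Suc_large(2)[OF d(1)] eventually_Suc_large(1)[of "\<nu> * R"]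
      eventually_Suc_large(1)[of "real p"]
  proof eventually_elim
    case (elim k)
    let ?K = "Suc k"
    have "(\<integral>\<^sup>+t\<in>{0..real p}. ennreal ((simple_process (euler k) t \<omega> - H t \<omega>)\<^sup>2) \<partial>lborel) \<le>
        (\<integral>\<^sup>+t. ennreal ((\<nu> * w)\<^sup>2) * indicator {0..real p} t \<partial>lborel)"
    proof (rule nn_integral_mono_AE)
      show "AE t in lborel. ennreal ((simple_process (euler k) t \<omega> - H t \<omega>)\<^sup>2) * indicator {0..real p} t \<le>
          ennreal ((\<nu> * w)\<^sup>2) * indicator {0..real p} t"
        using HZ AE_lborel_singleton[of "0::real"]
      proof eventually_elim
        case (elim t)
        show ?case
        proof (cases "t \<in> {0..real p}")
          case True
          then have t: "0 < t" "t \<le> real p" using elim by auto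
          obtain i where i: "real i / real ?K < t" "t \<le> real (Suc i) / real ?K"
            by (rule ceiling_cell[OF zero_less_Suc t(1)])
          have "real i / real ?K < real p" using i t by linarith
          then have "real i < real p * real ?K" by (simp add: pos_divide_less_eq del: of_nat_Suc)
          also have "\<dots> \<le> real ?K * real ?K" using \<open>real p \<le> real ?K\<close> by (intro mult_right_mono) auto
          finally have "i < ?K * ?K" unfolding of_nat_mult[symmetric] of_nat_less_iff .
          from simple_process_uniform[OF zero_less_Suc this i]
          have sp: "simple_process (euler k) t \<omega> = min (real ?K) (\<nu> * Z (real i / real ?K) \<omega>)"
            unfolding euler_def .
          have iT: "real i / real ?K \<in> {0..real p}" using i t by auto
          have "\<nu> * Z (real i / real ?K) \<omega> \<le> \<nu> * R" using R(2)[OF iT] nu by (intro mult_left_mono) auto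
          then have sp': "simple_process (euler k) t \<omega> = \<nu> * Z (real i / real ?K) \<omega>"
            unfolding sp using \<open>\<nu> * R \<le> real ?K\<close> by simp
          have "real (Suc i) / real ?K = real i / real ?K + 1 / real ?K" by (simp add: add_divide_distrib)
          then have "\<bar>real i / real ?K - t\<bar> < d" using i \<open>1 / real ?K < d\<close> by auto
          then have "\<bar>Z (real i / real ?K) \<omega> - Z t \<omega>\<bar> \<le> w" using d(2)[OF iT True] by simp
          then have "\<bar>simple_process (euler k) t \<omega> - H t \<omega>\<bar> \<le> \<nu> * w"
            using elim t nu unfolding sp' by (simp add: right_diff_distrib[symmetric] abs_mult)
          then have "(simple_process (euler k) t \<omega> - H t \<omega>)\<^sup>2 \<le> (\<nu> * w)\<^sup>2"
            using nu w by (simp add: abs_le_square_iff[symmetric])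
          then show ?thesis by (intro mult_right_mono ennreal_leI) auto
        qed simp
      qed
    qed
    also have "\<dots> = ennreal ((\<nu> * w)\<^sup>2) * ennreal (real p)" by (simp add: nn_integral_cmult_indicator)
    also have "\<dots> = ennreal ((\<nu> * w)\<^sup>2 * real p)" by (rule ennreal_mult[symmetric]) auto
    also have "\<dots> \<le> ennreal e" using w(2) by (rule ennreal_leI)
    finally show ?case .
  qed
qed

text \<open>Summation of the one-step identity: the increment of Z is Z times the sum of the error,
  exp (m u) - 1 and \<nu> times the Brownian increment.\<close>

lemma gbm_telescope:
  "(\<Sum>l<i. \<nu> * Z (real l / real (Suc k)) \<omega> * (B (real (Suc l) / real (Suc k)) \<omega>
    - B (real l / real (Suc k)) \<omega>)) =
    Z (real i / real (Suc k)) \<omega> - z - euler_martingale k i \<omega>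
      - (exp (m / real (Suc k)) - 1) * (\<Sum>l<i. Z (real l / real (Suc k)) \<omega>)"
proof (induction i)
  case 0
  then show ?case by (simp add: euler_martingale_def gbm_def)
next
  case (Suc i)
  let ?a = "real i / real (Suc k)" and ?b = "real (Suc i) / real (Suc k)"
  have "?b - ?a = 1 / real (Suc k)" by (simp add: diff_divide_distrib[symmetric])
  then have "Z ?b \<omega> = Z ?a \<omega> * exp ((m - \<nu>\<^sup>2 / 2) * (1 / real (Suc k)) + \<nu> * (B ?b \<omega> - B ?a \<omega>))"
    using gbm_increment[of z m \<nu> B ?b \<omega> ?a] by simp
  also have "\<dots> = Z ?a \<omega> * (gbm_error m \<nu> (1 / real (Suc k)) (B ?b \<omega> - B ?a \<omega>)
    + exp (m / real (Suc k)) + \<nu> * (B ?b \<omega> - B ?a \<omega>))"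
    by (simp add: gbm_error_def)
  finally have step: "Z ?b \<omega> - Z ?a \<omega> = Z ?a \<omega> * gbm_error m \<nu> (1 / real (Suc k)) (B ?b \<omega> - B ?a \<omega>)
      + (exp (m / real (Suc k)) - 1) * Z ?a \<omega> + \<nu> * Z ?a \<omega> * (B ?b \<omega> - B ?a \<omega>)"
    by (simp add: algebra_simps del: of_nat_Suc)
  show ?case using Suc step
    by (simp add: euler_martingale_def transform_Suc distrib_left del: of_nat_Suc)
qed

text \<open>The index j is that of the last grid point up to t. Every term but the martingale is
  small for the given path, uniformly in t.\<close>

lemma euler_path_uniform:
  assumes om: "\<omega> \<in> space M" and e: "0 < (e::real)"
  shows "\<forall>\<^sub>F k in sequentially. \<forall>t\<in>{0..real p}. \<exists>j\<le>p * Suc k.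
    \<bar>simple_integral B (euler k) t \<omega> - gbm_integral t \<omega>\<bar> \<le> \<bar>euler_martingale k j \<omega>\<bar> + e"
proof -
  obtain R where R: "0 \<le> R" "\<And>t. t \<in> {0..real p} \<Longrightarrow> Z t \<omega> \<le> R" by (rule gbm_bounded[OF om])
    (rule that, assumption+)
  \<comment> \<open>Four errors of this size: the unfinished last cell of the Euler sum, the
    movement of \<open>gbm_integral\<close> over that cell, compounding against simple growth, and
    the Riemann sum of Z.\<close>
  define e4 where "e4 = e / 4"
  have e4: "0 < e4" "4 * e4 = e" using e by (auto simp: e4_def)
  define w1 where "w1 = e4 / (\<bar>m\<bar> * real p + 1)"
  have w1: "0 < w1" "\<bar>m\<bar> * real p * w1 \<le> e4"
    unfolding w1_def using divide_add_one_bounds[of "\<bar>m\<bar> * real p" e4] e4 by auto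
  define w2 where "w2 = e4 / (\<nu> * R + 1)"
  have w2: "0 < w2" "\<nu> * R * w2 \<le> e4"
    unfolding w2_def using divide_add_one_bounds[of "\<nu> * R" e4] e4 nu R(1) by auto
  obtain d1 where d1: "0 < d1" "\<And>s t. s \<in> {0..real p} \<Longrightarrow> t \<in> {0..real p} \<Longrightarrow> \<bar>s - t\<bar> < d1 \<Longrightarrow>
    \<bar>Z s \<omega> - Z t \<omega>\<bar> \<le> w1"
    by (rule uniform_modulus[OF gbm_continuous_on[OF om] w1(1)]) (rule that, assumption+)
  obtain d2 where d2: "0 < d2" "\<And>s t. s \<in> {0..real p} \<Longrightarrow> t \<in> {0..real p} \<Longrightarrow> \<bar>s - t\<bar> < d2 \<Longrightarrow>
    \<bar>B s \<omega> - B t \<omega>\<bar> \<le> w2"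
    by (rule uniform_modulus[OF continuous_B[OF om] w2(1)]) (rule that, assumption+)
  have Ic: "continuous_on {0..real p} (\<lambda>t. gbm_integral t \<omega>)"
    using gbm_integral_continuous om unfolding continuous_paths_def
      by (auto intro: continuous_on_subset[of "{0..}"])
  obtain d3 where d3: "0 < d3" "\<And>s t. s \<in> {0..real p} \<Longrightarrow> t \<in> {0..real p} \<Longrightarrow> \<bar>s - t\<bar> < d3 \<Longrightarrow>
    \<bar>gbm_integral s \<omega> - gbm_integral t \<omega>\<bar> \<le> e4"
    by (rule uniform_modulus[OF Ic e4(1)]) (rule that, assumption+)
  have "(\<lambda>k. real p * R * (real (Suc k) * \<bar>exp (m / real (Suc k)) - 1 - m / real (Suc k)\<bar>)) \<longlonglongrightarrow> real p
    * R * 0"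
    by (intro tendsto_mult tendsto_const exp_remainder_small)
  then have rem: "\<forall>\<^sub>F k in sequentially. real p * R * (real (Suc k) * \<bar>exp (m / real (Suc k)) - 1
    - m / real (Suc k)\<bar>) < e4"
    by (rule order_tendstoD(2)) (use e4 in simp)
  show ?thesis
    using eventually_Suc_large(2)[OF d1(1)] eventually_Suc_large(2)[OF d2(1)]
      eventually_Suc_large(2)[OF d3(1)]
      eventually_Suc_large(1)[of "\<nu> * R"] eventually_Suc_large(1)[of "real (Suc p)"] rem
  proof eventually_elim
    case (elim k)
    let ?K = "Suc k"
    show ?case
    proof
      fix t assume t: "t \<in> {0..real p}"
      define i where "i = nat \<lfloor>t * real ?K\<rfloor>"
      define a where "a = real i / real ?K"
      have c: "a \<le> t" "t < real (Suc i) / real ?K"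
        using floor_cell[of ?K t] t by (auto simp: i_def a_def)
      have ip: "i \<le> p * ?K"
      proof -
        have "real i / real ?K \<le> real p" using c t by (simp add: a_def)
        then have "real i \<le> real (p * ?K)" unfolding of_nat_mult
          by (simp add: pos_divide_le_eq del: of_nat_Suc)
        then show ?thesis by (simp only: of_nat_le_iff)
      qed
      \<comment> \<open>The inequality is strict because the cell of t = p has index p (k + 1),
        which must still be among the cells of the integrand.\<close>
      have "p < ?K" using elim by simp
      then have "p * ?K < ?K * ?K" by (rule mult_strict_right_mono) simp
      then have iK: "i < ?K * ?K" using ip by linarith
      have aT: "a \<in> {0..real p}" using c t by (auto simp: a_def)
      have close: "\<bar>t - a\<bar> < 1 / real ?K \<or> t = a"
        using c by (auto simp: a_def add_divide_distrib)
      have lT: "real l / real ?K \<in> {0..real p}" if "l \<le> i" for l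
      proof -
        have "real l / real ?K \<le> a" unfolding a_def using that by (intro divide_right_mono) auto
        then show ?thesis using aT by auto
      qed
      have min: "min (real ?K) (\<nu> * Z (real l / real ?K) \<omega>) = \<nu> * Z (real l / real ?K) \<omega>" if "l \<le> i" for l
      proof -
        have "\<nu> * Z (real l / real ?K) \<omega> \<le> \<nu> * R" using R(2)[OF lT[OF that]] nu
          by (intro mult_left_mono) auto
        then show ?thesis using elim by simp
      qed
      have "simple_integral B (euler k) t \<omega> =
         (\<Sum>l<i. \<nu> * Z (real l / real ?K) \<omega> * (B (real (Suc l) / real ?K) \<omega> - B (real l / real ?K)
           \<omega>)) + \<nu> * Z a \<omega> * (B t \<omega> - B a \<omega>)"
        unfolding euler_def using simple_integral_uniform[OF zero_less_Suc iK, of k t B _ \<omega>] c min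
        by (simp add: a_def del: of_nat_Suc)
      moreover have "\<bar>\<nu> * Z a \<omega> * (B t \<omega> - B a \<omega>)\<bar> \<le> e4"
      proof -
        have "\<bar>B t \<omega> - B a \<omega>\<bar> \<le> w2" using close
        proof
          assume "\<bar>t - a\<bar> < 1 / real ?K"
          then show ?thesis using d2(2)[OF t aT] elim by linarith
        qed (use w2 in simp)
        moreover have "\<bar>\<nu> * Z a \<omega>\<bar> \<le> \<nu> * R"
          using R(2)[OF aT] nu gbm_pos[OF z, of m \<nu> B a \<omega>] by (simp add: abs_mult)
        ultimately have "\<bar>\<nu> * Z a \<omega> * (B t \<omega> - B a \<omega>)\<bar> \<le> \<nu> * R * w2"
          unfolding abs_mult[of "\<nu> * Z a \<omega>"] using R(1) nu by (intro mult_mono) auto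
        then show ?thesis using w2 by linarith
      qed
      moreover have "\<bar>gbm_integral t \<omega> - gbm_integral a \<omega>\<bar> \<le> e4" using close
      proof
        assume "\<bar>t - a\<bar> < 1 / real ?K"
        then show ?thesis using d3(2)[OF t aT] elim by linarith
      qed (use e4 in simp)
      moreover have "\<bar>(exp (m / real ?K) - 1 - m / real ?K) * (\<Sum>l<i. Z (real l / real ?K) \<omega>)\<bar> \<le> e4"
      proof -
        have "0 \<le> (\<Sum>l<i. Z (real l / real ?K) \<omega>)" by (intro sum_nonneg)
          (simp add: gbm_pos[OF z] less_imp_le)
        moreover have "(\<Sum>l<i. Z (real l / real ?K) \<omega>) \<le> (\<Sum>l<i. R)" using R(2) lT by (intro sum_mono) auto
        moreover have "(\<Sum>l<i. R) \<le> real (p * ?K) * R" using ip R(1)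
          by (simp add: mult_right_mono del: of_nat_mult of_nat_Suc)
        ultimately have s: "\<bar>\<Sum>l<i. Z (real l / real ?K) \<omega>\<bar> \<le> real (p * ?K) * R" by linarith
        have "\<bar>exp (m / real ?K) - 1 - m / real ?K\<bar> * \<bar>\<Sum>l<i. Z (real l / real ?K) \<omega>\<bar> \<le>
          \<bar>exp (m / real ?K) - 1 - m / real ?K\<bar> * (real (p * ?K) * R)"
          using s by (intro mult_left_mono) auto
        also have "\<dots> = real p * R * (real ?K * \<bar>exp (m / real ?K) - 1 - m / real ?K\<bar>)"
          unfolding of_nat_mult by (simp add: ac_simps del: of_nat_Suc)
        also have "\<dots> \<le> e4" using elim by simp
        finally show ?thesis by (simp add: abs_mult)
      qed
      moreover have "\<bar>m / real ?K * (\<Sum>l<i. Z (real l / real ?K) \<omega>) - m * (LBINT u:{0..a}. Z u \<omega>)\<bar> \<le> e4"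
      proof -
        have "\<bar>(\<Sum>l<i. Z (real l / real ?K) \<omega> * (real (Suc l) / real ?K - real l / real ?K))
          - (LBINT u:{0..real i / real ?K}. Z u \<omega>)\<bar> \<le> w1 * (real i / real ?K)"
        proof (rule riemann_sum_error[OF uniform_grid[OF zero_less_Suc] gbm_continuous_on[OF om] _ ip])
          fix l t assume l: "l < p * ?K" and tl: "t \<in> {real l / real ?K..real (Suc l) / real ?K}"
          have "real (Suc l) \<le> real (p * ?K)" using l by (simp only: of_nat_le_iff Suc_le_eq)
          then have "real (Suc l) / real ?K \<le> real p"
            unfolding of_nat_mult by (simp add: pos_divide_le_eq del: of_nat_Suc)
          moreover have "real (Suc l) / real ?K = real l / real ?K + 1 / real ?K"
            by (simp add: add_divide_distrib)
          moreover have "0 \<le> real l / real ?K" "0 < 1 / real ?K" by simp_all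
          moreover have "real l / real ?K \<le> t" "t \<le> real (Suc l) / real ?K" using tl by simp_all
          moreover note \<open>1 / real ?K < d1\<close>
          ultimately have "0 \<le> t" "t \<le> real p" "0 \<le> real l / real ?K" "real l / real ?K \<le> real p"
            "\<bar>t - real l / real ?K\<bar> < d1"
            by linarith+
          then have "t \<in> {0..real p}" "real l / real ?K \<in> {0..real p}" "\<bar>t - real l / real ?K\<bar> < d1"
            by simp_all
          then show "\<bar>Z t \<omega> - Z (real l / real ?K) \<omega>\<bar> \<le> w1" by (rule d1(2))
        qed
        also have "w1 * (real i / real ?K) \<le> w1 * real p" using aT w1(1) by (intro mult_left_mono)
          (auto simp: a_def)
        finally have "\<bar>(\<Sum>l<i. Z (real l / real ?K) \<omega> * (real (Suc l) / real ?K - real l / real ?K))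
          - (LBINT u:{0..a}. Z u \<omega>)\<bar> \<le> w1 * real p"
          by (simp add: a_def)
        moreover have "(\<Sum>l<i. Z (real l / real ?K) \<omega> * (real (Suc l) / real ?K - real l / real ?K))
          = (1 / real ?K) * (\<Sum>l<i. Z (real l / real ?K) \<omega>)"
          unfolding sum_distrib_left by (intro sum.cong) (auto simp: diff_divide_distrib[symmetric])
        ultimately have "\<bar>m\<bar> * \<bar>(1 / real ?K) * (\<Sum>l<i. Z (real l / real ?K) \<omega>)
          - (LBINT u:{0..a}. Z u \<omega>)\<bar> \<le> \<bar>m\<bar> * (w1 * real p)"
          by (intro mult_left_mono) auto
        then show ?thesis using w1(2)
          by (simp add: abs_mult[symmetric] right_diff_distrib ac_simps del: of_nat_Suc)
      qed
      moreover have "(exp (m / real ?K) - 1) * (\<Sum>l<i. Z (real l / real ?K) \<omega>) =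
        (exp (m / real ?K) - 1 - m / real ?K) * (\<Sum>l<i. Z (real l / real ?K) \<omega>) + m / real ?K *
          (\<Sum>l<i. Z (real l / real ?K) \<omega>)"
        by (simp add: left_diff_distrib del: of_nat_Suc)
      moreover have "gbm_integral a \<omega> = Z a \<omega> - z - m * (LBINT u:{0..a}. Z u \<omega>)"
        by (simp add: gbm_integral_def)
      ultimately have "\<bar>simple_integral B (euler k) t \<omega> - gbm_integral t \<omega>\<bar> \<le>
        \<bar>euler_martingale k i \<omega>\<bar> + 4 * e4"
        unfolding gbm_telescope a_def[symmetric] by linarith
      then show "\<exists>j\<le>p * ?K. \<bar>simple_integral B (euler k) t \<omega> - gbm_integral t \<omega>\<bar> \<le>
        \<bar>euler_martingale k j \<omega>\<bar> + e"
        using ip e4 by auto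
    qed
  qed
qed

end

lemma euler_martingale_measurable:
  assumes z: "0 < z" and nu: "0 < \<nu>"
  shows "euler_martingale z m \<nu> k j \<in> borel_measurable M"
proof -
  have Bm: "B t \<in> borel_measurable M" if "0 \<le> t" for t using measurable_F[OF adap[of t t]] that by auto
  have Zm: "gbm z m \<nu> B t \<in> borel_measurable M" if "0 \<le> t" for t
    using Bm[OF that] Bm[of 0] unfolding gbm_def[abs_def] by measurable
  have g: "gbm_error m \<nu> u \<in> borel_measurable borel" for u unfolding gbm_error_def[abs_def] by measurable
  show ?thesis unfolding euler_martingale_def[OF z nu] transform_def[abs_def]
    by (intro borel_measurable_sum borel_measurable_times Zm measurable_compose[OF _ g]
      borel_measurable_diff Bm) auto
qed

text \<open>For a given path with Z at most R on [0, p], the bracket is at most p R^2 (k + 1) times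
  the error variance, which tends to 0 by \<open>gbm_error_var_small\<close>;
  \<open>transform_maximal\<close> turns a small bracket into a small maximum.\<close>

lemma euler_martingale_small:
  assumes z: "0 < z" and nu: "0 < \<nu>" and p: "0 < p" and e: "0 < (e::real)"
  shows "(\<lambda>k. prob {\<omega>\<in>space M. \<exists>j\<le>p * Suc k. e < \<bar>euler_martingale z m \<nu> k j \<omega>\<bar>}) \<longlonglongrightarrow> 0"
proof -
  let ?Z = "gbm z m \<nu> B" and ?v = "\<lambda>k. gbm_error_var m \<nu> (1 / real (Suc k))"
  have v: "0 < ?v k" for k using nu by (intro gbm_error_var_pos) auto
  have bracket: "(\<lambda>k. prob {\<omega>\<in>space M. \<delta> < (\<Sum>i<p * Suc k. (?Z (real i / real (Suc k)) \<omega>)\<^sup>2 * ?v k)})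
    \<longlonglongrightarrow> 0" if d: "0 < \<delta>" for \<delta>
  proof (rule prob_tendsto_0)
    fix k
    have [measurable]: "?Z (real i / real (Suc k)) \<in> borel_measurable M" for i
      by (rule adapted_M[OF gbm_adapted[OF z nu]]) simp
    show "{\<omega>\<in>space M. \<delta> < (\<Sum>i<p * Suc k. (?Z (real i / real (Suc k)) \<omega>)\<^sup>2 * ?v k)} \<in> events" by measurable
  next
    fix \<omega> assume om: "\<omega> \<in> space M"
    obtain R where R: "0 \<le> R" "\<And>t. t \<in> {0..real p} \<Longrightarrow> ?Z t \<omega> \<le> R"
      by (rule gbm_bounded[OF z nu om]) (rule that, assumption+)
    have "(\<lambda>k. real p * R\<^sup>2 * (real (Suc k) * ?v k)) \<longlonglongrightarrow> real p * R\<^sup>2 * 0"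
      by (intro tendsto_mult tendsto_const gbm_error_var_small)
    then have "\<forall>\<^sub>F k in sequentially. real p * R\<^sup>2 * (real (Suc k) * ?v k) < \<delta>"
      by (rule order_tendstoD(2)) (use d in simp)
    then show "\<forall>\<^sub>F k in sequentially. \<omega> \<notin> {\<omega>\<in>space M. \<delta> <
      (\<Sum>i<p * Suc k. (?Z (real i / real (Suc k)) \<omega>)\<^sup>2 * ?v k)}"
    proof eventually_elim
      case (elim k)
      have "(\<Sum>i<p * Suc k. (?Z (real i / real (Suc k)) \<omega>)\<^sup>2 * ?v k) \<le> (\<Sum>i<p * Suc k. R\<^sup>2 * ?v k)"
      proof (intro sum_mono mult_right_mono)
        fix i assume "i \<in> {..<p * Suc k}"
        then have "real i \<le> real (p * Suc k)" by (simp only: of_nat_le_iff lessThan_iff less_imp_le)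
        then have "real i / real (Suc k) \<le> real p" unfolding of_nat_mult
          by (simp add: pos_divide_le_eq del: of_nat_Suc)
        then have "?Z (real i / real (Suc k)) \<omega> \<le> R" by (intro R) auto
        then show "(?Z (real i / real (Suc k)) \<omega>)\<^sup>2 \<le> R\<^sup>2"
          using gbm_pos[OF z, of m \<nu> B _ \<omega>] by (intro power_mono) (auto simp: less_imp_le)
        show "0 \<le> ?v k" using v[of k] by simp
      qed
      also have "\<dots> = real p * R\<^sup>2 * (real (Suc k) * ?v k)"
        unfolding sum_constant card_lessThan of_nat_mult by (simp only: ac_simps)
      finally show ?case using elim by (simp add: not_less del: of_nat_Suc)
    qed
  qed
  have bound: "prob {\<omega>\<in>space M. \<exists>j\<le>p * Suc k. e < \<bar>euler_martingale z m \<nu> k j \<omega>\<bar>} \<le>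
    prob {\<omega>\<in>space M. \<delta> < (\<Sum>i<p * Suc k. (?Z (real i / real (Suc k)) \<omega>)\<^sup>2 * ?v k)} + \<delta> / e\<^sup>2"
    if d: "0 < \<delta>" for \<delta> k
  proof -
    let ?g = "\<lambda>l. real l / real (Suc k)"
    have step: "?g (Suc i) - ?g i = 1 / real (Suc k)" for i by (simp add: diff_divide_distrib[symmetric])
    have u: "0 < 1 / real (Suc k)" by simp
    interpret G: indep_increments M "p * Suc k" "\<lambda>i. F (?g i)"
      "\<lambda>i \<omega>. gbm_error m \<nu> (1 / real (Suc k)) (B (?g (Suc i)) \<omega> - B (?g i) \<omega>)" "\<lambda>_. ?v k"
    proof (rule indep_increments_grid[OF uniform_grid[OF zero_less_Suc], where
      \<psi>="\<lambda>_. gbm_error m \<nu> (1 / real (Suc k))"])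
      show "gbm_error m \<nu> (1 / real (Suc k)) \<in> borel_measurable borel"
        unfolding gbm_error_def[abs_def] by measurable
    qed (unfold step, (intro gbm_error_moments[OF u])+)
    show ?thesis unfolding euler_martingale_def[OF z nu]
    proof (rule G.transform_maximal[OF _ v e less_imp_le[OF d] sets.top])
      show "?Z (?g i) \<in> borel_measurable (F (?g i))" for i by (rule adapted_F[OF gbm_adapted[OF z nu]]) simp
    qed
  qed
  show ?thesis
  proof (rule LIMSEQ_I)
    fix r :: real assume r: "0 < r"
    define \<delta> where "\<delta> = e\<^sup>2 * (r / 2)"
    have d: "0 < \<delta>" "\<delta> / e\<^sup>2 = r / 2" using e r by (auto simp: \<delta>_def)
    have "\<forall>\<^sub>F k in sequentially. prob {\<omega>\<in>space M. \<delta> <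
      (\<Sum>i<p * Suc k. (?Z (real i / real (Suc k)) \<omega>)\<^sup>2 * ?v k)} < r / 2"
      by (rule order_tendstoD(2)[OF bracket[OF d(1)]]) (use r in simp)
    then obtain N where N: "\<And>k. N \<le> k \<Longrightarrow>
      prob {\<omega>\<in>space M. \<delta> < (\<Sum>i<p * Suc k. (?Z (real i / real (Suc k)) \<omega>)\<^sup>2 * ?v k)} < r / 2"
      unfolding eventually_sequentially by blast
    have "norm (prob {\<omega>\<in>space M. \<exists>j\<le>p * Suc k. e < \<bar>euler_martingale z m \<nu> k j \<omega>\<bar>} - 0) < r"
      if "N \<le> k" for k
      using bound[OF d(1), of k] N[OF that] unfolding d(2) by (simp del: of_nat_Suc)
    then show "\<exists>no. \<forall>n\<ge>no. norm (prob {\<omega>\<in>space M. \<exists>j\<le>p * Suc n. e < \<bar>euler_martingale z m \<nu> n j \<omega>\<bar>}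
      - 0) < r"
      by blast
  qed
qed

lemma simple_process_joint:
  assumes "is_simple_integrand M F h"
  shows "(\<lambda>y. simple_process h (fst y) (snd y)) \<in> borel_measurable (lborel \<Otimes>\<^sub>M M)"
proof -
  obtain n \<tau> \<xi> where h: "h = (n, \<tau>, \<xi>)" by (cases h)
  have xi: "\<xi> i \<in> borel_measurable M" if "i < n" for i
    using assms that measurable_F unfolding h is_simple_integrand.simps by blast
  show ?thesis unfolding h simple_process.simps
  proof (rule borel_measurable_sum, rule borel_measurable_times)
    fix i assume "i \<in> {..<n}"
    then show "(\<lambda>y. \<xi> i (snd y)) \<in> borel_measurable (lborel \<Otimes>\<^sub>M M)"
      by (intro measurable_compose[OF measurable_snd xi]) simp
    show "(\<lambda>y. indicat_real {\<tau> i<..\<tau> (Suc i)} (fst y)) \<in> borel_measurable (lborel \<Otimes>\<^sub>M M)" by measurable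
  qed
qed

lemma simple_integral_measurable:
  assumes "is_simple_integrand M F h" and t: "0 \<le> t"
  shows "simple_integral B h t \<in> borel_measurable M"
proof -
  obtain n \<tau> \<xi> where h: "h = (n, \<tau>, \<xi>)" by (cases h)
  have xi: "\<xi> i \<in> borel_measurable M" if "i < n" for i
    using assms that measurable_F unfolding h is_simple_integrand.simps by blast
  have tau: "0 \<le> \<tau> l" if "l \<le> n" for l
    using that
  proof (induction l)
    case (Suc l)
    then show ?case using assms(1) unfolding h by (auto dest!: spec[of _ l])
  qed (use assms h in auto)
  have Bm: "B t \<in> borel_measurable M" if "0 \<le> t" for t using measurable_F[OF adap[of t t]] that by auto
  have "simple_integral B h t = (\<lambda>\<omega>. \<Sum>i<n. \<xi> i \<omega> * (B (min t (\<tau> (Suc i))) \<omega> - B (min t (\<tau> i)) \<omega>))"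
    by (rule ext) (simp only: h simple_integral.simps)
  also have "\<dots> \<in> borel_measurable M"
    using tau t by (intro borel_measurable_sum borel_measurable_times borel_measurable_diff Bm xi) auto
  finally show ?thesis .
qed

lemma simple_integral_continuous:
  assumes "is_simple_integrand M F h" and om: "\<omega> \<in> space M"
  shows "continuous_on {0..T} (\<lambda>t. simple_integral B h t \<omega>)"
proof -
  obtain n \<tau> \<xi> where h: "h = (n, \<tau>, \<xi>)" by (cases h)
  have tau: "0 \<le> \<tau> l" if "l \<le> n" for l
    using that
  proof (induction l)
    case (Suc l)
    then show ?case using assms(1) unfolding h by (auto dest!: spec[of _ l])
  qed (use assms h in auto)
  have Bc: "continuous_on {0..T} (\<lambda>t. B (min t a) \<omega>)" if "0 \<le> a" for a
    by (rule continuous_on_compose2[OF continuous_B[OF om, of T]])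
      (use that in \<open>auto intro!: continuous_intros\<close>)
  show ?thesis unfolding h simple_integral.simps
    using tau by (intro continuous_intros Bc) auto
qed

text \<open>\<open>H\<close> agrees with \<nu> Z only almost everywhere, because the risky share is
  a quotient by the wealth and the formula breaks down where the wealth is 0.\<close>

theorem gbm_has_ito_integral:
  assumes z: "0 < z" and nu: "0 < \<nu>" and H: "measurable_adapted M F H"
    and HZ: "AE \<omega> in M. AE t in lborel. 0 \<le> t \<longrightarrow> H t \<omega> = \<nu> * gbm z m \<nu> B t \<omega>"
  shows "has_ito_integral M F B H (gbm_integral z m \<nu>)"
proof -
  let ?Z = "gbm z m \<nu> B" and ?I = "gbm_integral z m \<nu>" and ?h = "euler z m \<nu>"
  have sq: "AE \<omega> in M. \<forall>T\<ge>0. (\<integral>\<^sup>+t\<in>{0..T}. ennreal ((H t \<omega>)\<^sup>2) \<partial>lborel) < \<infinity>"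
    using HZ AE_space
  proof eventually_elim
    case (elim \<omega>)
    show ?case
    proof (intro allI impI)
      fix T :: real assume T: "0 \<le> T"
      obtain R where R: "0 \<le> R" "\<And>t. t \<in> {0..T} \<Longrightarrow> ?Z t \<omega> \<le> R"
        by (rule gbm_bounded[OF z nu elim(2)]) (rule that, assumption+)
      have "(\<integral>\<^sup>+t\<in>{0..T}. ennreal ((H t \<omega>)\<^sup>2) \<partial>lborel) \<le>
        (\<integral>\<^sup>+t. ennreal ((\<nu> * R)\<^sup>2) * indicator {0..T} t \<partial>lborel)"
      proof (rule nn_integral_mono_AE)
        show "AE t in lborel. ennreal ((H t \<omega>)\<^sup>2) * indicator {0..T} t \<le>
          ennreal ((\<nu> * R)\<^sup>2) * indicator {0..T} t"
          using elim(1)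
        proof eventually_elim
          case (elim t)
          show ?case
          proof (cases "t \<in> {0..T}")
            case True
            have "(\<nu> * ?Z t \<omega>)\<^sup>2 \<le> (\<nu> * R)\<^sup>2"
              using R(2)[OF True] nu gbm_pos[OF z, of m \<nu> B t \<omega>]
                by (intro power_mono mult_left_mono) (auto simp: less_imp_le)
            then show ?thesis using elim True by (intro mult_right_mono ennreal_leI) auto
          qed simp
        qed
      qed
      also have "\<dots> = ennreal ((\<nu> * R)\<^sup>2) * ennreal T" using T by (simp add: nn_integral_cmult_indicator)
      also have "\<dots> < \<infinity>" by (simp add: ennreal_mult_less_top)
      finally show "(\<integral>\<^sup>+t\<in>{0..T}. ennreal ((H t \<omega>)\<^sup>2) \<partial>lborel) < \<infinity>" .
    qed
  qed
  have L2: "tendsto_0_in_prob M (\<lambda>k \<omega>. \<integral>\<^sup>+t\<in>{0..T}. ennreal ((simple_process (?h k) t \<omega> - H t \<omega>)\<^sup>2)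
    \<partial>lborel)" if T: "0 \<le> T" for T
  proof (rule tendsto_0_in_prob_AE)
    fix k
    have 1: "(\<lambda>y. simple_process (?h k) (fst y) (snd y)) \<in> borel_measurable (lborel \<Otimes>\<^sub>M M)"
      by (rule simple_process_joint[OF euler_simple[OF z nu]])
    have 2: "(\<lambda>y. H (max 0 (fst y)) (snd y)) \<in> borel_measurable (lborel \<Otimes>\<^sub>M M)"
      using measurable_adapted_joint[OF H]
      by (subst measurable_cong_sets[OF sets_pair_measure_cong[OF sets_lborel refl] refl])
        (simp add: split_beta)
    have "(\<lambda>y. ennreal ((simple_process (?h k) (fst y) (snd y) - H (max 0 (fst y)) (snd y))\<^sup>2) *
      indicator {0..T} (fst y))
        \<in> borel_measurable (lborel \<Otimes>\<^sub>M M)" using 1 2 by measurable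
    then have "(\<lambda>y. ennreal ((simple_process (?h k) (snd y) (fst y) - H (max 0 (snd y)) (fst y))\<^sup>2)
      * indicator {0..T} (snd y))
        \<in> borel_measurable (M \<Otimes>\<^sub>M lborel)"
      by (rule measurable_compose[OF measurable_pair_swap'[of M lborel], where
        g="\<lambda>y. ennreal ((simple_process (?h k) (fst y) (snd y) - H (max 0 (fst y)) (snd y))\<^sup>2) *
        indicator {0..T} (fst y)", simplified split_beta fst_conv snd_conv])
    then have "(\<lambda>\<omega>. \<integral>\<^sup>+t. ennreal ((simple_process (?h k) t \<omega> - H (max 0 t) \<omega>)\<^sup>2) * indicator {0..T}
      t \<partial>lborel) \<in> borel_measurable M"
      by (intro lborel.borel_measurable_nn_integral) (simp add: split_beta)
    moreover have "(\<integral>\<^sup>+t. ennreal ((simple_process (?h k) t \<omega> - H (max 0 t) \<omega>)\<^sup>2) * indicator {0..T}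
      t \<partial>lborel) =
       (\<integral>\<^sup>+t\<in>{0..T}. ennreal ((simple_process (?h k) t \<omega> - H t \<omega>)\<^sup>2) \<partial>lborel)" for \<omega>
      by (intro nn_integral_cong) (auto simp: indicator_def max_def)
    ultimately show "(\<lambda>\<omega>. \<integral>\<^sup>+t\<in>{0..T}. ennreal ((simple_process (?h k) t \<omega> - H t \<omega>)\<^sup>2) \<partial>lborel) \<in>
      borel_measurable M"
      by simp
  next
    fix e :: real assume e: "0 < e"
    obtain p :: nat where p: "T \<le> real p" using real_arch_simple by blast
    show "AE \<omega> in M. \<forall>\<^sub>F k in sequentially.
      (\<integral>\<^sup>+t\<in>{0..T}. ennreal ((simple_process (?h k) t \<omega> - H t \<omega>)\<^sup>2) \<partial>lborel) \<le> ennreal e"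
      using HZ AE_space
    proof eventually_elim
      case (elim \<omega>)
      have "\<forall>\<^sub>F k in sequentially.
        (\<integral>\<^sup>+t\<in>{0..real p}. ennreal ((simple_process (?h k) t \<omega> - H t \<omega>)\<^sup>2) \<partial>lborel) \<le> ennreal e"
        using z nu elim(2,1) e by (rule euler_path_L2[where H=H])
      then show ?case
      proof eventually_elim
        case (elim k)
        have "(\<integral>\<^sup>+t\<in>{0..T}. ennreal ((simple_process (?h k) t \<omega> - H t \<omega>)\<^sup>2) \<partial>lborel) \<le>
          (\<integral>\<^sup>+t\<in>{0..real p}. ennreal ((simple_process (?h k) t \<omega> - H t \<omega>)\<^sup>2) \<partial>lborel)"
          using p by (intro nn_integral_mono mult_left_mono) (auto simp: indicator_def)
        then show ?case using elim by (rule order_trans)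
      qed
    qed
  qed
  have ucp: "tendsto_0_in_prob M (\<lambda>k \<omega>. SUP t\<in>{0..T}. ennreal \<bar>simple_integral B (?h k) t \<omega>
    - ?I t \<omega>\<bar>)" if T: "0 \<le> T" for T
    unfolding tendsto_0_in_prob_def
  proof (intro conjI allI impI)
    let ?X = "\<lambda>k \<omega>. SUP t\<in>{0..T}. ennreal \<bar>simple_integral B (?h k) t \<omega> - ?I t \<omega>\<bar>"
    have Ic: "continuous_on {0..T} (\<lambda>t. ?I t \<omega>)" if "\<omega> \<in> space M" for \<omega>
      using gbm_integral_continuous[OF z nu, of m] that unfolding continuous_paths_def
        by (auto intro: continuous_on_subset[of "{0..}"])
    show Xm: "?X k \<in> borel_measurable M" for k
      by (rule sup_measurable[OF T])
        (auto intro!: borel_measurable_diff continuous_on_diff simple_integral_measurable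
          simple_integral_continuous
          euler_simple[OF z nu] gbm_integral_measurable[OF z nu] Ic)
    fix e :: real assume e: "0 < e"
    then have e2: "0 < e / 2" by simp
    obtain p0 :: nat where p0: "T \<le> real p0" using real_arch_simple by blast
    define p where "p = Suc p0"
    have p: "0 < p" "T \<le> real p" using p0 by (auto simp: p_def)
    \<comment> \<open>A large supremum is due either to a large value of the martingale, an event
      bounded by the maximal inequality, or to the remaining errors, an event \<open>C k\<close>
      that each path leaves for good as k grows.\<close>
    define A where "A k = {\<omega>\<in>space M. \<exists>j\<le>p * Suc k. e / 2 < \<bar>euler_martingale z m \<nu> k j \<omega>\<bar>}" for k
    define C where "C k = {\<omega>\<in>space M. ennreal e < ?X k \<omega>} - A k" for k
    have Am: "A k \<in> events" for k
    proof -
      have "A k = (\<Union>j\<in>{..p * Suc k}. {\<omega>\<in>space M. e / 2 < \<bar>euler_martingale z m \<nu> k j \<omega>\<bar>})"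
        by (auto simp: A_def)
      moreover have "{\<omega>\<in>space M. e / 2 < \<bar>euler_martingale z m \<nu> k j \<omega>\<bar>} \<in> events" if "j \<le> p * Suc k" for j
        using euler_martingale_measurable[OF z nu, of m k j] by measurable
      ultimately show ?thesis by auto
    qed
    have Dm: "{\<omega>\<in>space M. ennreal e < ?X k \<omega>} \<in> events" for k using Xm[of k] by measurable
    have Cm: "C k \<in> events" for k unfolding C_def using Dm Am by auto
    have "(\<lambda>k. prob (C k)) \<longlonglongrightarrow> 0"
    proof (rule prob_tendsto_0[OF Cm])
      fix \<omega> assume om: "\<omega> \<in> space M"
      show "\<forall>\<^sub>F k in sequentially. \<omega> \<notin> C k"
        using euler_path_uniform[OF z nu om e2, of p m]
      proof eventually_elim
        case (elim k)
        have "?X k \<omega> \<le> ennreal e" if nA: "\<omega> \<notin> A k"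
        proof (rule SUP_least, rule ennreal_leI)
          fix t assume "t \<in> {0..T}"
          then have "t \<in> {0..real p}" using p by auto
          then obtain j where j: "j \<le> p * Suc k" "\<bar>simple_integral B (?h k) t \<omega> - ?I t \<omega>\<bar> \<le>
            \<bar>euler_martingale z m \<nu> k j \<omega>\<bar> + e / 2"
            using elim by blast
          have "\<not> e / 2 < \<bar>euler_martingale z m \<nu> k j \<omega>\<bar>" using nA j(1) om unfolding A_def by blast
          then show "\<bar>simple_integral B (?h k) t \<omega> - ?I t \<omega>\<bar> \<le> e" using j(2) by linarith
        qed
        then show ?case unfolding C_def by (auto simp: not_less)
      qed
    qed
    moreover have "(\<lambda>k. prob (A k)) \<longlonglongrightarrow> 0" unfolding A_def by (rule euler_martingale_small[OF z nu p(1) e2])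
    ultimately have lim: "(\<lambda>k. prob (A k) + prob (C k)) \<longlonglongrightarrow> 0" using tendsto_add_zero by blast
    show "(\<lambda>k. prob {\<omega>\<in>space M. ennreal e < ?X k \<omega>}) \<longlonglongrightarrow> 0"
    proof (rule tendsto_sandwich[OF _ _ tendsto_const lim])
      show "\<forall>\<^sub>F k in sequentially. prob {\<omega>\<in>space M. ennreal e < ?X k \<omega>} \<le> prob (A k) + prob (C k)"
      proof (rule always_eventually, rule allI)
        fix k
        have "prob {\<omega>\<in>space M. ennreal e < ?X k \<omega>} \<le> prob (A k \<union> C k)"
        proof (rule finite_measure_mono)
          show "{\<omega>\<in>space M. ennreal e < ?X k \<omega>} \<subseteq> A k \<union> C k" unfolding C_def by blast
          show "A k \<union> C k \<in> events" using Am[of k] Cm[of k] by (rule sets.Un)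
        qed
        also have "\<dots> \<le> prob (A k) + prob (C k)" using Am Cm by (intro measure_Un_le) auto
        finally show "prob {\<omega>\<in>space M. ennreal e < ?X k \<omega>} \<le> prob (A k) + prob (C k)" .
      qed
    qed simp
  qed
  show ?thesis unfolding has_ito_integral_def
    using H sq gbm_integral_measurable[OF z nu] gbm_integral_continuous[OF z nu]
      euler_simple[OF z nu] L2 ucp
    by (intro conjI exI[of _ ?h]) auto
qed

end

section \<open>Utility and its conjugate\<close>

text \<open>A convex function lies above its tangent at \<open>c0\<close>, which is Fenchel's
  inequality with the slope at \<open>c0\<close> as multiplier. After scaling to r = c / c0 it
  follows from ln r \<le> r - 1 and 1 + x \<le> exp x.\<close>

lemma powr_tangent:
  fixes c c0 g :: real
  assumes "0 < c" "0 < c0" "1 < g"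
  shows "c0 powr (1 - g) / (g - 1) - c0 powr (- g) * (c - c0) \<le> c powr (1 - g) / (g - 1)"
proof -
  define r where "r = c / c0"
  have r: "0 < r" "c = r * c0" using assms by (auto simp: r_def)
  have "(1 - g) * (r - 1) \<le> (1 - g) * ln r"
    using ln_le_minus_one[OF r(1)] assms by (intro mult_left_mono_neg) auto
  also have "\<dots> + 1 \<le> exp ((1 - g) * ln r)" using exp_ge_add_one_self[of "(1 - g) * ln r"] by linarith
  finally have b: "1 + (1 - g) * (r - 1) \<le> r powr (1 - g)" using r by (simp add: powr_def)
  have "c0 powr (1 - g) * (1 + (1 - g) * (r - 1)) \<le> c0 powr (1 - g) * r powr (1 - g)"
    using b by (intro mult_left_mono) auto
  also have "\<dots> = c powr (1 - g)" using r assms by (simp add: powr_mult mult.commute)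
  finally have "c0 powr (1 - g) * (1 + (1 - g) * (r - 1)) / (g - 1) \<le> c powr (1 - g) / (g - 1)"
    using assms by (intro divide_right_mono) auto
  moreover have "c0 powr (1 - g) * (1 + (1 - g) * (r - 1)) / (g - 1) = c0 powr (1 - g) / (g - 1)
    - c0 powr (1 - g) * (r - 1)"
    using assms by (simp add: field_simps)
  moreover have "c0 powr (1 - g) * (r - 1) = c0 powr (- g) * (c - c0)"
  proof -
    have "c0 powr (1 - g) = c0 powr (- g) * c0" using assms powr_add[of c0 1 "- g"] by simp
    then show ?thesis by (simp add: r(2) algebra_simps)
  qed
  ultimately show ?thesis by simp
qed

text \<open>The inequality of weighted arithmetic and geometric means, with logarithms taken
  relative to the best split u = (1 - b) S, q v = b S of the expenditure S, where they vanish. The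
  shares 1 - \<beta> and \<beta> of optimal consumption are these weights.\<close>

lemma cobb_douglas_le:
  fixes u v q b :: real
  assumes "0 < u" "0 < v" "0 < q" "0 < b" "b < 1"
  shows "u powr (1 - b) * v powr b \<le> (u + q * v) / (q powr b / ((1 - b) powr (1 - b) * b powr b))"
proof -
  let ?S = "u + q * v"
  have S: "0 < ?S" using assms by (intro add_pos_pos mult_pos_pos)
  have "(1 - b) * ln (u / ((1 - b) * ?S)) + b * ln (q * v / (b * ?S)) \<le>
    (1 - b) * (u / ((1 - b) * ?S) - 1) + b * (q * v / (b * ?S) - 1)"
    using assms S by (intro add_mono mult_left_mono ln_le_minus_one divide_pos_pos mult_pos_pos) auto
  also have "\<dots> = u / ?S + q * v / ?S - 1" using assms S by (simp add: right_diff_distrib)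
  also have "\<dots> = 0" using S by (simp add: add_divide_distrib[symmetric])
  finally have le0: "(1 - b) * ln (u / ((1 - b) * ?S)) + b * ln (q * v / (b * ?S)) \<le> 0" .
  have ln1: "ln (u / ((1 - b) * ?S)) = ln u - ln (1 - b) - ln ?S"
    using assms S by (simp add: ln_div ln_mult)
  have ln2: "ln (q * v / (b * ?S)) = ln q + ln v - ln b - ln ?S"
    using assms S by (simp add: ln_div ln_mult)
  have le: "(1 - b) * ln u + b * ln v \<le> ln ?S - (b * ln q - ((1 - b) * ln (1 - b) + b * ln b))"
    using le0 unfolding ln1 ln2 by (simp add: algebra_simps)
  have "u powr (1 - b) * v powr b = exp ((1 - b) * ln u + b * ln v)"
    using assms by (simp add: powr_def exp_add)
  also have "\<dots> \<le> exp (ln ?S - (b * ln q - ((1 - b) * ln (1 - b) + b * ln b)))" using le by simp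
  also have "\<dots> = ?S / (q powr b / ((1 - b) powr (1 - b) * b powr b))"
    using assms S by (simp add: powr_def exp_diff exp_add)
  finally show ?thesis .
qed

locale household_params =
  fixes p :: household
  assumes valid: "valid_household p"
begin

definition price :: real where "price = energy_price p / eta_new p"
text \<open>A price index: the least expenditure above subsistence that buys one unit of the
  Cobb-Douglas composite.\<close>

definition base :: real where
  "base = price powr beta p / ((1 - beta p) powr (1 - beta p) * beta p powr beta p)"
text \<open>Volatility and drift of optimal total wealth. The amount \<kappa> Z / (\<gamma>
  \<sigma>) in the risky asset gives volatility \<kappa> / \<gamma> and the premium \<kappa>^2 /
  \<gamma>; consumption at rate \<phi> Z lowers the drift by \<phi>.\<close>

definition opt_vol :: real where "opt_vol = kappa p / gamma p"
definition opt_drift :: real where "opt_drift = mu_R p + (kappa p)\<^sup>2 / gamma p - phi p"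

lemma params: "0 < price" "1 < gamma p" "0 < beta p" "beta p < 1" "0 < mu_R p" "0 < sigma_S p"
    "0 < kappa p" "0 < delta_hat p"
  using valid by (auto simp: valid_household_def price_def kappa_def delta_hat_def)

lemma base_pos: "0 < base"
  using params by (simp add: base_def)

lemma opt_vol_pos: "0 < opt_vol"
  using params by (simp add: opt_vol_def)

lemma phi_pos: "0 < phi p"
proof -
  have "gamma p * ((kappa p)\<^sup>2 + 2 * delta_hat p + 2 * (gamma p - 1) * mu_R p) - (kappa p)\<^sup>2 =
     (gamma p - 1) * (kappa p)\<^sup>2 + gamma p * (2 * delta_hat p + 2 * (gamma p - 1) * mu_R p)"
    by (simp add: algebra_simps)
  also have "\<dots> > 0"
    using params by (intro add_nonneg_pos mult_nonneg_nonneg mult_pos_pos) auto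
  finally show ?thesis unfolding phi_def using params by simp
qed

lemma Gamma_eq: "Gamma_const p = base powr ((1 - gamma p) / gamma p) * phi p"
  by (simp add: Gamma_const_def base_def price_def)

lemma Gamma_pos: "0 < Gamma_const p"
  unfolding Gamma_eq using base_pos phi_pos by simp

lemma Gamma_powr: "Gamma_const p powr (- gamma p) = base powr (gamma p - 1) * phi p powr (- gamma p)"
proof -
  have "Gamma_const p powr (- gamma p) = base powr ((1 - gamma p) / gamma p * (- gamma p)) * phi p
    powr (- gamma p)"
    unfolding Gamma_eq using base_pos phi_pos by (simp add: powr_mult powr_powr)
  also have "(1 - gamma p) / gamma p * (- gamma p) = gamma p - 1" using params by simp
  finally show ?thesis .
qed

text \<open>Here the formula for \<open>phi\<close> enters: with it, \<gamma> times the logarithmic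
  drift of optimal wealth is what the state price requires.\<close>

lemma opt_drift_eq: "opt_drift - opt_vol\<^sup>2 / 2 = ((kappa p)\<^sup>2 / 2 - delta_hat p + mu_R p) / gamma p"
  unfolding opt_drift_def opt_vol_def phi_def using params by (simp add: field_simps power2_eq_square)

lemma utility_nonpos: "utility p x s \<le> 0"
  unfolding utility_def using params by (intro divide_nonneg_neg) auto

abbreviation opt_wealth :: "real \<Rightarrow> 'a process \<Rightarrow> 'a process" where
  "opt_wealth z B \<equiv> gbm z opt_drift opt_vol B"

text \<open>The first-order condition. \<gamma> times the volatility of Z is \<kappa>, so the noise
  terms agree, and \<open>opt_drift_eq\<close> matches the trends once utility is discounted by
  \<open>delta_hat p\<close>.\<close>

lemma marginal_utility:
  assumes z: "0 < z"
  shows "exp (- delta_hat p * t) * (opt_wealth z B t \<omega>) powr (- gamma p) =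
    z powr (- gamma p) * state_price p B t \<omega>"
proof -
  have g: "gamma p * opt_vol = kappa p" using params by (simp add: opt_vol_def)
  have d: "gamma p * (opt_drift - opt_vol\<^sup>2 / 2) = (kappa p)\<^sup>2 / 2 - delta_hat p + mu_R p"
    unfolding opt_drift_eq using params by simp
  let ?D = "B t \<omega> - B 0 \<omega>"
  have "(opt_wealth z B t \<omega>) powr (- gamma p) =
    z powr (- gamma p) * exp (- gamma p * ((opt_drift - opt_vol\<^sup>2 / 2) * t + opt_vol * ?D))"
    unfolding gbm_def using z by (simp add: powr_mult exp_powr_real mult.commute)
  also have "- gamma p * ((opt_drift - opt_vol\<^sup>2 / 2) * t + opt_vol * ?D) =
     - (gamma p * (opt_drift - opt_vol\<^sup>2 / 2)) * t - (gamma p * opt_vol) * ?D"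
    by (simp add: algebra_simps)
  also have "\<dots> = - ((kappa p)\<^sup>2 / 2 - delta_hat p + mu_R p) * t - kappa p * ?D" unfolding g d ..
  finally show ?thesis
    unfolding state_price_def exp_density_def
    by (simp add: exp_add[symmetric] mult.left_commute[of "exp _"]) (simp add: algebra_simps)
qed

text \<open>The Lagrange multiplier of the budget constraint, equal to the derivative at z of the
  claimed value.\<close>

definition multiplier :: "real \<Rightarrow> real" where
  "multiplier z = base powr (gamma p - 1) * (phi p * z) powr (- gamma p)"

lemma multiplier_pos: "0 < z \<Longrightarrow> 0 < multiplier z"
  using base_pos phi_pos by (simp add: multiplier_def)

lemma value_eq:
  assumes z: "0 < z"
  shows "Gamma_const p powr (- gamma p) * (z powr (1 - gamma p) / (1 - gamma p)) =
    - (multiplier z * z / (gamma p - 1))"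
proof -
  have "z powr (1 - gamma p) = z powr (- gamma p) * z" using z powr_add[of z 1 "- gamma p"] by simp
  then have "Gamma_const p powr (- gamma p) * z powr (1 - gamma p) = multiplier z * z"
    unfolding Gamma_powr multiplier_def using z phi_pos by (simp add: powr_mult)
  then have "Gamma_const p powr (- gamma p) * (z powr (1 - gamma p) / (1 - gamma p)) =
    multiplier z * z / (1 - gamma p)" by simp
  also have "\<dots> = - (multiplier z * z / (gamma p - 1))" by (metis minus_diff_eq minus_divide_right)
  finally show ?thesis .
qed

lemma discounted_opt:
  assumes z: "0 < z"
  shows "exp (- delta_hat p * t) * (base powr (gamma p - 1) * (phi p * opt_wealth z B t \<omega>) powr
    (- gamma p)) =
    multiplier z * state_price p B t \<omega>"
proof -
  have "(phi p * opt_wealth z B t \<omega>) powr (- gamma p) =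
    phi p powr (- gamma p) * (opt_wealth z B t \<omega>) powr (- gamma p)"
    using phi_pos gbm_pos[OF z] by (simp add: powr_mult less_imp_le)
  then have "exp (- delta_hat p * t) * (base powr (gamma p - 1) * (phi p * opt_wealth z B t \<omega>) powr
    (- gamma p)) =
    base powr (gamma p - 1) * phi p powr (- gamma p) *
      (exp (- delta_hat p * t) * (opt_wealth z B t \<omega>) powr (- gamma p))"
    by (simp only: ac_simps)
  also have "\<dots> = multiplier z * state_price p B t \<omega>"
    unfolding marginal_utility[OF z] multiplier_def using z phi_pos by (simp add: powr_mult)
  finally show ?thesis .
qed

text \<open>Equality holds for the consumption rates with surplus \<open>\<phi> Z\<close>, where \<open>Z\<close> is the optimal total wealth.\<close>

lemma utility_bound:
  assumes z: "0 < z" and xs: "x_min p < x t \<omega>" "s_min p < s t \<omega>"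
  shows "multiplier z * phi p * (gamma p / (gamma p - 1)) * (state_price p B t \<omega> * opt_wealth z B t \<omega>) \<le>
    - (exp (- delta_hat p * t) * utility p (x t \<omega>) (s t \<omega>)) + multiplier z *
      (state_price p B t \<omega> * surplus p x s t \<omega>)"
proof -
  let ?u = "x t \<omega> - x_min p" and ?v = "s t \<omega> - s_min p" and ?g = "gamma p"
  let ?C = "surplus p x s t \<omega>" and ?K = "phi p * opt_wealth z B t \<omega>" and ?e = "exp (- delta_hat p * t)"
  have uv: "0 < ?u" "0 < ?v" using xs by auto
  have C: "?C = ?u + price * ?v" by (simp add: surplus_def price_def mult.commute)
  have C0: "0 < ?K" by (intro mult_pos_pos phi_pos gbm_pos z)
  have Cpos: "0 < ?C" unfolding C using uv params by (intro add_pos_pos mult_pos_pos)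
  have pos: "0 < ?u powr (1 - beta p) * ?v powr beta p" using uv by simp
  have cd: "?u powr (1 - beta p) * ?v powr beta p \<le> ?C / base"
    unfolding C base_def using cobb_douglas_le[OF uv] params by auto
  \<comment> \<open>The exponent 1 - \<gamma> is negative, so the upper bound for the composite
    becomes a lower bound for the loss.\<close>
  have "(?C / base) powr (1 - ?g) \<le> (?u powr (1 - beta p) * ?v powr beta p) powr (1 - ?g)"
    using cd pos params by (intro powr_mono2') auto
  also have "(?C / base) powr (1 - ?g) = base powr (?g - 1) * ?C powr (1 - ?g)"
    using Cpos base_pos powr_minus_divide[of base "?g - 1"] by (simp add: powr_divide)
  finally have "base powr (?g - 1) * ?C powr (1 - ?g) / (?g - 1) \<le>
    (?u powr (1 - beta p) * ?v powr beta p) powr (1 - ?g) / (?g - 1)"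
    using params by (intro divide_right_mono) auto
  also have "\<dots> = - utility p (x t \<omega>) (s t \<omega>)"
    unfolding utility_def by (metis minus_diff_eq minus_divide_right minus_minus)
  finally have U: "base powr (?g - 1) * (?C powr (1 - ?g) / (?g - 1)) \<le> - utility p (x t \<omega>) (s t \<omega>)" by simp
  \<comment> \<open>The tangent is taken at \<phi> Z, where its discounted slope is, up to sign, the
    multiplier times the state price for every \<omega> and t. The term linear in consumption is
    thus one that the budget constraint controls.\<close>
  have "base powr (?g - 1) * (?K powr (1 - ?g) / (?g - 1) - ?K powr (- ?g) * (?C - ?K)) \<le>
    base powr (?g - 1) * (?C powr (1 - ?g) / (?g - 1))"
    using powr_tangent[OF Cpos C0] params by (intro mult_left_mono) auto
  with U have main: "?e * (base powr (?g - 1) * (?K powr (1 - ?g) / (?g - 1) - ?K powr (- ?g) *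
    (?C - ?K))) \<le> ?e * (- utility p (x t \<omega>) (s t \<omega>))"
    by (intro mult_left_mono) auto
  have pw: "?K powr (1 - ?g) = ?K powr (- ?g) * ?K" using C0 powr_add[of ?K 1 "- ?g"] by simp
  have alg: "?e * (base powr (?g - 1) * (k * c / (?g - 1) - k * (d - c))) =
    (?e * (base powr (?g - 1) * k)) * (?g / (?g - 1) * c - d)" for k c d
  proof -
    have "k * c / (?g - 1) - k * (d - c) = k * (?g / (?g - 1) * c - d)" using params
      by (simp add: field_simps)
    then show ?thesis by simp
  qed
  have "multiplier z * state_price p B t \<omega> * (?g / (?g - 1) * ?K - ?C) \<le> ?e * (- utility p (x t \<omega>) (s t \<omega>))"
    using main unfolding pw alg discounted_opt[OF z] .
  then show ?thesis by (simp add: algebra_simps)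
qed

text \<open>The split in shares 1 - \<beta> and \<beta> gives equality in
  \<open>cobb_douglas_le\<close>, so the composite is \<phi> Z / \<open>base\<close>; by the
  first-order condition the discounted loss is again a multiple of \<xi> Z.\<close>

lemma optimal_utility:
  assumes z: "0 < z" and Z: "Z = opt_wealth z B t \<omega>"
  shows "- (exp (- delta_hat p * t) * utility p (x_min p + (1 - beta p) * phi p * Z)
    (s_min p + beta p * phi p * (Z / (energy_price p / eta_new p)))) =
    multiplier z * phi p / (gamma p - 1) * (state_price p B t \<omega> * opt_wealth z B t \<omega>)"
proof -
  let ?K = "phi p * Z" and ?g = "gamma p"
  have Zp: "0 < Z" unfolding Z by (rule gbm_pos[OF z])
  have C0: "0 < ?K" using phi_pos Zp by simp
  have "((1 - beta p) * phi p * Z) powr (1 - beta p) * (beta p * phi p * (Z / price)) powr beta p =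
     ((1 - beta p) * ?K) powr (1 - beta p) * (beta p / price * ?K) powr beta p" by (simp add: ac_simps)
  also have "\<dots> = (1 - beta p) powr (1 - beta p) * (beta p / price) powr beta p *
    (?K powr (1 - beta p) * ?K powr beta p)"
    using params C0 by (simp only: powr_mult less_imp_le divide_nonneg_pos ac_simps diff_ge_0_iff_ge)
  also have "?K powr (1 - beta p) * ?K powr beta p = ?K" using C0 by (simp add: powr_add[symmetric])
  also have "(1 - beta p) powr (1 - beta p) * (beta p / price) powr beta p = 1 / base"
    using params unfolding base_def by (simp add: powr_divide)
  finally have cd: "((1 - beta p) * phi p * Z) powr (1 - beta p) * (beta p * phi p * (Z / price))
    powr beta p = ?K / base" by simp
  have "(?K / base) powr (1 - ?g) = base powr (?g - 1) * ?K powr (1 - ?g)"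
    using C0 base_pos powr_minus_divide[of base "?g - 1"] by (simp add: powr_divide)
  also have "?K powr (1 - ?g) = ?K powr (- ?g) * ?K" using C0 powr_add[of ?K 1 "- ?g"] by simp
  finally have pw: "(?K / base) powr (1 - ?g) = base powr (?g - 1) * (?K powr (- ?g) * ?K)" .
  have "utility p (x_min p + (1 - beta p) * phi p * Z) (s_min p + beta p * phi p * (Z / price)) =
    base powr (?g - 1) * (?K powr (- ?g) * ?K) / (1 - ?g)"
    unfolding utility_def using cd pw by simp
  then have "- (exp (- delta_hat p * t) * utility p (x_min p + (1 - beta p) * phi p * Z)
    (s_min p + beta p * phi p * (Z / price))) =
    (exp (- delta_hat p * t) * (base powr (?g - 1) * ?K powr (- ?g))) * ?K / (?g - 1)"
    by (simp add: minus_divide_right)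
  also have "\<dots> = multiplier z * state_price p B t \<omega> * ?K / (?g - 1)"
    unfolding Z discounted_opt[OF z] ..
  finally show ?thesis unfolding price_def Z by simp
qed

end

section \<open>The value function and the optimal strategies\<close>

locale household_problem = brownian M F B + household_params p
  for M :: "'a measure" and F B p
begin

abbreviation Zopt :: "real \<Rightarrow> 'a process" where "Zopt z \<equiv> opt_wealth z B"

text \<open>Expected utility with its sign reversed. As utility is at most 0, this is the integral
  of a nonnegative function and may be infinite.\<close>

definition loss :: "'a process \<Rightarrow> 'a process \<Rightarrow> ennreal" where
  "loss x s = (\<integral>\<^sup>+\<omega>. (\<integral>\<^sup>+t\<in>{0..}. ennreal (- (exp (- delta_hat p * t) * utility p (x t \<omega>) (s t \<omega>)))
    \<partial>lborel) \<partial>M)"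

lemma expected_utility_loss: "expected_utility M p (a, x, s) = - enn2ereal (loss x s)"
proof -
  let ?u = "\<lambda>\<omega> t. exp (- delta_hat p * t) * utility p (x t \<omega>) (s t \<omega>)"
  have neg: "?u \<omega> t \<le> 0" for \<omega> t using utility_nonpos by (intro mult_nonneg_nonpos) auto
  have inner: "ext_integral (restrict_space lborel {0..}) (\<lambda>t. ereal (?u \<omega> t)) =
      - enn2ereal (\<integral>\<^sup>+t\<in>{0..}. ennreal (- ?u \<omega> t) \<partial>lborel)" for \<omega>
  proof -
    have "e2ennreal (ereal (?u \<omega> t)) = 0" for t using neg by (simp only: e2ennreal_ereal ennreal_neg)
    then have 0: "(\<integral>\<^sup>+t. e2ennreal (ereal (?u \<omega> t)) \<partial>restrict_space lborel {0..}) = 0" by simp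
    have "e2ennreal (- ereal (?u \<omega> t)) = ennreal (- ?u \<omega> t)" for t
      by (simp only: uminus_ereal.simps e2ennreal_ereal)
    moreover have "(\<integral>\<^sup>+t. ennreal (- ?u \<omega> t) \<partial>restrict_space lborel {0..}) =
      (\<integral>\<^sup>+t\<in>{0..}. ennreal (- ?u \<omega> t) \<partial>lborel)"
      by (rule nn_integral_restrict_space) simp
    ultimately show ?thesis unfolding ext_integral_def 0 by (simp add: zero_ennreal.rep_eq)
  qed
  show ?thesis unfolding expected_utility.simps inner
    unfolding ext_integral_def loss_def by (simp add: e2ennreal_neg zero_ennreal.rep_eq)
qed

text \<open>The exponent of \<xi> Z is - \<phi> t plus that of another Girsanov density, with
  parameter \<kappa> minus the volatility of Z, and that density has mean 1.\<close>

lemma state_price_opt_expectation: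
  assumes z: "0 < z" and t: "0 \<le> t"
  shows "(\<integral>\<^sup>+\<omega>. ennreal (state_price p B t \<omega> * Zopt z t \<omega>) \<partial>M) = ennreal (z * exp (- phi p * t))"
proof -
  let ?k = "kappa p - opt_vol"
  have kv: "kappa p * opt_vol = (kappa p)\<^sup>2 / gamma p" by (simp add: opt_vol_def power2_eq_square)
  have eq: "state_price p B t \<omega> * Zopt z t \<omega> = z * exp (- phi p * t) * exp_density B ?k t \<omega>" for \<omega>
  proof -
    have "- mu_R p * t + (- kappa p * D - (kappa p)\<^sup>2 * t / 2) + ((opt_drift - opt_vol\<^sup>2 / 2) * t
      + opt_vol * D) =
       (opt_drift - mu_R p - kappa p * opt_vol) * t + (- ?k * D - ?k\<^sup>2 * t / 2)" for D
      by (simp add: power2_diff field_simps)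
    also have "(opt_drift - mu_R p - kappa p * opt_vol) = - phi p" unfolding kv opt_drift_def by simp
    finally have e: "- mu_R p * t + (- kappa p * D - (kappa p)\<^sup>2 * t / 2)
      + ((opt_drift - opt_vol\<^sup>2 / 2) * t + opt_vol * D) =
       - phi p * t + (- ?k * D - ?k\<^sup>2 * t / 2)" for D .
    show ?thesis unfolding state_price_def gbm_def exp_density_def
      using arg_cong[OF e[of "B t \<omega> - B 0 \<omega>"], of exp] unfolding exp_add by (simp only: ac_simps)
  qed
  have "(\<integral>\<^sup>+\<omega>. ennreal (state_price p B t \<omega> * Zopt z t \<omega>) \<partial>M) =
    (\<integral>\<^sup>+\<omega>. ennreal (z * exp (- phi p * t)) * ennreal (exp_density B ?k t \<omega>) \<partial>M)"
    unfolding eq using z by (intro nn_integral_cong ennreal_mult) (auto simp: exp_density_pos less_imp_le)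
  also have "\<dots> = (\<integral>\<^sup>+\<omega>. ennreal (z * exp (- phi p * t)) * ennreal (exp_density B ?k 0 \<omega>) \<partial>M)"
    using t by (intro exp_density_martingale[of 0 t t]) auto
  also have "\<dots> = ennreal (z * exp (- phi p * t))" by (simp add: exp_density_def emeasure_space_1)
  finally show ?thesis .
qed

lemma opt_joint:
  assumes z: "0 < z"
  shows "(\<lambda>y. state_price p B (max 0 (fst y)) (snd y) * Zopt z (max 0 (fst y)) (snd y)) \<in>
    borel_measurable (lborel \<Otimes>\<^sub>M M)"
proof -
  have "measurable_adapted M F (Zopt z)"
    by (rule measurable_adapted_continuous[OF gbm_adapted[OF z opt_vol_pos]
      gbm_continuous[OF z opt_vol_pos]])
  from measurable_adapted_joint[OF this] measurable_adapted_joint[OF measurable_adapted_state_price[of p]]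
  have "(\<lambda>y. state_price p B (max 0 (fst y)) (snd y) * Zopt z (max 0 (fst y)) (snd y)) \<in>
    borel_measurable (borel \<Otimes>\<^sub>M M)"
    by (simp add: split_beta)
  then show ?thesis by (subst measurable_cong_sets[OF sets_pair_measure_cong[OF sets_lborel refl] refl])
qed

lemma state_price_opt_integral:
  assumes z: "0 < z" and c: "0 \<le> c" and S: "S \<in> sets borel" "S \<subseteq> {0..}"
  shows "(\<integral>\<^sup>+\<omega>. (\<integral>\<^sup>+t\<in>S. ennreal (c * (state_price p B t \<omega> * Zopt z t \<omega>)) \<partial>lborel) \<partial>M) =
    (\<integral>\<^sup>+t\<in>S. ennreal (c * z * exp (- phi p * t)) \<partial>lborel)"
proof -
  interpret P: pair_sigma_finite lborel M by unfold_locales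
  let ?f = "\<lambda>t \<omega>. ennreal (c * (state_price p B (max 0 t) \<omega> * Zopt z (max 0 t) \<omega>)) * indicator S t"
  have "(\<integral>\<^sup>+\<omega>. (\<integral>\<^sup>+t\<in>S. ennreal (c * (state_price p B t \<omega> * Zopt z t \<omega>)) \<partial>lborel) \<partial>M) =
    (\<integral>\<^sup>+\<omega>. (\<integral>\<^sup>+t. ?f t \<omega> \<partial>lborel) \<partial>M)"
    using S(2) by (intro nn_integral_cong) (auto simp: indicator_def max_def)
  also have "\<dots> = (\<integral>\<^sup>+t. (\<integral>\<^sup>+\<omega>. ?f t \<omega> \<partial>M) \<partial>lborel)"
    by (rule P.Fubini') (use opt_joint[OF z] S(1) in \<open>simp add: split_beta\<close>)
  also have "\<dots> = (\<integral>\<^sup>+t\<in>S. ennreal (c * z * exp (- phi p * t)) \<partial>lborel)"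
  proof (rule nn_integral_cong)
    fix t :: real
    show "(\<integral>\<^sup>+\<omega>. ?f t \<omega> \<partial>M) = ennreal (c * z * exp (- phi p * t)) * indicator S t"
    proof (cases "t \<in> S")
      case True
      then have t: "0 \<le> t" using S(2) by auto
      have m: "(\<lambda>\<omega>. ennreal (state_price p B t \<omega> * Zopt z t \<omega>)) \<in> borel_measurable M"
        using adapted_M[OF gbm_adapted[OF z opt_vol_pos] t] measurable_adapted_state_price[of p] t
          measurable_F
        by (auto simp: measurable_adapted_def intro!: borel_measurable_times adapted_M)
      have "(\<integral>\<^sup>+\<omega>. ?f t \<omega> \<partial>M) = (\<integral>\<^sup>+\<omega>. ennreal c * ennreal (state_price p B t \<omega> * Zopt z t \<omega>) \<partial>M)"
        using True t c gbm_pos[OF z] state_price_pos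
        by (intro nn_integral_cong) (simp add: max_def ennreal_mult' )
      also have "\<dots> = ennreal c * ennreal (z * exp (- phi p * t))"
        using m state_price_opt_expectation[OF z t] by (simp add: nn_integral_cmult)
      also have "\<dots> = ennreal (c * z * exp (- phi p * t))"
        using c z by (simp add: ennreal_mult[symmetric] mult.assoc)
      finally show ?thesis using True by simp
    qed simp
  qed
  finally show ?thesis .
qed

lemma measurable_adapted_utility:
  assumes "measurable_adapted M F x" "measurable_adapted M F s"
  shows "(\<lambda>y. ennreal (- (exp (- delta_hat p * fst y) * utility p (x (max 0 (fst y)) (snd y))
    (s (max 0 (fst y)) (snd y)))))
    \<in> borel_measurable (lborel \<Otimes>\<^sub>M M)"
proof -
  have [measurable]: "(\<lambda>y. x (max 0 (fst y)) (snd y)) \<in> borel_measurable (lborel \<Otimes>\<^sub>M M)"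
    "(\<lambda>y. s (max 0 (fst y)) (snd y)) \<in> borel_measurable (lborel \<Otimes>\<^sub>M M)"
    using measurable_adapted_joint[OF assms(1)] measurable_adapted_joint[OF assms(2)]
    by (subst measurable_cong_sets[OF sets_pair_measure_cong[OF sets_lborel refl] refl], simp add:
      split_beta)+
  show ?thesis unfolding utility_def by measurable
qed

text \<open>\<open>utility_bound\<close> is integrated over [0, T]. With y the multiplier, its left
  side gives y z \<gamma> / (\<gamma> - 1) (1 - exp (- \<phi> T)), while the budget constraint
  limits the cost of consumption to y z. As T grows, the difference tends to y z / (\<gamma> -
  1).\<close>

lemma loss_ge:
  assumes adm: "admissible_with M F B p w (a, x, s) W" and z: "0 < total_wealth p w"
  shows "ennreal (multiplier (total_wealth p w) * total_wealth p w / (gamma p - 1)) \<le> loss x s"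
proof -
  let ?z = "total_wealth p w" and ?g = "gamma p"
  define y where "y = multiplier ?z"
  have y: "0 < y" unfolding y_def by (rule multiplier_pos[OF z])
  have ctrl: "is_control M F p (a, x, s)" using adm by (simp add: admissible_with_def)
  then have xs: "measurable_adapted M F x" "measurable_adapted M F s"
    and pos: "AE \<omega> in M. \<forall>t\<ge>0. x_min p < x t \<omega> \<and> s_min p < s t \<omega>" by auto
  have g: "0 < ?g - 1" using params by simp
  have bound: "ennreal (y * ?z * (?g / (?g - 1)) * (1 - exp (- phi p * T))) \<le>
    loss x s + ennreal (y * ?z)" if T: "0 < T" for T
  proof -
    \<comment> \<open>\<open>f1\<close> is the loss and \<open>f2\<close> the cost of consumption,
      cut off at T and frozen for negative times to be jointly measurable. Both count as
      nonnegative, so they can be integrated separately even if the loss is infinite.\<close>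
    define f1 where "f1 t \<omega> = ennreal
      (- (exp (- delta_hat p * t) * utility p (x (max 0 t) \<omega>) (s (max 0 t) \<omega>))) * indicator {0..T}
      t" for t \<omega>
    define f2 where "f2 t \<omega> = ennreal
      (y * (state_price p B (max 0 t) \<omega> * surplus p x s (max 0 t) \<omega>)) * indicator {0..T} t" for t \<omega>
    have m1: "(\<lambda>q. f1 (fst q) (snd q)) \<in> borel_measurable (lborel \<Otimes>\<^sub>M M)"
      unfolding f1_def using measurable_adapted_utility[OF xs] by measurable
    have m2: "(\<lambda>q. f2 (fst q) (snd q)) \<in> borel_measurable (lborel \<Otimes>\<^sub>M M)"
    proof -
      have [measurable]: "(\<lambda>q. state_price p B (max 0 (fst q)) (snd q)) \<in> borel_measurable (lborel \<Otimes>\<^sub>M M)"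
        "(\<lambda>q. surplus p x s (max 0 (fst q)) (snd q)) \<in> borel_measurable (lborel \<Otimes>\<^sub>M M)"
        using measurable_adapted_joint[OF measurable_adapted_state_price[of p]]
          measurable_adapted_joint[OF measurable_adapted_surplus[OF xs, of p]]
        by (subst measurable_cong_sets[OF sets_pair_measure_cong[OF sets_lborel refl] refl], simp
          add: split_beta)+
      show ?thesis unfolding f2_def by measurable
    qed
    have sec: "(\<lambda>t. f1 t \<omega>) \<in> borel_measurable lborel" "(\<lambda>t. f2 t \<omega>) \<in> borel_measurable lborel"
      if "\<omega> \<in> space M" for \<omega>
      using measurable_compose[OF measurable_Pair2'[of \<omega> M lborel] m1]
        measurable_compose[OF measurable_Pair2'[of \<omega> M lborel] m2] that by simp_all
    have swp: "(\<lambda>(\<omega>, t). f t \<omega>) \<in> borel_measurable (M \<Otimes>\<^sub>M lborel)"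
      if "(\<lambda>q. f (fst q) (snd q)) \<in> borel_measurable (lborel \<Otimes>\<^sub>M M)" for f :: "real \<Rightarrow> 'a \<Rightarrow> ennreal"
      using measurable_compose[OF measurable_pair_swap'[of M lborel] that] by (simp add: split_beta)
    have out: "(\<lambda>\<omega>. \<integral>\<^sup>+t. f1 t \<omega> \<partial>lborel) \<in> borel_measurable M"
      "(\<lambda>\<omega>. \<integral>\<^sup>+t. f2 t \<omega> \<partial>lborel) \<in> borel_measurable M"
      using lborel.borel_measurable_nn_integral[OF swp[OF m1]]
        lborel.borel_measurable_nn_integral[OF swp[OF m2]] by simp_all
    define c where "c = y * phi p * (?g / (?g - 1))"
    have c: "0 \<le> c" unfolding c_def using y phi_pos g params by (intro mult_nonneg_nonneg) auto
    have int: "(\<integral>\<^sup>+t\<in>{0..T}. ennreal (c * ?z * exp (- phi p * t)) \<partial>lborel) =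
      ennreal (y * ?z * (?g / (?g - 1)) * (1 - exp (- phi p * T)))"
    proof -
      let ?F = "\<lambda>t. - (y * ?z * (?g / (?g - 1))) * exp (- phi p * t)"
      have "(\<integral>\<^sup>+t. ennreal (c * ?z * exp (- phi p * t)) * indicator {0..T} t \<partial>lborel) =
        ennreal (?F T - ?F 0)"
      proof (rule nn_integral_FTC_Icc)
        show "DERIV ?F t :> c * ?z * exp (- phi p * t)" if "t \<in> {0..T}" for t
          unfolding c_def using g by (auto intro!: derivative_eq_intros)
      qed (use T c z in auto)
      also have "?F T - ?F 0 = y * ?z * (?g / (?g - 1)) * (1 - exp (- phi p * T))"
        by (simp add: right_diff_distrib)
      finally show ?thesis .
    qed
    have "(\<integral>\<^sup>+t\<in>{0..T}. ennreal (c * ?z * exp (- phi p * t)) \<partial>lborel) =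
       (\<integral>\<^sup>+\<omega>. (\<integral>\<^sup>+t\<in>{0..T}. ennreal (c * (state_price p B t \<omega> * Zopt ?z t \<omega>)) \<partial>lborel) \<partial>M)"
      by (rule state_price_opt_integral[OF z c, symmetric]) auto
    also have "\<dots> \<le> (\<integral>\<^sup>+\<omega>. (\<integral>\<^sup>+t. f1 t \<omega> \<partial>lborel) + (\<integral>\<^sup>+t. f2 t \<omega> \<partial>lborel) \<partial>M)"
    proof (rule nn_integral_mono_AE)
      show "AE \<omega> in M. (\<integral>\<^sup>+t\<in>{0..T}. ennreal (c * (state_price p B t \<omega> * Zopt ?z t \<omega>)) \<partial>lborel) \<le>
        (\<integral>\<^sup>+t. f1 t \<omega> \<partial>lborel) + (\<integral>\<^sup>+t. f2 t \<omega> \<partial>lborel)"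
        using pos AE_space
      proof eventually_elim
        case (elim \<omega>)
        have "(\<integral>\<^sup>+t\<in>{0..T}. ennreal (c * (state_price p B t \<omega> * Zopt ?z t \<omega>)) \<partial>lborel) \<le>
          (\<integral>\<^sup>+t. f1 t \<omega> + f2 t \<omega> \<partial>lborel)"
        proof (rule nn_integral_mono)
          fix t
          show "ennreal (c * (state_price p B t \<omega> * Zopt ?z t \<omega>)) * indicator {0..T} t \<le> f1 t \<omega> + f2 t \<omega>"
          proof (cases "t \<in> {0..T}")
            case True
            then have gt: "x_min p < x t \<omega>" "s_min p < s t \<omega>" using elim by auto
            have "c * (state_price p B t \<omega> * Zopt ?z t \<omega>) \<le>
              - (exp (- delta_hat p * t) * utility p (x t \<omega>) (s t \<omega>)) + y *
              (state_price p B t \<omega> * surplus p x s t \<omega>)"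
              unfolding c_def y_def using z gt by (rule utility_bound[where x=x and s=s])
            then have "ennreal (c * (state_price p B t \<omega> * Zopt ?z t \<omega>)) \<le>
              ennreal (- (exp (- delta_hat p * t) * utility p (x t \<omega>) (s t \<omega>)) + y *
              (state_price p B t \<omega> * surplus p x s t \<omega>))"
              by (rule ennreal_leI)
            also have "\<dots> = ennreal (- (exp (- delta_hat p * t) * utility p (x t \<omega>) (s t \<omega>)))
              + ennreal (y * (state_price p B t \<omega> * surplus p x s t \<omega>))"
            proof (rule ennreal_plus)
              show "0 \<le> - (exp (- delta_hat p * t) * utility p (x t \<omega>) (s t \<omega>))"
                using utility_nonpos[of "x t \<omega>" "s t \<omega>"] by (simp add: mult_nonneg_nonpos)
              have "0 \<le> surplus p x s t \<omega>"
                unfolding surplus_def using gt params(1)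
                  by (intro add_nonneg_nonneg mult_nonneg_nonneg) (auto simp: price_def)
              then show "0 \<le> y * (state_price p B t \<omega> * surplus p x s t \<omega>)"
                using y state_price_pos[of p B t \<omega>] by (intro mult_nonneg_nonneg) auto
            qed
            finally show ?thesis using True by (simp add: f1_def f2_def max_def)
          qed simp
        qed
        also have "\<dots> = (\<integral>\<^sup>+t. f1 t \<omega> \<partial>lborel) + (\<integral>\<^sup>+t. f2 t \<omega> \<partial>lborel)"
          using sec[of \<omega>] elim by (intro nn_integral_add) auto
        finally show ?case .
      qed
    qed
    also have "\<dots> = (\<integral>\<^sup>+\<omega>. (\<integral>\<^sup>+t. f1 t \<omega> \<partial>lborel) \<partial>M) + (\<integral>\<^sup>+\<omega>. (\<integral>\<^sup>+t. f2 t \<omega> \<partial>lborel) \<partial>M)"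
      using out by (rule nn_integral_add)
    also have "\<dots> \<le> loss x s + ennreal (y * ?z)"
    proof (rule add_mono)
      show "(\<integral>\<^sup>+\<omega>. (\<integral>\<^sup>+t. f1 t \<omega> \<partial>lborel) \<partial>M) \<le> loss x s"
        unfolding loss_def by (intro nn_integral_mono) (auto simp: f1_def indicator_def max_def)
      have "(\<integral>\<^sup>+\<omega>. (\<integral>\<^sup>+t. f2 t \<omega> \<partial>lborel) \<partial>M) =
        (\<integral>\<^sup>+\<omega>. ennreal y * (\<integral>\<^sup>+t\<in>{0..T}. ennreal (state_price p B t \<omega> * surplus p x s t \<omega>) \<partial>lborel) \<partial>M)"
      proof (rule nn_integral_cong)
        fix \<omega> assume om: "\<omega> \<in> space M"
        have m: "(\<lambda>t. ennreal (state_price p B (max 0 t) \<omega> * surplus p x s (max 0 t) \<omega>) * indicator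
          {0..T} t) \<in> borel_measurable lborel"
          using measurable_adapted_section[OF measurable_adapted_state_price[of p] om]
            measurable_adapted_section[OF measurable_adapted_surplus[OF xs, of p] om]
          by measurable
        have "(\<integral>\<^sup>+t. f2 t \<omega> \<partial>lborel) =
          (\<integral>\<^sup>+t. ennreal y * (ennreal (state_price p B (max 0 t) \<omega> * surplus p x s (max 0 t) \<omega>) *
          indicator {0..T} t) \<partial>lborel)"
          using y by (intro nn_integral_cong) (simp add: f2_def ennreal_mult' mult.assoc)
        also have "\<dots> = ennreal y *
          (\<integral>\<^sup>+t. ennreal (state_price p B (max 0 t) \<omega> * surplus p x s (max 0 t) \<omega>) * indicator
          {0..T} t \<partial>lborel)"
          by (rule nn_integral_cmult[OF m])
        also have "(\<integral>\<^sup>+t. ennreal (state_price p B (max 0 t) \<omega> * surplus p x s (max 0 t) \<omega>) *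
          indicator {0..T} t \<partial>lborel) =
          (\<integral>\<^sup>+t\<in>{0..T}. ennreal (state_price p B t \<omega> * surplus p x s t \<omega>) \<partial>lborel)"
          by (intro nn_integral_cong) (auto simp: indicator_def max_def)
        finally show "(\<integral>\<^sup>+t. f2 t \<omega> \<partial>lborel) =
          ennreal y * (\<integral>\<^sup>+t\<in>{0..T}. ennreal (state_price p B t \<omega> * surplus p x s t \<omega>) \<partial>lborel)" .
      qed
      also have "\<dots> \<le> ennreal y *
        (\<integral>\<^sup>+\<omega>. (\<integral>\<^sup>+t\<in>{0..T}. ennreal (state_price p B t \<omega> * surplus p x s t \<omega>) \<partial>lborel) \<partial>M)"
      proof -
        have "(\<lambda>\<omega>. \<integral>\<^sup>+t\<in>{0..T}. ennreal (state_price p B t \<omega> * surplus p x s t \<omega>) \<partial>lborel) \<in>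
          borel_measurable M"
        proof -
          have "(\<lambda>q. ennreal (state_price p B (max 0 (fst q)) (snd q) * surplus p x s
            (max 0 (fst q)) (snd q)) * indicator {0..T} (fst q)) \<in> borel_measurable (lborel \<Otimes>\<^sub>M M)"
          proof -
            have [measurable]: "(\<lambda>q. state_price p B (max 0 (fst q)) (snd q)) \<in> borel_measurable
              (lborel \<Otimes>\<^sub>M M)"
              "(\<lambda>q. surplus p x s (max 0 (fst q)) (snd q)) \<in> borel_measurable (lborel \<Otimes>\<^sub>M M)"
              using measurable_adapted_joint[OF measurable_adapted_state_price[of p]]
                measurable_adapted_joint[OF measurable_adapted_surplus[OF xs, of p]]
              by (subst measurable_cong_sets[OF sets_pair_measure_cong[OF sets_lborel refl] refl],
                simp add: split_beta)+
            show ?thesis by measurable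
          qed
          from lborel.borel_measurable_nn_integral[OF swp[OF this]]
          have "(\<lambda>\<omega>. \<integral>\<^sup>+t. ennreal (state_price p B (max 0 t) \<omega> * surplus p x s (max 0 t) \<omega>) *
            indicator {0..T} t \<partial>lborel) \<in> borel_measurable M" .
          moreover have "(\<integral>\<^sup>+t. ennreal (state_price p B (max 0 t) \<omega> * surplus p x s (max 0 t) \<omega>) *
            indicator {0..T} t \<partial>lborel) =
            (\<integral>\<^sup>+t\<in>{0..T}. ennreal (state_price p B t \<omega> * surplus p x s t \<omega>) \<partial>lborel)" for \<omega>
            by (intro nn_integral_cong) (auto simp: indicator_def max_def)
          ultimately show ?thesis by simp
        qed
        then show ?thesis by (simp add: nn_integral_cmult)
      qed
      also have "\<dots> \<le> ennreal y * ennreal ?z"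
        by (intro mult_left_mono budget_constraint[OF valid adm z T]) simp
      also have "\<dots> = ennreal (y * ?z)" using y z by (simp add: ennreal_mult less_imp_le)
      finally show "(\<integral>\<^sup>+\<omega>. (\<integral>\<^sup>+t. f2 t \<omega> \<partial>lborel) \<partial>M) \<le> ennreal (y * ?z)" .
    qed
    finally show ?thesis unfolding int .
  qed
  show ?thesis
  proof (cases "loss x s")
    case (real l)
    have le: "y * ?z * (?g / (?g - 1)) * (1 - exp (- phi p * T)) \<le> l + y * ?z" if "0 < T" for T
    proof -
      have "ennreal (y * ?z * (?g / (?g - 1)) * (1 - exp (- phi p * T))) \<le> ennreal (l + y * ?z)"
        using bound[OF that] real y z by simp
      then show ?thesis using real y z by (subst (asm) ennreal_le_iff) auto
    qed
    have "((\<lambda>T. y * ?z * (?g / (?g - 1)) * (1 - exp (- phi p * T))) \<longlongrightarrow> y * ?z * (?g / (?g - 1)) *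
      (1 - 0)) at_top"
    proof (intro tendsto_intros)
      have "filterlim (\<lambda>T. - phi p * T) at_bot at_top"
        by (rule filterlim_tendsto_neg_mult_at_bot[OF tendsto_const _ filterlim_ident])
          (use phi_pos in simp)
      then show "((\<lambda>T. exp (- phi p * T)) \<longlongrightarrow> 0) at_top" by (rule filterlim_compose[OF exp_at_bot])
    qed
    moreover have "\<forall>\<^sub>F T in at_top. y * ?z * (?g / (?g - 1)) * (1 - exp (- phi p * T)) \<le> l + y * ?z"
      using eventually_gt_at_top[of "0::real"] by eventually_elim (rule le)
    ultimately have "y * ?z * (?g / (?g - 1)) * (1 - 0) \<le> l + y * ?z"
      by (rule tendsto_upperbound) simp
    moreover have "y * ?z * (?g / (?g - 1)) = y * ?z / (?g - 1) + y * ?z" using g by (simp add: field_simps)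
    ultimately have "y * ?z / (?g - 1) \<le> l" by simp
    then show ?thesis unfolding real y_def[symmetric] by (rule ennreal_leI)
  qed simp
qed

text \<open>Along the optimal path the loss is a multiple of the integral of \<xi> Z and is computed
  exactly, over the infinite horizon at once.\<close>

lemma loss_opt:
  assumes z: "0 < z" and W: "AE \<omega> in M. \<forall>t\<ge>0. total_wealth p (W t \<omega>) = Zopt z t \<omega>"
  shows "expected_utility M p (feedback_control p W) = ereal (- (multiplier z * z / (gamma p - 1)))"
proof -
  let ?x = "\<lambda>t \<omega>. x_min p + (1 - beta p) * phi p * total_wealth p (W t \<omega>)"
  let ?s = "\<lambda>t \<omega>. s_min p + beta p * phi p * (total_wealth p (W t \<omega>) / (energy_price p / eta_new p))"
  define c where "c = multiplier z * phi p / (gamma p - 1)"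
  have c: "0 \<le> c" unfolding c_def using multiplier_pos[OF z] phi_pos params
    by (intro divide_nonneg_pos mult_nonneg_nonneg) auto
  have "loss ?x ?s = (\<integral>\<^sup>+\<omega>. (\<integral>\<^sup>+t\<in>{0..}. ennreal (c * (state_price p B t \<omega> * Zopt z t \<omega>)) \<partial>lborel) \<partial>M)"
    unfolding loss_def
  proof (rule nn_integral_cong_AE)
    show "AE \<omega> in M. (\<integral>\<^sup>+t\<in>{0..}. ennreal
      (- (exp (- delta_hat p * t) * utility p (?x t \<omega>) (?s t \<omega>))) \<partial>lborel) =
        (\<integral>\<^sup>+t\<in>{0..}. ennreal (c * (state_price p B t \<omega> * Zopt z t \<omega>)) \<partial>lborel)"
      using W
    proof eventually_elim
      case (elim \<omega>)
      show ?case
      proof (rule nn_integral_cong)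
        fix t :: real
        show "ennreal (- (exp (- delta_hat p * t) * utility p (?x t \<omega>) (?s t \<omega>))) * indicator {0..}
          t = ennreal (c * (state_price p B t \<omega> * Zopt z t \<omega>)) * indicator {0..} t"
        proof (cases "0 \<le> t")
          case True
          then have "total_wealth p (W t \<omega>) = Zopt z t \<omega>" using elim by auto
          from optimal_utility[OF z this] show ?thesis unfolding c_def by simp
        qed simp
      qed
    qed
  qed
  also have "\<dots> = (\<integral>\<^sup>+t\<in>{0..}. ennreal (c * z * exp (- phi p * t)) \<partial>lborel)"
    by (rule state_price_opt_integral[OF z c]) auto
  also have "\<dots> = ennreal (0 - (- (c * z / phi p) * exp (- phi p * 0)))"
  proof (rule nn_integral_FTC_atLeast[where F="\<lambda>t. - (c * z / phi p) * exp (- phi p * t)"])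
    show "DERIV (\<lambda>t. - (c * z / phi p) * exp (- phi p * t)) t :> c * z * exp (- phi p * t)" if "0 \<le> t" for t
      using phi_pos by (auto intro!: derivative_eq_intros)
    have "filterlim (\<lambda>T. - phi p * T) at_bot at_top"
      by (rule filterlim_tendsto_neg_mult_at_bot[OF tendsto_const _ filterlim_ident]) (use phi_pos in simp)
    then have "((\<lambda>T. exp (- phi p * T)) \<longlongrightarrow> 0) at_top" by (rule filterlim_compose[OF exp_at_bot])
    from tendsto_mult_left[OF this, of "- (c * z / phi p)"] show
      "((\<lambda>t. - (c * z / phi p) * exp (- phi p * t)) \<longlongrightarrow> 0) at_top" by simp
  qed (use c z in auto)
  also have "0 - (- (c * z / phi p) * exp (- phi p * 0)) = multiplier z * z / (gamma p - 1)"
    unfolding c_def using phi_pos by simp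
  finally have l: "loss ?x ?s = ennreal (multiplier z * z / (gamma p - 1))" .
  have "0 \<le> multiplier z * z / (gamma p - 1)" using multiplier_pos[OF z] z params by simp
  then show ?thesis unfolding feedback_control_def expected_utility_loss l by simp
qed

text \<open>The two consumption shares add up to 1, so the surplus is \<phi> Z. Where W is not 0,
  the share times W is free of the quotient, and the equation for total wealth becomes
  linear.\<close>

lemma feedback_drift:
  assumes "W t \<omega> \<noteq> 0"
  shows "kappa p / (gamma p * sigma_S p) * (total_wealth p (W t \<omega>) / W t \<omega>) * sigma_S p * W t \<omega> =
    opt_vol * total_wealth p (W t \<omega>)"
    "wealth_drift p (feedback_control p W) W t \<omega> = opt_drift * total_wealth p (W t \<omega>)"
proof -
  show H: "kappa p / (gamma p * sigma_S p) * (total_wealth p (W t \<omega>) / W t \<omega>) * sigma_S p * W t \<omega> =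
    opt_vol * total_wealth p (W t \<omega>)"
    using assms params by (simp add: opt_vol_def)
  have S: "surplus p (\<lambda>t \<omega>. x_min p + (1 - beta p) * phi p * total_wealth p (W t \<omega>))
      (\<lambda>t \<omega>. s_min p + beta p * phi p * (total_wealth p (W t \<omega>) / (energy_price p / eta_new p))) t \<omega>
        = phi p * total_wealth p (W t \<omega>)"
    using params(1) by (simp add: surplus_def price_def[symmetric] algebra_simps)
  show "wealth_drift p (feedback_control p W) W t \<omega> = opt_drift * total_wealth p (W t \<omega>)"
    unfolding feedback_control_def total_wealth_drift[OF valid] S H
    by (simp add: opt_drift_def opt_vol_def power2_eq_square algebra_simps)
qed

lemma feedback_measurable:
  assumes W: "adapted F W" "continuous_paths M W" and c: "feedback_control p W = (a, x, s)"
  shows "measurable_adapted M F a" "measurable_adapted M F x" "measurable_adapted M F s"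
    "measurable_adapted M F (\<lambda>t \<omega>. a t \<omega> * sigma_S p * W t \<omega>)"
proof -
  have Wm: "measurable_adapted M F W" by (rule measurable_adapted_continuous[OF W])
  have eq: "a = (\<lambda>t \<omega>. kappa p / (gamma p * sigma_S p) * (total_wealth p (W t \<omega>) / W t \<omega>))"
    "x = (\<lambda>t \<omega>. x_min p + (1 - beta p) * phi p * total_wealth p (W t \<omega>))"
    "s = (\<lambda>t \<omega>. s_min p + beta p * phi p * (total_wealth p (W t \<omega>) / (energy_price p / eta_new p)))"
    using c by (auto simp: feedback_control_def)
  show "measurable_adapted M F a" "measurable_adapted M F x" "measurable_adapted M F s"
    "measurable_adapted M F (\<lambda>t \<omega>. a t \<omega> * sigma_S p * W t \<omega>)"
    unfolding eq total_wealth_def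
    by (rule measurable_adapted_borel[OF _ Wm]; measurable)+
qed

lemma feedback_integrals:
  assumes W: "continuous_paths M W" and ne: "AE \<omega> in M. AE t in lborel. 0 \<le> t \<longrightarrow> W t \<omega> \<noteq> 0"
  shows "AE \<omega> in M. \<forall>T\<ge>0. set_integrable lborel {0..T} (\<lambda>t. wealth_drift p (feedback_control p W) W t \<omega>) \<and>
    (LBINT t:{0..T}. wealth_drift p (feedback_control p W) W t \<omega>) = opt_drift *
      (LBINT t:{0..T}. total_wealth p (W t \<omega>))"
  using ne AE_space
proof eventually_elim
  case (elim \<omega>)
  show ?case
  proof (intro allI impI)
    fix T :: real assume T: "0 \<le> T"
    let ?d = "\<lambda>t. wealth_drift p (feedback_control p W) W t \<omega>"
      and ?Z = "\<lambda>t. opt_drift * total_wealth p (W t \<omega>)"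
    have c: "continuous_on {0..T} (\<lambda>t. W t \<omega>)"
      using W elim unfolding continuous_paths_def by (auto intro: continuous_on_subset[of "{0..}"])
    have Zi: "set_integrable lborel {0..T} ?Z"
      unfolding total_wealth_def by (rule borel_integrable_atLeastAtMost') (intro continuous_intros c)
    have Wb: "(\<lambda>t. indicator {0..T} t * W t \<omega>) \<in> borel_measurable borel"
      using borel_integrable_atLeastAtMost'[OF c] unfolding set_integrable_def
        by (auto dest: borel_measurable_integrable)
    \<comment> \<open>The drift agrees almost everywhere with a continuous function, which alone
      does not make it Borel measurable. Written in terms of the path cut off outside [0, T], it is
      a Borel function of a Borel function.\<close>
    let ?w = "\<lambda>t. indicator {0..T} t * W t \<omega>"
    have "(\<lambda>t. indicator {0..T} t *\<^sub>R wealth_drift p (feedback_control p (\<lambda>t \<omega>. ?w t)) (\<lambda>t \<omega>. ?w t)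
      t \<omega>) \<in> borel_measurable borel"
      unfolding feedback_control_def wealth_drift.simps total_wealth_def using Wb by measurable
    moreover have "indicator {0..T} t *\<^sub>R wealth_drift p (feedback_control p (\<lambda>t \<omega>. ?w t))
      (\<lambda>t \<omega>. ?w t) t \<omega> = indicator {0..T} t *\<^sub>R ?d t" for t
      by (auto simp: indicator_def feedback_control_def wealth_drift.simps)
    ultimately have dm: "(\<lambda>t. indicator {0..T} t *\<^sub>R ?d t) \<in> borel_measurable borel" by (simp only:)
    have ae: "AE t in lborel. indicator {0..T} t *\<^sub>R ?Z t = indicator {0..T} t *\<^sub>R ?d t"
      using elim(1)
    proof eventually_elim
      case (elim t)
      show ?case
      proof (cases "t \<in> {0..T}")
        case True
        then have "W t \<omega> \<noteq> 0" using elim by auto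
        then show ?thesis by (simp add: feedback_drift)
      qed simp
    qed
    have "set_integrable lborel {0..T} ?d"
      using Zi dm ae unfolding set_integrable_def
        by (subst integrable_cong_AE[where g="\<lambda>t. indicator {0..T} t *\<^sub>R ?Z t"])
        (auto elim: eventually_mono dest: borel_measurable_integrable)
    moreover have "(LBINT t:{0..T}. ?d t) = (LBINT t:{0..T}. ?Z t)"
      using Zi dm ae unfolding set_integrable_def set_lebesgue_integral_def
      by (intro integral_cong_AE) (auto elim: eventually_mono dest: borel_measurable_integrable)
    ultimately show "set_integrable lborel {0..T} ?d \<and> (LBINT t:{0..T}. ?d t) =
      opt_drift * (LBINT t:{0..T}. total_wealth p (W t \<omega>))"
      by simp
  qed
qed

text \<open>At a fixed time t > 0 the logarithm of Z is Gaussian with positive variance, so Z = h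
  has probability 0. By Fubini's theorem almost every path takes the value h on a null set of times
  only.\<close>

lemma opt_wealth_ne:
  assumes z: "0 < z"
  shows "AE \<omega> in M. AE t in lborel. 0 \<le> t \<longrightarrow> Zopt z t \<omega> \<noteq> h"
proof -
  interpret P: pair_sigma_finite lborel M by unfold_locales
  define S where "S t \<omega> = (indicator {h} (Zopt z (max 0 t) \<omega>) * indicator {0<..} t :: ennreal)"
    for t :: real and \<omega>
  have Zj: "(\<lambda>y. Zopt z (max 0 (fst y)) (snd y)) \<in> borel_measurable (lborel \<Otimes>\<^sub>M M)"
  proof -
    have "measurable_adapted M F (Zopt z)"
      by (rule measurable_adapted_continuous[OF gbm_adapted[OF z opt_vol_pos]
        gbm_continuous[OF z opt_vol_pos]])
    from measurable_adapted_joint[OF this] show ?thesis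
      by (subst measurable_cong_sets[OF sets_pair_measure_cong[OF sets_lborel refl] refl])
        (simp add: split_beta)
  qed
  have Sj: "(\<lambda>y. S (fst y) (snd y)) \<in> borel_measurable (lborel \<Otimes>\<^sub>M M)"
    unfolding S_def using Zj by measurable
  have zero: "(\<integral>\<^sup>+\<omega>. S t \<omega> \<partial>M) = 0" for t
  proof (cases "0 < t")
    case True
    define r where "r = (ln (h / z) - (opt_drift - opt_vol\<^sup>2 / 2) * t) / opt_vol"
    have "(\<integral>\<^sup>+\<omega>. S t \<omega> \<partial>M) \<le> (\<integral>\<^sup>+\<omega>. 1 * indicator {r} (B t \<omega> - B 0 \<omega>) \<partial>M)"
    proof (rule nn_integral_mono)
      fix \<omega>
      have "B t \<omega> - B 0 \<omega> = r" if "Zopt z t \<omega> = h"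
      proof -
        have "h / z = exp ((opt_drift - opt_vol\<^sup>2 / 2) * t + opt_vol * (B t \<omega> - B 0 \<omega>))"
          using that z by (simp add: gbm_def field_simps)
        then have "ln (h / z) = (opt_drift - opt_vol\<^sup>2 / 2) * t + opt_vol * (B t \<omega> - B 0 \<omega>)" by simp
        then show ?thesis unfolding r_def using opt_vol_pos by (simp add: field_simps)
      qed
      then show "S t \<omega> \<le> 1 * indicator {r} (B t \<omega> - B 0 \<omega>)"
        using True by (auto simp: S_def indicator_def max_def)
    qed
    also have "\<dots> = (\<integral>\<^sup>+\<omega>. 1 \<partial>M) * (\<integral>\<^sup>+x. ennreal (normal_density 0 (sqrt (t - 0)) x) * indicator {r}
      x \<partial>lborel)"
      by (rule nn_integral_increment[of 0 t t]) (use True in auto)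
    also have "(\<integral>\<^sup>+x. ennreal (normal_density 0 (sqrt (t - 0)) x) * indicator {r} x \<partial>lborel) =
      (\<integral>\<^sup>+(x::real). 0 \<partial>lborel)"
      by (rule nn_integral_cong_AE)
        (use AE_lborel_singleton[of r] in \<open>eventually_elim, auto simp: indicator_def\<close>)
    finally show ?thesis by simp
  qed (simp add: S_def)
  have "(\<integral>\<^sup>+\<omega>. (\<integral>\<^sup>+t. S t \<omega> \<partial>lborel) \<partial>M) = (\<integral>\<^sup>+t. (\<integral>\<^sup>+\<omega>. S t \<omega> \<partial>M) \<partial>lborel)"
    by (rule P.Fubini') (use Sj in \<open>simp add: split_beta\<close>)
  also have "\<dots> = 0" unfolding zero by simp
  finally have z0: "(\<integral>\<^sup>+\<omega>. (\<integral>\<^sup>+t. S t \<omega> \<partial>lborel) \<partial>M) = 0" .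
  have swp: "(\<lambda>(\<omega>, t). S t \<omega>) \<in> borel_measurable (M \<Otimes>\<^sub>M lborel)"
    using measurable_compose[OF measurable_pair_swap'[of M lborel] Sj] by (simp add: split_beta)
  have "AE \<omega> in M. (\<integral>\<^sup>+t. S t \<omega> \<partial>lborel) = 0"
    using z0 nn_integral_0_iff_AE[OF lborel.borel_measurable_nn_integral[OF swp]] by simp
  then show ?thesis using AE_space
  proof eventually_elim
    case (elim \<omega>)
    have "(\<lambda>t. S t \<omega>) \<in> borel_measurable lborel"
      using measurable_compose[OF measurable_Pair2'[of \<omega> M lborel] Sj] elim by simp
    then have "AE t in lborel. S t \<omega> = 0" using elim nn_integral_0_iff_AE by blast
    then show ?case using AE_lborel_singleton[of "0::real"]
      by eventually_elim (auto simp: S_def indicator_def max_def split: if_splits)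
  qed
qed

text \<open>Wealth is read off from the geometric Brownian motion by subtracting human capital. By
  \<open>opt_wealth_ne\<close> it vanishes on a null set of times only, so the quotient in the share
  does no harm.\<close>

lemma feedback_exists:
  assumes z: "0 < total_wealth p w"
  shows "feedback_wealth M F B p w (\<lambda>t \<omega>. Zopt (total_wealth p w) t \<omega> - human_capital p)"
proof -
  let ?z = "total_wealth p w"
  define W where "W t \<omega> = Zopt ?z t \<omega> - human_capital p" for t \<omega>
  have WZ: "total_wealth p (W t \<omega>) = Zopt ?z t \<omega>" for t \<omega> by (simp add: total_wealth_def W_def)
  have ad: "adapted F W" using gbm_adapted[OF z opt_vol_pos, of opt_drift] unfolding adapted_def
    W_def[abs_def] by auto
  have co: "continuous_paths M W"
    using gbm_continuous[OF z opt_vol_pos, of opt_drift] unfolding continuous_paths_def W_def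
      by (auto intro!: continuous_intros)
  have ne: "AE \<omega> in M. AE t in lborel. 0 \<le> t \<longrightarrow> W t \<omega> \<noteq> 0"
    using opt_wealth_ne[OF z, of "human_capital p"] by (simp add: W_def)
  obtain a x s where c: "feedback_control p W = (a, x, s)" by (cases "feedback_control p W")
  have a: "a = (\<lambda>t \<omega>. kappa p / (gamma p * sigma_S p) * (total_wealth p (W t \<omega>) / W t \<omega>))"
    using c by (simp add: feedback_control_def)
  note int = feedback_integrals[OF co ne, unfolded c WZ]
  have I: "has_ito_integral M F B (\<lambda>t \<omega>. a t \<omega> * sigma_S p * W t \<omega>) (gbm_integral ?z opt_drift opt_vol)"
  proof (rule gbm_has_ito_integral[OF z opt_vol_pos feedback_measurable(4)[OF ad co c]])
    show "AE \<omega> in M. AE t in lborel. 0 \<le> t \<longrightarrow> a t \<omega> * sigma_S p * W t \<omega> = opt_vol * Zopt ?z t \<omega>"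
      using ne
    proof eventually_elim
      case (elim \<omega>)
      then show ?case
      proof eventually_elim
        case (elim t)
        show ?case
        proof
          assume "0 \<le> t"
          then have "W t \<omega> \<noteq> 0" using elim by simp
          from feedback_drift(1)[where W=W, OF this] show "a t \<omega> * sigma_S p * W t \<omega> =
            opt_vol * Zopt ?z t \<omega>"
            unfolding a WZ .
        qed
      qed
    qed
  qed
  have "wealth_process M F B p w (a, x, s) W"
    unfolding wealth_process.simps
  proof (intro conjI ad co exI[of _ "gbm_integral ?z opt_drift opt_vol"] I)
    show "AE \<omega> in M. \<forall>T\<ge>0. set_integrable lborel {0..T} (\<lambda>t. wealth_drift p (a, x, s) W t \<omega>)"
      using int by eventually_elim auto
    show "AE \<omega> in M. \<forall>T\<ge>0. W T \<omega> = w + (LBINT t:{0..T}. wealth_drift p (a, x, s) W t \<omega>)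
      + gbm_integral ?z opt_drift opt_vol T \<omega>"
      using int
    proof eventually_elim
      case (elim \<omega>)
      show ?case
      proof (intro allI impI)
        fix T :: real assume "0 \<le> T"
        then have "(LBINT t:{0..T}. wealth_drift p (a, x, s) W t \<omega>) =
          opt_drift * (LBINT t:{0..T}. Zopt ?z t \<omega>)"
          using elim by blast
        then show "W T \<omega> = w + (LBINT t:{0..T}. wealth_drift p (a, x, s) W t \<omega>) + gbm_integral ?z
          opt_drift opt_vol T \<omega>"
          unfolding gbm_integral_def[OF z opt_vol_pos] W_def[of T] total_wealth_def[of p w, symmetric]
          by (simp add: total_wealth_def[of p w])
      qed
    qed
  qed
  then show ?thesis using ne unfolding feedback_wealth_def W_def[symmetric, abs_def] c[symmetric] by simp
qed

text \<open>Total wealth under the feedback strategies and the geometric Brownian motion solve the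
  same linear equation, by \<open>feedback_drift\<close> at almost every time. Positivity, and with
  it admissibility, is inherited from the exponential.\<close>

lemma feedback_unique:
  assumes z: "0 < total_wealth p w" and fb: "feedback_wealth M F B p w W"
  shows "AE \<omega> in M. \<forall>t\<ge>0. total_wealth p (W t \<omega>) = Zopt (total_wealth p w) t \<omega>"
    and "admissible_with M F B p w (feedback_control p W) W"
proof -
  let ?z = "total_wealth p w"
  obtain a x s where c: "feedback_control p W = (a, x, s)" by (cases "feedback_control p W")
  have a: "a = (\<lambda>t \<omega>. kappa p / (gamma p * sigma_S p) * (total_wealth p (W t \<omega>) / W t \<omega>))"
    and x: "x = (\<lambda>t \<omega>. x_min p + (1 - beta p) * phi p * total_wealth p (W t \<omega>))"
    and s: "s = (\<lambda>t \<omega>. s_min p + beta p * phi p * (total_wealth p (W t \<omega>) / (energy_price p / eta_new p)))"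
    using c by (auto simp: feedback_control_def)
  have ne: "AE \<omega> in M. AE t in lborel. 0 \<le> t \<longrightarrow> W t \<omega> \<noteq> 0" and wp: "wealth_process M F B p w (a, x, s) W"
    using fb unfolding feedback_wealth_def c by auto
  from wp have ad: "adapted F W" and co: "continuous_paths M W" by auto
  from wp obtain I where I: "has_ito_integral M F B (\<lambda>t \<omega>. a t \<omega> * sigma_S p * W t \<omega>) I"
    and eq: "AE \<omega> in M. \<forall>T\<ge>0. W T \<omega> = w + (LBINT t:{0..T}. wealth_drift p (a, x, s) W t \<omega>) + I T \<omega>"
    by auto
  let ?Z = "\<lambda>t \<omega>. total_wealth p (W t \<omega>)"
  note int = feedback_integrals[OF co ne, unfolded c]
  have Zad: "adapted F ?Z" "continuous_paths M ?Z"
    using ad co unfolding adapted_def continuous_paths_def total_wealth_def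
      by (auto intro!: continuous_intros)
  have HZ: "AE \<omega> in M. AE t in lborel. 0 \<le> t \<longrightarrow> a t \<omega> * sigma_S p * W t \<omega> = opt_vol * ?Z t \<omega>"
    using ne
  proof eventually_elim
    case (elim \<omega>)
    then show ?case by eventually_elim (use feedback_drift(1)[where W=W] in \<open>simp add: a\<close>)
  qed
  have Zeq: "AE \<omega> in M. \<forall>T\<ge>0. ?Z T \<omega> = ?z + opt_drift * (LBINT t:{0..T}. ?Z t \<omega>) + I T \<omega>"
    using eq int by eventually_elim (simp add: total_wealth_def)
  have "measurable_adapted M F (\<lambda>t \<omega>. opt_vol * Zopt ?z t \<omega>)"
    by (rule measurable_adapted_borel[OF _ measurable_adapted_continuous[OF
      gbm_adapted[OF z opt_vol_pos] gbm_continuous[OF z opt_vol_pos]], of "\<lambda>x. opt_vol * x"]) measurable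
  then have I2: "has_ito_integral M F B (\<lambda>t \<omega>. opt_vol * Zopt ?z t \<omega>) (gbm_integral ?z opt_drift opt_vol)"
    by (rule gbm_has_ito_integral[OF z opt_vol_pos]) simp
  show main: "AE \<omega> in M. \<forall>t\<ge>0. ?Z t \<omega> = Zopt ?z t \<omega>"
  proof (rule linear_sde_unique[OF I Zad HZ Zeq I2 gbm_adapted[OF z opt_vol_pos]
    gbm_continuous[OF z opt_vol_pos]])
    show "AE \<omega> in M. \<forall>T\<ge>0. Zopt ?z T \<omega> = ?z + opt_drift * (LBINT t:{0..T}. Zopt ?z t \<omega>)
      + gbm_integral ?z opt_drift opt_vol T \<omega>"
      by (simp add: gbm_integral_def[OF z opt_vol_pos])
  qed simp
  have pos: "AE \<omega> in M. \<forall>t\<ge>0. 0 < ?Z t \<omega>"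
    using main by eventually_elim (use gbm_pos[OF z] in auto)
  have "AE \<omega> in M. \<forall>t\<ge>0. x_min p < x t \<omega> \<and> s_min p < s t \<omega>"
    using pos
  proof eventually_elim
    case (elim \<omega>)
    show ?case
    proof (intro allI impI conjI)
      fix t :: real assume "0 \<le> t"
      then have Zp: "0 < ?Z t \<omega>" using elim by auto
      show "x_min p < x t \<omega>" unfolding x using Zp params phi_pos by simp
      show "s_min p < s t \<omega>" unfolding s price_def[symmetric] using Zp params phi_pos by simp
    qed
  qed
  then show "admissible_with M F B p w (feedback_control p W) W"
    unfolding admissible_with_def c using feedback_measurable[OF ad co c] wp pos by auto
qed

theorem optimal_investment:
  assumes z: "0 < total_wealth p w"
  shows "value_function M F B p w =
      ereal (Gamma_const p powr (- gamma p) * (total_wealth p w powr (1 - gamma p) / (1 - gamma p))) \<and>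
    (\<exists>W. feedback_wealth M F B p w W) \<and>
    (\<forall>W. feedback_wealth M F B p w W \<longrightarrow>
       admissible_with M F B p w (feedback_control p W) W \<and>
       expected_utility M p (feedback_control p W) = value_function M F B p w)"
proof -
  let ?z = "total_wealth p w"
  define V where "V = ereal (Gamma_const p powr (- gamma p) * (?z powr (1 - gamma p) / (1 - gamma p)))"
  have V: "V = ereal (- (multiplier ?z * ?z / (gamma p - 1)))" unfolding V_def value_eq[OF z] ..
  have upper: "expected_utility M p c \<le> V" if cA: "c \<in> admissible M F B p w" for c
  proof -
    obtain W where adm: "admissible_with M F B p w c W" using cA by (auto simp: admissible_def)
    obtain a x s where c: "c = (a, x, s)" by (cases c)
    have "0 \<le> multiplier ?z * ?z / (gamma p - 1)" using multiplier_pos[OF z] z params by simp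
    then have "ereal (multiplier ?z * ?z / (gamma p - 1)) \<le> enn2ereal (loss x s)"
      using loss_ge[OF adm[unfolded c] z] by (simp add: less_eq_ennreal.rep_eq)
    then show ?thesis unfolding c V expected_utility_loss
      by (simp add: ereal_minus_le_minus flip: uminus_ereal.simps)
  qed
  have opt: "admissible_with M F B p w (feedback_control p W) W \<and>
    expected_utility M p (feedback_control p W) = V"
    if "feedback_wealth M F B p w W" for W
    using feedback_unique[OF z that] loss_opt[OF z] unfolding V by blast
  have ex: "\<exists>W. feedback_wealth M F B p w W" using feedback_exists[OF z] by blast
  then obtain W where W: "feedback_wealth M F B p w W" ..
  \<comment> \<open>Existence of a feedback solution is what makes the upper bound an attained
    supremum.\<close>
  have "feedback_control p W \<in> admissible M F B p w" using opt[OF W] by (auto simp: admissible_def)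
  then have "V \<le> value_function M F B p w"
    unfolding value_function_def using opt[OF W] by (metis SUP_upper)
  moreover have "value_function M F B p w \<le> V"
    unfolding value_function_def using upper by (rule SUP_least)
  ultimately have "value_function M F B p w = V" by (rule antisym[rotated])
  then show ?thesis using ex opt unfolding V_def by simp
qed

end

theorem proposition1:
  fixes M :: "'a measure" and F :: "real \<Rightarrow> 'a measure" and B :: "'a process"
    and p :: household and w :: real
  assumes "filtered_prob_space M F"
    and "brownian_motion M F B"
    and "valid_household p"
    and "w > - human_capital p"
  shows "phi p > 0 \<and> Gamma_const p > 0 \<and>
    value_function M F B p w =
      ereal (Gamma_const p powr (- gamma p) * (total_wealth p w powr (1 - gamma p) / (1 - gamma p))) \<and>
    (\<exists>W. feedback_wealth M F B p w W) \<and>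
    (\<forall>W. feedback_wealth M F B p w W \<longrightarrow>
       admissible_with M F B p w (feedback_control p W) W \<and>
       expected_utility M p (feedback_control p W) = value_function M F B p w)"
proof -
  interpret household_problem M F B p
    using assms by (intro household_problem.intro brownian.intro household_params.intro)
  have "0 < total_wealth p w" using assms(4) by (simp add: total_wealth_def)
  then show ?thesis using phi_pos Gamma_pos optimal_investment by simp
qed

end
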